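(* Let $\Bbbk$ be a field, $q\in\Bbbk\setminus\{0,1\}$, $\mathsf q=qe^{d_1h}\in\Bbbk[[h]]$ with $d_1\in\Bbbk$ ($d_1=0$ if $\operatorname{char}\Bbbk>0$), and $n\ge1$. The affine Hecke algebra $\widetilde{\mathcal H}(\mathsf q)$ of rank $n$ is isomorphic to the rank $n$ type O affine Hecke algebra via the map sending $T_r+1$ to the crossing of the $r$th and $(r+1)$st strands, and $X_r$ to the square on the $r$th strand.
   Context: **Affine Hecke algebra.** $\widetilde{\mathcal H}(\mathsf q)$ is the $\Bbbk[[h]]$-algebra generated by $X_1^{\pm1},\dots,X_n^{\pm1},T_1,\dots,T_{n-1}$ with relations: the $X_r^{\pm1}$ commute (and $X_rX_r^{-1}=1$); $T_r^2=(\mathsf q-1)T_r+\mathsf q$; $T_rX_rT_r=\mathsf qX_{r+1}$; $T_rT_{r+1}T_r=T_{r+1}T_rT_{r+1}$; $T_rX_s=X_sT_r$ for $s\ne r,r+1$; $T_rT_s=T_sT_r$ for $s\neq r\pm1$. **Type O diagrams.** A rank $n$ type O diagram is a collection of $n$ curves in $\mathbb R\times[0,1]$, each mapping diffeomorphically to $[0,1]$ via the projection to the $y$-axis, each allowed to carry any number of squares or the formal inverse of a square; the curves have no triple points or tangencies, no squares lie on crossings, and diagrams are considered up to isotopies preserving these conditions. The product $ab$ places $a$ on top of $b$, matching the bottom of $a$ with the top of $b$. **Type O affine Hecke algebra.** It is the quotient of the $\Bbbk[[h]]$-span of rank $n$ type O diagrams by the following local relations (applied to any two or three adjacent strands in a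 small region of a diagram), where $c_r$ denotes the crossing of strands $r,r+1$ (other strands vertical) and $X_r$ the vertical diagram with a square on the $r$th strand: $$X_rc_r-c_rX_{r+1}=c_rX_r-X_{r+1}c_r=X_r-\mathsf qX_{r+1},\qquad c_r^2=(1+\mathsf q)c_r,\qquad c_rc_{r+1}c_r-c_{r+1}c_rc_{r+1}=\mathsf qc_r-\mathsf qc_{r+1}.$$ *)

theory Defs
  imports
    "HOL-Analysis.Analysis"
    "HOL-Computational_Algebra.Formal_Power_Series"
    "HOL-Algebra.QuotRing"
    "HOL-Algebra.Module"
begin

section \<open>Algebras over a commutative ring given by a monoid and relations\<close>

definition basis_elt :: "'m \<Rightarrow> 'm \<Rightarrow> 'r::comm_ring_1" where
  "basis_elt m = (\<lambda>x. if x = m then 1 else 0)"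

text \<open>The \<open>'r\<close>-span of a monoid: finitely supported functions with the convolution product.\<close>

definition monoid_algebra :: "'m monoid \<Rightarrow> ('r::comm_ring_1, 'm \<Rightarrow> 'r) module" where
  "monoid_algebra M =
    \<lparr> carrier = {f. finite {x. f x \<noteq> 0} \<and> {x. f x \<noteq> 0} \<subseteq> carrier M},
      mult = (\<lambda>f g z. \<Sum>(x, y) \<in> {(x, y). f x \<noteq> 0 \<and> g y \<noteq> 0 \<and> x \<otimes>\<^bsub>M\<^esub> y = z}. f x * g y),
      one = basis_elt \<one>\<^bsub>M\<^esub>,
      zero = (\<lambda>x. 0),
      add = (\<lambda>f g x. f x + g x),
      smult = (\<lambda>a f x. a * f x) \<rparr>"

definition free_monoid :: "'g set \<Rightarrow> 'g list monoid" where
  "free_monoid G = \<lparr> carrier = lists G, mult = (@), one = [] \<rparr>"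

text \<open>A pair \<open>(l, r)\<close> in \<open>R\<close> stands for the relation \<open>l = r\<close>.\<close>

definition relation_ideal :: "('r, 'a) module \<Rightarrow> ('a \<times> 'a) set \<Rightarrow> 'a set" where
  "relation_ideal A R = Idl\<^bsub>A\<^esub> {l \<ominus>\<^bsub>A\<^esub> r | l r. (l, r) \<in> R}"

definition relation_class :: "('r, 'a) module \<Rightarrow> ('a \<times> 'a) set \<Rightarrow> 'a \<Rightarrow> 'a set" where
  "relation_class A R x = relation_ideal A R +>\<^bsub>A\<^esub> x"

text \<open>The library quotient ring together with the induced scalar multiplication; on a coset
  \<open>C\<close> all the cosets in the union below coincide.\<close>

definition quotient_algebra :: "('r, 'a) module \<Rightarrow> ('a \<times> 'a) set \<Rightarrow> ('r, 'a set) module" where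
  "quotient_algebra A R =
    ring.extend (A Quot relation_ideal A R)
      (module.fields (\<lambda>a C. \<Union>x\<in>C. relation_class A R (a \<odot>\<^bsub>A\<^esub> x)))"

definition algebra_iso :: "('r, 'a) module \<Rightarrow> ('r, 'b) module \<Rightarrow> ('a \<Rightarrow> 'b) set" where
  "algebra_iso A B =
    {f \<in> ring_iso A B. \<forall>a. \<forall>x \<in> carrier A. f (a \<odot>\<^bsub>A\<^esub> x) = a \<odot>\<^bsub>B\<^esub> f x}"


section \<open>The affine Hecke algebra\<close>

datatype hecke_gen = GenX nat | GenXinv nat | GenT nat

definition hecke_gens :: "nat \<Rightarrow> hecke_gen set" where
  "hecke_gens n = GenX ` {1..n} \<union> GenXinv ` {1..n} \<union> GenT ` {1..<n}"

definition free_hecke :: "nat \<Rightarrow> ('r::comm_ring_1, hecke_gen list \<Rightarrow> 'r) module" where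
  "free_hecke n = monoid_algebra (free_monoid (hecke_gens n))"

text \<open>In the commutation relations, \<open>Y\<close> and \<open>Z\<close> range over both the \<open>X\<^sub>r\<close> and their inverses.\<close>

definition hecke_relations ::
    "nat \<Rightarrow> 'r::comm_ring_1 \<Rightarrow> ((hecke_gen list \<Rightarrow> 'r) \<times> (hecke_gen list \<Rightarrow> 'r)) set" where
  "hecke_relations n \<q> =
    (let A = free_hecke n;
         X = (\<lambda>r. basis_elt [GenX r]);
         Xinv = (\<lambda>r. basis_elt [GenXinv r]);
         T = (\<lambda>r. basis_elt [GenT r])
     in {(X r \<otimes>\<^bsub>A\<^esub> Xinv r, \<one>\<^bsub>A\<^esub>) | r. r \<in> {1..n}}
      \<union> {(Xinv r \<otimes>\<^bsub>A\<^esub> X r, \<one>\<^bsub>A\<^esub>) | r. r \<in> {1..n}}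
      \<union> {(Y r \<otimes>\<^bsub>A\<^esub> Z s, Z s \<otimes>\<^bsub>A\<^esub> Y r) | Y Z r s.
           Y \<in> {X, Xinv} \<and> Z \<in> {X, Xinv} \<and> r \<in> {1..n} \<and> s \<in> {1..n}}
      \<union> {(T r \<otimes>\<^bsub>A\<^esub> T r, (\<q> - 1) \<odot>\<^bsub>A\<^esub> T r \<oplus>\<^bsub>A\<^esub> \<q> \<odot>\<^bsub>A\<^esub> \<one>\<^bsub>A\<^esub>) | r. r \<in> {1..<n}}
      \<union> {(T r \<otimes>\<^bsub>A\<^esub> X r \<otimes>\<^bsub>A\<^esub> T r, \<q> \<odot>\<^bsub>A\<^esub> X (r + 1)) | r. r \<in> {1..<n}}
      \<union> {(T r \<otimes>\<^bsub>A\<^esub> T (r + 1) \<otimes>\<^bsub>A\<^esub> T r, T (r + 1) \<otimes>\<^bsub>A\<^esub> T r \<otimes>\<^bsub>A\<^esub> T (r + 1)) | r.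
           r \<in> {1..<n} \<and> r + 1 \<in> {1..<n}}
      \<union> {(T r \<otimes>\<^bsub>A\<^esub> X s, X s \<otimes>\<^bsub>A\<^esub> T r) | r s.
           r \<in> {1..<n} \<and> s \<in> {1..n} \<and> s \<noteq> r \<and> s \<noteq> r + 1}
      \<union> {(T r \<otimes>\<^bsub>A\<^esub> T s, T s \<otimes>\<^bsub>A\<^esub> T r) | r s.
           r \<in> {1..<n} \<and> s \<in> {1..<n} \<and> s \<noteq> r + 1 \<and> r \<noteq> s + 1})"

definition hecke_algebra :: "nat \<Rightarrow> 'r::comm_ring_1 \<Rightarrow> ('r, (hecke_gen list \<Rightarrow> 'r) set) module" where
  "hecke_algebra n \<q> = quotient_algebra (free_hecke n) (hecke_relations n \<q>)"

definition hecke_X :: "nat \<Rightarrow> 'r::comm_ring_1 \<Rightarrow> nat \<Rightarrow> (hecke_gen list \<Rightarrow> 'r) set" where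
  "hecke_X n \<q> r = relation_class (free_hecke n) (hecke_relations n \<q>) (basis_elt [GenX r])"

definition hecke_T :: "nat \<Rightarrow> 'r::comm_ring_1 \<Rightarrow> nat \<Rightarrow> (hecke_gen list \<Rightarrow> 'r) set" where
  "hecke_T n \<q> r = relation_class (free_hecke n) (hecke_relations n \<q>) (basis_elt [GenT r])"


section \<open>Type O diagrams\<close>

text \<open>A curve that projects diffeomorphically to \<open>[0,1]\<close> is the graph
  \<open>{(curve d i t, t) | t \<in> [0,1]}\<close> of a \<open>C\<^sup>1\<close> function of the height \<open>t\<close>. The curves of a rank
  \<open>n\<close> diagram are indexed by \<open>{1..n}\<close> in an arbitrary way. A square is a triple of the
  index of its curve, a flag (\<^term>\<open>True\<close> for a square, \<^term>\<open>False\<close> for the formal inverse of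
  a square) and its height.\<close>

record diagram =
  curve :: "nat \<Rightarrow> real \<Rightarrow> real"
  squares :: "(nat \<times> bool \<times> real) list"

definition slope :: "diagram \<Rightarrow> nat \<Rightarrow> real \<Rightarrow> real" where
  "slope d i t = vector_derivative (curve d i) (at t within {0..1})"

text \<open>The ends of the curves are required to be distinct, so that diagrams can be stacked;
  likewise squares lie in the interior of the strip.\<close>

definition is_diagram :: "nat \<Rightarrow> diagram \<Rightarrow> bool" where
  "is_diagram n d \<longleftrightarrow>
     (\<forall>i\<in>{1..n}. curve d i differentiable_on {0..1} \<and> continuous_on {0..1} (slope d i)) \<and>
     (\<forall>t\<in>{0, 1}. inj_on (\<lambda>i. curve d i t) {1..n}) \<and>
     (\<forall>t\<in>{0..1}. \<forall>i\<in>{1..n}. \<forall>j\<in>{1..n}. \<forall>k\<in>{1..n}. i \<noteq> j \<longrightarrow> j \<noteq> k \<longrightarrow> i \<noteq> k \<longrightarrow>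
        \<not> (curve d i t = curve d j t \<and> curve d j t = curve d k t)) \<and>
     (\<forall>t\<in>{0..1}. \<forall>i\<in>{1..n}. \<forall>j\<in>{1..n}. i \<noteq> j \<longrightarrow> curve d i t = curve d j t \<longrightarrow>
        slope d i t \<noteq> slope d j t) \<and>
     (\<forall>(i, \<epsilon>, t)\<in>set (squares d). i \<in> {1..n} \<and> t \<in> {0<..<1} \<and>
        (\<forall>j\<in>{1..n}. j \<noteq> i \<longrightarrow> curve d j t \<noteq> curve d i t))"

text \<open>Two data describe the same picture if they differ by renumbering the curves, permuting the
  list of squares, and changing the values of \<^const>\<open>curve\<close> at irrelevant arguments.\<close>

definition same_picture :: "nat \<Rightarrow> diagram \<Rightarrow> diagram \<Rightarrow> bool" where
  "same_picture n d e \<longleftrightarrow>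
     (\<exists>\<pi>. \<pi> permutes {1..n} \<and>
        (\<forall>i\<in>{1..n}. \<forall>t\<in>{0..1}. curve e (\<pi> i) t = curve d i t) \<and>
        mset (squares e) = image_mset (\<lambda>(i, \<epsilon>, t). (\<pi> i, \<epsilon>, t)) (mset (squares d)))"

text \<open>A path of diagrams, continuous in the \<open>C\<^sup>1\<close> topology, along which the squares move
  continuously on their curves.\<close>

definition isotopy :: "nat \<Rightarrow> (real \<Rightarrow> diagram) \<Rightarrow> bool" where
  "isotopy n H \<longleftrightarrow>
     (\<forall>s\<in>{0..1}. is_diagram n (H s)) \<and>
     (\<forall>i\<in>{1..n}. continuous_on ({0..1} \<times> {0..1}) (\<lambda>(s, t). curve (H s) i t) \<and>
                  continuous_on ({0..1} \<times> {0..1}) (\<lambda>(s, t). slope (H s) i t)) \<and>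
     (\<forall>s\<in>{0..1}. map (\<lambda>(i, \<epsilon>, t). (i, \<epsilon>)) (squares (H s)) =
                   map (\<lambda>(i, \<epsilon>, t). (i, \<epsilon>)) (squares (H 0))) \<and>
     (\<forall>k < length (squares (H 0)). continuous_on {0..1} (\<lambda>s. snd (snd (squares (H s) ! k))))"

definition isotopic :: "nat \<Rightarrow> diagram \<Rightarrow> diagram \<Rightarrow> bool" where
  "isotopic n d e \<longleftrightarrow> is_diagram n d \<and> is_diagram n e \<and>
     (\<exists>H. isotopy n H \<and> same_picture n d (H 0) \<and> same_picture n e (H 1))"

definition isotopy_class :: "nat \<Rightarrow> diagram \<Rightarrow> diagram set" where
  "isotopy_class n d = {e. isotopic n d e}"

text \<open>\<open>is_stack n a b d\<close>: the diagram \<open>d\<close> is obtained by placing \<open>a\<close> on top of \<open>b\<close> and rescaling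
  heights to \<open>[0,1]\<close>. The two conditions on curves at height \<open>1/2\<close> force the bottom of \<open>a\<close>
  to match the top of \<open>b\<close>.\<close>

definition is_stack :: "nat \<Rightarrow> diagram \<Rightarrow> diagram \<Rightarrow> diagram \<Rightarrow> bool" where
  "is_stack n a b d \<longleftrightarrow>
     is_diagram n a \<and> is_diagram n b \<and> is_diagram n d \<and>
     (\<forall>i\<in>{1..n}. \<forall>t\<in>{0..1}. curve d i (t / 2) = curve b i t) \<and>
     (\<forall>i\<in>{1..n}. \<forall>t\<in>{0..1}. curve d i ((1 + t) / 2) = curve a i t) \<and>
     mset (squares d) =
       image_mset (\<lambda>(i, \<epsilon>, t). (i, \<epsilon>, t / 2)) (mset (squares b)) +
       image_mset (\<lambda>(i, \<epsilon>, t). (i, \<epsilon>, (1 + t) / 2)) (mset (squares a))"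

definition vertical_diagram :: diagram where
  "vertical_diagram = \<lparr> curve = (\<lambda>i t. real i), squares = [] \<rparr>"

definition square_diagram :: "nat \<Rightarrow> bool \<Rightarrow> diagram" where
  "square_diagram r \<epsilon> = \<lparr> curve = (\<lambda>i t. real i), squares = [(r, \<epsilon>, 1 / 2)] \<rparr>"

definition crossing_diagram :: "nat \<Rightarrow> diagram" where
  "crossing_diagram r =
    \<lparr> curve = (\<lambda>i t. if i = r then real r + t
                      else if i = r + 1 then real r + 1 - t
                      else real i),
      squares = [] \<rparr>"

text \<open>The product of two isotopy classes is the class of a stack of representatives that have
  been chosen so that their ends match and the stacked curves are again \<open>C\<^sup>1\<close>.\<close>

definition diagram_monoid :: "nat \<Rightarrow> diagram set monoid" where
  "diagram_monoid n =
    \<lparr> carrier = {isotopy_class n d | d. is_diagram n d},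
      mult = (\<lambda>A B. {e. \<exists>a\<in>A. \<exists>b\<in>B. \<exists>d. is_stack n a b d \<and> isotopic n d e}),
      one = isotopy_class n vertical_diagram \<rparr>"


section \<open>The type O affine Hecke algebra\<close>

definition diagram_span :: "nat \<Rightarrow> ('r::comm_ring_1, diagram set \<Rightarrow> 'r) module" where
  "diagram_span n = monoid_algebra (diagram_monoid n)"

text \<open>Imposing a relation locally, i.e. in a small region of arbitrary diagrams, means passing to
  the quotient by the two-sided ideal of the diagram algebra that it generates. The first two
  families say that the formal inverse of a square is inverse to it.\<close>

definition typeO_relations ::
    "nat \<Rightarrow> 'r::comm_ring_1 \<Rightarrow> ((diagram set \<Rightarrow> 'r) \<times> (diagram set \<Rightarrow> 'r)) set" where
  "typeO_relations n \<q> =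
    (let A = diagram_span n;
         X = (\<lambda>r. basis_elt (isotopy_class n (square_diagram r True)));
         Xinv = (\<lambda>r. basis_elt (isotopy_class n (square_diagram r False)));
         c = (\<lambda>r. basis_elt (isotopy_class n (crossing_diagram r)))
     in {(X r \<otimes>\<^bsub>A\<^esub> Xinv r, \<one>\<^bsub>A\<^esub>) | r. r \<in> {1..n}}
      \<union> {(Xinv r \<otimes>\<^bsub>A\<^esub> X r, \<one>\<^bsub>A\<^esub>) | r. r \<in> {1..n}}
      \<union> {(X r \<otimes>\<^bsub>A\<^esub> c r \<ominus>\<^bsub>A\<^esub> c r \<otimes>\<^bsub>A\<^esub> X (r + 1),
           X r \<ominus>\<^bsub>A\<^esub> \<q> \<odot>\<^bsub>A\<^esub> X (r + 1)) | r. r \<in> {1..<n}}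
      \<union> {(c r \<otimes>\<^bsub>A\<^esub> X r \<ominus>\<^bsub>A\<^esub> X (r + 1) \<otimes>\<^bsub>A\<^esub> c r,
           X r \<ominus>\<^bsub>A\<^esub> \<q> \<odot>\<^bsub>A\<^esub> X (r + 1)) | r. r \<in> {1..<n}}
      \<union> {(c r \<otimes>\<^bsub>A\<^esub> c r, (1 + \<q>) \<odot>\<^bsub>A\<^esub> c r) | r. r \<in> {1..<n}}
      \<union> {(c r \<otimes>\<^bsub>A\<^esub> c (r + 1) \<otimes>\<^bsub>A\<^esub> c r \<ominus>\<^bsub>A\<^esub> c (r + 1) \<otimes>\<^bsub>A\<^esub> c r \<otimes>\<^bsub>A\<^esub> c (r + 1),
           \<q> \<odot>\<^bsub>A\<^esub> c r \<ominus>\<^bsub>A\<^esub> \<q> \<odot>\<^bsub>A\<^esub> c (r + 1)) | r.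
           r \<in> {1..<n} \<and> r + 1 \<in> {1..<n}})"

definition typeO_algebra :: "nat \<Rightarrow> 'r::comm_ring_1 \<Rightarrow> ('r, (diagram set \<Rightarrow> 'r) set) module" where
  "typeO_algebra n \<q> = quotient_algebra (diagram_span n) (typeO_relations n \<q>)"

definition typeO_class :: "nat \<Rightarrow> 'r::comm_ring_1 \<Rightarrow> diagram \<Rightarrow> (diagram set \<Rightarrow> 'r) set" where
  "typeO_class n \<q> d =
    relation_class (diagram_span n) (typeO_relations n \<q>) (basis_elt (isotopy_class n d))"

end

theory Submission
  imports Defs
begin

text \<open>
Two things have to be seen: up to isotopy a diagram is a word in crossings and squares, and the
local relations for the crossings \<open>c\<close> are the Hecke relations for \<open>T = c - 1\<close>.

\<^emph>\<open>Diagrams are words.\<close> Reading the crossings and squares of a diagram from the top down gives a word.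
Letters at the same height can be read in any order; such letters sit on disjoint sets of strands,
or are both squares (which may pass each other even on one strand). Call letters of these kinds far
apart. So the word is determined up to exchanging adjacent letters that are far apart, and two
diagrams are isotopic if and only if their words are equivalent in this sense
(\<open>isotopic_iff_words\<close>).

For one direction (\<open>isotopic_far_commutes\<close>), compactness gives an isotopy uniform margins: events less
than \<open>\<delta>\<close> apart in height are far apart, and in a short time no event moves by more than \<open>\<delta> / 4\<close>. Hence
only events that are far apart can overtake each other. For the other direction, every
diagram is moved to a standard diagram of its word (\<open>reads_isotopic_standard\<close>) by three kinds of
isotopies. Two diagrams with the same events at the same heights have, after renumbering the curves,
the same order of curves from left to right at every height, so that the linear path between them
consists of diagrams (\<open>same_events_isotopic\<close>). Changing the height coordinate moves the events to any
heights in the same order (\<open>same_order_isotopic\<close>). Finally, in a pile of blocks, each containing letters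
that are pairwise far apart, the heights of the letters of a block can be moved past one another; this
separates events of equal height and realises the exchanges. Stacking diagrams concatenates words.
Therefore the monoid of diagrams is presented by the letters and the commutation of letters that are
far apart (\<open>standard_words_present_diagrams\<close>).

\<^emph>\<open>Comparison of the relations.\<close> By the previous paragraph both algebras have a universal property in
terms of the same letters, and it remains to see that elements \<open>T\<close>, \<open>X\<close> satisfy the Hecke relations if and
only if \<open>T + 1\<close>, \<open>X\<close> satisfy the type O relations and the commutations
(\<open>hecke_relations_iff_typeO_relations\<close>). The quadratic and the braid relations are translated by expanding.
The two relations for sliding a square through a crossing become \<open>X\<^sub>r T + q X\<^sub>r\<^sub>+\<^sub>1 = T X\<^sub>r\<^sub>+\<^sub>1 + X\<^sub>r\<^sub>+\<^sub>1\<close> and its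
mirror image. Multiplying by \<open>T\<close> and using the quadratic relation turns them into \<open>T X\<^sub>r T = q X\<^sub>r\<^sub>+\<^sub>1\<close>, and
conversely up to a factor \<open>q\<close>, which is invertible because its constant coefficient is. The two
homomorphisms that the universal properties provide are inverse to each other on generators.
\<close>

section \<open>Words of crossings and squares up to far commutation\<close>

text \<open>Letters that commute as diagrams: two crossings without a common strand, a crossing and
  a square on another strand, and any two squares, since several squares may sit at one
  height.\<close>

fun far_apart :: "hecke_gen \<Rightarrow> hecke_gen \<Rightarrow> bool" where
  "far_apart (GenT r) (GenT s) \<longleftrightarrow> r + 1 < s \<or> s + 1 < r"
| "far_apart (GenT r) (GenX s) \<longleftrightarrow> s \<noteq> r \<and> s \<noteq> r + 1"
| "far_apart (GenT r) (GenXinv s) \<longleftrightarrow> s \<noteq> r \<and> s \<noteq> r + 1"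
| "far_apart (GenX s) (GenT r) \<longleftrightarrow> s \<noteq> r \<and> s \<noteq> r + 1"
| "far_apart (GenXinv s) (GenT r) \<longleftrightarrow> s \<noteq> r \<and> s \<noteq> r + 1"
| "far_apart _ _ \<longleftrightarrow> True"

lemma far_apart_sym: "far_apart a b \<Longrightarrow> far_apart b a"
  by (cases a; cases b) auto

inductive far_commutes :: "hecke_gen list \<Rightarrow> hecke_gen list \<Rightarrow> bool" where
  unchanged: "far_commutes w w"
| adjacent_swap: "far_commutes u (v @ [a, b] @ w) \<Longrightarrow> far_apart a b \<Longrightarrow> far_commutes u (v @ [b, a] @ w)"

lemma far_commutes_trans: "far_commutes v w \<Longrightarrow> far_commutes u v \<Longrightarrow> far_commutes u w"
proof (induction rule: far_commutes.induct)
  case (adjacent_swap v' v a b w)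
  then show ?case using far_commutes.adjacent_swap[of u v a b w] by simp
qed

lemma far_commutes_swap: "far_apart a b \<Longrightarrow> far_commutes (v @ [a, b] @ w) (v @ [b, a] @ w)"
  by (intro far_commutes.intros)

lemma far_commutes_append_left: "far_commutes v w \<Longrightarrow> far_commutes (u @ v) (u @ w)"
proof (induction rule: far_commutes.induct)
  case (adjacent_swap x v a b w)
  then show ?case using far_commutes.adjacent_swap[of "u @ x" "u @ v" a b w] by simp
qed (rule far_commutes.unchanged)

lemma far_commutes_append_right: "far_commutes v w \<Longrightarrow> far_commutes (v @ u) (w @ u)"
proof (induction rule: far_commutes.induct)
  case (adjacent_swap x v a b w)
  then show ?case using far_commutes.adjacent_swap[of "x @ u" v a b "w @ u"] by simp
qed (rule far_commutes.unchanged)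

lemma far_commutes_append:
  "far_commutes v v' \<Longrightarrow> far_commutes w w' \<Longrightarrow> far_commutes (v @ w) (v' @ w')"
  using far_commutes_append_left far_commutes_append_right far_commutes_trans by blast

lemma far_commutes_pull: "(\<And>b. b \<in> set v \<Longrightarrow> far_apart b a) \<Longrightarrow> far_commutes (v @ a # w) (a # v @ w)"
proof (induction v)
  case Nil
  show ?case by (simp add: far_commutes.unchanged)
next
  case (Cons b v)
  have "far_commutes (b # v @ a # w) (b # a # v @ w)"
    using far_commutes_append_left[of _ _ "[b]"] Cons by simp
  moreover have "far_commutes (b # a # v @ w) (a # b # v @ w)"
    using far_commutes_swap[of b a "[]" "v @ w"] Cons.prems by simp
  ultimately show ?case using far_commutes_trans by simp
qed

text \<open>The heights \<open>h\<close> and \<open>h'\<close> list the same finite family of events in two orders. Bubble sort: the first event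
  of the second list is pulled to the front of the first one, and all the events that it passes are
  far apart from it.\<close>

lemma far_commutes_reorder:
  fixes h h' :: "'i \<Rightarrow> real" and g :: "'i \<Rightarrow> hecke_gen"
  assumes "distinct xs" "distinct ys" "set xs = set ys"
    and "sorted_wrt (\<lambda>x y. h y \<le> h x) xs" "sorted_wrt (\<lambda>x y. h' y \<le> h' x) ys"
    and "\<And>e f. e \<in> set xs \<Longrightarrow> f \<in> set xs \<Longrightarrow> e \<noteq> f \<Longrightarrow> h e \<le> h f \<Longrightarrow> h' f \<le> h' e \<Longrightarrow> far_apart (g e) (g f)"
  shows "far_commutes (map g xs) (map g ys)"
  using assms
proof (induction ys arbitrary: xs)
  case Nil
  then show ?case by (simp add: far_commutes.unchanged)
next
  case (Cons e ys)
  then have "e \<in> set xs" by simp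
  then obtain us vs where xs: "xs = us @ e # vs" by (meson split_list)
  have "far_apart (g f) (g e)" if "f \<in> set us" for f
  proof -
    have "h e \<le> h f" "e \<noteq> f" using that Cons.prems xs by (auto simp: sorted_wrt_append)
    moreover from this have "f \<in> set ys" using that Cons.prems(3) xs by auto
    then have "h' f \<le> h' e" using Cons.prems(5) by simp
    ultimately show ?thesis using Cons.prems(6)[of e f] that xs far_apart_sym by auto
  qed
  then have "far_commutes (map g us @ g e # map g vs) (g e # map g us @ map g vs)"
    by (intro far_commutes_pull) auto
  moreover have "far_commutes (map g (us @ vs)) (map g ys)"
  proof (rule Cons.IH)
    show "set (us @ vs) = set ys" using Cons.prems(1-3) xs by auto
    show "sorted_wrt (\<lambda>x y. h y \<le> h x) (us @ vs)" using Cons.prems(4) xs by (auto simp: sorted_wrt_append)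
    show "far_apart (g e) (g f)" if "e \<in> set (us @ vs)" "f \<in> set (us @ vs)" "e \<noteq> f" "h e \<le> h f" "h' f \<le> h' e" for e f
      using Cons.prems(6)[of e f] that xs by auto
  qed (use Cons.prems xs in auto)
  then have "far_commutes (g e # map g us @ map g vs) (g e # map g ys)"
    using far_commutes_append_left[of _ _ "[g e]"] by simp
  ultimately have "far_commutes (map g us @ g e # map g vs) (g e # map g ys)"
    by (rule far_commutes_trans[rotated])
  then show ?case by (simp add: xs)
qed

lemma far_commutes_set: "far_commutes v w \<Longrightarrow> set v = set w"
  by (induction rule: far_commutes.induct) auto

text \<open>Events of equal height may be listed in any order, so that a family of events has several words.\<close>

definition descending :: "(real \<times> hecke_gen) list \<Rightarrow> bool" where
  "descending es \<longleftrightarrow> sorted_wrt (\<lambda>e f. fst f \<le> fst e) es"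

lemma descending_exists: "\<exists>es. descending es \<and> mset es = M"
proof -
  obtain es where es: "mset es = M" using ex_mset by blast
  let ?s = "rev (sort_key fst es)"
  have "descending ?s"
    unfolding descending_def sorted_wrt_rev using sorted_sort_key[of fst es]
    by (simp add: sorted_map)
  then show ?thesis using es by (metis mset_rev mset_sort)
qed

definition reads_events :: "(real \<times> hecke_gen) multiset \<Rightarrow> hecke_gen list \<Rightarrow> bool" where
  "reads_events M w \<longleftrightarrow> (\<exists>es. descending es \<and> mset es = M \<and> map snd es = w)"

lemma pair_in_mset_nth:
  assumes "i < length es" "j < length es" "i \<noteq> j"
  shows "{#es ! i, es ! j#} \<subseteq># mset es"
proof -
  have "image_mset ((!) es) (mset_set {i, j}) \<subseteq># image_mset ((!) es) (mset_set {0..<length es})"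
    using assms by (intro image_mset_subseteq_mono subset_imp_msubset_mset_set) auto
  moreover have "image_mset ((!) es) (mset_set {0..<length es}) = mset es"
    by (metis map_nth mset_map mset_upt)
  moreover have "image_mset ((!) es) (mset_set {i, j}) = {#es ! i, es ! j#}"
    using assms by simp
  ultimately show ?thesis by simp
qed

text \<open>The combinatorial core of the invariance of words: if every two events that change their order, or have
  equal heights before or after, are far apart, then the word changes only by far commutation. The
  index set \<open>I\<close> keeps track of an event while its height changes.\<close>

lemma reads_events_move:
  fixes h h' :: "'i \<Rightarrow> real"
  assumes "finite I" "M = image_mset (\<lambda>e. (h e, g e)) (mset_set I)" "M' = image_mset (\<lambda>e. (h' e, g e)) (mset_set I)"
    and far: "\<And>e f. e \<in> I \<Longrightarrow> f \<in> I \<Longrightarrow> e \<noteq> f \<Longrightarrow> h e \<le> h f \<Longrightarrow> h' f \<le> h' e \<Longrightarrow> far_apart (g e) (g f)"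
    and w: "reads_events M w" and w': "reads_events M' w'"
  shows "far_commutes w w'"
proof -
  have lift: "\<exists>xs. distinct xs \<and> set xs = I \<and> map (\<lambda>e. (k e, g e)) xs = es"
    if "mset es = image_mset (\<lambda>e. (k e, g e)) (mset_set I)" for es and k :: "'i \<Rightarrow> real"
  proof -
    obtain zs where zs: "set zs = I" "distinct zs"
      using finite_distinct_list[OF assms(1)] by blast
    let ?zs = "map (\<lambda>e. (k e, g e)) zs"
    have "mset es = mset ?zs" using that zs mset_set_set[of zs] by simp
    then obtain p where "p permutes {..<length ?zs}" "permute_list p ?zs = es"
      by (rule mset_eq_permutation)
    then have p: "p permutes {..<length zs}" "permute_list p ?zs = es" by simp_all
    define xs where "xs = permute_list p zs"
    have "map (\<lambda>e. (k e, g e)) xs = es" using p by (simp add: xs_def permute_list_map)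
    moreover have "set xs = I" "distinct xs"
      using zs p(1) by (simp_all add: xs_def set_permute_list)
    ultimately show ?thesis by blast
  qed
  obtain es es' where es: "descending es" "mset es = M" "map snd es = w"
    and es': "descending es'" "mset es' = M'" "map snd es' = w'"
    using w w' by (auto simp: reads_events_def)
  obtain xs where xs: "distinct xs" "set xs = I" "map (\<lambda>e. (h e, g e)) xs = es"
    using lift es(2) assms(2) by blast
  obtain ys where ys: "distinct ys" "set ys = I" "map (\<lambda>e. (h' e, g e)) ys = es'"
    using lift es'(2) assms(3) by blast
  have "far_commutes (map g xs) (map g ys)"
  proof (rule far_commutes_reorder[where h = h and h' = h'])
    show "sorted_wrt (\<lambda>x y. h y \<le> h x) xs" "sorted_wrt (\<lambda>x y. h' y \<le> h' x) ys"
      using es(1) es'(1) unfolding descending_def xs(3)[symmetric] ys(3)[symmetric] sorted_wrt_map by simp_all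
  qed (use xs ys far in auto)
  moreover have "map g xs = w" "map g ys = w'"
    using es(3) es'(3) unfolding xs(3)[symmetric] ys(3)[symmetric] by (simp_all add: comp_def)
  ultimately show ?thesis by simp
qed

text \<open>Equality of heights is preserved as well: it is the absence of both strict inequalities.\<close>

definition same_order :: "(real \<times> hecke_gen) list \<Rightarrow> (real \<times> hecke_gen) list \<Rightarrow> bool" where
  "same_order es es' \<longleftrightarrow> map snd es = map snd es' \<and>
     (\<forall>k<length es. \<forall>l<length es. fst (es ! k) < fst (es ! l) \<longleftrightarrow> fst (es' ! k) < fst (es' ! l))"

lemma same_order_strict:
  assumes "sorted_wrt (\<lambda>e f. fst f < fst e) es" "sorted_wrt (\<lambda>e f. fst f < fst e) es'" "map snd es = map snd es'"
  shows "same_order es es'"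
  unfolding same_order_def
proof (intro conjI allI impI)
  fix k l assume kl: "k < length es" "l < length es"
  have len: "length es' = length es" using assms(3) by (metis length_map)
  have "fst (es ! k) < fst (es ! l) \<longleftrightarrow> l < k" "fst (es' ! k) < fst (es' ! l) \<longleftrightarrow> l < k"
    using kl len assms(1,2) sorted_wrt_nth_less[of _ es] sorted_wrt_nth_less[of _ es']
    by (metis linorder_neqE_nat order_less_asym order_less_irrefl)+
  then show "fst (es ! k) < fst (es ! l) \<longleftrightarrow> fst (es' ! k) < fst (es' ! l)" by simp
qed (use assms in auto)

section \<open>Slopes, renumbering and concatenation of isotopies\<close>

lemma slope_eqI:
  assumes "(curve d i has_real_derivative D) (at t within {0..1})" "t \<in> {0..1}"
  shows "slope d i t = D"
  using assms unfolding slope_def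
  by (intro vector_derivative_within_closed_interval)
     (auto simp: has_real_derivative_iff_has_vector_derivative)

lemma slope_deriv:
  assumes "curve d i differentiable_on {0..1}" "t \<in> {0..1}"
  shows "(curve d i has_real_derivative slope d i t) (at t within {0..1})"
proof -
  have "curve d i differentiable (at t within {0..1})"
    using assms by (simp add: differentiable_on_def)
  then obtain D where "(curve d i has_real_derivative D) (at t within {0..1})"
    by (auto simp: real_differentiable_def)
  then show ?thesis using slope_eqI[OF _ assms(2)] by metis
qed

text \<open>The derivatives are taken within \<open>[0,1]\<close>, so that only values there
  matter.\<close>

lemma slope_cong:
  assumes "\<And>t. t \<in> {0..1} \<Longrightarrow> curve d i t = curve e j t" "t \<in> {0..1}"
  shows "slope d i t = slope e j t"
  unfolding slope_def vector_derivative_def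
proof (rule arg_cong[where f = Eps], rule ext)
  fix D
  show "(curve d i has_vector_derivative D) (at t within {0..1}) = (curve e j has_vector_derivative D) (at t within {0..1})"
    using assms by (intro has_vector_derivative_cong_ev eventually_mono[OF always_eventually]) (auto simp: eventually_at_filter)
qed

lemma smooth_cong:
  assumes "\<And>t. t \<in> {0..1} \<Longrightarrow> curve d i t = curve e j t"
  shows "curve d i differentiable_on {0..1} \<longleftrightarrow> curve e j differentiable_on {0..1}"
    and "continuous_on {0..1} (slope d i) \<longleftrightarrow> continuous_on {0..1} (slope e j)"
proof -
  show "curve d i differentiable_on {0..1} \<longleftrightarrow> curve e j differentiable_on {0..1}"
    using assms unfolding differentiable_on_def
    by (auto elim!: differentiable_transform_within[OF _ zero_less_one])
  show "continuous_on {0..1} (slope d i) \<longleftrightarrow> continuous_on {0..1} (slope e j)"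
    by (rule continuous_on_cong) (auto intro!: slope_cong assms)
qed

lemma smoothI:
  assumes "\<And>t. t \<in> {0..1} \<Longrightarrow> (curve d i has_real_derivative f t) (at t within {0..1})"
    and "continuous_on {0..1} f"
  shows "curve d i differentiable_on {0..1}" "continuous_on {0..1} (slope d i)"
proof -
  show "curve d i differentiable_on {0..1}"
    using assms(1) unfolding differentiable_on_def real_differentiable_def by blast
  show "continuous_on {0..1} (slope d i)"
    using assms(2) by (rule continuous_on_eq) (use slope_eqI[OF assms(1)] in auto)
qed

lemma is_diagramD:
  assumes "is_diagram n d"
  shows "\<And>i. i \<in> {1..n} \<Longrightarrow> curve d i differentiable_on {0..1}"
    and "\<And>i. i \<in> {1..n} \<Longrightarrow> continuous_on {0..1} (slope d i)"
    and "\<And>t. t \<in> {0,1} \<Longrightarrow> inj_on (\<lambda>i. curve d i t) {1..n}"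
    and "\<And>t i j k. t \<in> {0..1} \<Longrightarrow> i \<in> {1..n} \<Longrightarrow> j \<in> {1..n} \<Longrightarrow> k \<in> {1..n} \<Longrightarrow> i \<noteq> j \<Longrightarrow> j \<noteq> k \<Longrightarrow> i \<noteq> k \<Longrightarrow>
      curve d i t = curve d j t \<Longrightarrow> curve d j t \<noteq> curve d k t"
    and "\<And>t i j. t \<in> {0..1} \<Longrightarrow> i \<in> {1..n} \<Longrightarrow> j \<in> {1..n} \<Longrightarrow> i \<noteq> j \<Longrightarrow> curve d i t = curve d j t \<Longrightarrow>
      slope d i t \<noteq> slope d j t"
    and "\<And>i \<epsilon> t. (i, \<epsilon>, t) \<in> set (squares d) \<Longrightarrow> i \<in> {1..n}"
    and "\<And>i \<epsilon> t. (i, \<epsilon>, t) \<in> set (squares d) \<Longrightarrow> 0 < t \<and> t < 1"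
    and "\<And>i \<epsilon> t j. (i, \<epsilon>, t) \<in> set (squares d) \<Longrightarrow> j \<in> {1..n} \<Longrightarrow> j \<noteq> i \<Longrightarrow> curve d j t \<noteq> curve d i t"
proof -
  note D = assms[unfolded is_diagram_def]
  note D2 = D[THEN conjunct2] note D3 = D2[THEN conjunct2] note D4 = D3[THEN conjunct2] note D5 = D4[THEN conjunct2]
  show "curve d i differentiable_on {0..1}" "continuous_on {0..1} (slope d i)" if "i \<in> {1..n}" for i
    using bspec[OF D[THEN conjunct1] that] by auto
  show "inj_on (\<lambda>i. curve d i t) {1..n}" if "t \<in> {0,1}" for t
    using bspec[OF D2[THEN conjunct1] that] .
  show "curve d j t \<noteq> curve d k t" if "t \<in> {0..1}" "i \<in> {1..n}" "j \<in> {1..n}" "k \<in> {1..n}"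
    "i \<noteq> j" "j \<noteq> k" "i \<noteq> k" "curve d i t = curve d j t" for t i j k
    using D3[THEN conjunct1, rule_format, OF that(1-7)] that(8) by simp
  show "slope d i t \<noteq> slope d j t" if "t \<in> {0..1}" "i \<in> {1..n}" "j \<in> {1..n}" "i \<noteq> j" "curve d i t = curve d j t" for t i j
    by (rule D4[THEN conjunct1, rule_format, OF that])
  fix i \<epsilon> t assume sq: "(i, \<epsilon>, t) \<in> set (squares d)"
  note S = bspec[OF D5 sq, unfolded prod.case]
  show "i \<in> {1..n}" "0 < t \<and> t < 1" using S by auto
  show "curve d j t \<noteq> curve d i t" if "j \<in> {1..n}" "j \<noteq> i" for j
    using S that by blast
qed

subsection \<open>Renumbering\<close>

text \<open>The curve \<open>i\<close> of the new diagram is the curve \<open>\<sigma> i\<close> of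
  the old one, and \<open>p\<close> permutes the list of squares. Renumbering acts on whole
  isotopies, which makes it possible to join isotopies whose ends are merely the same
  picture.\<close>

definition renumber :: "(nat \<Rightarrow> nat) \<Rightarrow> (nat \<Rightarrow> nat) \<Rightarrow> diagram \<Rightarrow> diagram" where
  "renumber \<sigma> p d = \<lparr> curve = (\<lambda>i. curve d (\<sigma> i)),
     squares = permute_list p (map (\<lambda>(i, \<epsilon>, t). (inv_into UNIV \<sigma> i, \<epsilon>, t)) (squares d)) \<rparr>"

lemma renumber_simps [simp]:
  "curve (renumber \<sigma> p d) i = curve d (\<sigma> i)" "slope (renumber \<sigma> p d) i = slope d (\<sigma> i)"
  "length (squares (renumber \<sigma> p d)) = length (squares d)"
  by (simp_all add: renumber_def slope_def fun_eq_iff)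

lemma mset_renumber:
  "p permutes {..<length (squares d)} \<Longrightarrow>
    mset (squares (renumber \<sigma> p d)) = image_mset (\<lambda>(i, \<epsilon>, t). (inv_into UNIV \<sigma> i, \<epsilon>, t)) (mset (squares d))"
  by (simp add: renumber_def)

lemma permutes_inv_in: "\<pi> permutes A \<Longrightarrow> i \<in> A \<Longrightarrow> inv_into UNIV \<pi> i \<in> A"
  using permutes_in_image permutes_inv by metis

lemma is_diagram_same_picture:
  assumes "is_diagram n d" "same_picture n d e"
  shows "is_diagram n e"
proof -
  obtain \<pi> where \<pi>: "\<pi> permutes {1..n}" "\<And>i t. i \<in> {1..n} \<Longrightarrow> t \<in> {0..1} \<Longrightarrow> curve e (\<pi> i) t = curve d i t"
    "mset (squares e) = image_mset (\<lambda>(i, \<epsilon>, t). (\<pi> i, \<epsilon>, t)) (mset (squares d))"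
    using assms(2) unfolding same_picture_def by blast
  have ce: "curve e i t = curve d (inv_into UNIV \<pi> i) t" if "i \<in> {1..n}" "t \<in> {0..1}" for i t
    using \<pi>(2)[OF permutes_inv_in[OF \<pi>(1) that(1)] that(2)] \<pi>(1) by (simp add: permutes_inverses)
  have se: "slope e i t = slope d (inv_into UNIV \<pi> i) t" if "i \<in> {1..n}" "t \<in> {0..1}" for i t
    using that by (intro slope_cong) (auto simp: ce)
  have inv_in: "inv_into UNIV \<pi> i \<in> {1..n}" if "i \<in> {1..n}" for i
    using that \<pi>(1) by (metis permutes_in_image permutes_inv)
  have inv_inj: "inv_into UNIV \<pi> i = inv_into UNIV \<pi> j \<longleftrightarrow> i = j" for i j
    using \<pi>(1) by (metis permutes_inverses(1))
  note D = is_diagramD[OF assms(1)]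
  show ?thesis
    unfolding is_diagram_def
  proof (intro conjI ballI impI; (intro conjI)?)
    fix i assume i: "i \<in> {1..n}"
    show "curve e i differentiable_on {0..1}" "continuous_on {0..1} (slope e i)"
      using smooth_cong[of e i d "inv_into UNIV \<pi> i"] ce i D(1,2)[OF inv_in[OF i]] by auto
  next
    fix t :: real assume t: "t \<in> {0, 1}"
    show "inj_on (\<lambda>i. curve e i t) {1..n}"
    proof (rule inj_onI)
      fix i j assume "i \<in> {1..n}" "j \<in> {1..n}" "curve e i t = curve e j t"
      then show "i = j"
        using inj_onD[OF D(3)[OF t], of "inv_into UNIV \<pi> i" "inv_into UNIV \<pi> j"] t ce[of i t] ce[of j t] inv_in inv_inj by auto
    qed
  next
    fix t :: real and i j k
    assume "t \<in> {0..1}" "i \<in> {1..n}" "j \<in> {1..n}" "k \<in> {1..n}" "i \<noteq> j" "j \<noteq> k" "i \<noteq> k"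
    then show "\<not> (curve e i t = curve e j t \<and> curve e j t = curve e k t)"
      using D(4)[of t "inv_into UNIV \<pi> i" "inv_into UNIV \<pi> j" "inv_into UNIV \<pi> k"] inv_in inv_inj ce by simp
  next
    fix t :: real and i j
    assume "t \<in> {0..1}" "i \<in> {1..n}" "j \<in> {1..n}" "i \<noteq> j" "curve e i t = curve e j t"
    then show "slope e i t \<noteq> slope e j t"
      using D(5)[of t "inv_into UNIV \<pi> i" "inv_into UNIV \<pi> j"] inv_in inv_inj ce se by simp
  next
    fix x assume "x \<in> set (squares e)"
    then have "x \<in># image_mset (\<lambda>(i, \<epsilon>, t). (\<pi> i, \<epsilon>, t)) (mset (squares d))" using \<pi>(3) by (metis set_mset_mset)
    then obtain i \<epsilon> t where x: "x = (\<pi> i, \<epsilon>, t)" "(i, \<epsilon>, t) \<in> set (squares d)" by auto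
    note d5 = D(6-8)[OF x(2)]
    have "curve e j t \<noteq> curve e (\<pi> i) t" if "j \<in> {1..n}" "j \<noteq> \<pi> i" for j
    proof -
      have "inv_into UNIV \<pi> j \<noteq> i" using that \<pi>(1) by (metis permutes_inverses(1))
      then show ?thesis using d5 that inv_in ce[OF that(1), of t] \<pi>(2)[of i t] by auto
    qed
    moreover have "\<pi> i \<in> {1..n}" using d5 \<pi>(1) by (metis permutes_in_image)
    ultimately show "case x of (i, \<epsilon>, t) \<Rightarrow> i \<in> {1..n} \<and> t \<in> {0<..<1} \<and>
        (\<forall>j\<in>{1..n}. j \<noteq> i \<longrightarrow> curve e j t \<noteq> curve e i t)"
      using x d5 by auto
  qed
qed

lemma same_picture_refl: "same_picture n d d"
  unfolding same_picture_def
  by (intro exI[of _ id]) (auto simp: permutes_id case_prod_beta)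

lemma same_picture_sym:
  assumes "same_picture n d e" shows "same_picture n e d"
proof -
  obtain \<pi> where \<pi>: "\<pi> permutes {1..n}" "\<And>i t. i \<in> {1..n} \<Longrightarrow> t \<in> {0..1} \<Longrightarrow> curve e (\<pi> i) t = curve d i t"
    "mset (squares e) = image_mset (\<lambda>(i, \<epsilon>, t). (\<pi> i, \<epsilon>, t)) (mset (squares d))"
    using assms unfolding same_picture_def by blast
  have "curve d (inv_into UNIV \<pi> i) t = curve e i t" if "i \<in> {1..n}" "t \<in> {0..1}" for i t
    using \<pi>(2)[OF permutes_inv_in[OF \<pi>(1) that(1)] that(2)] \<pi>(1) by (simp add: permutes_inverses)
  moreover have "mset (squares d) = image_mset (\<lambda>(i, \<epsilon>, t). (inv_into UNIV \<pi> i, \<epsilon>, t)) (mset (squares e))"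
    using \<pi>(1) by (simp add: \<pi>(3) image_mset.compositionality comp_def case_prod_beta permutes_inverses)
  ultimately show ?thesis
    unfolding same_picture_def using \<pi>(1) by (intro exI[of _ "inv_into UNIV \<pi>"]) (auto simp: permutes_inv)
qed

lemma same_picture_trans:
  assumes "same_picture n d e" "same_picture n e f" shows "same_picture n d f"
proof -
  obtain \<pi> where \<pi>: "\<pi> permutes {1..n}" "\<And>i t. i \<in> {1..n} \<Longrightarrow> t \<in> {0..1} \<Longrightarrow> curve e (\<pi> i) t = curve d i t"
    "mset (squares e) = image_mset (\<lambda>(i, \<epsilon>, t). (\<pi> i, \<epsilon>, t)) (mset (squares d))"
    using assms(1) unfolding same_picture_def by blast
  obtain \<rho> where \<rho>: "\<rho> permutes {1..n}" "\<And>i t. i \<in> {1..n} \<Longrightarrow> t \<in> {0..1} \<Longrightarrow> curve f (\<rho> i) t = curve e i t"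
    "mset (squares f) = image_mset (\<lambda>(i, \<epsilon>, t). (\<rho> i, \<epsilon>, t)) (mset (squares e))"
    using assms(2) unfolding same_picture_def by blast
  have \<pi>in: "\<pi> i \<in> {1..n}" if "i \<in> {1..n}" for i using that \<pi>(1) by (metis permutes_in_image)
  show ?thesis
    unfolding same_picture_def
  proof (intro exI[of _ "\<rho> \<circ> \<pi>"] conjI ballI)
    show "\<rho> \<circ> \<pi> permutes {1..n}" using \<pi>(1) \<rho>(1) by (rule permutes_compose)
    show "curve f ((\<rho> \<circ> \<pi>) i) t = curve d i t" if "i \<in> {1..n}" "t \<in> {0..1}" for i t
      using \<pi>(2)[OF that] \<rho>(2)[OF \<pi>in[OF that(1)] that(2)] by simp
    show "mset (squares f) = image_mset (\<lambda>(i, \<epsilon>, t). ((\<rho> \<circ> \<pi>) i, \<epsilon>, t)) (mset (squares d))"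
      unfolding \<rho>(3) \<pi>(3) image_mset.compositionality by (rule image_mset_cong) auto
  qed
qed

text \<open>Equality as functions fails in general, because the curves may differ at irrelevant arguments.\<close>

definition agree :: "nat \<Rightarrow> diagram \<Rightarrow> diagram \<Rightarrow> bool" where
  "agree n d e \<longleftrightarrow> (\<forall>i\<in>{1..n}. \<forall>t\<in>{0..1}. curve d i t = curve e i t) \<and> squares d = squares e"

lemma agree_same_picture: "agree n d e \<Longrightarrow> same_picture n d e"
  unfolding same_picture_def agree_def
  by (intro exI[of _ id]) (auto simp: permutes_id case_prod_beta)

lemma same_picture_renumber:
  assumes "\<sigma> permutes {1..n}" "p permutes {..<length (squares d)}"
  shows "same_picture n d (renumber \<sigma> p d)"
  unfolding same_picture_def
  using assms by (intro exI[of _ "inv_into UNIV \<sigma>"]) (auto simp: permutes_inv mset_renumber permutes_inverses)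

lemma renumber_to_agree:
  assumes "same_picture n d e"
  shows "\<exists>\<sigma> p. \<sigma> permutes {1..n} \<and> p permutes {..<length (squares d)} \<and> agree n (renumber \<sigma> p d) e"
proof -
  obtain \<pi> where \<pi>: "\<pi> permutes {1..n}" "\<And>i t. i \<in> {1..n} \<Longrightarrow> t \<in> {0..1} \<Longrightarrow> curve e (\<pi> i) t = curve d i t"
    "mset (squares e) = image_mset (\<lambda>(i, \<epsilon>, t). (\<pi> i, \<epsilon>, t)) (mset (squares d))"
    using assms unfolding same_picture_def by blast
  let ?L = "map (\<lambda>(i, \<epsilon>, t). (\<pi> i, \<epsilon>, t)) (squares d)"
  have "mset (squares e) = mset ?L" using \<pi>(3) by simp
  then obtain p where "p permutes {..<length ?L}" "permute_list p ?L = squares e"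
    by (rule mset_eq_permutation)
  moreover have "curve d (inv_into UNIV \<pi> i) t = curve e i t" if "i \<in> {1..n}" "t \<in> {0..1}" for i t
    using \<pi>(2)[OF permutes_inv_in[OF \<pi>(1) that(1)] that(2)] \<pi>(1) by (simp add: permutes_inverses)
  ultimately show ?thesis
    using \<pi>(1) by (intro exI[of _ "inv_into UNIV \<pi>"] exI[of _ p])
      (auto simp: permutes_inv agree_def renumber_def permutes_inv_inv)
qed

subsection \<open>Isotopy is an equivalence relation\<close>

lemma isotopyD:
  assumes "isotopy n H"
  shows "\<And>s. s \<in> {0..1} \<Longrightarrow> is_diagram n (H s)"
    and "\<And>i. i \<in> {1..n} \<Longrightarrow> continuous_on ({0..1} \<times> {0..1}) (\<lambda>(s, t). curve (H s) i t)"
    and "\<And>i. i \<in> {1..n} \<Longrightarrow> continuous_on ({0..1} \<times> {0..1}) (\<lambda>(s, t). slope (H s) i t)"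
    and "\<And>s. s \<in> {0..1} \<Longrightarrow> map (\<lambda>(i, \<epsilon>, t). (i, \<epsilon>)) (squares (H s)) = map (\<lambda>(i, \<epsilon>, t). (i, \<epsilon>)) (squares (H 0))"
    and "\<And>k. k < length (squares (H 0)) \<Longrightarrow> continuous_on {0..1} (\<lambda>s. snd (snd (squares (H s) ! k)))"
  using assms unfolding isotopy_def by blast+

lemma isotopyI:
  assumes "\<And>s. s \<in> {0..1} \<Longrightarrow> is_diagram n (H s)"
    and "\<And>i. i \<in> {1..n} \<Longrightarrow> continuous_on ({0..1} \<times> {0..1}) (\<lambda>(s, t). curve (H s) i t)"
    and "\<And>i. i \<in> {1..n} \<Longrightarrow> continuous_on ({0..1} \<times> {0..1}) (\<lambda>(s, t). slope (H s) i t)"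
    and "\<And>s. s \<in> {0..1} \<Longrightarrow> map (\<lambda>(i, \<epsilon>, t). (i, \<epsilon>)) (squares (H s)) = map (\<lambda>(i, \<epsilon>, t). (i, \<epsilon>)) (squares (H 0))"
    and "\<And>k. k < length (squares (H 0)) \<Longrightarrow> continuous_on {0..1} (\<lambda>s. snd (snd (squares (H s) ! k)))"
  shows "isotopy n H"
  using assms unfolding isotopy_def by blast

lemma isotopy_length:
  "isotopy n H \<Longrightarrow> s \<in> {0..1} \<Longrightarrow> length (squares (H s)) = length (squares (H 0))"
  using isotopyD(4) by (metis length_map)

lemma isotopy_renumber:
  assumes H: "isotopy n H" and \<sigma>: "\<sigma> permutes {1..n}" and p: "p permutes {..<length (squares (H 0))}"
  shows "isotopy n (\<lambda>s. renumber \<sigma> p (H s))"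
proof (rule isotopyI)
  note h = isotopyD[OF H]
  have len: "length (squares (H s)) = length (squares (H 0))" if "s \<in> {0..1}" for s
    using isotopy_length[OF H that] .
  have \<sigma>in: "\<sigma> i \<in> {1..n}" if "i \<in> {1..n}" for i using \<sigma> that by (metis permutes_in_image)
  show "is_diagram n (renumber \<sigma> p (H s))" if "s \<in> {0..1}" for s
    using is_diagram_same_picture[OF h(1)[OF that] same_picture_renumber[OF \<sigma>]] p len[OF that] by simp
  show "continuous_on ({0..1} \<times> {0..1}) (\<lambda>(s, t). curve (renumber \<sigma> p (H s)) i t)"
    "continuous_on ({0..1} \<times> {0..1}) (\<lambda>(s, t). slope (renumber \<sigma> p (H s)) i t)" if "i \<in> {1..n}" for i
    using h(2,3)[OF \<sigma>in[OF that]] by simp_all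
  have m: "map (\<lambda>(i, \<epsilon>, t). (i, \<epsilon>)) (squares (renumber \<sigma> p (H s)))
      = permute_list p (map (\<lambda>(i, \<epsilon>). (inv_into UNIV \<sigma> i, \<epsilon>)) (map (\<lambda>(i, \<epsilon>, t). (i, \<epsilon>)) (squares (H s))))" if "s \<in> {0..1}" for s
    using p len[OF that] by (simp add: renumber_def permute_list_map comp_def case_prod_beta)
  show "map (\<lambda>(i, \<epsilon>, t). (i, \<epsilon>)) (squares (renumber \<sigma> p (H s))) =
      map (\<lambda>(i, \<epsilon>, t). (i, \<epsilon>)) (squares (renumber \<sigma> p (H 0)))" if "s \<in> {0..1}" for s
    using m[OF that] m[of 0] h(4)[OF that] by simp
  fix k assume "k < length (squares (renumber \<sigma> p (H 0)))"
  then have k: "k < length (squares (H 0))" by simp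
  then have pk: "p k < length (squares (H 0))" using p by (metis lessThan_iff permutes_in_image)
  show "continuous_on {0..1} (\<lambda>s. snd (snd (squares (renumber \<sigma> p (H s)) ! k)))"
    using h(5)[OF pk]
  proof (rule continuous_on_eq)
    fix s :: real assume s: "s \<in> {0..1}"
    show "snd (snd (squares (H s) ! p k)) = snd (snd (squares (renumber \<sigma> p (H s)) ! k))"
      using k pk p len[OF s] by (simp add: renumber_def permute_list_nth case_prod_beta)
  qed
qed

lemma isotopy_reverse:
  assumes H: "isotopy n H" shows "isotopy n (\<lambda>s. H (1 - s))"
proof (rule isotopyI)
  note h = isotopyD[OF H]
  have m: "(\<lambda>(s, t). (1 - s, t)) ` ({0..1::real} \<times> {0..1::real}) \<subseteq> {0..1} \<times> {0..1}" by auto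
  have c: "continuous_on ({0..1::real} \<times> {0..1::real}) (\<lambda>(s, t). (1 - s, t))"
    by (auto simp: case_prod_beta intro!: continuous_intros)
  show "is_diagram n (H (1 - s))" if "s \<in> {0..1}" for s using h(1)[of "1 - s"] that by simp
  show "continuous_on ({0..1} \<times> {0..1}) (\<lambda>(s, t). curve (H (1 - s)) i t)"
    "continuous_on ({0..1} \<times> {0..1}) (\<lambda>(s, t). slope (H (1 - s)) i t)" if "i \<in> {1..n}" for i
    using continuous_on_compose2[OF h(2)[OF that] c m] continuous_on_compose2[OF h(3)[OF that] c m]
    by (simp_all add: case_prod_beta)
  show "map (\<lambda>(i, \<epsilon>, t). (i, \<epsilon>)) (squares (H (1 - s))) = map (\<lambda>(i, \<epsilon>, t). (i, \<epsilon>)) (squares (H (1 - 0)))"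
    if "s \<in> {0..1}" for s
    using h(4)[of "1 - s"] h(4)[of 1] that by simp
  show "continuous_on {0..1} (\<lambda>s. snd (snd (squares (H (1 - s)) ! k)))" if "k < length (squares (H (1 - 0)))" for k
  proof -
    have "k < length (squares (H 0))" using that isotopy_length[OF H, of 1] by simp
    then show ?thesis
      by (intro continuous_on_compose2[OF h(5), of k "{0..1}" "\<lambda>s. 1 - s"]) (auto intro!: continuous_intros)
  qed
qed

lemma isotopy_concat:
  assumes H: "isotopy n H" and K: "isotopy n K" and HK: "agree n (H 1) (K 0)"
  shows "isotopy n (\<lambda>s. if s \<le> 1/2 then H (2 * s) else K (2 * s - 1))" (is "isotopy n ?L")
proof (rule isotopyI)
  note h = isotopyD[OF H] and k = isotopyD[OF K]
  show "is_diagram n (?L s)" if "s \<in> {0..1}" for s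
    using h(1)[of "2 * s"] k(1)[of "2 * s - 1"] that by simp
  let ?A = "{0..1/2::real} \<times> {0..1::real}" and ?B = "{1/2..1::real} \<times> {0..1::real}"
  have AB: "{0..1::real} \<times> {0..1::real} = ?A \<union> ?B" by auto
  have glue: "continuous_on ({0..1} \<times> {0..1}) (\<lambda>(s, t). g (?L s) t)"
    if g: "continuous_on ({0..1} \<times> {0..1}) (\<lambda>(s, t). g (H s) t)" "continuous_on ({0..1} \<times> {0..1}) (\<lambda>(s, t). g (K s) t)"
      "\<And>t. t \<in> {0..1} \<Longrightarrow> g (H 1) t = g (K 0) t" for g :: "diagram \<Rightarrow> real \<Rightarrow> real"
  proof -
    have 1: "continuous_on ?A (\<lambda>p. g (H (2 * fst p)) (snd p))"
    proof -
      have "continuous_on ?A (\<lambda>p. (2 * fst p, snd p))" by (intro continuous_intros)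
      moreover have "(\<lambda>p. (2 * fst p, snd p)) ` ?A \<subseteq> {0..1} \<times> {0..1}" by auto
      ultimately have "continuous_on ?A (\<lambda>p. case (2 * fst p, snd p) of (s, t) \<Rightarrow> g (H s) t)"
        by (rule continuous_on_compose2[OF g(1)])
      then show ?thesis by simp
    qed
    have 2: "continuous_on ?B (\<lambda>p. g (K (2 * fst p - 1)) (snd p))"
    proof -
      have "continuous_on ?B (\<lambda>p. (2 * fst p - 1, snd p))" by (intro continuous_intros)
      moreover have "(\<lambda>p. (2 * fst p - 1, snd p)) ` ?B \<subseteq> {0..1} \<times> {0..1}" by auto
      ultimately have "continuous_on ?B (\<lambda>p. case (2 * fst p - 1, snd p) of (s, t) \<Rightarrow> g (K s) t)"
        by (rule continuous_on_compose2[OF g(2)])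
      then show ?thesis by simp
    qed
    have "continuous_on (?A \<union> ?B) (\<lambda>p. if fst p \<le> 1/2 then g (H (2 * fst p)) (snd p) else g (K (2 * fst p - 1)) (snd p))"
    proof (rule continuous_on_cases[OF _ _ 1 2])
      show "closed ?A" "closed ?B" by (intro closed_Times closed_atLeastAtMost)+
      show "\<forall>p. p \<in> ?A \<and> \<not> fst p \<le> 1/2 \<or> p \<in> ?B \<and> fst p \<le> 1/2 \<longrightarrow>
         g (H (2 * fst p)) (snd p) = g (K (2 * fst p - 1)) (snd p)"
      proof (intro allI impI)
        fix p :: "real \<times> real"
        assume p: "p \<in> ?A \<and> \<not> fst p \<le> 1/2 \<or> p \<in> ?B \<and> fst p \<le> 1/2"
        then have f: "2 * fst p = 1" and "snd p \<in> {0..1}" by auto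
        then show "g (H (2 * fst p)) (snd p) = g (K (2 * fst p - 1)) (snd p)"
          unfolding f using g(3) by simp
      qed
    qed
    then show ?thesis unfolding AB[symmetric] by (simp add: case_prod_beta if_distrib if_distribR)
  qed
  show "continuous_on ({0..1} \<times> {0..1}) (\<lambda>(s, t). curve (?L s) i t)" if "i \<in> {1..n}" for i
    by (rule glue[of "\<lambda>d. curve d i"]) (use h(2)[OF that] k(2)[OF that] HK that in \<open>auto simp: agree_def\<close>)
  show "continuous_on ({0..1} \<times> {0..1}) (\<lambda>(s, t). slope (?L s) i t)" if "i \<in> {1..n}" for i
    by (rule glue[of "\<lambda>d. slope d i"])
       (use h(3)[OF that] k(3)[OF that] HK that in \<open>auto simp: agree_def intro!: slope_cong\<close>)
  have sq: "squares (H 1) = squares (K 0)" using HK by (simp add: agree_def)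
  show "map (\<lambda>(i, \<epsilon>, t). (i, \<epsilon>)) (squares (?L s)) = map (\<lambda>(i, \<epsilon>, t). (i, \<epsilon>)) (squares (?L 0))"
    if "s \<in> {0..1}" for s
    using h(4)[of "2 * s"] h(4)[of 1] k(4)[of "2 * s - 1"] that sq by simp
  show "continuous_on {0..1} (\<lambda>s. snd (snd (squares (?L s) ! m)))" if "m < length (squares (?L 0))" for m
  proof -
    have m: "m < length (squares (H 0))" using that by simp
    then have m': "m < length (squares (K 0))" using isotopy_length[OF H, of 1] sq by simp
    have 1: "continuous_on {0..1/2} (\<lambda>s. snd (snd (squares (H (2 * s)) ! m)))"
      by (rule continuous_on_compose2[OF h(5)[OF m]]) (auto intro!: continuous_intros)
    have 2: "continuous_on {1/2..1} (\<lambda>s. snd (snd (squares (K (2 * s - 1)) ! m)))"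
      by (rule continuous_on_compose2[OF k(5)[OF m']]) (auto intro!: continuous_intros)
    have "continuous_on ({0..1/2} \<union> {1/2..1}) (\<lambda>s. if s \<le> 1/2 then snd (snd (squares (H (2 * s)) ! m))
        else snd (snd (squares (K (2 * s - 1)) ! m)))"
    proof (rule continuous_on_cases[OF _ _ 1 2])
      show "\<forall>s. s \<in> {0..1/2} \<and> \<not> s \<le> 1/2 \<or> s \<in> {1/2..1} \<and> s \<le> 1/2 \<longrightarrow>
         snd (snd (squares (H (2 * s)) ! m)) = snd (snd (squares (K (2 * s - 1)) ! m))"
      proof (intro allI impI)
        fix s :: real assume "s \<in> {0..1/2} \<and> \<not> s \<le> 1/2 \<or> s \<in> {1/2..1} \<and> s \<le> 1/2"
        then have e: "2 * s = 1" by auto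
        show "snd (snd (squares (H (2 * s)) ! m)) = snd (snd (squares (K (2 * s - 1)) ! m))" unfolding e sq by simp
      qed
    qed auto
    moreover have "{0..1/2} \<union> {1/2..1} = {0..1::real}" by auto
    ultimately show ?thesis by (simp add: if_distrib if_distribR cong: if_cong)
  qed
qed

lemma isotopic_sym: assumes "isotopic n d e" shows "isotopic n e d"
proof -
  obtain H where H: "isotopy n H" "same_picture n d (H 0)" "same_picture n e (H 1)"
    using assms unfolding isotopic_def by blast
  show ?thesis
    using assms isotopy_reverse[OF H(1)] H(2,3) unfolding isotopic_def
    by (intro conjI exI[of _ "\<lambda>s. H (1 - s)"]) simp_all
qed

text \<open>Two isotopies through \<open>e\<close> end and start at the same picture only; the
  second one is renumbered as a whole so that they fit together.\<close>

lemma isotopic_trans: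
  assumes "isotopic n d e" "isotopic n e f" shows "isotopic n d f"
proof -
  obtain H where H: "isotopy n H" "same_picture n d (H 0)" "same_picture n e (H 1)"
    using assms unfolding isotopic_def by blast
  obtain K where K: "isotopy n K" "same_picture n e (K 0)" "same_picture n f (K 1)"
    using assms unfolding isotopic_def by blast
  have "same_picture n (K 0) (H 1)"
    using same_picture_trans[OF same_picture_sym[OF K(2)] H(3)] .
  then obtain \<sigma> p where \<sigma>: "\<sigma> permutes {1..n}" "p permutes {..<length (squares (K 0))}"
    "agree n (renumber \<sigma> p (K 0)) (H 1)"
    using renumber_to_agree by blast
  let ?K = "\<lambda>s. renumber \<sigma> p (K s)"
  have K': "isotopy n ?K" by (rule isotopy_renumber[OF K(1) \<sigma>(1,2)])
  have ag: "agree n (H 1) (?K 0)" using \<sigma>(3) by (simp add: agree_def)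
  have "same_picture n f (?K 1)"
    using same_picture_trans[OF K(3) same_picture_renumber[OF \<sigma>(1)]] \<sigma>(2) isotopy_length[OF K(1), of 1] by simp
  then show ?thesis
    using assms isotopy_concat[OF H(1) K' ag] H(2) unfolding isotopic_def
    by (intro conjI exI[of _ "\<lambda>s. if s \<le> 1/2 then H (2 * s) else ?K (2 * s - 1)"]) simp_all
qed

lemma isotopy_const: assumes "is_diagram n d" shows "isotopy n (\<lambda>s. d)"
proof (rule isotopyI)
  note D = is_diagramD[OF assms]
  have c: "continuous_on {0..1} (curve d i)" if "i \<in> {1..n}" for i
    using D(1)[OF that] by (rule differentiable_imp_continuous_on)
  show "continuous_on ({0..1} \<times> {0..1}) (\<lambda>(s, t). curve d i t)"
    "continuous_on ({0..1} \<times> {0..1}) (\<lambda>(s, t). slope d i t)" if "i \<in> {1..n}" for i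
    unfolding case_prod_beta
    by (rule continuous_on_compose2[OF c[OF that] continuous_on_snd[OF continuous_on_id]]; auto)
       (rule continuous_on_compose2[OF D(2)[OF that] continuous_on_snd[OF continuous_on_id]]; auto)
qed (use assms in auto)

lemma same_picture_isotopic:
  assumes "is_diagram n d" "same_picture n d e" shows "isotopic n d e"
  unfolding isotopic_def
  using assms is_diagram_same_picture isotopy_const[OF assms(1)] same_picture_refl same_picture_sym by blast

lemma isotopic_refl: "is_diagram n d \<Longrightarrow> isotopic n d d"
  using same_picture_isotopic same_picture_refl by blast

section \<open>The word of a diagram is an isotopy invariant\<close>

text \<open>The position of a curve, counted from the left. Both curves of a crossing have the
  position of the left strand, because the inequality is strict.\<close>

definition place :: "nat \<Rightarrow> diagram \<Rightarrow> nat \<Rightarrow> real \<Rightarrow> nat" where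
  "place n d i t = Suc (card {k \<in> {1..n}. curve d k t < curve d i t})"

definition crossings :: "nat \<Rightarrow> diagram \<Rightarrow> (real \<times> nat) set" where
  "crossings n d = {(t, r). t \<in> {0..1} \<and>
     (\<exists>i\<in>{1..n}. \<exists>j\<in>{1..n}. i \<noteq> j \<and> curve d i t = curve d j t \<and> r = place n d i t)}"

definition square_gen :: "bool \<Rightarrow> nat \<Rightarrow> hecke_gen" where
  "square_gen \<epsilon> r = (if \<epsilon> then GenX r else GenXinv r)"

text \<open>A crossing contributes once, although it arises from two ordered pairs of curves;
  squares contribute with multiplicity.\<close>

definition events :: "nat \<Rightarrow> diagram \<Rightarrow> (real \<times> hecke_gen) multiset" where
  "events n d = mset_set ((\<lambda>(t, r). (t, GenT r)) ` crossings n d) +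
     image_mset (\<lambda>(i, \<epsilon>, t). (t, square_gen \<epsilon> (place n d i t))) (mset (squares d))"

definition reads :: "nat \<Rightarrow> diagram \<Rightarrow> hecke_gen list \<Rightarrow> bool" where
  "reads n d w \<longleftrightarrow> is_diagram n d \<and> reads_events (events n d) w"

lemma crossingsI:
  "t \<in> {0..1} \<Longrightarrow> i \<in> {1..n} \<Longrightarrow> j \<in> {1..n} \<Longrightarrow> i \<noteq> j \<Longrightarrow> curve d i t = curve d j t \<Longrightarrow>
    (t, place n d i t) \<in> crossings n d"
  unfolding crossings_def by blast

lemma crossingsE:
  assumes "(t, r) \<in> crossings n d"
  obtains i j where "t \<in> {0..1}" "i \<in> {1..n}" "j \<in> {1..n}" "i \<noteq> j" "curve d i t = curve d j t" "r = place n d i t"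
  using assms unfolding crossings_def by blast

lemma far_apart_square_gen [simp]:
  "far_apart (square_gen \<epsilon> r) (square_gen \<epsilon>' r')"
  "far_apart (square_gen \<epsilon> r) (GenT s) \<longleftrightarrow> r \<noteq> s \<and> r \<noteq> s + 1"
  "far_apart (GenT s) (square_gen \<epsilon> r) \<longleftrightarrow> r \<noteq> s \<and> r \<noteq> s + 1"
  by (auto simp: square_gen_def)

lemma place_eqI:
  assumes "\<And>m. m \<in> {1..n} \<Longrightarrow> curve d m t < curve d i t \<longleftrightarrow> curve e m t' < curve e j t'"
  shows "place n d i t = place n e j t'"
proof -
  have "{k \<in> {1..n}. curve d k t < curve d i t} = {k \<in> {1..n}. curve e k t' < curve e j t'}"
    using assms by blast
  then show ?thesis by (simp add: place_def)
qed

lemma place_above_pair: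
  assumes "i \<in> {1..n}" "j \<in> {1..n}" "i \<noteq> j" "curve e i t' < curve e k t'" "curve e j t' < curve e k t'"
    and "\<And>m. m \<in> {1..n} \<Longrightarrow> curve d m t < curve d i t \<Longrightarrow> curve e m t' < curve e k t' \<and> m \<noteq> i \<and> m \<noteq> j"
  shows "place n d i t + 1 < place n e k t'"
proof -
  let ?A = "{m \<in> {1..n}. curve d m t < curve d i t}" and ?B = "{m \<in> {1..n}. curve e m t' < curve e k t'}"
  have "insert i (insert j ?A) \<subseteq> ?B" using assms by blast
  then have "card (insert i (insert j ?A)) \<le> card ?B" by (intro card_mono) auto
  moreover have "card (insert i (insert j ?A)) = Suc (Suc (card ?A))"
  proof -
    have "j \<notin> ?A" "i \<notin> insert j ?A" "finite ?A" using assms(3,6) by auto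
    then show ?thesis by simp
  qed
  ultimately show ?thesis by (simp add: place_def)
qed

lemma place_above_one:
  assumes "i \<in> {1..n}" "curve e i t' < curve e k t'"
    and "\<And>m. m \<in> {1..n} \<Longrightarrow> curve d m t < curve d i t \<Longrightarrow> curve e m t' < curve e k t' \<and> m \<noteq> i"
  shows "place n d i t < place n e k t'"
proof -
  let ?A = "{m \<in> {1..n}. curve d m t < curve d i t}" and ?B = "{m \<in> {1..n}. curve e m t' < curve e k t'}"
  have "insert i ?A \<subseteq> ?B" using assms by blast
  then have "card (insert i ?A) \<le> card ?B" by (intro card_mono) auto
  moreover have "card (insert i ?A) = Suc (card ?A)"
    using assms(3) by (subst card_insert_disjoint) force+
  ultimately show ?thesis by (simp add: place_def)
qed

subsection \<open>Uniform margins\<close>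

lemma compact_positive_margin:
  fixes f :: "'a::topological_space \<Rightarrow> real"
  assumes "compact K" "continuous_on K f" "\<And>x. x \<in> K \<Longrightarrow> 0 < f x"
  shows "\<exists>\<mu>>0. \<forall>x\<in>K. \<mu> \<le> f x"
proof (cases "K = {}")
  case False
  then obtain x where "x \<in> K" "\<And>y. y \<in> K \<Longrightarrow> f x \<le> f y"
    using continuous_attains_inf[OF assms(1) False assms(2)] by blast
  then show ?thesis using assms(3) by (intro exI[of _ "f x"]) auto
qed (auto intro: exI[of _ 1])

lemma finite_common_margin:
  fixes P :: "'i \<Rightarrow> real \<Rightarrow> bool"
  assumes "finite I" "\<And>i. i \<in> I \<Longrightarrow> \<exists>\<mu>>0. P i \<mu>"
    and mono: "\<And>i \<mu> \<mu>'. P i \<mu> \<Longrightarrow> 0 < \<mu>' \<Longrightarrow> \<mu>' \<le> \<mu> \<Longrightarrow> P i \<mu>'"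
  shows "\<exists>\<mu>>0. \<forall>i\<in>I. P i \<mu>"
  using assms(1,2)
proof (induction I rule: finite_induct)
  case (insert i I)
  then obtain \<mu> \<nu> where "\<mu> > 0" "\<forall>i\<in>I. P i \<mu>" "\<nu> > 0" "P i \<nu>" by blast
  then show ?case using mono by (intro exI[of _ "min \<mu> \<nu>"]) (auto intro: mono)
qed (auto intro: exI[of _ 1])

lemma uniform_margin:
  fixes f :: "'i \<Rightarrow> 'a::topological_space \<Rightarrow> real"
  assumes "finite I" "compact K" "\<And>i. i \<in> I \<Longrightarrow> continuous_on K (f i)" "\<And>i x. i \<in> I \<Longrightarrow> x \<in> K \<Longrightarrow> 0 < f i x"
  shows "\<exists>\<mu>>0. \<forall>i\<in>I. \<forall>x\<in>K. \<mu> \<le> f i x"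
  by (rule finite_common_margin[OF assms(1), of "\<lambda>i \<mu>. \<forall>x\<in>K. \<mu> \<le> f i x"])
     (use compact_positive_margin[OF assms(2) assms(3)] assms(4) in \<open>blast, force\<close>)

lemma uniform_modulus:
  fixes f :: "'i \<Rightarrow> real \<times> real \<Rightarrow> real"
  assumes "finite I" "compact K" "\<And>i. i \<in> I \<Longrightarrow> continuous_on K (f i)" "0 < e"
  shows "\<exists>\<delta>>0. \<forall>i\<in>I. \<forall>x\<in>K. \<forall>y\<in>K. dist x y < \<delta> \<longrightarrow> \<bar>f i x - f i y\<bar> < e"
proof (rule finite_common_margin[OF assms(1)])
  fix i assume "i \<in> I"
  then have "uniformly_continuous_on K (f i)"
    using assms by (intro compact_uniformly_continuous) auto
  then show "\<exists>\<delta>>0. \<forall>x\<in>K. \<forall>y\<in>K. dist x y < \<delta> \<longrightarrow> \<bar>f i x - f i y\<bar> < e"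
    using assms(4) unfolding uniformly_continuous_on_def dist_real_def
    by (metis dist_commute)
qed (meson order_less_le_trans)

text \<open>Uniform constants for an isotopy. At distance less than \<open>\<mu>\<close> two curves
  have slopes at least \<open>\<mu>\<close> apart and every third curve is at least
  \<open>\<mu>\<close> away; ends and squares keep distance \<open>\<mu>\<close> from the other
  curves. A gap between two curves changes by less than \<open>\<mu>\<close> within height
  \<open>\<delta>\<close> and time \<open>\<epsilon>\<close>. The constant \<open>\<epsilon>\<close>
  is so small that a pair of curves that cross with slope difference at least \<open>\<mu>\<close>
  still cross within height \<open>\<delta> / 4\<close>.\<close>

locale isotopy_margin =
  fixes n :: nat and H :: "real \<Rightarrow> diagram" and \<mu> \<delta> \<epsilon> :: real
  assumes isotopy: "isotopy n H"
    and pos: "0 < \<mu>" "0 < \<delta>" "0 < \<epsilon>"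
    and transversal: "\<And>s t i j. s \<in> {0..1} \<Longrightarrow> t \<in> {0..1} \<Longrightarrow> i \<in> {1..n} \<Longrightarrow> j \<in> {1..n} \<Longrightarrow> i \<noteq> j \<Longrightarrow>
      \<bar>curve (H s) i t - curve (H s) j t\<bar> < \<mu> \<Longrightarrow> \<mu> \<le> \<bar>slope (H s) i t - slope (H s) j t\<bar>"
    and no_triple: "\<And>s t i j k. s \<in> {0..1} \<Longrightarrow> t \<in> {0..1} \<Longrightarrow> i \<in> {1..n} \<Longrightarrow> j \<in> {1..n} \<Longrightarrow> k \<in> {1..n} \<Longrightarrow>
      i \<noteq> j \<Longrightarrow> j \<noteq> k \<Longrightarrow> i \<noteq> k \<Longrightarrow> \<bar>curve (H s) i t - curve (H s) j t\<bar> < \<mu> \<Longrightarrow> \<mu> \<le> \<bar>curve (H s) i t - curve (H s) k t\<bar>"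
    and ends: "\<And>s t i j. s \<in> {0..1} \<Longrightarrow> t \<in> {0, 1} \<Longrightarrow> i \<in> {1..n} \<Longrightarrow> j \<in> {1..n} \<Longrightarrow> i \<noteq> j \<Longrightarrow>
      \<mu> \<le> \<bar>curve (H s) i t - curve (H s) j t\<bar>"
    and squares_off: "\<And>s i \<epsilon>' t j. s \<in> {0..1} \<Longrightarrow> (i, \<epsilon>', t) \<in> set (squares (H s)) \<Longrightarrow> j \<in> {1..n} \<Longrightarrow> j \<noteq> i \<Longrightarrow>
      \<mu> \<le> \<bar>curve (H s) i t - curve (H s) j t\<bar>"
    and modulus: "\<And>s t s' t' i j. s \<in> {0..1} \<Longrightarrow> t \<in> {0..1} \<Longrightarrow> s' \<in> {0..1} \<Longrightarrow> t' \<in> {0..1} \<Longrightarrow>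
      i \<in> {1..n} \<Longrightarrow> j \<in> {1..n} \<Longrightarrow> \<bar>s - s'\<bar> < \<epsilon> \<Longrightarrow> \<bar>t - t'\<bar> < \<delta> \<Longrightarrow>
      \<bar>(curve (H s) i t - curve (H s) j t) - (curve (H s') i t' - curve (H s') j t')\<bar> < \<mu>"
    and fine_modulus: "\<And>s t s' i j. s \<in> {0..1} \<Longrightarrow> t \<in> {0..1} \<Longrightarrow> s' \<in> {0..1} \<Longrightarrow>
      i \<in> {1..n} \<Longrightarrow> j \<in> {1..n} \<Longrightarrow> \<bar>s - s'\<bar> < \<epsilon> \<Longrightarrow>
      \<bar>(curve (H s) i t - curve (H s) j t) - (curve (H s') i t - curve (H s') j t)\<bar> < \<mu> * (\<delta> / 4)"
    and square_modulus: "\<And>s s' k. s \<in> {0..1} \<Longrightarrow> s' \<in> {0..1} \<Longrightarrow> k < length (squares (H 0)) \<Longrightarrow> \<bar>s - s'\<bar> < \<epsilon> \<Longrightarrow>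
      \<bar>snd (snd (squares (H s) ! k)) - snd (snd (squares (H s') ! k))\<bar> < \<delta> / 4"

text \<open>Each margin is the positive minimum of a continuous function on a compact set. For
  instance the larger one of the distance of two curves and the difference of their slopes never
  vanishes, by transversality.\<close>

lemma isotopy_margin_exists:
  assumes H: "isotopy n H"
  shows "\<exists>\<mu> \<delta> \<epsilon>. isotopy_margin n H \<mu> \<delta> \<epsilon>"
proof -
  note h = isotopyD[OF H]
  let ?K = "{0..1::real} \<times> {0..1::real}"
  let ?N = "{1..n}"
  have K: "compact ?K" by (intro compact_Times compact_Icc)
  let ?g = "\<lambda>i j p. curve (H (fst p)) i (snd p) - curve (H (fst p)) j (snd p)"
  let ?v = "\<lambda>i j p. slope (H (fst p)) i (snd p) - slope (H (fst p)) j (snd p)"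
  have cg: "continuous_on ?K (?g i j)" "continuous_on ?K (?v i j)" if "i \<in> ?N" "j \<in> ?N" for i j
    using h(2,3)[OF that(1)] h(2,3)[OF that(2)] by (auto simp: case_prod_beta intro!: continuous_intros)
  let ?m = "length (squares (H 0))"
  define ik where "ik k = fst (squares (H 0) ! k)" for k
  define hk where "hk k s = snd (snd (squares (H s) ! k))" for k s
  have len: "length (squares (H s)) = ?m" if "s \<in> {0..1}" for s using isotopy_length[OF H that] .
  have ik: "fst (squares (H s) ! k) = ik k" if "s \<in> {0..1}" "k < ?m" for s k
  proof -
    have "map (\<lambda>(i, \<epsilon>, t). (i, \<epsilon>)) (squares (H s)) ! k = map (\<lambda>(i, \<epsilon>, t). (i, \<epsilon>)) (squares (H 0)) ! k"
      by (simp only: h(4)[OF that(1)])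
    then show ?thesis using that(2) len[OF that(1)] by (simp add: ik_def case_prod_beta)
  qed
  have hk_cont: "continuous_on {0..1} (hk k)" if "k < ?m" for k using h(5)[OF that] by (simp add: hk_def)
  have sq: "(ik k, fst (snd (squares (H s) ! k)), hk k s) \<in> set (squares (H s))" if "s \<in> {0..1}" "k < ?m" for s k
    using ik[OF that] nth_mem[of k "squares (H s)"] len that by (metis hk_def prod.collapse)
  have ik_in: "ik k \<in> ?N" and hk_in: "0 < hk k s \<and> hk k s < 1"
    and hk_off: "\<And>j. j \<in> ?N \<Longrightarrow> j \<noteq> ik k \<Longrightarrow> curve (H s) (ik k) (hk k s) \<noteq> curve (H s) j (hk k s)"
    if "s \<in> {0..1}" "k < ?m" for s k
    using is_diagramD(6,7,8)[OF h(1)[OF that(1)] sq[OF that]] by (blast, blast, metis)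
  obtain \<mu>1 where \<mu>1: "\<mu>1 > 0" "\<And>i j p. i \<in> ?N \<Longrightarrow> j \<in> ?N \<Longrightarrow> i \<noteq> j \<Longrightarrow> p \<in> ?K \<Longrightarrow> \<mu>1 \<le> max \<bar>?g i j p\<bar> \<bar>?v i j p\<bar>"
  proof -
    let ?I = "{(i, j). i \<in> ?N \<and> j \<in> ?N \<and> i \<noteq> j}"
    have "finite ?I" by (rule finite_subset[of _ "?N \<times> ?N"]) auto
    moreover have "0 < max \<bar>?g i j p\<bar> \<bar>?v i j p\<bar>" if "(i, j) \<in> ?I" "p \<in> ?K" for i j p
    proof (cases "?g i j p = 0")
      case True
      then have "?v i j p \<noteq> 0"
        using is_diagramD(5)[OF h(1), of "fst p" "snd p" i j] that by auto
      then show ?thesis by simp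
    qed simp
    ultimately have "\<exists>\<mu>>0. \<forall>q\<in>?I. \<forall>p\<in>?K. \<mu> \<le> max \<bar>?g (fst q) (snd q) p\<bar> \<bar>?v (fst q) (snd q) p\<bar>"
      by (intro uniform_margin K) (auto intro!: continuous_on_max continuous_on_rabs cg)
    then show ?thesis using that by fastforce
  qed
  obtain \<mu>2 where \<mu>2: "\<mu>2 > 0" "\<And>i j k p. i \<in> ?N \<Longrightarrow> j \<in> ?N \<Longrightarrow> k \<in> ?N \<Longrightarrow> i \<noteq> j \<Longrightarrow> j \<noteq> k \<Longrightarrow> i \<noteq> k \<Longrightarrow> p \<in> ?K \<Longrightarrow>
      \<mu>2 \<le> max \<bar>?g i j p\<bar> \<bar>?g i k p\<bar>"
  proof -
    let ?I = "{(i, j, k). i \<in> ?N \<and> j \<in> ?N \<and> k \<in> ?N \<and> i \<noteq> j \<and> j \<noteq> k \<and> i \<noteq> k}"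
    have "finite ?I" by (rule finite_subset[of _ "?N \<times> ?N \<times> ?N"]) auto
    moreover have "0 < max \<bar>?g i j p\<bar> \<bar>?g i k p\<bar>" if "(i, j, k) \<in> ?I" "p \<in> ?K" for i j k p
    proof (cases "?g i j p = 0")
      case True
      then have "?g i k p \<noteq> 0"
        using is_diagramD(4)[OF h(1), of "fst p" "snd p" i j k] that by auto
      then show ?thesis by simp
    qed simp
    ultimately have "\<exists>\<mu>>0. \<forall>q\<in>?I. \<forall>p\<in>?K. \<mu> \<le> max \<bar>?g (fst q) (fst (snd q)) p\<bar> \<bar>?g (fst q) (snd (snd q)) p\<bar>"
      by (intro uniform_margin K) (auto intro!: continuous_on_max continuous_on_rabs cg)
    then show ?thesis using that by fastforce
  qed
  obtain \<mu>3 where \<mu>3: "\<mu>3 > 0" "\<And>i j t s. i \<in> ?N \<Longrightarrow> j \<in> ?N \<Longrightarrow> i \<noteq> j \<Longrightarrow> t \<in> {0, 1} \<Longrightarrow> s \<in> {0..1} \<Longrightarrow> \<mu>3 \<le> \<bar>?g i j (s, t)\<bar>"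
  proof -
    let ?I = "{(i, j, t). i \<in> ?N \<and> j \<in> ?N \<and> t \<in> {0, 1::real} \<and> i \<noteq> j}"
    have "finite ?I" by (rule finite_subset[of _ "?N \<times> ?N \<times> {0, 1}"]) auto
    moreover have "0 < \<bar>?g i j (s, t)\<bar>" if "(i, j, t) \<in> ?I" "s \<in> {0..1}" for i j s t
      using inj_onD[OF is_diagramD(3)[OF h(1), of s t], of i j] that by auto
    moreover have "continuous_on {0..1} (\<lambda>s. \<bar>?g i j (s, t)\<bar>)" if "(i, j, t) \<in> ?I" for i j t
      by (rule continuous_on_rabs, rule continuous_on_compose2[OF cg(1)[of i j], of _ "\<lambda>s. (s, t)"])
         (use that in \<open>auto intro!: continuous_intros\<close>)
    ultimately have "\<exists>\<mu>>0. \<forall>q\<in>?I. \<forall>s\<in>{0..1}. \<mu> \<le> \<bar>?g (fst q) (fst (snd q)) (s, snd (snd q))\<bar>"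
      by (intro uniform_margin compact_Icc) auto
    then show ?thesis using that by fastforce
  qed
  obtain \<mu>4 where \<mu>4: "\<mu>4 > 0" "\<And>k j s. k < ?m \<Longrightarrow> j \<in> ?N \<Longrightarrow> j \<noteq> ik k \<Longrightarrow> s \<in> {0..1} \<Longrightarrow> \<mu>4 \<le> \<bar>?g (ik k) j (s, hk k s)\<bar>"
  proof -
    let ?I = "{(k, j). k < ?m \<and> j \<in> ?N \<and> j \<noteq> ik k}"
    have "finite ?I" by (rule finite_subset[of _ "{..<?m} \<times> ?N"]) auto
    moreover have "0 < \<bar>?g (ik k) j (s, hk k s)\<bar>" if "(k, j) \<in> ?I" "s \<in> {0..1}" for k j s
      using hk_off[OF that(2), of k j] that by auto
    moreover have "continuous_on {0..1} (\<lambda>s. \<bar>?g (ik k) j (s, hk k s)\<bar>)" if q: "(k, j) \<in> ?I" for k j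
    proof (rule continuous_on_rabs, rule continuous_on_compose2[OF cg(1)[of "ik k" j], of _ "\<lambda>s. (s, hk k s)"])
      show "ik k \<in> ?N" using ik_in[of 0 k] q by simp
      show "(\<lambda>s. (s, hk k s)) ` {0..1} \<subseteq> ?K" using hk_in[of _ k] q by (force simp: less_imp_le)
    qed (use q hk_cont in \<open>auto intro!: continuous_intros\<close>)
    ultimately have "\<exists>\<mu>>0. \<forall>q\<in>?I. \<forall>s\<in>{0..1}. \<mu> \<le> \<bar>?g (ik (fst q)) (snd q) (s, hk (fst q) s)\<bar>"
      by (intro uniform_margin compact_Icc) auto
    then show ?thesis using that by fastforce
  qed
  define \<mu> where "\<mu> = min (min \<mu>1 \<mu>2) (min \<mu>3 \<mu>4)"
  have \<mu>: "\<mu> > 0" "\<mu> \<le> \<mu>1" "\<mu> \<le> \<mu>2" "\<mu> \<le> \<mu>3" "\<mu> \<le> \<mu>4"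
    using \<mu>1 \<mu>2 \<mu>3 \<mu>4 by (auto simp: \<mu>_def)
  have mod: "\<exists>\<delta>>0. \<forall>i\<in>?N. \<forall>j\<in>?N. \<forall>p\<in>?K. \<forall>p'\<in>?K. dist p p' < \<delta> \<longrightarrow> \<bar>?g i j p - ?g i j p'\<bar> < e" if "e > 0" for e
  proof -
    have "\<exists>\<delta>>0. \<forall>q\<in>?N \<times> ?N. \<forall>p\<in>?K. \<forall>p'\<in>?K. dist p p' < \<delta> \<longrightarrow>
        \<bar>?g (fst q) (snd q) p - ?g (fst q) (snd q) p'\<bar> < e"
      by (rule uniform_modulus) (use K cg(1) that in auto)
    then obtain \<delta> where \<delta>: "\<delta> > 0" "\<forall>q\<in>?N \<times> ?N. \<forall>p\<in>?K. \<forall>p'\<in>?K. dist p p' < \<delta> \<longrightarrow>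
        \<bar>?g (fst q) (snd q) p - ?g (fst q) (snd q) p'\<bar> < e" by (elim exE conjE)
    show ?thesis
    proof (intro exI[of _ \<delta>] conjI ballI impI \<delta>(1))
      fix i j p p' assume "i \<in> ?N" "j \<in> ?N" "p \<in> ?K" "p' \<in> ?K" "dist p p' < \<delta>"
      then show "\<bar>?g i j p - ?g i j p'\<bar> < e"
        using bspec[OF bspec[OF bspec[OF \<delta>(2), of "(i, j)"], of p], of p'] by simp
    qed
  qed
  obtain \<delta>0 where \<delta>0: "\<delta>0 > 0" "\<And>i j p p'. i \<in> ?N \<Longrightarrow> j \<in> ?N \<Longrightarrow> p \<in> ?K \<Longrightarrow> p' \<in> ?K \<Longrightarrow> dist p p' < \<delta>0 \<Longrightarrow> \<bar>?g i j p - ?g i j p'\<bar> < \<mu>"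
    using mod[OF \<mu>(1)] by blast
  define \<delta> where "\<delta> = \<delta>0 / 2"
  have \<delta>: "\<delta> > 0" using \<delta>0 by (simp add: \<delta>_def)
  have "\<mu> * (\<delta> / 4) > 0" using \<mu> \<delta> by simp
  then obtain \<epsilon>1 where \<epsilon>1: "\<epsilon>1 > 0" "\<And>i j p p'. i \<in> ?N \<Longrightarrow> j \<in> ?N \<Longrightarrow> p \<in> ?K \<Longrightarrow> p' \<in> ?K \<Longrightarrow> dist p p' < \<epsilon>1 \<Longrightarrow>
     \<bar>?g i j p - ?g i j p'\<bar> < \<mu> * (\<delta> / 4)"
    using mod by meson
  have "\<exists>\<epsilon>>0. \<forall>k\<in>{..<?m}. \<forall>s\<in>{0..1}. \<forall>s'\<in>{0..1}. \<bar>s - s'\<bar> < \<epsilon> \<longrightarrow> \<bar>hk k s - hk k s'\<bar> < \<delta> / 4"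
  proof (rule finite_common_margin)
    fix k assume "k \<in> {..<?m}"
    then have "uniformly_continuous_on {0..1} (hk k)"
      using hk_cont by (intro compact_uniformly_continuous) auto
    then show "\<exists>\<epsilon>>0. \<forall>s\<in>{0..1}. \<forall>s'\<in>{0..1}. \<bar>s - s'\<bar> < \<epsilon> \<longrightarrow> \<bar>hk k s - hk k s'\<bar> < \<delta> / 4"
    proof -
      have d4: "\<delta> / 4 > 0" using \<delta> by simp
      obtain e where "e > 0" "\<forall>s\<in>{0..1}. \<forall>s'\<in>{0..1}. dist s' s < e \<longrightarrow> dist (hk k s') (hk k s) < \<delta> / 4"
        using \<open>uniformly_continuous_on {0..1} (hk k)\<close> d4 unfolding uniformly_continuous_on_def by blast
      then show ?thesis unfolding dist_real_def by (intro exI[of _ e]) (auto simp: abs_minus_commute)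
    qed
  qed (simp, meson order_less_le_trans)
  then obtain \<epsilon>2 where \<epsilon>2: "\<epsilon>2 > 0" "\<And>k s s'. k < ?m \<Longrightarrow> s \<in> {0..1} \<Longrightarrow> s' \<in> {0..1} \<Longrightarrow> \<bar>s - s'\<bar> < \<epsilon>2 \<Longrightarrow> \<bar>hk k s - hk k s'\<bar> < \<delta> / 4"
    by (meson lessThan_iff)
  define \<epsilon> where "\<epsilon> = min \<delta> (min \<epsilon>1 \<epsilon>2)"
  have \<epsilon>: "\<epsilon> > 0" "\<epsilon> \<le> \<delta>" "\<epsilon> \<le> \<epsilon>1" "\<epsilon> \<le> \<epsilon>2" using \<delta> \<epsilon>1 \<epsilon>2 by (auto simp: \<epsilon>_def)
  have "isotopy_margin n H \<mu> \<delta> \<epsilon>"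
  proof
    show "isotopy n H" "0 < \<mu>" "0 < \<delta>" "0 < \<epsilon>" by fact+
  next
    fix s t i j assume *: "s \<in> {0..1::real}" "t \<in> {0..1::real}" "i \<in> ?N" "j \<in> ?N" "i \<noteq> j"
      "\<bar>curve (H s) i t - curve (H s) j t\<bar> < \<mu>"
    then show "\<mu> \<le> \<bar>slope (H s) i t - slope (H s) j t\<bar>" using \<mu>1(2)[of i j "(s, t)"] \<mu> by simp
  next
    fix s t i j k assume *: "s \<in> {0..1::real}" "t \<in> {0..1::real}" "i \<in> ?N" "j \<in> ?N" "k \<in> ?N" "i \<noteq> j" "j \<noteq> k" "i \<noteq> k"
      "\<bar>curve (H s) i t - curve (H s) j t\<bar> < \<mu>"
    then show "\<mu> \<le> \<bar>curve (H s) i t - curve (H s) k t\<bar>" using \<mu>2(2)[of i j k "(s, t)"] \<mu> by simp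
  next
    fix s t i j assume *: "s \<in> {0..1::real}" "t \<in> {0, 1::real}" "i \<in> ?N" "j \<in> ?N" "i \<noteq> j"
    then show "\<mu> \<le> \<bar>curve (H s) i t - curve (H s) j t\<bar>" using \<mu>3(2)[of i j t s] \<mu> by simp
  next
    fix s i \<epsilon>' t j assume *: "s \<in> {0..1::real}" "(i, \<epsilon>', t) \<in> set (squares (H s))" "j \<in> ?N" "j \<noteq> i"
    then obtain k where k: "k < ?m" "squares (H s) ! k = (i, \<epsilon>', t)" using len by (metis in_set_conv_nth)
    then have "ik k = i" "hk k s = t" using ik[OF *(1) k(1)] by (simp_all add: hk_def)
    then show "\<mu> \<le> \<bar>curve (H s) i t - curve (H s) j t\<bar>" using \<mu>4(2)[OF k(1), of j s] * \<mu> by simp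
  next
    fix s t s' t' i j assume *: "s \<in> {0..1::real}" "t \<in> {0..1::real}" "s' \<in> {0..1::real}" "t' \<in> {0..1::real}"
      "i \<in> ?N" "j \<in> ?N" "\<bar>s - s'\<bar> < \<epsilon>" "\<bar>t - t'\<bar> < \<delta>"
    have "dist (s, t) (s', t') \<le> \<bar>s - s'\<bar> + \<bar>t - t'\<bar>"
      unfolding dist_Pair_Pair dist_real_def using sqrt_sum_squares_le_sum_abs[of "s - s'" "t - t'"] by simp
    also have "\<dots> < \<delta>0" using * \<epsilon>(2) by (simp add: \<delta>_def)
    finally show "\<bar>(curve (H s) i t - curve (H s) j t) - (curve (H s') i t' - curve (H s') j t')\<bar> < \<mu>"
      using \<delta>0(2)[of i j "(s, t)" "(s', t')"] * by simp
  next
    fix s t s' i j assume *: "s \<in> {0..1::real}" "t \<in> {0..1::real}" "s' \<in> {0..1::real}"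
      "i \<in> ?N" "j \<in> ?N" "\<bar>s - s'\<bar> < \<epsilon>"
    have "dist (s, t) (s', t) < \<epsilon>1" using * \<epsilon>(3) by (simp add: dist_Pair_Pair dist_real_def)
    then show "\<bar>(curve (H s) i t - curve (H s) j t) - (curve (H s') i t - curve (H s') j t)\<bar> < \<mu> * (\<delta> / 4)"
      using \<epsilon>1(2)[of i j "(s, t)" "(s', t)"] * by simp
  next
    fix s s' k assume *: "s \<in> {0..1::real}" "s' \<in> {0..1::real}" "k < ?m" "\<bar>s - s'\<bar> < \<epsilon>"
    then show "\<bar>snd (snd (squares (H s) ! k)) - snd (snd (squares (H s') ! k))\<bar> < \<delta> / 4"
      using \<epsilon>2(2)[of k s s'] \<epsilon>(4) by (simp add: hk_def)
  qed
  then show ?thesis by blast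
qed

lemma separated_finite:
  fixes S :: "real set"
  assumes "S \<subseteq> {0..1}" "0 < \<delta>" "\<And>x y. x \<in> S \<Longrightarrow> y \<in> S \<Longrightarrow> x \<noteq> y \<Longrightarrow> \<delta> \<le> \<bar>x - y\<bar>"
  shows "finite S"
proof -
  let ?f = "\<lambda>x. \<lfloor>x / \<delta>\<rfloor>"
  have "inj_on ?f S"
  proof (rule inj_onI, rule ccontr)
    fix x y assume *: "x \<in> S" "y \<in> S" "?f x = ?f y" "x \<noteq> y"
    have "\<bar>x / \<delta> - y / \<delta>\<bar> < 1" using *(3) by linarith
    then have "\<bar>x - y\<bar> < \<delta>" using assms(2) by (simp add: field_simps abs_if split: if_splits)
    then show False using assms(3)[OF *(1,2,4)] by simp
  qed
  moreover have "?f ` S \<subseteq> {0..\<lfloor>1 / \<delta>\<rfloor>}"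
    using assms(1,2) by (force intro!: floor_mono divide_right_mono simp: subset_iff)
  ultimately show ?thesis by (meson finite_atLeastAtMost_int finite_imageD finite_subset)
qed

context isotopy_margin
begin

abbreviation "x \<equiv> \<lambda>s i t. curve (H s) i t"

lemma diagrams: "s \<in> {0..1} \<Longrightarrow> is_diagram n (H s)"
  using isotopyD(1)[OF isotopy] .

lemma deriv_gap:
  assumes "s \<in> {0..1}" "t \<in> {0..1}" "i \<in> {1..n}" "j \<in> {1..n}"
  shows "((\<lambda>t. x s i t - x s j t) has_real_derivative (slope (H s) i t - slope (H s) j t)) (at t within {0..1})"
  using assms diagrams by (intro derivative_intros slope_deriv is_diagramD(1)) auto

lemma cont_gap:
  assumes "s \<in> {0..1}" "i \<in> {1..n}" "j \<in> {1..n}"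
  shows "continuous_on {0..1} (\<lambda>t. x s i t - x s j t)"
  using deriv_gap[OF assms(1) _ assms(2,3)]
  by (intro DERIV_continuous_on)

lemma mean_value:
  assumes "s \<in> {0..1}" "i \<in> {1..n}" "j \<in> {1..n}" "0 \<le> a" "a < b" "b \<le> 1"
  shows "\<exists>\<xi>\<in>{a<..<b}. (x s i b - x s j b) - (x s i a - x s j a) = (b - a) * (slope (H s) i \<xi> - slope (H s) j \<xi>)"
proof -
  have "\<exists>\<xi>\<in>{a<..<b}. (x s i b - x s j b) - (x s i a - x s j a) =
      (\<lambda>h. (slope (H s) i \<xi> - slope (H s) j \<xi>) * h) (b - a)"
  proof (rule mvt_simple[OF assms(5)])
    fix t assume t: "a \<le> t" "t \<le> b"
    have "((\<lambda>t. x s i t - x s j t) has_real_derivative (slope (H s) i t - slope (H s) j t)) (at t within {a..b})"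
      by (rule DERIV_subset[OF deriv_gap[OF assms(1) _ assms(2,3)]]) (use assms t in auto)
    then show "((\<lambda>t. x s i t - x s j t) has_derivative (\<lambda>h. (slope (H s) i t - slope (H s) j t) * h)) (at t within {a..b})"
      by (simp add: has_field_derivative_def)
  qed
  then show ?thesis by (simp add: mult.commute)
qed

lemma sign_persists:
  assumes "s \<in> {0..1}" "t \<in> {0..1}" "s' \<in> {0..1}" "t' \<in> {0..1}" "i \<in> {1..n}" "j \<in> {1..n}"
    "\<bar>s - s'\<bar> < \<epsilon>" "\<bar>t - t'\<bar> < \<delta>" "\<mu> \<le> \<bar>x s i t - x s j t\<bar>"
  shows "x s i t < x s j t \<longleftrightarrow> x s' i t' < x s' j t'" "x s' i t' \<noteq> x s' j t'"
  using modulus[OF assms(1-8)] assms(9) by (auto simp: abs_if split: if_splits)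

lemma crossing_others:
  assumes "s \<in> {0..1}" "t \<in> {0..1}" "i \<in> {1..n}" "j \<in> {1..n}" "i \<noteq> j" "x s i t = x s j t"
    "m \<in> {1..n}" "m \<noteq> i" "m \<noteq> j"
  shows "\<mu> \<le> \<bar>x s m t - x s i t\<bar>" "\<mu> \<le> \<bar>x s m t - x s j t\<bar>"
  using no_triple[of s t i j m] assms pos by (auto simp: abs_minus_commute)

text \<open>A pair of curves cannot cross twice within height \<open>\<delta>\<close>, for by the
  mean value theorem their slopes would agree in between, where the curves are close. Two crossing
  pairs with a common curve would bring three curves together. For disjoint pairs all other order
  relations persist between the two heights, and so the two positions differ by at least
  two.\<close>

lemma near_crossings_far_apart:
  assumes s: "s \<in> {0..1}" and c: "(t, r) \<in> crossings n (H s)" "(t', r') \<in> crossings n (H s)"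
    and ne: "(t, r) \<noteq> (t', r')" and near: "\<bar>t - t'\<bar> < \<delta>"
  shows "far_apart (GenT r) (GenT r')"
proof -
  obtain i j where ij: "t \<in> {0..1}" "i \<in> {1..n}" "j \<in> {1..n}" "i \<noteq> j" "x s i t = x s j t" "r = place n (H s) i t"
    using c(1) by (rule crossingsE)
  obtain k l where kl: "t' \<in> {0..1}" "k \<in> {1..n}" "l \<in> {1..n}" "k \<noteq> l" "x s k t' = x s l t'" "r' = place n (H s) k t'"
    using c(2) by (rule crossingsE)
  have pers: "x s a t < x s b t \<longleftrightarrow> x s a t' < x s b t'" "x s a t' \<noteq> x s b t'"
    if "a \<in> {1..n}" "b \<in> {1..n}" "\<mu> \<le> \<bar>x s a t - x s b t\<bar>" for a b
    using sign_persists[OF s ij(1) s kl(1) that(1,2) _ near that(3)] pos by auto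
  have pers': "x s a t < x s b t \<longleftrightarrow> x s a t' < x s b t'" "x s a t \<noteq> x s b t"
    if "a \<in> {1..n}" "b \<in> {1..n}" "\<mu> \<le> \<bar>x s a t' - x s b t'\<bar>" for a b
    using sign_persists[OF s kl(1) s ij(1) that(1,2) _ _ that(3)] pos near by (auto simp: abs_minus_commute)
  note o = crossing_others[OF s ij(1-5)] and o' = crossing_others[OF s kl(1-5)]
  have tt': "t \<noteq> t' \<Longrightarrow> {i, j} \<noteq> {k, l}"
  proof
    assume neq: "t \<noteq> t'" "{i, j} = {k, l}"
    then have z: "x s i t' - x s j t' = 0" using kl(5) by (auto simp: doubleton_eq_iff)
    have "\<exists>\<xi>\<in>{0..1}. \<bar>t - \<xi>\<bar> < \<delta> \<and> slope (H s) i \<xi> - slope (H s) j \<xi> = 0"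
    proof (cases "t < t'")
      case True
      then obtain \<xi> where "\<xi> \<in> {t<..<t'}" "(x s i t' - x s j t') - (x s i t - x s j t) = (t' - t) * (slope (H s) i \<xi> - slope (H s) j \<xi>)"
        using mean_value[OF s ij(2,3), of t t'] ij(1) kl(1) by auto
      then show ?thesis using z ij(1,5) kl(1) near by (intro bexI[of _ \<xi>]) auto
    next
      case False
      then obtain \<xi> where "\<xi> \<in> {t'<..<t}" "(x s i t - x s j t) - (x s i t' - x s j t') = (t - t') * (slope (H s) i \<xi> - slope (H s) j \<xi>)"
        using mean_value[OF s ij(2,3), of t' t] ij(1) kl(1) neq by auto
      then show ?thesis using z ij(1,5) kl(1) near by (intro bexI[of _ \<xi>]) auto
    qed
    then obtain \<xi> where \<xi>: "\<xi> \<in> {0..1}" "\<bar>t - \<xi>\<bar> < \<delta>" "slope (H s) i \<xi> - slope (H s) j \<xi> = 0" by blast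
    have "\<bar>x s i \<xi> - x s j \<xi>\<bar> < \<mu>"
      using modulus[OF s ij(1) s \<xi>(1) ij(2,3) _ \<xi>(2)] ij(5) pos by simp
    then show False using transversal[OF s \<xi>(1) ij(2-4)] \<xi>(3) pos by simp
  qed
  have same: "{i, j} \<noteq> {k, l}"
  proof
    assume eq: "{i, j} = {k, l}"
    then have "t = t'" using tt' by blast
    moreover have "r = r'"
      using eq ij(5,6) kl(6) calculation unfolding doubleton_eq_iff by (auto intro!: place_eqI)
    ultimately show False using ne by simp
  qed
  have disj: "i \<noteq> k \<and> i \<noteq> l \<and> j \<noteq> k \<and> j \<noteq> l"
  proof (rule ccontr)
    assume "\<not> ?thesis"
    then consider "i = k" "j \<noteq> l" | "i = l" "j \<noteq> k" | "j = k" "i \<noteq> l" | "j = l" "i \<noteq> k"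
      using same by blast
    then show False
    proof cases
      case 1 then show False using o(1)[of l] pers(2)[of l i] ij kl by auto
    next
      case 2 then show False using o(1)[of k] pers(2)[of k i] ij kl by auto
    next
      case 3 then show False using o(2)[of l] pers(2)[of l j] ij kl by auto
    next
      case 4 then show False using o(2)[of k] pers(2)[of k j] ij kl by auto
    qed
  qed
  have oki: "\<mu> \<le> \<bar>x s k t - x s i t\<bar>" using o(1)[of k] disj kl by blast
  have ne: "x s k t \<noteq> x s i t" using oki pos by auto
  show ?thesis
  proof (cases "x s i t < x s k t")
    case True
    have "r + 1 < r'"
      unfolding ij(6) kl(6)
    proof (rule place_above_pair[OF ij(2-4)])
      show "x s i t' < x s k t'" using pers'(1)[of i k] o'(1)[of i] True disj ij kl by blast
      show "x s j t' < x s k t'" using pers'(1)[of j k] o'(1)[of j] True disj ij kl by simp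
      fix m assume m: "m \<in> {1..n}" "x s m t < x s i t"
      then have mij: "m \<noteq> i" "m \<noteq> j" "m \<noteq> k" using ij(5) True by auto
      have "x s m t < x s k t" using m True by simp
      moreover have "m \<noteq> l"
      proof
        assume "m = l"
        then have "x s l t' < x s i t'" using pers(1)[of l i] o(1)[of l] m ij kl disj by blast
        moreover have "x s i t' < x s k t'" using pers'(1)[of i k] o'(1)[of i] True disj ij kl by blast
        ultimately show False using kl(5) by simp
      qed
      ultimately show "x s m t' < x s k t' \<and> m \<noteq> i \<and> m \<noteq> j"
        using pers'(1)[of m k] o'(1)[of m] mij m kl by blast
    qed
    then show ?thesis by simp
  next
    case False
    then have lt: "x s k t < x s i t" using ne by simp
    then have lt': "x s k t' < x s i t'" using pers(1)[of k i] oki ij kl by blast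
    have "r' + 1 < r"
      unfolding ij(6) kl(6)
    proof (rule place_above_pair[OF kl(2-4)])
      show "x s k t < x s i t" by fact
      show "x s l t < x s i t" using pers(1)[of l i] o(1)[of l] lt' kl ij disj by simp
      fix m assume m: "m \<in> {1..n}" "x s m t' < x s k t'"
      then have mkl: "m \<noteq> k" "m \<noteq> l" "m \<noteq> i" using kl(5) lt' by auto
      have "m \<noteq> j"
      proof
        assume "m = j"
        then have "x s j t < x s k t" using pers'(1)[of j k] o'(1)[of j] m ij kl disj by blast
        then show False using lt ij(5) by simp
      qed
      moreover have "x s m t' < x s i t'" using m lt' by simp
      ultimately show "x s m t < x s i t \<and> m \<noteq> k \<and> m \<noteq> l"
        using pers(1)[of m i] o(1)[of m] mkl m ij by blast
    qed
    then show ?thesis by simp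
  qed
qed

lemma near_crossing_square_far_apart:
  assumes s: "s \<in> {0..1}" and c: "(t, r) \<in> crossings n (H s)" and sq: "(k, b, h) \<in> set (squares (H s))"
    and near: "\<bar>t - h\<bar> < \<delta>"
  shows "far_apart (GenT r) (square_gen b (place n (H s) k h))"
proof -
  obtain i j where ij: "t \<in> {0..1}" "i \<in> {1..n}" "j \<in> {1..n}" "i \<noteq> j" "x s i t = x s j t" "r = place n (H s) i t"
    using c by (rule crossingsE)
  have h: "h \<in> {0..1}" "k \<in> {1..n}" using is_diagramD(6,7)[OF diagrams[OF s] sq] by auto
  have off: "\<mu> \<le> \<bar>x s k h - x s m h\<bar>" "\<mu> \<le> \<bar>x s m h - x s k h\<bar>" if "m \<in> {1..n}" "m \<noteq> k" for m
    using squares_off[OF s sq that] by (auto simp: abs_minus_commute)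
  have pers: "x s a h < x s b h \<longleftrightarrow> x s a t < x s b t" "x s a t \<noteq> x s b t"
    if "a \<in> {1..n}" "b \<in> {1..n}" "\<mu> \<le> \<bar>x s a h - x s b h\<bar>" for a b
    using sign_persists[OF s h(1) s ij(1) that(1,2) _ _ that(3)] pos near by (auto simp: abs_minus_commute)
  have pers': "x s a t < x s b t \<longleftrightarrow> x s a h < x s b h"
    if "a \<in> {1..n}" "b \<in> {1..n}" "\<mu> \<le> \<bar>x s a t - x s b t\<bar>" for a b
    using sign_persists[OF s ij(1) s h(1) that(1,2) _ near that(3)] pos by auto
  note o = crossing_others[OF s ij(1-5)]
  have k: "k \<noteq> i" "k \<noteq> j" using off(1)[of j] off(1)[of i] pers(2)[of i j] pers(2)[of j i] ij by metis+
  show ?thesis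
  proof (cases "x s i t < x s k t")
    case True
    have "r + 1 < place n (H s) k h"
      unfolding ij(6)
    proof (rule place_above_pair[OF ij(2-4)])
      show "x s i h < x s k h" using pers(1)[of i k] off(2)[of i] True k ij h by metis
      show "x s j h < x s k h" using pers(1)[of j k] off(2)[of j] True k ij h by metis
      fix m assume m: "m \<in> {1..n}" "x s m t < x s i t"
      then have mij: "m \<noteq> i" "m \<noteq> j" "m \<noteq> k" using ij(5) True by auto
      then show "x s m h < x s k h \<and> m \<noteq> i \<and> m \<noteq> j"
        using pers(1)[of m k] off(2)[of m] m True h by auto
    qed
    then show ?thesis by simp
  next
    case False
    have oki: "\<mu> \<le> \<bar>x s k t - x s i t\<bar>" using o(1)[of k] k h by blast
    then have lt: "x s k t < x s i t" using False pos by (auto simp: abs_if split: if_splits)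
    have "place n (H s) k h < r"
      unfolding ij(6)
    proof (rule place_above_one[OF h(2) lt])
      fix m assume m: "m \<in> {1..n}" "x s m h < x s k h"
      then have "m \<noteq> k" by auto
      then have "x s m t < x s k t" using pers(1)[of m k] off(2)[of m] m h by blast
      then show "x s m t < x s i t \<and> m \<noteq> k" using lt by auto
    qed
    then show ?thesis by simp
  qed
qed

text \<open>Within height \<open>\<delta>\<close> of the crossing the gap has slope at least
  \<open>\<mu>\<close>. Hence at distance \<open>\<delta> / 4\<close> above and below it has
  absolute value at least \<open>\<mu> \<delta> / 4\<close>, with opposite signs. The signs survive
  until time \<open>s'\<close>, and the intermediate value theorem yields the new crossing.\<close>

lemma crossing_moves:
  assumes s: "s \<in> {0..1}" "s' \<in> {0..1}" "\<bar>s - s'\<bar> < \<epsilon>" and c: "(t, r) \<in> crossings n (H s)"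
  shows "\<exists>t'. \<bar>t - t'\<bar> < \<delta> / 4 \<and> (t', r) \<in> crossings n (H s')"
proof -
  obtain i j where ij: "t \<in> {0..1}" "i \<in> {1..n}" "j \<in> {1..n}" "i \<noteq> j" "x s i t = x s j t" "r = place n (H s) i t"
    using c by (rule crossingsE)
  have zero: "\<bar>x s i \<tau> - x s j \<tau>\<bar> < \<mu>" if "\<tau> \<in> {0..1}" "\<bar>t - \<tau>\<bar> < \<delta>" for \<tau>
    using modulus[OF s(1) ij(1) s(1) that(1) ij(2,3) _ that(2)] ij(5) pos by simp
  have t0: "\<delta> / 4 < t"
  proof (rule ccontr)
    assume "\<not> \<delta> / 4 < t"
    then have "\<bar>x s i 0 - x s j 0\<bar> < \<mu>" using ij(1) pos by (intro zero) auto
    then show False using ends[OF s(1) _ ij(2-4), of 0] by simp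
  qed
  have t1: "t < 1 - \<delta> / 4"
  proof (rule ccontr)
    assume "\<not> t < 1 - \<delta> / 4"
    then have "\<bar>x s i 1 - x s j 1\<bar> < \<mu>" using ij(1) pos by (intro zero) auto
    then show False using ends[OF s(1) _ ij(2-4), of 1] by simp
  qed
  let ?a = "t - \<delta> / 4" and ?b = "t + \<delta> / 4"
  have sub: "{?a..?b} \<subseteq> {0..1}" using t0 t1 by auto
  have main: "\<exists>t'\<in>{?a<..<?b}. x s' k t' = x s' l t'"
    if kl: "k \<in> {1..n}" "l \<in> {1..n}" "k \<noteq> l" "x s k t = x s l t" "slope (H s) k t - slope (H s) l t > 0" for k l
  proof -
    let ?v = "\<lambda>\<tau>. slope (H s) k \<tau> - slope (H s) l \<tau>"
    have near: "\<bar>x s k \<tau> - x s l \<tau>\<bar> < \<mu>" if "\<tau> \<in> {?a..?b}" for \<tau>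
    proof -
      have "\<tau> \<in> {0..1}" "\<bar>t - \<tau>\<bar> < \<delta>" using that sub pos by auto
      then show ?thesis using modulus[OF s(1) ij(1) s(1) _ kl(1,2), of \<tau>] kl(4) pos by simp
    qed
    have big: "\<mu> \<le> \<bar>?v \<tau>\<bar>" if "\<tau> \<in> {?a..?b}" for \<tau>
      using transversal[OF s(1) _ kl(1-3) near[OF that]] that sub by auto
    have cv: "continuous_on {0..1} ?v"
      using is_diagramD(2)[OF diagrams[OF s(1)]] kl by (intro continuous_intros) auto
    have vpos: "\<mu> \<le> ?v \<tau>" if \<tau>: "\<tau> \<in> {?a..?b}" for \<tau>
    proof (rule ccontr)
      assume "\<not> \<mu> \<le> ?v \<tau>"
      then have neg: "?v \<tau> < 0" using big[OF \<tau>] by (auto simp: abs_if split: if_splits)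
      have "\<exists>\<xi>\<in>{?a..?b}. ?v \<xi> = 0"
      proof (cases "\<tau> \<le> t")
        case True
        then have "\<exists>\<xi>\<ge>\<tau>. \<xi> \<le> t \<and> ?v \<xi> = 0"
          by (intro IVT') (use neg kl(5) \<tau> sub in \<open>auto intro!: continuous_on_subset[OF cv]\<close>)
        then show ?thesis using \<tau> pos by auto
      next
        case False
        then have "\<exists>\<xi>\<ge>t. \<xi> \<le> \<tau> \<and> ?v \<xi> = 0"
          by (intro IVT2') (use neg kl(5) \<tau> sub ij(1) in \<open>auto intro!: continuous_on_subset[OF cv]\<close>)
        then show ?thesis using \<tau> pos by auto
      qed
      then show False using big pos by fastforce
    qed
    obtain \<xi> where \<xi>: "\<xi> \<in> {t<..<?b}" "(x s k ?b - x s l ?b) - (x s k t - x s l t) = (?b - t) * ?v \<xi>"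
      using mean_value[OF s(1) kl(1,2), of t ?b] ij(1) t1 pos by auto
    have "\<mu> * (\<delta> / 4) \<le> x s k ?b - x s l ?b"
      using \<xi>(2) vpos[of \<xi>] \<xi>(1) kl(4) pos by (simp add: mult.commute)
    moreover obtain \<zeta> where \<zeta>: "\<zeta> \<in> {?a<..<t}" "(x s k t - x s l t) - (x s k ?a - x s l ?a) = (t - ?a) * ?v \<zeta>"
      using mean_value[OF s(1) kl(1,2), of ?a t] ij(1) t0 pos by auto
    have ta: "t - ?a = \<delta> / 4" by simp
    have "\<delta> / 4 * \<mu> \<le> \<delta> / 4 * ?v \<zeta>" using \<zeta>(1) pos by (intro mult_left_mono vpos) auto
    then have "x s k ?a - x s l ?a \<le> - (\<mu> * (\<delta> / 4))"
      using \<zeta>(2)[unfolded ta] kl(4) by (simp add: mult.commute)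
    moreover have "\<bar>(x s k ?b - x s l ?b) - (x s' k ?b - x s' l ?b)\<bar> < \<mu> * (\<delta> / 4)"
      "\<bar>(x s k ?a - x s l ?a) - (x s' k ?a - x s' l ?a)\<bar> < \<mu> * (\<delta> / 4)"
      using fine_modulus[OF s(1) _ s(2) kl(1,2) s(3), of ?b] fine_modulus[OF s(1) _ s(2) kl(1,2) s(3), of ?a]
        sub pos by auto
    ultimately have e: "x s' k ?a - x s' l ?a < 0" "0 < x s' k ?b - x s' l ?b" by linarith+
    have "\<exists>t'\<ge>?a. t' \<le> ?b \<and> x s' k t' - x s' l t' = 0"
      by (intro IVT') (use e pos in \<open>auto intro!: continuous_on_subset[OF cont_gap[OF s(2) kl(1,2)] sub]\<close>)
    then obtain t' where t': "?a \<le> t'" "t' \<le> ?b" "x s' k t' - x s' l t' = 0" by blast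
    then have "t' \<noteq> ?a" "t' \<noteq> ?b" using e by auto
    then show ?thesis using t' by (intro bexI[of _ t']) auto
  qed
  have "slope (H s) i t - slope (H s) j t \<noteq> 0"
    using transversal[OF s(1) ij(1-4)] ij(5) pos by auto
  then obtain t' where t': "t' \<in> {?a<..<?b}" "x s' i t' = x s' j t'"
    using main[OF ij(2-5)] main[OF ij(3,2) ij(4)[symmetric] ij(5)[symmetric]] by fastforce
  then have t01: "t' \<in> {0..1}" using sub by auto
  have near: "\<bar>t - t'\<bar> < \<delta> / 4" using t'(1) by (simp only: abs_less_iff greaterThanLessThan_iff) linarith
  have "place n (H s') i t' = r"
    unfolding ij(6)
  proof (rule place_eqI)
    fix m assume m: "m \<in> {1..n}"
    show "x s' m t' < x s' i t' \<longleftrightarrow> x s m t < x s i t"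
    proof (cases "m = i \<or> m = j")
      case True then show ?thesis using ij(5) t'(2) by auto
    next
      case False
      then have "\<mu> \<le> \<bar>x s m t - x s i t\<bar>" using crossing_others(1)[OF s(1) ij(1-5) m] by blast
      then show ?thesis
        using sign_persists(1)[OF s(1) ij(1) s(2) t01 m ij(2) s(3)] near pos by auto
    qed
  qed
  then show ?thesis using crossingsI[OF t01 ij(2-4) t'(2)] near by blast
qed

end

context isotopy_margin
begin

lemma finite_crossings:
  assumes s: "s \<in> {0..1}" shows "finite (crossings n (H s))"
proof -
  have "crossings n (H s) \<subseteq> (\<Union>r\<in>{..Suc n}. {t. (t, r) \<in> crossings n (H s)} \<times> {r})"
  proof
    fix p assume p: "p \<in> crossings n (H s)"
    obtain t r where tr: "p = (t, r)" by (cases p)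
    have "card {k \<in> {1..n}. curve (H s) k t < curve (H s) i t} \<le> n" for i
    proof -
      have "card {k \<in> {1..n}. curve (H s) k t < curve (H s) i t} \<le> card {1..n}" by (intro card_mono) auto
      then show ?thesis by simp
    qed
    then have "r \<le> Suc n" using p unfolding tr crossings_def place_def by auto
    then show "p \<in> (\<Union>r\<in>{..Suc n}. {t. (t, r) \<in> crossings n (H s)} \<times> {r})" using p tr by auto
  qed
  moreover have "finite {t. (t, r) \<in> crossings n (H s)}" for r
  proof (rule separated_finite[OF _ pos(2)])
    show "{t. (t, r) \<in> crossings n (H s)} \<subseteq> {0..1}" by (auto simp: crossings_def)
    fix t t' assume "t \<in> {t. (t, r) \<in> crossings n (H s)}" "t' \<in> {t. (t, r) \<in> crossings n (H s)}" "t \<noteq> t'"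
    then show "\<delta> \<le> \<bar>t - t'\<bar>"
      using near_crossings_far_apart[OF s, of t r t' r] by fastforce
  qed
  ultimately show ?thesis by (auto intro: finite_subset)
qed

lemma squares_move:
  assumes s: "s \<in> {0..1}" "s' \<in> {0..1}" "\<bar>s - s'\<bar> < \<epsilon>" and k: "k < length (squares (H 0))"
    and sq: "squares (H s) ! k = (i, b, t)" "squares (H s') ! k = (i', b', t')"
  shows "i' = i" "b' = b" "\<bar>t - t'\<bar> < \<delta> / 4" "place n (H s') i t' = place n (H s) i t"
proof -
  have m: "map (\<lambda>(i, \<epsilon>, t). (i, \<epsilon>)) (squares (H s)) ! k = map (\<lambda>(i, \<epsilon>, t). (i, \<epsilon>)) (squares (H s')) ! k"
    unfolding isotopyD(4)[OF isotopy s(1)] isotopyD(4)[OF isotopy s(2)] ..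
  have len: "length (squares (H s)) = length (squares (H 0))" "length (squares (H s')) = length (squares (H 0))"
    using isotopy_length[OF isotopy s(1)] isotopy_length[OF isotopy s(2)] .
  show ib: "i' = i" "b' = b" using m k len sq by simp_all
  show tt: "\<bar>t - t'\<bar> < \<delta> / 4" using square_modulus[OF s(1,2) k s(3)] sq by simp
  have mem: "(i, b, t) \<in> set (squares (H s))" "(i, b, t') \<in> set (squares (H s'))"
    using nth_mem[of k "squares (H s)"] nth_mem[of k "squares (H s')"] k len sq ib by simp_all
  note D = is_diagramD(6,7)[OF diagrams[OF s(1)] mem(1)] and D' = is_diagramD(6,7)[OF diagrams[OF s(2)] mem(2)]
  show "place n (H s') i t' = place n (H s) i t"
  proof (rule place_eqI)
    fix m assume m: "m \<in> {1..n}"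
    show "x s' m t' < x s' i t' \<longleftrightarrow> x s m t < x s i t"
    proof (cases "m = i")
      case False
      then have "\<mu> \<le> \<bar>x s m t - x s i t\<bar>" using squares_off[OF s(1) mem(1) m] by (simp add: abs_minus_commute)
      then show ?thesis
        using sign_persists(1)[OF s(1) _ s(2) _ m D(1) s(3), of t t'] D D' tt pos by auto
    qed simp
  qed
qed

text \<open>For a short time the events of the two diagrams correspond to each other. No event moves
  by more than \<open>\<delta> / 4\<close>, so two events that change their order were closer than
  \<open>\<delta>\<close>, hence far apart.\<close>

lemma far_commutes_step:
  assumes s: "s \<in> {0..1}" "s' \<in> {0..1}" "\<bar>s - s'\<bar> < \<epsilon>"
    and w: "reads n (H s) w" and w': "reads n (H s') w'"
  shows "far_commutes w w'"
proof -
  let ?C = "crossings n (H s)" and ?C' = "crossings n (H s')" and ?m = "length (squares (H 0))"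
  have s'': "\<bar>s' - s\<bar> < \<epsilon>" using s(3) by (simp add: abs_minus_commute)
  have "\<forall>p\<in>?C. \<exists>t'. \<bar>fst p - t'\<bar> < \<delta> / 4 \<and> (t', snd p) \<in> ?C'"
    using crossing_moves[OF s] by auto
  then obtain f where f: "\<And>p. p \<in> ?C \<Longrightarrow> \<bar>fst p - f p\<bar> < \<delta> / 4 \<and> (f p, snd p) \<in> ?C'" by metis
  let ?F = "\<lambda>p. (f p, snd p)"
  have uniq: "(t, r) = (t', r)" if "(t, r) \<in> crossings n (H u)" "(t', r) \<in> crossings n (H u)" "\<bar>t - t'\<bar> < \<delta>" "u \<in> {0..1}" for t t' r u
    using near_crossings_far_apart[OF that(4) that(1,2) _ that(3)] by fastforce
  have bij: "bij_betw ?F ?C ?C'"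
    unfolding bij_betw_def
  proof
    show "inj_on ?F ?C"
    proof (rule inj_onI)
      fix p p' assume p: "p \<in> ?C" "p' \<in> ?C" and eq: "?F p = ?F p'"
      have "f p = f p'" using eq by simp
      then have "\<bar>fst p - fst p'\<bar> < \<delta>" using f[OF p(1)] f[OF p(2)] pos by linarith
      then show "p = p'"
        using uniq[of "fst p" "snd p" s "fst p'"] p eq s(1) by (cases p; cases p') auto
    qed
    show "?F ` ?C = ?C'"
    proof
      show "?F ` ?C \<subseteq> ?C'" using f by auto
      show "?C' \<subseteq> ?F ` ?C"
      proof
        fix p assume p: "p \<in> ?C'"
        obtain t where t: "\<bar>fst p - t\<bar> < \<delta> / 4" "(t, snd p) \<in> ?C"
          using crossing_moves[OF s(2,1) s'', of "fst p" "snd p"] p by auto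
        have "(f (t, snd p), snd p) \<in> ?C'" and "\<bar>t - f (t, snd p)\<bar> < \<delta> / 4" using f[OF t(2)] by auto
        moreover from this(2) have "\<bar>f (t, snd p) - fst p\<bar> < \<delta>" using t(1) pos by linarith
        ultimately have "p = ?F (t, snd p)"
          using uniq[of "f (t, snd p)" "snd p" s' "fst p"] p s(2) by (cases p) auto
        then show "p \<in> ?F ` ?C" using t(2) by blast
      qed
    qed
  qed
  note fin = finite_crossings[OF s(1)]
  let ?I = "Inl ` ?C \<union> Inr ` {..<?m}"
  define h :: "(real \<times> nat) + nat \<Rightarrow> real" where "h = case_sum fst (\<lambda>k. snd (snd (squares (H s) ! k)))"
  define h' :: "(real \<times> nat) + nat \<Rightarrow> real" where "h' = case_sum f (\<lambda>k. snd (snd (squares (H s') ! k)))"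
  define g :: "(real \<times> nat) + nat \<Rightarrow> hecke_gen" where "g = case_sum (\<lambda>p. GenT (snd p))
    (\<lambda>k. case squares (H s) ! k of (i, b, t) \<Rightarrow> square_gen b (place n (H s) i t))"
  have split: "image_mset \<phi> (mset_set ?I) = image_mset (\<phi> \<circ> Inl) (mset_set ?C) + image_mset (\<phi> \<circ> Inr) (mset_set {..<?m})"
    for \<phi> :: "(real \<times> nat) + nat \<Rightarrow> real \<times> hecke_gen"
  proof -
    have "mset_set ?I = mset_set (Inl ` ?C) + mset_set (Inr ` {..<?m})"
      using fin by (intro mset_set_Union) auto
    also have "mset_set (Inl ` ?C) = (image_mset Inl (mset_set ?C) :: ((real \<times> nat) + nat) multiset)"
      by (rule image_mset_mset_set[symmetric]) auto
    also have "mset_set (Inr ` {..<?m}) = (image_mset Inr (mset_set {..<?m}) :: ((real \<times> nat) + nat) multiset)"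
      by (rule image_mset_mset_set[symmetric]) auto
    finally show ?thesis by (simp add: image_mset.compositionality)
  qed
  have gen_inj: "inj_on (\<lambda>(t, r). (t, GenT r)) A" for A :: "(real \<times> nat) set" by (auto simp: inj_on_def)
  have cr: "mset_set ((\<lambda>(t, r). (t, GenT r)) ` A) = image_mset (\<lambda>(t, r). (t, GenT r)) (mset_set A)" for A :: "(real \<times> nat) set"
    by (rule image_mset_mset_set[symmetric, OF gen_inj])
  have lst: "mset xs = image_mset ((!) xs) (mset_set {..<?m})" if "length xs = ?m" for xs :: "(nat \<times> bool \<times> real) list"
  proof -
    have "mset_set {..<?m} = mset [0..<length xs]"
      using mset_set_set[of "[0..<length xs]"] that by (simp add: atLeast0LessThan)
    then show ?thesis by (metis map_nth mset_map)
  qed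
  have len: "length (squares (H s)) = ?m" "length (squares (H s')) = ?m"
    using isotopy_length[OF isotopy s(1)] isotopy_length[OF isotopy s(2)] .
  have ev: "events n (H s) = image_mset (\<lambda>e. (h e, g e)) (mset_set ?I)"
    unfolding events_def split cr lst[OF len(1)] image_mset.compositionality
    by (intro arg_cong2[where f = "(+)"] image_mset_cong) (auto simp: h_def g_def split: prod.splits)
  have "mset_set ?C' = image_mset ?F (mset_set ?C)"
    using bij by (simp add: bij_betw_def image_mset_mset_set)
  then have ev': "events n (H s') = image_mset (\<lambda>e. (h' e, g e)) (mset_set ?I)"
    unfolding events_def split cr lst[OF len(2)]
  proof (intro arg_cong2[where f = "(+)"])
    show "image_mset (\<lambda>(i, \<epsilon>, t). (t, square_gen \<epsilon> (place n (H s') i t))) (image_mset ((!) (squares (H s'))) (mset_set {..<?m}))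
      = image_mset ((\<lambda>e. (h' e, g e)) \<circ> Inr) (mset_set {..<?m})"
      unfolding image_mset.compositionality
    proof (rule image_mset_cong)
      fix k assume "k \<in># mset_set {..<?m}"
      then have k: "k < ?m" by simp
      obtain i b t where 1: "squares (H s) ! k = (i, b, t)" by (cases "squares (H s) ! k")
      obtain i' b' t' where 2: "squares (H s') ! k = (i', b', t')" by (cases "squares (H s') ! k")
      show "((\<lambda>(i, \<epsilon>, t). (t, square_gen \<epsilon> (place n (H s') i t))) \<circ> (!) (squares (H s'))) k = ((\<lambda>e. (h' e, g e)) \<circ> Inr) k"
        using squares_move[OF s k 1 2] 1 2 by (simp add: h'_def g_def)
    qed
  qed (simp add: image_mset.compositionality comp_def h'_def g_def case_prod_beta)
  have hh: "\<bar>h e - h' e\<bar> < \<delta> / 4" if "e \<in> ?I" for e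
    using that f square_modulus[OF s(1,2) _ s(3)] by (auto simp: h_def h'_def)
  show ?thesis
  proof (rule reads_events_move[OF _ ev ev'])
    fix e e' assume e: "e \<in> ?I" "e' \<in> ?I" "e \<noteq> e'" "h e \<le> h e'" "h' e' \<le> h' e"
    have near: "\<bar>h e - h e'\<bar> < \<delta>" using hh[OF e(1)] hh[OF e(2)] e(4,5) pos by linarith
    have sq: "g (Inr k) = square_gen b (place n (H s) i t) \<and> h (Inr k) = t \<and> (i, b, t) \<in> set (squares (H s))"
      if "k < ?m" "squares (H s) ! k = (i, b, t)" for k i b t
      using that len nth_mem[of k "squares (H s)"] by (simp add: g_def h_def)
    consider (cc) p p' where "e = Inl p" "e' = Inl p'" | (cs) p k where "e = Inl p" "e' = Inr k"
      | (sc) k p where "e = Inr k" "e' = Inl p" | (ss) k k' where "e = Inr k" "e' = Inr k'"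
      by (cases e; cases e') auto
    then show "far_apart (g e) (g e')"
    proof cases
      case cc
      then show ?thesis
        using near_crossings_far_apart[OF s(1), of "fst p" "snd p" "fst p'" "snd p'"] e near
        by (auto simp: g_def h_def prod_eq_iff)
    next
      case cs
      obtain i b t where 1: "squares (H s) ! k = (i, b, t)" by (cases "squares (H s) ! k")
      then show ?thesis
        using near_crossing_square_far_apart[OF s(1), of "fst p" "snd p" i b t] sq[OF _ 1] e near cs
        by (auto simp: g_def h_def)
    next
      case sc
      obtain i b t where 1: "squares (H s) ! k = (i, b, t)" by (cases "squares (H s) ! k")
      then have "far_apart (g e') (g e)"
        using near_crossing_square_far_apart[OF s(1), of "fst p" "snd p" i b t] sq[OF _ 1] e near sc
        by (auto simp: g_def h_def abs_minus_commute)
      then show ?thesis by (rule far_apart_sym)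
    next
      case ss
      then show ?thesis by (auto simp: g_def split: prod.split)
    qed
  qed (use fin w w' in \<open>auto simp: reads_def\<close>)
qed

end

lemma finite_crossings: "is_diagram n d \<Longrightarrow> finite (crossings n d)"
  using isotopy_margin_exists[OF isotopy_const] isotopy_margin.finite_crossings by fastforce

lemma reads_exists: "is_diagram n d \<Longrightarrow> \<exists>w. reads n d w"
  using descending_exists unfolding reads_def reads_events_def by metis

lemma isotopy_far_commutes:
  assumes H: "isotopy n H" and w: "reads n (H 0) w" and w': "reads n (H 1) w'"
  shows "far_commutes w w'"
proof -
  obtain \<mu> \<delta> \<epsilon> where m: "isotopy_margin n H \<mu> \<delta> \<epsilon>" using isotopy_margin_exists[OF H] by blast
  interpret isotopy_margin n H \<mu> \<delta> \<epsilon> by (rule m)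
  obtain N :: nat where N: "1 / \<epsilon> < real N" using reals_Archimedean2 by blast
  have "0 < 1 / \<epsilon>" using pos by simp
  then have N0: "0 < real N" using N by linarith
  have step: "1 / real N < \<epsilon>" using N N0 pos by (simp add: field_simps)
  have "reads n (H (real k / real N)) v \<Longrightarrow> k \<le> N \<Longrightarrow> far_commutes w v" for k v
  proof (induction k arbitrary: v)
    case 0
    then show ?case using far_commutes_step[of 0 0 w v] w pos by simp
  next
    case (Suc k)
    let ?s = "real k / real N" and ?s' = "real (Suc k) / real N"
    have s: "?s \<in> {0..1}" "?s' \<in> {0..1}" using Suc.prems(2) N0 by auto
    have eq: "?s' - ?s = 1 / real N" by (simp add: add_divide_distrib)
    have "\<bar>?s' - ?s\<bar> < \<epsilon>" unfolding eq using step N0 by simp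
    then have close: "\<bar>?s - ?s'\<bar> < \<epsilon>" by (simp add: abs_minus_commute)
    obtain u where u: "reads n (H ?s) u" using reads_exists[OF diagrams[OF s(1)]] by blast
    have "far_commutes w u" using Suc.IH[OF u] Suc.prems(2) by simp
    moreover have "far_commutes u v" by (rule far_commutes_step[OF s close u Suc.prems(1)])
    ultimately show ?case using far_commutes_trans by blast
  qed
  from this[of N w'] show ?thesis using w' N0 by simp
qed

lemma place_same_picture:
  assumes \<pi>: "\<pi> permutes {1..n}" "\<And>i t. i \<in> {1..n} \<Longrightarrow> t \<in> {0..1} \<Longrightarrow> curve e (\<pi> i) t = curve d i t"
    and i: "i \<in> {1..n}" "t \<in> {0..1}"
  shows "place n e (\<pi> i) t = place n d i t"
proof -
  have "{k \<in> {1..n}. curve e k t < curve e (\<pi> i) t} = \<pi> ` {k \<in> {1..n}. curve d k t < curve d i t}"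
  proof
    show "{k \<in> {1..n}. curve e k t < curve e (\<pi> i) t} \<subseteq> \<pi> ` {k \<in> {1..n}. curve d k t < curve d i t}"
    proof
      fix k assume k: "k \<in> {k \<in> {1..n}. curve e k t < curve e (\<pi> i) t}"
      then obtain m where "k = \<pi> m" "m \<in> {1..n}" using permutes_image[OF \<pi>(1)] by blast
      then show "k \<in> \<pi> ` {k \<in> {1..n}. curve d k t < curve d i t}" using k \<pi>(2) i by auto
    qed
    show "\<pi> ` {k \<in> {1..n}. curve d k t < curve d i t} \<subseteq> {k \<in> {1..n}. curve e k t < curve e (\<pi> i) t}"
      using \<pi>(2) i permutes_in_image[OF \<pi>(1)] by auto
  qed
  moreover have "card (\<pi> ` A) = card A" for A
    using \<pi>(1) by (intro card_image) (metis permutes_inj inj_on_subset subset_UNIV)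
  ultimately show ?thesis by (simp add: place_def)
qed

lemma crossings_same_picture:
  assumes "same_picture n d e" shows "crossings n d \<subseteq> crossings n e"
proof -
  obtain \<pi> where \<pi>: "\<pi> permutes {1..n}" "\<And>i t. i \<in> {1..n} \<Longrightarrow> t \<in> {0..1} \<Longrightarrow> curve e (\<pi> i) t = curve d i t"
    using assms unfolding same_picture_def by blast
  have \<pi>in: "\<pi> i \<in> {1..n}" if "i \<in> {1..n}" for i using that \<pi>(1) by (metis permutes_in_image)
  show ?thesis
  proof
    fix p assume "p \<in> crossings n d"
    then obtain t i j where *: "p = (t, place n d i t)" "t \<in> {0..1}" "i \<in> {1..n}" "j \<in> {1..n}" "i \<noteq> j" "curve d i t = curve d j t"
      unfolding crossings_def by blast
    have "\<pi> i \<noteq> \<pi> j" using *(5) \<pi>(1) by (metis permutes_inverses(2))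
    then show "p \<in> crossings n e"
      using crossingsI[OF *(2) \<pi>in[OF *(3)] \<pi>in[OF *(4)], of e] * \<pi>(2) place_same_picture[OF \<pi> *(3,2)] by simp
  qed
qed

lemma events_same_picture:
  assumes d: "is_diagram n d" and sp: "same_picture n d e" shows "events n e = events n d"
proof -
  obtain \<pi> where \<pi>: "\<pi> permutes {1..n}" "\<And>i t. i \<in> {1..n} \<Longrightarrow> t \<in> {0..1} \<Longrightarrow> curve e (\<pi> i) t = curve d i t"
    "mset (squares e) = image_mset (\<lambda>(i, \<epsilon>, t). (\<pi> i, \<epsilon>, t)) (mset (squares d))"
    using sp unfolding same_picture_def by blast
  have c: "crossings n e = crossings n d"
    using crossings_same_picture sp same_picture_sym[OF sp] by blast
  have "image_mset (\<lambda>(i, \<epsilon>, t). (t, square_gen \<epsilon> (place n e i t))) (mset (squares e)) =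
    image_mset (\<lambda>(i, \<epsilon>, t). (t, square_gen \<epsilon> (place n d i t))) (mset (squares d))"
    unfolding \<pi>(3) image_mset.compositionality
  proof (rule image_mset_cong)
    fix p assume "p \<in># mset (squares d)"
    then obtain i b t where p: "p = (i, b, t)" "(i, b, t) \<in> set (squares d)" by (cases p) auto
    have "place n e (\<pi> i) t = place n d i t"
      using is_diagramD(6,7)[OF d p(2)] by (intro place_same_picture[OF \<pi>(1,2)]) auto
    then show "((\<lambda>(i, \<epsilon>, t). (t, square_gen \<epsilon> (place n e i t))) \<circ> (\<lambda>(i, \<epsilon>, t). (\<pi> i, \<epsilon>, t))) p =
        (\<lambda>(i, \<epsilon>, t). (t, square_gen \<epsilon> (place n d i t))) p" by (simp add: p)
  qed
  then show ?thesis by (simp add: events_def c)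
qed

theorem isotopic_far_commutes:
  assumes "isotopic n d e" "reads n d v" "reads n e w"
  shows "far_commutes v w"
proof -
  obtain H where H: "isotopy n H" "same_picture n d (H 0)" "same_picture n e (H 1)"
    using assms(1) unfolding isotopic_def by blast
  have "reads n (H 0) v" "reads n (H 1) w"
    using assms H isotopyD(1)[OF H(1)] events_same_picture unfolding reads_def by auto
  then show ?thesis by (rule isotopy_far_commutes[OF H(1)])
qed

lemma place_less: 
  assumes "i \<in> {1..n}" shows "place n d i t \<in> {1..n}"
proof -
  have "card {k \<in> {1..n}. curve d k t < curve d i t} \<le> card ({1..n} - {i})"
    by (intro card_mono) auto
  then show ?thesis using assms by (auto simp: place_def)
qed

lemma crossing_place:
  assumes "(t, r) \<in> crossings n d" shows "r \<in> {1..<n}"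
proof -
  obtain i j where ij: "t \<in> {0..1}" "i \<in> {1..n}" "j \<in> {1..n}" "i \<noteq> j" "curve d i t = curve d j t" "r = place n d i t"
    using assms by (rule crossingsE)
  have "card {k \<in> {1..n}. curve d k t < curve d i t} \<le> card ({1..n} - {i, j})"
    using ij(5) by (intro card_mono) auto
  also have "card ({1..n} - {i, j}) = n - 2" using ij(2-4) by (subst card_Diff_subset) auto
  finally have "r \<le> Suc (n - 2)" by (simp add: ij(6) place_def)
  moreover have "2 \<le> n" using ij(2-4) by (auto simp: not_le)
  ultimately show ?thesis by (auto simp: ij(6) place_def)
qed

lemma finite_events_set:
  assumes "is_diagram n d"
  shows "set_mset (events n d) = (\<lambda>(t, r). (t, GenT r)) ` crossings n d \<union>
    (\<lambda>(i, \<epsilon>, t). (t, square_gen \<epsilon> (place n d i t))) ` set (squares d)"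
  using finite_crossings[OF assms] by (simp add: events_def)

lemma reads_letters: assumes "reads n d w" shows "w \<in> lists (hecke_gens n)"
proof -
  have d: "is_diagram n d" using assms by (simp add: reads_def)
  obtain es where es: "mset es = events n d" "map snd es = w"
    using assms by (auto simp: reads_def reads_events_def)
  have "snd ` set_mset (events n d) \<subseteq> hecke_gens n"
    unfolding finite_events_set[OF d]
    using is_diagramD(6)[OF d] place_less[of _ n d] crossing_place[of _ _ n d]
    by (fastforce simp: square_gen_def hecke_gens_def)
  moreover have "set w = snd ` set_mset (events n d)" using es by (metis set_map set_mset_mset)
  ultimately show ?thesis by auto
qed

section \<open>Diagrams with the same events at the same heights are isotopic\<close>

text \<open>Consider the supremum of the \<open>t\<close> for which \<open>P\<close> holds on
  \<open>[0,t]\<close>.\<close>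

lemma real_interval_induct:
  fixes P :: "real \<Rightarrow> bool"
  assumes "P 0"
    and left: "\<And>t. 0 < t \<Longrightarrow> t \<le> 1 \<Longrightarrow> (\<And>s. 0 \<le> s \<Longrightarrow> s < t \<Longrightarrow> P s) \<Longrightarrow> P t"
    and right: "\<And>t. 0 \<le> t \<Longrightarrow> t < 1 \<Longrightarrow> (\<And>s. 0 \<le> s \<Longrightarrow> s \<le> t \<Longrightarrow> P s) \<Longrightarrow> \<exists>e>0. \<forall>s. t < s \<longrightarrow> s < t + e \<longrightarrow> s \<le> 1 \<longrightarrow> P s"
    and t: "t \<in> {0..1}"
  shows "P t"
proof -
  define S where "S = {t \<in> {0..1}. \<forall>s. 0 \<le> s \<longrightarrow> s \<le> t \<longrightarrow> P s}"
  have S0: "0 \<in> S" using assms(1) by (auto simp: S_def)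
  have Sb: "bdd_above S" by (rule bdd_aboveI[of _ 1]) (auto simp: S_def)
  define c where "c = Sup S"
  have c: "0 \<le> c" unfolding c_def by (rule cSup_upper[OF S0 Sb])
  moreover have "c \<le> 1" unfolding c_def
  proof (rule cSup_least)
    show "S \<noteq> {}" using S0 by blast
    show "t \<le> 1" if "t \<in> S" for t using that by (simp add: S_def)
  qed
  ultimately have c: "0 \<le> c" "c \<le> 1" .
  have below: "P s" if s: "0 \<le> s" "s < c" for s
  proof -
    obtain t where "t \<in> S" "s < t" using s(2) less_cSup_iff[of S s] S0 Sb unfolding c_def by blast
    then show ?thesis using s(1) by (auto simp: S_def)
  qed
  have Pc: "P c" using left[of c] below c assms(1) by (cases "c = 0") auto
  then have all: "P s" if "0 \<le> s" "s \<le> c" for s using below that by (cases "s = c") auto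
  have "c = 1"
  proof (rule ccontr)
    assume "c \<noteq> 1"
    then have "c < 1" using c by simp
    then obtain e where e: "e > 0" "\<forall>s. c < s \<longrightarrow> s < c + e \<longrightarrow> s \<le> 1 \<longrightarrow> P s" using right[OF c(1) _ all] by blast
    let ?u = "min (c + e / 2) 1"
    have "P s" if "0 \<le> s" "s \<le> ?u" for s
      using all[of s] e that by (cases "s \<le> c") auto
    then have "?u \<in> S" using c e by (auto simp: S_def)
    then have "?u \<le> c" using Sb by (simp add: c_def cSup_upper)
    then show False using e \<open>c < 1\<close> by (auto simp: min_def split: if_splits)
  qed
  then show ?thesis using all t by auto
qed

lemma curve_continuous:
  assumes "is_diagram n d" "i \<in> {1..n}" shows "continuous_on {0..1} (curve d i)"
  using is_diagramD(1)[OF assms] by (rule differentiable_imp_continuous_on)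

lemma order_persists:
  assumes d: "is_diagram n d" and ij: "i \<in> {1..n}" "j \<in> {1..n}" and t: "t \<in> {0..1}" and lt: "curve d i t < curve d j t"
  shows "\<forall>\<^sub>F u in at t within {0..1}. curve d i u < curve d j u"
proof -
  have c: "(curve d k \<longlongrightarrow> curve d k t) (at t within {0..1})" if "k \<in> {1..n}" for k
    using curve_continuous[OF d that] t by (simp add: continuous_on_def)
  have "((\<lambda>u. curve d j u - curve d i u) \<longlongrightarrow> curve d j t - curve d i t) (at t within {0..1})"
    using c ij by (intro tendsto_diff)
  then have "\<forall>\<^sub>F u in at t within {0..1}. 0 < curve d j u - curve d i u"
    using lt by (intro order_tendstoD) auto
  then show ?thesis by (auto elim: eventually_mono)
qed

lemma crossing_switches:
  assumes d: "is_diagram n d" and ij: "i \<in> {1..n}" "j \<in> {1..n}" and t: "t \<in> {0..1}"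
    and eq: "curve d i t = curve d j t" and v: "slope d j t < slope d i t"
  shows "\<forall>\<^sub>F u in at t within {0..1}. (t < u \<longrightarrow> curve d j u < curve d i u) \<and> (u < t \<longrightarrow> curve d i u < curve d j u)"
proof -
  let ?f = "\<lambda>u. curve d i u - curve d j u"
  have D: "(?f has_real_derivative slope d i t - slope d j t) (at t within {0..1})"
    using slope_deriv[OF is_diagramD(1)[OF d]] ij t by (intro derivative_intros) auto
  obtain a where a: "a > 0" "\<And>h. h > 0 \<Longrightarrow> t + h \<in> {0..1} \<Longrightarrow> h < a \<Longrightarrow> ?f t < ?f (t + h)"
    using has_real_derivative_pos_inc_right[OF D] v by auto
  obtain b where b: "b > 0" "\<And>h. h > 0 \<Longrightarrow> t - h \<in> {0..1} \<Longrightarrow> h < b \<Longrightarrow> ?f (t - h) < ?f t"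
    using has_real_derivative_pos_inc_left[OF D] v by auto
  show ?thesis
    unfolding eventually_at
  proof (intro exI[of _ "min a b"] conjI ballI impI)
    fix u assume u: "u \<in> {0..1}" "u \<noteq> t \<and> dist u t < min a b"
    show "curve d j u < curve d i u" if "t < u"
      using a(2)[of "u - t"] u that eq by (auto simp: dist_real_def)
    show "curve d i u < curve d j u" if "u < t"
      using b(2)[of "t - u"] u that eq by (auto simp: dist_real_def)
  qed (use a b in auto)
qed

lemma generic_nearby:
  assumes d: "is_diagram n d" and t: "t \<in> {0..1}"
  shows "\<forall>\<^sub>F u in at t within {0..1}. \<forall>i\<in>{1..n}. \<forall>j\<in>{1..n}. i \<noteq> j \<longrightarrow> curve d i u \<noteq> curve d j u \<and>
    (curve d i t < curve d j t \<longrightarrow> curve d i u < curve d j u)"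
proof (intro eventually_ball_finite ballI finite_atLeastAtMost)
  fix i j assume ij: "i \<in> {1..n}" "j \<in> {1..n}"
  show "\<forall>\<^sub>F u in at t within {0..1}. i \<noteq> j \<longrightarrow> curve d i u \<noteq> curve d j u \<and> (curve d i t < curve d j t \<longrightarrow> curve d i u < curve d j u)"
  proof (cases "i = j")
    case False
    consider "curve d i t < curve d j t" | "curve d j t < curve d i t" | "curve d i t = curve d j t" by linarith
    then show ?thesis
    proof cases
      case 1
      show ?thesis using order_persists[OF d ij t 1] by (rule eventually_mono) auto
    next
      case 2
      show ?thesis using order_persists[OF d ij(2,1) t 2] by (rule eventually_mono) (use 2 in auto)
    next
      case 3
      then have "slope d i t \<noteq> slope d j t" using is_diagramD(5)[OF d t ij False] by blast
      then consider "slope d j t < slope d i t" | "slope d i t < slope d j t" by linarith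
      then have "\<forall>\<^sub>F u in at t within {0..1}. u \<noteq> t \<longrightarrow> curve d i u \<noteq> curve d j u"
      proof cases
        case 1
        show ?thesis using crossing_switches[OF d ij t 3 1] by (rule eventually_mono) force
      next
        case 2
        show ?thesis using crossing_switches[OF d ij(2,1) t 3[symmetric] 2] by (rule eventually_mono) force
      qed
      moreover have "\<forall>\<^sub>F u in at t within {0..1}. u \<noteq> t" by (auto simp: eventually_at intro: exI[of _ 1])
      ultimately show ?thesis by eventually_elim (use 3 in auto)
    qed
  qed simp
qed

text \<open>The order of the curves from left to right. Coincidences agree too, being the absence of
  both strict inequalities.\<close>

definition same_pattern :: "nat \<Rightarrow> diagram \<Rightarrow> diagram \<Rightarrow> real \<Rightarrow> bool" where
  "same_pattern n d e t \<longleftrightarrow> (\<forall>i\<in>{1..n}. \<forall>j\<in>{1..n}. curve d i t < curve d j t \<longleftrightarrow> curve e i t < curve e j t)"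

lemma same_pattern_sym: "same_pattern n d e t \<Longrightarrow> same_pattern n e d t"
  by (auto simp: same_pattern_def)

lemma same_pattern_eq:
  "same_pattern n d e t \<Longrightarrow> i \<in> {1..n} \<Longrightarrow> j \<in> {1..n} \<Longrightarrow> curve d i t = curve d j t \<longleftrightarrow> curve e i t = curve e j t"
  unfolding same_pattern_def by (metis less_irrefl linorder_less_linear)

text \<open>In an order two initial segments with the same number of elements are equal. This
  recovers curves from their positions.\<close>

lemma initial_segments_eq:
  fixes R :: "'a \<Rightarrow> 'a \<Rightarrow> bool"
  assumes "\<And>u v. R u v \<Longrightarrow> \<not> R v u" "finite U" "finite V" "card U = card V"
    and "\<And>u v. u \<in> U \<Longrightarrow> v \<in> V \<Longrightarrow> v \<notin> U \<Longrightarrow> R u v" "\<And>u v. v \<in> V \<Longrightarrow> u \<in> U \<Longrightarrow> u \<notin> V \<Longrightarrow> R v u"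
  shows "U = V"
proof -
  have "U \<subseteq> V \<or> V \<subseteq> U" using assms(1,5,6) by blast
  then show ?thesis using assms(2-4) card_subset_eq by metis
qed

lemma left_nearby:
  fixes t :: real
  assumes t: "0 < t" "t \<le> 1" and ev: "\<forall>\<^sub>F u in at t within {0..1}. Q u"
  shows "\<exists>u\<ge>0. u < t \<and> Q u"
proof -
  obtain e where e: "e > 0" "\<forall>u\<in>{0..1}. u \<noteq> t \<and> dist u t < e \<longrightarrow> Q u" using ev unfolding eventually_at by blast
  let ?u = "max 0 (t - e / 2)"
  have "?u \<in> {0..1}" "?u \<noteq> t" "dist ?u t < e" using t e(1) by (auto simp: dist_real_def max_def)
  then show ?thesis using e t by (intro exI[of _ ?u]) (auto simp: max_def)
qed

text \<open>In \<open>e\<close> some pair \<open>k\<close>, \<open>l\<close> crosses at the same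
  height and the same position as \<open>i\<close>, \<open>j\<close> do in \<open>d\<close>. Just
  below that height the two diagrams have the same order of curves. In this common order the curves
  left of \<open>i\<close>, \<open>j\<close> and those left of \<open>k\<close>, \<open>l\<close>
  are initial segments of the same size, so they are equal, and the next two curves give \<open>{i,
  j} = {k, l}\<close>.\<close>

lemma crossing_transfers:
  assumes d: "is_diagram n d" and e: "is_diagram n e" and c: "crossings n d = crossings n e"
    and t: "0 < t" "t \<le> 1" and before: "\<And>s. 0 \<le> s \<Longrightarrow> s < t \<Longrightarrow> same_pattern n d e s"
    and ij: "i \<in> {1..n}" "j \<in> {1..n}" "i \<noteq> j" and eq: "curve d i t = curve d j t"
  shows "curve e i t = curve e j t"
proof -
  have t01: "t \<in> {0..1}" using t by simp
  have "(t, place n d i t) \<in> crossings n e" using crossingsI[OF t01 ij eq] c by simp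
  then obtain k l where kl: "k \<in> {1..n}" "l \<in> {1..n}" "k \<noteq> l" "curve e k t = curve e l t" "place n d i t = place n e k t"
    by (rule crossingsE)
  obtain u where u: "u \<ge> 0" "u < t"
    "\<forall>i\<in>{1..n}. \<forall>j\<in>{1..n}. i \<noteq> j \<longrightarrow> curve d i u \<noteq> curve d j u \<and> (curve d i t < curve d j t \<longrightarrow> curve d i u < curve d j u)"
    "\<forall>i\<in>{1..n}. \<forall>j\<in>{1..n}. i \<noteq> j \<longrightarrow> curve e i u \<noteq> curve e j u \<and> (curve e i t < curve e j t \<longrightarrow> curve e i u < curve e j u)"
    using left_nearby[OF t eventually_conj[OF generic_nearby[OF d t01] generic_nearby[OF e t01]]] by blast
  have P: "curve d a u < curve d b u \<longleftrightarrow> curve e a u < curve e b u" if "a \<in> {1..n}" "b \<in> {1..n}" for a b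
    using before[OF u(1,2)] that by (simp add: same_pattern_def)
  have pd: "curve d a u < curve d b u" if "a \<in> {1..n}" "b \<in> {1..n}" "curve d a t < curve d b t" for a b
  proof -
    have "a \<noteq> b" using that(3) by auto
    then show ?thesis using u(3)[rule_format, OF that(1,2)] that(3) by blast
  qed
  have pe: "curve d a u < curve d b u" if "a \<in> {1..n}" "b \<in> {1..n}" "curve e a t < curve e b t" for a b
  proof -
    have "a \<noteq> b" using that(3) by auto
    then have "curve e a u < curve e b u" using u(4)[rule_format, OF that(1,2)] that(3) by blast
    then show ?thesis using P[OF that(1,2)] by simp
  qed
  let ?B = "{m \<in> {1..n}. curve d m t < curve d i t}" and ?B' = "{m \<in> {1..n}. curve e m t < curve e k t}"
  have card: "card ?B = card ?B'" using kl(5) by (simp add: place_def)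
  let ?R = "\<lambda>a b. curve d a u < curve d b u"
  have B: "?B = ?B'"
  proof (rule initial_segments_eq[of ?R])
    fix a b assume "a \<in> ?B" "b \<in> ?B'" "b \<notin> ?B" then show "?R a b" by (intro pd) auto
  next
    fix a b assume "b \<in> ?B'" "a \<in> ?B" "a \<notin> ?B'" then show "?R b a" by (intro pe) auto
  qed (use card in auto)
  have "{i, j} \<union> ?B = {k, l} \<union> ?B'"
  proof (rule initial_segments_eq[of ?R])
    fix a b assume ab: "a \<in> {i, j} \<union> ?B" "b \<in> {k, l} \<union> ?B'" "b \<notin> {i, j} \<union> ?B"
    then have bN: "b \<in> {1..n}" "b \<noteq> i" "b \<noteq> j" "\<not> curve d b t < curve d i t" using kl by auto
    moreover have "curve d i t \<noteq> curve d b t"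
      using is_diagramD(4)[OF d t01 ij(2,1) bN(1) ij(3)[symmetric] bN(2)[symmetric] bN(3)[symmetric] eq[symmetric]] .
    ultimately have "curve d i t < curve d b t" by linarith
    moreover have "a \<in> {1..n}" using ab ij by auto
    ultimately show "?R a b" using ab(1) eq bN by (intro pd) auto
  next
    fix a b assume ab: "b \<in> {k, l} \<union> ?B'" "a \<in> {i, j} \<union> ?B" "a \<notin> {k, l} \<union> ?B'"
    then have aN: "a \<in> {1..n}" "a \<noteq> k" "a \<noteq> l" "\<not> curve e a t < curve e k t" using ij by auto
    moreover have "curve e k t \<noteq> curve e a t"
      using is_diagramD(4)[OF e t01 kl(2,1) aN(1) kl(3)[symmetric] aN(2)[symmetric] aN(3)[symmetric] kl(4)[symmetric]] .
    ultimately have "curve e k t < curve e a t" by linarith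
    moreover have "b \<in> {1..n}" using ab kl by auto
    ultimately show "?R b a" using ab(1) kl(4) aN by (intro pe) auto
  next
    have "card ({i, j} \<union> ?B) = card {i, j} + card ?B" using eq by (intro card_Un_disjoint) auto
    moreover have "card ({k, l} \<union> ?B') = card {k, l} + card ?B'" using kl(4) by (intro card_Un_disjoint) auto
    ultimately show "card ({i, j} \<union> ?B) = card ({k, l} \<union> ?B')" using card ij(3) kl(3) by simp
  qed auto
  moreover have "i \<notin> ?B'" "j \<notin> ?B'" unfolding B[symmetric] using eq by auto
  ultimately have "{i, j} \<subseteq> {k, l}" by blast
  then show ?thesis using kl(4) by auto
qed

text \<open>Both pairs are in the same order just below \<open>t\<close>, and a transversal crossing
  reverses this order.\<close>

lemma slopes_same_sign:
  assumes d: "is_diagram n d" and e: "is_diagram n e"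
    and t: "0 < t" "t \<le> 1" and before: "\<And>s. 0 \<le> s \<Longrightarrow> s < t \<Longrightarrow> same_pattern n d e s"
    and ij: "i \<in> {1..n}" "j \<in> {1..n}" and eq: "curve d i t = curve d j t" "curve e i t = curve e j t"
    and v: "slope d j t < slope d i t" and ne: "slope e i t \<noteq> slope e j t"
  shows "slope e j t < slope e i t"
proof (rule ccontr)
  assume "\<not> ?thesis"
  then have w: "slope e i t < slope e j t" using ne by simp
  have t01: "t \<in> {0..1}" using t by simp
  obtain u where u: "u \<ge> 0" "u < t" "u < t \<longrightarrow> curve d i u < curve d j u" "u < t \<longrightarrow> curve e j u < curve e i u"
    using left_nearby[OF t eventually_conj[OF crossing_switches[OF d ij t01 eq(1) v]
          crossing_switches[OF e ij(2,1) t01 eq(2)[symmetric] w]]] by blast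
  then show False using before[OF u(1,2)] ij by (auto simp: same_pattern_def)
qed

lemma same_pattern_continues:
  assumes d: "is_diagram n d" and e: "is_diagram n e" and t: "0 \<le> t" "t < 1"
    and upto: "\<And>s. 0 \<le> s \<Longrightarrow> s \<le> t \<Longrightarrow> same_pattern n d e s"
  shows "\<forall>\<^sub>F u in at t within {0..1}. \<forall>i\<in>{1..n}. \<forall>j\<in>{1..n}. t < u \<longrightarrow> (curve d i u < curve d j u \<longleftrightarrow> curve e i u < curve e j u)"
proof -
  have t01: "t \<in> {0..1}" using t by simp
  show "\<forall>\<^sub>F u in at t within {0..1}. \<forall>i\<in>{1..n}. \<forall>j\<in>{1..n}. t < u \<longrightarrow> (curve d i u < curve d j u \<longleftrightarrow> curve e i u < curve e j u)"
  proof (intro eventually_ball_finite ballI finite_atLeastAtMost)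
    fix i j assume ij: "i \<in> {1..n}" "j \<in> {1..n}"
    show "\<forall>\<^sub>F u in at t within {0..1}. t < u \<longrightarrow> (curve d i u < curve d j u \<longleftrightarrow> curve e i u < curve e j u)"
    proof (cases "i = j")
      case ne: False
      have P: "curve d a t < curve d b t \<longleftrightarrow> curve e a t < curve e b t" if "a \<in> {1..n}" "b \<in> {1..n}" for a b
        using upto[OF t(1)] that by (simp add: same_pattern_def)
      consider "curve d i t < curve d j t" | "curve d j t < curve d i t" | "curve d i t = curve d j t" by linarith
      then show ?thesis
      proof cases
        case 1
        then have "curve e i t < curve e j t" using P ij by simp
        from eventually_conj[OF order_persists[OF d ij t01 1] order_persists[OF e ij t01 this]]
        show ?thesis by (rule eventually_mono) auto
      next
        case 2
        then have "curve e j t < curve e i t" using P ij by simp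
        from eventually_conj[OF order_persists[OF d ij(2,1) t01 2] order_persists[OF e ij(2,1) t01 this]]
        show ?thesis by (rule eventually_mono) auto
      next
        case 3
        then have e3: "curve e i t = curve e j t" using same_pattern_eq[OF upto[OF t(1)] ij] by simp
        have "t \<noteq> 0" using 3 inj_onD[OF is_diagramD(3)[OF d, of 0], of i j] ij ne by auto
        then have t0: "0 < t" "t \<le> 1" using t by auto
        have before: "same_pattern n d e s" if "0 \<le> s" "s < t" for s using upto that by simp
        have nd: "slope d i t \<noteq> slope d j t" and ne': "slope e i t \<noteq> slope e j t"
          using is_diagramD(5)[OF d t01 ij ne 3] is_diagramD(5)[OF e t01 ij ne e3] by auto
        show ?thesis
        proof (cases "slope d j t < slope d i t")
          case True
          then have "slope e j t < slope e i t" using slopes_same_sign[OF d e t0 _ ij 3 e3 True ne'] before by blast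
          from eventually_conj[OF crossing_switches[OF d ij t01 3 True] crossing_switches[OF e ij t01 e3 this]]
          show ?thesis by (rule eventually_mono) auto
        next
          case False
          then have lt: "slope d i t < slope d j t" using nd by simp
          then have "slope e i t < slope e j t"
            using slopes_same_sign[OF d e t0 _ ij(2,1) 3[symmetric] e3[symmetric] lt ne'[symmetric]] before by blast
          from eventually_conj[OF crossing_switches[OF d ij(2,1) t01 3[symmetric] lt]
              crossing_switches[OF e ij(2,1) t01 e3[symmetric] this]]
          show ?thesis by (rule eventually_mono) auto
        qed
      qed
    qed simp
  qed
qed

text \<open>Induction upwards along \<open>[0,1]\<close>. The order of two curves changes only at
  crossings, where it is reversed, and the crossings are at the same heights and positions in both
  diagrams.\<close>

lemma same_pattern_all:
  assumes d: "is_diagram n d" and e: "is_diagram n e" and c: "crossings n d = crossings n e"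
    and start: "same_pattern n d e 0" and t: "t \<in> {0..1}"
  shows "same_pattern n d e t"
  using start _ _ t
proof (rule real_interval_induct)
  fix t :: real assume t: "0 < t" "t \<le> 1" and before: "\<And>s. 0 \<le> s \<Longrightarrow> s < t \<Longrightarrow> same_pattern n d e s"
  have t01: "t \<in> {0..1}" using t by simp
  obtain u where u: "u \<ge> 0" "u < t"
    "\<forall>i\<in>{1..n}. \<forall>j\<in>{1..n}. i \<noteq> j \<longrightarrow> curve d i u \<noteq> curve d j u \<and> (curve d i t < curve d j t \<longrightarrow> curve d i u < curve d j u)"
    "\<forall>i\<in>{1..n}. \<forall>j\<in>{1..n}. i \<noteq> j \<longrightarrow> curve e i u \<noteq> curve e j u \<and> (curve e i t < curve e j t \<longrightarrow> curve e i u < curve e j u)"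
    using left_nearby[OF t eventually_conj[OF generic_nearby[OF d t01] generic_nearby[OF e t01]]] by blast
  have P: "curve d a u < curve d b u \<longleftrightarrow> curve e a u < curve e b u" if "a \<in> {1..n}" "b \<in> {1..n}" for a b
    using before[OF u(1,2)] that by (simp add: same_pattern_def)
  show "same_pattern n d e t"
    unfolding same_pattern_def
  proof (intro ballI)
    fix i j assume ij: "i \<in> {1..n}" "j \<in> {1..n}"
    show "curve d i t < curve d j t \<longleftrightarrow> curve e i t < curve e j t"
    proof (cases "i = j")
      case False
      have eq: "curve d i t = curve d j t \<longleftrightarrow> curve e i t = curve e j t"
        using crossing_transfers[OF d e c t before ij False]
          crossing_transfers[OF e d c[symmetric] t same_pattern_sym[OF before] ij False] by blast
      have u1: "curve d i t < curve d j t \<longrightarrow> curve d i u < curve d j u" "curve d j t < curve d i t \<longrightarrow> curve d j u < curve d i u"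
        "curve e i t < curve e j t \<longrightarrow> curve e i u < curve e j u" "curve e j t < curve e i t \<longrightarrow> curve e j u < curve e i u"
        using u(3)[rule_format, OF ij False] u(3)[rule_format, OF ij(2,1) False[symmetric]]
          u(4)[rule_format, OF ij False] u(4)[rule_format, OF ij(2,1) False[symmetric]] by blast+
      show ?thesis using eq u1 P[OF ij] P[OF ij(2,1)] by linarith
    qed simp
  qed
next
  fix t :: real assume t: "0 \<le> t" "t < 1" and upto: "\<And>s. 0 \<le> s \<Longrightarrow> s \<le> t \<Longrightarrow> same_pattern n d e s"
  obtain r where r: "r > 0" "\<forall>u\<in>{0..1}. u \<noteq> t \<and> dist u t < r \<longrightarrow> (\<forall>i\<in>{1..n}. \<forall>j\<in>{1..n}. t < u \<longrightarrow>
      (curve d i u < curve d j u \<longleftrightarrow> curve e i u < curve e j u))"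
    using same_pattern_continues[OF d e t upto] unfolding eventually_at by blast
  show "\<exists>r>0. \<forall>s. t < s \<longrightarrow> s < t + r \<longrightarrow> s \<le> 1 \<longrightarrow> same_pattern n d e s"
    using r t by (intro exI[of _ r]) (auto simp: same_pattern_def dist_real_def)
qed

subsection \<open>Linear interpolation\<close>

definition interpolate :: "diagram \<Rightarrow> diagram \<Rightarrow> real \<Rightarrow> diagram" where
  "interpolate d e s = \<lparr> curve = (\<lambda>i t. (1 - s) * curve d i t + s * curve e i t), squares = squares d \<rparr>"

lemma interpolate_sel [simp]:
  "curve (interpolate d e s) i t = (1 - s) * curve d i t + s * curve e i t"
  "squares (interpolate d e s) = squares d"
  by (simp_all add: interpolate_def)

lemma convex_less: "a < b \<Longrightarrow> c < d \<Longrightarrow> 0 \<le> s \<Longrightarrow> s \<le> 1 \<Longrightarrow> (1 - s) * a + s * c < (1 - s) * b + s * (d::real)"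
  by (cases "s = 0") (auto intro!: add_le_less_mono mult_left_mono)

text \<open>At every height the curves of \<open>d\<close> and \<open>e\<close> are in the same
  order, hence so are convex combinations, which meet only where \<open>d\<close> and
  \<open>e\<close> have a common crossing. There the two differences of slopes have the same sign,
  so the crossing stays transversal.\<close>

lemma interpolate_isotopy:
  assumes d: "is_diagram n d" and e: "is_diagram n e" and P: "\<And>t. t \<in> {0..1} \<Longrightarrow> same_pattern n d e t"
  shows "isotopy n (interpolate d e)"
proof -
  have D: "(curve (interpolate d e s) i has_real_derivative (1 - s) * slope d i t + s * slope e i t) (at t within {0..1})"
    if "i \<in> {1..n}" "t \<in> {0..1}" for i s t
    unfolding interpolate_def diagram.simps
    using slope_deriv[OF is_diagramD(1)[OF d that(1)] that(2)] slope_deriv[OF is_diagramD(1)[OF e that(1)] that(2)]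
    by (intro derivative_intros DERIV_cmult)
  have sl: "slope (interpolate d e s) i t = (1 - s) * slope d i t + s * slope e i t"
    if "i \<in> {1..n}" "t \<in> {0..1}" for i s t by (rule slope_eqI[OF D[OF that] that(2)])
  have less: "curve (interpolate d e s) i t < curve (interpolate d e s) j t"
    if "curve d i t < curve d j t" "s \<in> {0..1}" "t \<in> {0..1}" "i \<in> {1..n}" "j \<in> {1..n}" for i j s t
    using P[OF that(3)] that by (auto simp: same_pattern_def intro!: convex_less)
  have eqD: "curve d i t = curve d j t"
    if "curve (interpolate d e s) i t = curve (interpolate d e s) j t" "s \<in> {0..1}" "t \<in> {0..1}" "i \<in> {1..n}" "j \<in> {1..n}" for i j s t
    using less[of i t j s] less[of j t i s] that by (metis less_irrefl linorder_less_linear)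
  show ?thesis
  proof (rule isotopyI)
    fix s :: real assume s: "s \<in> {0..1}"
    let ?f = "interpolate d e s"
    have slopes: "slope ?f i t \<noteq> slope ?f j t"
      if t: "t \<in> {0..1}" and ij: "i \<in> {1..n}" "j \<in> {1..n}" "i \<noteq> j" and eq: "curve ?f i t = curve ?f j t" for i j t
    proof -
      have eqd: "curve d i t = curve d j t" by (rule eqD[OF eq s t ij(1,2)])
      then have eqe: "curve e i t = curve e j t" using same_pattern_eq[OF P[OF t] ij(1,2)] by simp
      have "t \<noteq> 0" using eqd inj_onD[OF is_diagramD(3)[OF d, of 0], of i j] ij by auto
      then have t0: "0 < t" "t \<le> 1" using t by auto
      have nd: "slope d i t \<noteq> slope d j t" and ne: "slope e i t \<noteq> slope e j t"
        using is_diagramD(5)[OF d t ij eqd] is_diagramD(5)[OF e t ij eqe] by auto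
      have before: "same_pattern n d e u" if "0 \<le> u" "u < t" for u using P that t by auto
      have "slope ?f j t < slope ?f i t" if "slope d j t < slope d i t" 
        using convex_less[OF that slopes_same_sign[OF d e t0 before ij(1,2) eqd eqe that ne]] s sl[OF ij(1) t] sl[OF ij(2) t] by simp
      moreover have "slope ?f i t < slope ?f j t" if "slope d i t < slope d j t"
        using convex_less[OF that slopes_same_sign[OF d e t0 before ij(2,1) eqd[symmetric] eqe[symmetric] that ne[symmetric]]]
          s sl[OF ij(1) t] sl[OF ij(2) t] by simp
      ultimately show ?thesis using nd by linarith
    qed
    show "is_diagram n ?f"
      unfolding is_diagram_def
    proof (intro conjI ballI impI; (intro conjI)?)
      fix i assume i: "i \<in> {1..n}"
      have "continuous_on {0..1} (\<lambda>t. (1 - s) * slope d i t + s * slope e i t)"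
        using is_diagramD(2)[OF d i] is_diagramD(2)[OF e i] by (intro continuous_intros)
      then show "curve ?f i differentiable_on {0..1}" "continuous_on {0..1} (slope ?f i)"
        using smoothI[OF D[OF i]] by blast+
    next
      fix t :: real assume t: "t \<in> {0, 1}"
      show "inj_on (\<lambda>i. curve ?f i t) {1..n}"
        using eqD s t inj_onD[OF is_diagramD(3)[OF d t]] by (intro inj_onI) force
    next
      fix t :: real and i j k
      assume "t \<in> {0..1}" "i \<in> {1..n}" "j \<in> {1..n}" "k \<in> {1..n}" "i \<noteq> j" "j \<noteq> k" "i \<noteq> k"
      then show "\<not> (curve ?f i t = curve ?f j t \<and> curve ?f j t = curve ?f k t)"
        using is_diagramD(4)[OF d, of t i j k] eqD[of s i t j] eqD[of s j t k] s by blast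
    next
      fix t :: real and i j
      assume "t \<in> {0..1}" "i \<in> {1..n}" "j \<in> {1..n}" "i \<noteq> j" "curve ?f i t = curve ?f j t"
      then show "slope ?f i t \<noteq> slope ?f j t" by (rule slopes)
    next
      fix x assume "x \<in> set (squares ?f)"
      moreover obtain i b t where xe: "x = (i, b, t)" by (rule prod_cases3)
      ultimately have x: "x = (i, b, t)" "(i, b, t) \<in> set (squares d)" by auto
      note S = is_diagramD(6-8)[OF d x(2)]
      have "curve ?f j t \<noteq> curve ?f i t" if "j \<in> {1..n}" "j \<noteq> i" for j
        using eqD[of s j t i] S that s by auto
      then show "case x of (i, b, t) \<Rightarrow> i \<in> {1..n} \<and> t \<in> {0<..<1} \<and> (\<forall>j\<in>{1..n}. j \<noteq> i \<longrightarrow> curve ?f j t \<noteq> curve ?f i t)"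
        using S x by auto
    qed
  next
    fix i assume i: "i \<in> {1..n}"
    have c: "continuous_on ({0..1::real} \<times> {0..1::real}) (\<lambda>p. g (snd p))" if "continuous_on {0..1} g" for g :: "real \<Rightarrow> real"
      by (rule continuous_on_compose2[OF that continuous_on_snd[OF continuous_on_id]]) auto
    show "continuous_on ({0..1} \<times> {0..1}) (\<lambda>(s, t). curve (interpolate d e s) i t)"
      using c[OF curve_continuous[OF d i]] c[OF curve_continuous[OF e i]]
      by (auto simp: case_prod_beta intro!: continuous_intros)
    have "continuous_on ({0..1} \<times> {0..1}) (\<lambda>p. (1 - fst p) * slope d i (snd p) + fst p * slope e i (snd p))"
      using c[OF is_diagramD(2)[OF d i]] c[OF is_diagramD(2)[OF e i]] by (intro continuous_intros)
    then show "continuous_on ({0..1} \<times> {0..1}) (\<lambda>(s, t). slope (interpolate d e s) i t)"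
      by (rule continuous_on_eq) (auto simp: sl[OF i])
  qed auto
qed

lemma image_mset_inj:
  assumes "inj_on f (set_mset A \<union> set_mset B)" "image_mset f A = image_mset f B" shows "A = B"
proof -
  let ?g = "inv_into (set_mset A \<union> set_mset B) f"
  have "image_mset ?g (image_mset f C) = C" if "C = A \<or> C = B" for C
  proof -
    have "image_mset (?g \<circ> f) C = image_mset id C"
      using that assms(1) by (intro image_mset_cong) (auto simp: inv_into_f_f)
    then show ?thesis by (simp add: image_mset.compositionality)
  qed
  then show ?thesis using assms(2) by metis
qed

lemma place_strict:
  assumes "i \<in> {1..n}" "curve d i t < curve d k t" shows "place n d i t < place n d k t"
  by (rule place_above_one[OF assms]) (use assms in auto)

lemma place_less_iff:
  assumes "i \<in> {1..n}" "k \<in> {1..n}" shows "place n d i t < place n d k t \<longleftrightarrow> curve d i t < curve d k t"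
proof -
  have "place n d i t = place n d k t" if "curve d i t = curve d k t" using that by (simp add: place_def)
  then show ?thesis using place_strict[OF assms(1), of d t k] place_strict[OF assms(2), of d t i] by linarith
qed

text \<open>The multiset of events separates into crossings and squares because their letters
  differ.\<close>

lemma events_parts:
  assumes d: "is_diagram n d"
  shows "crossings n d = {(t, r). (t, GenT r) \<in># events n d}"
    and "image_mset (\<lambda>(i, \<epsilon>, t). (t, square_gen \<epsilon> (place n d i t))) (mset (squares d)) =
      filter_mset (\<lambda>(t, g). \<nexists>r. g = GenT r) (events n d)"
proof -
  have sg: "square_gen b r \<noteq> GenT s" for b r s by (simp add: square_gen_def)
  show "crossings n d = {(t, r). (t, GenT r) \<in># events n d}"
  proof -
    have A: "(t, GenT r) \<in> (\<lambda>(t, r). (t, GenT r)) ` crossings n d \<longleftrightarrow> (t, r) \<in> crossings n d" for t r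
      by (auto simp: image_iff case_prod_beta prod_eq_iff intro: bexI[of _ "(t, r)"])
    have B: "(t, GenT r) \<notin> (\<lambda>(i, \<epsilon>, t). (t, square_gen \<epsilon> (place n d i t))) ` set (squares d)" for t r
    proof
      assume "(t, GenT r) \<in> (\<lambda>(i, \<epsilon>, t). (t, square_gen \<epsilon> (place n d i t))) ` set (squares d)"
      then obtain p where "(t, GenT r) = (case p of (i, \<epsilon>, t) \<Rightarrow> (t, square_gen \<epsilon> (place n d i t)))" by (elim imageE)
      then show False using sg by (cases p) (auto dest: sym)
    qed
    show ?thesis unfolding finite_events_set[OF d] Un_iff A by (simp only: B) auto
  qed
  have "filter_mset (\<lambda>(t, g). \<nexists>r. g = GenT r) (mset_set ((\<lambda>(t, r). (t, GenT r)) ` crossings n d)) = {#}"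
  proof -
    have "set_mset (filter_mset (\<lambda>(t, g). \<nexists>r. g = GenT r) (mset_set ((\<lambda>(t, r). (t, GenT r)) ` crossings n d))) = {}"
      using finite_crossings[OF d] by auto
    then show ?thesis by (simp only: set_mset_eq_empty_iff)
  qed
  moreover have "filter_mset (\<lambda>(t, g). \<nexists>r. g = GenT r) (image_mset (\<lambda>(i, \<epsilon>, t). (t, square_gen \<epsilon> (place n d i t))) M) =
     image_mset (\<lambda>(i, \<epsilon>, t). (t, square_gen \<epsilon> (place n d i t))) M" for M
    by (induction M) (auto simp: sg)
  ultimately show "image_mset (\<lambda>(i, \<epsilon>, t). (t, square_gen \<epsilon> (place n d i t))) (mset (squares d)) =
      filter_mset (\<lambda>(t, g). \<nexists>r. g = GenT r) (events n d)"
    by (simp add: events_def)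
qed

text \<open>The curves are in the same order everywhere, so the squares of the two diagrams, being
  at the same heights and positions, lie on curves with the same numbers, and linear interpolation
  applies.\<close>

lemma same_events_same_start_isotopic:
  assumes d: "is_diagram n d" and e: "is_diagram n e" and ev: "events n d = events n e"
    and start: "same_pattern n d e 0"
  shows "isotopic n d e"
proof -
  have c: "crossings n d = crossings n e"
    using events_parts(1)[OF d] events_parts(1)[OF e] ev by simp
  note P = same_pattern_all[OF d e c start]
  have rk: "place n e i t = place n d i t" if "i \<in> {1..n}" "t \<in> {0..1}" for i t
    using P[OF that(2)] that(1) by (intro place_eqI) (auto simp: same_pattern_def)
  let ?F = "\<lambda>(i, \<epsilon>, t). (t, square_gen \<epsilon> (place n d i t))"
  have valid: "i \<in> {1..n} \<and> t \<in> {0..1} \<and> (\<forall>j\<in>{1..n}. j \<noteq> i \<longrightarrow> curve d j t \<noteq> curve d i t)"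
    if "(i, b, t) \<in> set (squares d) \<union> set (squares e)" for i b t
    using that
  proof
    assume s: "(i, b, t) \<in> set (squares d)"
    show ?thesis using is_diagramD(6-8)[OF d s] by auto
  next
    assume s: "(i, b, t) \<in> set (squares e)"
    note S = is_diagramD(6-8)[OF e s]
    have "curve d j t \<noteq> curve d i t" if "j \<in> {1..n}" "j \<noteq> i" for j
      using same_pattern_eq[OF P that(1) S(1)] S that by auto
    then show ?thesis using S by auto
  qed
  have "mset (squares d) = mset (squares e)"
  proof (rule image_mset_inj[of ?F])
    show "inj_on ?F (set_mset (mset (squares d)) \<union> set_mset (mset (squares e)))"
    proof (rule inj_onI)
      fix p p' assume p: "p \<in> set_mset (mset (squares d)) \<union> set_mset (mset (squares e))"
        "p' \<in> set_mset (mset (squares d)) \<union> set_mset (mset (squares e))" and E: "?F p = ?F p'"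
      obtain i b t where p1: "p = (i, b, t)" by (rule prod_cases3)
      obtain i' b' t' where p2: "p' = (i', b', t')" by (rule prod_cases3)
      have v: "(i, b, t) \<in> set (squares d) \<union> set (squares e)" "(i', b', t') \<in> set (squares d) \<union> set (squares e)"
        using p p1 p2 by auto
      have t: "t = t'" and eq: "b = b'" "place n d i t = place n d i' t"
        using E p1 p2 by (auto simp: square_gen_def split: if_splits)
      moreover have "i = i'"
      proof (rule ccontr)
        assume "i \<noteq> i'"
        then have "curve d i t \<noteq> curve d i' t" using valid[OF v(1)] valid[OF v(2)] t by metis
        then show False
          using place_strict[of i n d t i'] place_strict[of i' n d t i] valid[OF v(1)] valid[OF v(2)] eq(2) by linarith
      qed
      ultimately show "p = p'" using p1 p2 by simp
    qed
    have "image_mset ?F (mset (squares e)) = image_mset (\<lambda>(i, \<epsilon>, t). (t, square_gen \<epsilon> (place n e i t))) (mset (squares e))"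
    proof (rule image_mset_cong)
      fix p assume p: "p \<in># mset (squares e)"
      obtain i b t where p1: "p = (i, b, t)" by (rule prod_cases3)
      show "?F p = (\<lambda>(i, \<epsilon>, t). (t, square_gen \<epsilon> (place n e i t))) p"
        using rk[of i t] valid[of i b t] p p1 by auto
    qed
    then show "image_mset ?F (mset (squares d)) = image_mset ?F (mset (squares e))"
      using events_parts(2)[OF d] events_parts(2)[OF e] ev by simp
  qed
  then have "same_picture n e (interpolate d e 1)"
    unfolding same_picture_def
    by (intro exI[of _ id]) (auto simp: permutes_id case_prod_beta)
  moreover have "same_picture n d (interpolate d e 0)"
    by (rule agree_same_picture) (simp add: agree_def)
  ultimately show ?thesis
    unfolding isotopic_def using d e interpolate_isotopy[OF d e P] by blast
qed

text \<open>Numbering the curves of both diagrams from left to right at the bottom reduces to the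
  previous case.\<close>

theorem same_events_isotopic:
  assumes d: "is_diagram n d" and e: "is_diagram n e" and ev: "events n d = events n e"
  shows "isotopic n d e"
proof -
  have bij: "bij_betw (\<lambda>i. place n f i 0) {1..n} {1..n}" if f: "is_diagram n f" for f
  proof -
    have "inj_on (\<lambda>i. place n f i 0) {1..n}"
    proof (rule inj_onI)
      fix i j assume ij: "i \<in> {1..n}" "j \<in> {1..n}" "place n f i 0 = place n f j 0"
      then have "curve f i 0 = curve f j 0"
        using place_less_iff[OF ij(1,2), of f 0] place_less_iff[OF ij(2,1), of f 0] by linarith
      then show "i = j" using inj_onD[OF is_diagramD(3)[OF f, of 0]] ij by simp
    qed
    then show ?thesis
      using place_less[of _ n f 0] by (intro bij_betw_imageI endo_inj_surj) auto
  qed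
  define \<sigma> where "\<sigma> i = (if i \<in> {1..n} then inv_into {1..n} (\<lambda>i. place n e i 0) (place n d i 0) else i)" for i
  have bij\<sigma>: "bij_betw \<sigma> {1..n} {1..n}"
  proof -
    have "bij_betw (inv_into {1..n} (\<lambda>i. place n e i 0) \<circ> (\<lambda>i. place n d i 0)) {1..n} {1..n}"
      by (rule bij_betw_trans[OF bij[OF d] bij_betw_inv_into[OF bij[OF e]]])
    then show ?thesis by (rule bij_betw_cong[THEN iffD1, rotated]) (simp add: \<sigma>_def)
  qed
  then have \<sigma>: "\<sigma> permutes {1..n}" by (rule bij_imp_permutes) (auto simp: \<sigma>_def)
  have r: "place n e (\<sigma> i) 0 = place n d i 0" if "i \<in> {1..n}" for i
    using that bij_betw_inv_into_right[OF bij[OF e], of "place n d i 0"] place_less[OF that, of d 0] by (simp add: \<sigma>_def)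
  let ?e = "renumber \<sigma> id e"
  have sp: "same_picture n e ?e" by (rule same_picture_renumber[OF \<sigma> permutes_id])
  note e' = is_diagram_same_picture[OF e sp]
  have \<sigma>in: "\<sigma> i \<in> {1..n}" if "i \<in> {1..n}" for i using \<sigma> that by (metis permutes_in_image)
  have "same_pattern n d ?e 0"
    unfolding same_pattern_def
  proof (intro ballI)
    fix i j assume ij: "i \<in> {1..n}" "j \<in> {1..n}"
    show "curve d i 0 < curve d j 0 \<longleftrightarrow> curve ?e i 0 < curve ?e j 0"
      using place_less_iff[OF ij, of d 0] place_less_iff[OF \<sigma>in[OF ij(1)] \<sigma>in[OF ij(2)], of e 0] r[OF ij(1)] r[OF ij(2)]
      by simp
  qed
  then have "isotopic n d ?e"
    using same_events_same_start_isotopic[OF d e'] ev events_same_picture[OF e sp] by simp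
  then show ?thesis
    using same_picture_isotopic[OF e sp] isotopic_sym isotopic_trans by blast
qed

section \<open>Changing the heights of the events\<close>

subsection \<open>A smooth step\<close>

lemma pos_part_square_deriv: "((\<lambda>u. (max 0 u)\<^sup>2) has_real_derivative 2 * max 0 u) (at (u::real))"
proof -
  consider "u < 0" | "u = 0" | "0 < u" by linarith
  then show ?thesis
  proof cases
    case 1
    have "((\<lambda>u. 0::real) has_real_derivative 0) (at u)" by simp
    then have "((\<lambda>u. (max 0 u)\<^sup>2) has_real_derivative 0) (at u)"
      by (rule has_field_derivative_transform_within_open[of _ _ _ "{..<0}"]) (use 1 in auto)
    then show ?thesis using 1 by simp
  next
    case 3
    have "((\<lambda>u. u\<^sup>2) has_real_derivative 2 * u) (at u)" by (auto intro!: derivative_eq_intros)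
    then have "((\<lambda>u. (max 0 u)\<^sup>2) has_real_derivative 2 * u) (at u)"
      by (rule has_field_derivative_transform_within_open[of _ _ _ "{0<..}"]) (use 3 in auto)
    then show ?thesis using 3 by simp
  next
    case 2
    have "((\<lambda>h. max 0 h) \<longlongrightarrow> max 0 0) (at (0::real))" by (intro tendsto_intros)
    then have "((\<lambda>h. ((max 0 (0 + h))\<^sup>2 - (max 0 0)\<^sup>2) / h) \<longlongrightarrow> 0) (at (0::real))"
      by (simp, elim Lim_transform_eventually)
         (auto simp: eventually_at max_def power2_eq_square intro!: exI[of _ 1])
    then show ?thesis using 2 by (simp add: DERIV_def)
  qed
qed

text \<open>The quadratic spline that is \<open>0\<close> up to \<open>0\<close>, \<open>2 u\<^sup>2\<close> up to \<open>1/2\<close>, \<open>1 - 2 (1 - u)\<^sup>2\<close> up to \<open>1\<close>, and \<open>1\<close> from there on.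
  It is continuously differentiable and takes the value \<open>1/2\<close> only at \<open>1/2\<close>, with slope \<open>2\<close>.\<close>

definition smooth_step :: "real \<Rightarrow> real" where
  "smooth_step u = 2 * (max 0 u)\<^sup>2 - 4 * (max 0 (u - 1/2))\<^sup>2 + 2 * (max 0 (u - 1))\<^sup>2"

definition smooth_step' :: "real \<Rightarrow> real" where
  "smooth_step' u = 4 * max 0 u - 8 * max 0 (u - 1/2) + 4 * max 0 (u - 1)"

lemma smooth_step_deriv: "(smooth_step has_real_derivative smooth_step' u) (at u)"
proof -
  have s: "((\<lambda>u. (max 0 (u - a))\<^sup>2) has_real_derivative 2 * max 0 (u - a)) (at u)" for a
  proof -
    have "((\<lambda>u. u - a) has_real_derivative 1) (at u)" by (auto intro!: derivative_eq_intros)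
    from DERIV_chain2[OF pos_part_square_deriv this] show ?thesis by simp
  qed
  show ?thesis
    using DERIV_add[OF DERIV_diff[OF DERIV_cmult[OF s[of 0], of 2] DERIV_cmult[OF s[of "1/2"], of 4]]
        DERIV_cmult[OF s[of 1], of 2]]
    unfolding smooth_step_def[abs_def] smooth_step'_def by simp
qed

lemma smooth_step'_cont: "continuous_on A (\<lambda>x. smooth_step' (f x))" if "continuous_on A f"
  unfolding smooth_step'_def using that by (intro continuous_intros)

lemma smooth_step_cont: "continuous_on A (\<lambda>x. smooth_step (f x))" if "continuous_on A f"
  unfolding smooth_step_def using that by (intro continuous_intros)

lemma smooth_step_outside:
  "u \<le> 0 \<Longrightarrow> smooth_step u = 0" "1 \<le> u \<Longrightarrow> smooth_step u = 1"
  "u \<le> 0 \<Longrightarrow> smooth_step' u = 0" "1 \<le> u \<Longrightarrow> smooth_step' u = 0"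
  by (auto simp: smooth_step_def smooth_step'_def max_def power2_eq_square algebra_simps)

lemma smooth_step_lower: "0 \<le> u \<Longrightarrow> u \<le> 1/2 \<Longrightarrow> smooth_step u = 2 * u\<^sup>2"
  by (auto simp: smooth_step_def max_def)

lemma smooth_step_upper: "1/2 \<le> u \<Longrightarrow> u \<le> 1 \<Longrightarrow> smooth_step u = 1 - 2 * (1 - u)\<^sup>2"
  by (auto simp: smooth_step_def max_def power2_eq_square algebra_simps)

lemma smooth_step'_nonneg: "0 \<le> smooth_step' u"
  by (auto simp: smooth_step'_def max_def)

lemma smooth_step_half: "smooth_step (1/2) = 1/2" "smooth_step' (1/2) = 2"
  by (auto simp: smooth_step_def smooth_step'_def max_def power2_eq_square)

lemma smooth_step_less_half: assumes "u < 1/2" shows "0 \<le> smooth_step u" "smooth_step u < 1/2"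
proof -
  have "0 \<le> smooth_step u \<and> smooth_step u < 1/2"
  proof (cases "u \<le> 0")
    case False
    then have "u\<^sup>2 < (1/2)\<^sup>2" using assms by (intro power_strict_mono) auto
    then show ?thesis using False assms by (simp add: smooth_step_lower power2_eq_square)
  qed (simp add: smooth_step_outside)
  then show "0 \<le> smooth_step u" "smooth_step u < 1/2" by auto
qed

lemma smooth_step_greater_half: assumes "1/2 < u" shows "1/2 < smooth_step u" "smooth_step u \<le> 1"
proof -
  have "1/2 < smooth_step u \<and> smooth_step u \<le> 1"
  proof (cases "1 \<le> u")
    case False
    then have "(1 - u)\<^sup>2 < (1/2)\<^sup>2" using assms by (intro power_strict_mono) auto
    then show ?thesis using False assms by (simp add: smooth_step_upper power2_eq_square)
  qed (simp add: smooth_step_outside)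
  then show "1/2 < smooth_step u" "smooth_step u \<le> 1" by auto
qed

lemma smooth_step_bounds: "0 \<le> smooth_step u" "smooth_step u \<le> 1"
  using smooth_step_less_half[of u] smooth_step_greater_half[of u] smooth_step_half(1)
  by (cases "u < 1/2"; cases "u = 1/2"; force)+

lemma smooth_step_eq_half: "smooth_step u = 1/2 \<longleftrightarrow> u = 1/2"
  using smooth_step_less_half(2)[of u] smooth_step_greater_half(1)[of u] smooth_step_half(1)
  by (metis less_irrefl linorder_less_linear)

subsection \<open>Time changes\<close>

text \<open>The lower bound \<open>c\<close> for the derivative \<open>\<phi>'\<close> makes
  inverses of a path of time changes continuous along the path.\<close>

definition time_change :: "(real \<Rightarrow> real) \<Rightarrow> (real \<Rightarrow> real) \<Rightarrow> real \<Rightarrow> bool" where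
  "time_change \<phi> \<phi>' c \<longleftrightarrow> 0 < c \<and> \<phi> 0 = 0 \<and> \<phi> 1 = 1 \<and> continuous_on {0..1} \<phi>' \<and>
     (\<forall>t\<in>{0..1}. (\<phi> has_real_derivative \<phi>' t) (at t within {0..1}) \<and> c \<le> \<phi>' t)"

text \<open>Points are added from left to right. To the right of the last point \<open>a\<close> the
  function constructed so far is linear with slope \<open>e\<close>; adding a multiple of a smooth
  step between \<open>a\<close> and the next point \<open>b\<close> lifts it to \<open>g b\<close>.
  The multiple is positive if \<open>e\<close> is smaller than the slope of the chord, whence the
  bound \<open>e0\<close>.\<close>

lemma smooth_interpolation:
  fixes g :: "real \<Rightarrow> real"
  assumes "finite T" "T \<noteq> {}" "\<And>x y. x \<in> T \<Longrightarrow> y \<in> T \<Longrightarrow> x < y \<Longrightarrow> g x < g y"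
  shows "\<exists>e0>0. \<forall>e>0. e < e0 \<longrightarrow> (\<exists>\<phi> \<phi>'. (\<forall>t. (\<phi> has_real_derivative \<phi>' t) (at t) \<and> e \<le> \<phi>' t) \<and>
     continuous_on UNIV \<phi>' \<and> (\<forall>t\<in>T. \<phi> t = g t) \<and> (\<forall>t\<ge>Max T. \<phi> t = g (Max T) + e * (t - Max T)))"
  using assms
proof (induction T rule: finite_linorder_max_induct)
  case (insert b A)
  show ?case
  proof (cases "A = {}")
    case True
    have "\<exists>\<phi> \<phi>'. (\<forall>t. (\<phi> has_real_derivative \<phi>' t) (at t) \<and> e \<le> \<phi>' t) \<and>
     continuous_on UNIV \<phi>' \<and> (\<forall>t\<in>{b}. \<phi> t = g t) \<and> (\<forall>t\<ge>b. \<phi> t = g b + e * (t - b))" for e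
      by (rule exI[of _ "\<lambda>t. g b + e * (t - b)"], rule exI[of _ "\<lambda>t. e"])
         (auto intro!: derivative_eq_intros)
    then show ?thesis using True by (intro exI[of _ 1]) simp
  next
    case False
    let ?a = "Max A"
    have a: "?a \<in> A" "?a < b" using insert(1,2) False by auto
    have gab: "g ?a < g b" using insert.prems(2) a by auto
    obtain e0 where e0: "e0 > 0" "\<And>e. 0 < e \<Longrightarrow> e < e0 \<Longrightarrow> \<exists>\<phi> \<phi>'. (\<forall>t. (\<phi> has_real_derivative \<phi>' t) (at t) \<and> e \<le> \<phi>' t) \<and>
     continuous_on UNIV \<phi>' \<and> (\<forall>t\<in>A. \<phi> t = g t) \<and> (\<forall>t\<ge>?a. \<phi> t = g ?a + e * (t - ?a))"
      using insert.IH[OF False] insert.prems(2) by blast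
    define e1 where "e1 = (g b - g ?a) / (b - ?a)"
    have e1: "0 < e1" using a gab by (simp add: e1_def)
    have Mb: "Max (insert b A) = b" using a insert(1,2) by (intro Max_eqI) (auto simp: less_imp_le)
    have "\<exists>\<phi> \<phi>'. (\<forall>t. (\<phi> has_real_derivative \<phi>' t) (at t) \<and> e \<le> \<phi>' t) \<and>
     continuous_on UNIV \<phi>' \<and> (\<forall>t\<in>insert b A. \<phi> t = g t) \<and> (\<forall>t\<ge>b. \<phi> t = g b + e * (t - b))"
      if e: "0 < e" "e < min e0 e1" for e
    proof -
      obtain \<phi> \<phi>' where \<phi>: "\<And>t. (\<phi> has_real_derivative \<phi>' t) (at t)" "\<And>t. e \<le> \<phi>' t" "continuous_on UNIV \<phi>'"
        "\<And>t. t \<in> A \<Longrightarrow> \<phi> t = g t" "\<And>t. ?a \<le> t \<Longrightarrow> \<phi> t = g ?a + e * (t - ?a)"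
        using e0(2)[of e] e by auto
      define L where "L = b - ?a"
      define k where "k = g b - g ?a - e * L"
      have L: "0 < L" using a by (simp add: L_def)
      have k: "0 < k"
      proof -
        have "e * L < e1 * L" using e L by simp
        then show ?thesis using L by (simp add: k_def e1_def L_def)
      qed
      let ?u = "\<lambda>t. (t - ?a) / L"
      have u: "(?u has_real_derivative 1 / L) (at t)" for t
        using L by (auto intro!: derivative_eq_intros)
      let ?\<psi> = "\<lambda>t. \<phi> t + k * smooth_step (?u t)" and ?\<psi>' = "\<lambda>t. \<phi>' t + k * (smooth_step' (?u t) * (1 / L))"
      have "(?\<psi> has_real_derivative ?\<psi>' t) (at t)" for t
        by (intro DERIV_add \<phi>(1) DERIV_cmult DERIV_chain2[OF smooth_step_deriv u])
      moreover have "e \<le> ?\<psi>' t" for t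
        using \<phi>(2)[of t] k L smooth_step'_nonneg[of "?u t"] by (simp add: add_increasing2)
      moreover have "continuous_on UNIV ?\<psi>'"
        using \<phi>(3) L by (intro continuous_intros smooth_step'_cont) auto
      moreover have "?\<psi> t = g t" if "t \<in> A" for t
      proof -
        have "t \<le> ?a" using that insert(1) by simp
        then have "?u t \<le> 0" using L by (simp add: divide_nonpos_pos)
        then show ?thesis using \<phi>(4)[OF that] by (simp add: smooth_step_outside)
      qed
      moreover have tail: "?\<psi> t = g b + e * (t - b)" if "b \<le> t" for t
      proof -
        have "1 \<le> ?u t" using that L by (simp add: L_def)
        then show ?thesis using \<phi>(5)[of t] that a by (simp add: smooth_step_outside k_def L_def algebra_simps)
      qed
      moreover have "?\<psi> b = g b" using tail[of b] by simp
      ultimately show ?thesis by (intro exI[of _ ?\<psi>] exI[of _ ?\<psi>'] conjI allI ballI impI) auto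
    qed
    then show ?thesis using e0(1) e1 unfolding Mb by (intro exI[of _ "min e0 e1"]) auto
  qed
qed simp

lemma time_change_exists:
  assumes "finite T" "T \<subseteq> {0<..<1}" "g ` T \<subseteq> {0<..<1}" "\<And>x y. x \<in> T \<Longrightarrow> y \<in> T \<Longrightarrow> x < y \<Longrightarrow> g x < g y"
  shows "\<exists>\<phi> \<phi>' c. time_change \<phi> \<phi>' c \<and> (\<forall>t\<in>T. \<phi> t = g t)"
proof -
  define G where "G t = (if t \<in> T then g t else t)" for t
  have T01: "0 \<notin> T" "1 \<notin> T" using assms(2) by auto
  let ?T = "insert 0 (insert 1 T)"
  have mono: "G x < G y" if "x \<in> ?T" "y \<in> ?T" "x < y" for x y
  proof -
    have b: "0 < t \<and> t < 1 \<and> 0 < g t \<and> g t < 1" if "t \<in> T" for t using assms(2,3) that by auto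
    show ?thesis using that assms(4) T01 b[of x] b[of y] by (auto simp: G_def)
  qed
  obtain e0 where e0: "e0 > 0" "\<And>e. 0 < e \<Longrightarrow> e < e0 \<Longrightarrow> \<exists>\<phi> \<phi>'. (\<forall>t. (\<phi> has_real_derivative \<phi>' t) (at t) \<and> e \<le> \<phi>' t) \<and>
     continuous_on UNIV \<phi>' \<and> (\<forall>t\<in>?T. \<phi> t = G t) \<and> (\<forall>t\<ge>Max ?T. \<phi> t = G (Max ?T) + e * (t - Max ?T))"
    using smooth_interpolation[of ?T G] assms(1) mono by blast
  have e2: "0 < e0 / 2" "e0 / 2 < e0" using e0(1) by auto
  obtain \<phi> \<phi>' where \<phi>: "\<And>t. (\<phi> has_real_derivative \<phi>' t) (at t)" "\<And>t. e0 / 2 \<le> \<phi>' t" "continuous_on UNIV \<phi>'"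
    "\<And>t. t \<in> ?T \<Longrightarrow> \<phi> t = G t" using e0(2)[OF e2] by blast
  have "time_change \<phi> \<phi>' (e0 / 2)"
    unfolding time_change_def
    using e2 \<phi>(4)[of 0] \<phi>(4)[of 1] T01 \<phi>(2) continuous_on_subset[OF \<phi>(3)] has_field_derivative_at_within[OF \<phi>(1)]
    by (auto simp: G_def)
  moreover have "\<phi> t = g t" if "t \<in> T" for t using \<phi>(4)[of t] that by (simp add: G_def)
  ultimately show ?thesis by blast
qed

lemma time_changeD:
  assumes "time_change \<phi> \<phi>' c"
  shows "0 < c" "\<phi> 0 = 0" "\<phi> 1 = 1" "continuous_on {0..1} \<phi>'"
    and "\<And>t. t \<in> {0..1} \<Longrightarrow> (\<phi> has_real_derivative \<phi>' t) (at t within {0..1})"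
    and "\<And>t. t \<in> {0..1} \<Longrightarrow> c \<le> \<phi>' t"
  using assms by (auto simp: time_change_def)

lemma time_change_expands:
  assumes \<phi>: "time_change \<phi> \<phi>' c" and st: "s \<in> {0..1}" "t \<in> {0..1}" "s \<le> t"
  shows "c * (t - s) \<le> \<phi> t - \<phi> s"
proof (cases "s = t")
  case False
  then have "s < t" using st by simp
  then have "\<exists>x\<in>{s<..<t}. \<phi> t - \<phi> s = (\<lambda>h. \<phi>' x * h) (t - s)"
  proof (rule mvt_simple)
    fix x assume x: "s \<le> x" "x \<le> t"
    have "(\<phi> has_real_derivative \<phi>' x) (at x within {s..t})"
      by (rule DERIV_subset[OF time_changeD(5)[OF \<phi>]]) (use x st in auto)
    then show "(\<phi> has_derivative (\<lambda>h. \<phi>' x * h)) (at x within {s..t})" by (simp add: has_field_derivative_def)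
  qed
  then obtain x where x: "x \<in> {s<..<t}" "\<phi> t - \<phi> s = \<phi>' x * (t - s)" by auto
  then show ?thesis using time_changeD(6)[OF \<phi>, of x] st by (auto intro!: mult_right_mono)
qed simp

lemma time_change_continuous: "time_change \<phi> \<phi>' c \<Longrightarrow> continuous_on {0..1} \<phi>"
  using time_changeD(5) by (rule DERIV_continuous_on)

lemma time_change_strict:
  assumes "time_change \<phi> \<phi>' c" "s \<in> {0..1}" "t \<in> {0..1}" "s < t" shows "\<phi> s < \<phi> t"
proof -
  have "0 < c * (t - s)" using time_changeD(1)[OF assms(1)] assms(4) by simp
  then show ?thesis using time_change_expands[OF assms(1-3)] assms(4) by linarith
qed

lemma time_change_bij:
  assumes \<phi>: "time_change \<phi> \<phi>' c" shows "bij_betw \<phi> {0..1} {0..1}"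
  unfolding bij_betw_def
proof
  show "inj_on \<phi> {0..1}"
    by (rule inj_onI, rule ccontr) (metis time_change_strict[OF \<phi>] linorder_neqE_linordered_idom less_irrefl)
  show "\<phi> ` {0..1} = {0..1}"
  proof
    have "0 \<le> \<phi> t \<and> \<phi> t \<le> 1" if t: "t \<in> {0..1}" for t
      using time_change_strict[OF \<phi>, of 0 t] time_change_strict[OF \<phi>, of t 1] t time_changeD(2,3)[OF \<phi>]
      by (cases "t = 0"; cases "t = 1") auto
    then show "\<phi> ` {0..1} \<subseteq> {0..1}" by auto
    show "{0..1} \<subseteq> \<phi> ` {0..1}"
    proof
      fix y :: real assume "y \<in> {0..1}"
      then have "\<exists>x\<ge>0. x \<le> 1 \<and> \<phi> x = y"
        using time_changeD(2,3)[OF \<phi>] by (intro IVT' time_change_continuous[OF \<phi>]) auto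
      then show "y \<in> \<phi> ` {0..1}" by force
    qed
  qed
qed

text \<open>Curves are pulled back along \<open>\<phi>\<close>, and so the heights of squares are
  mapped by its inverse.\<close>

definition rescale :: "(real \<Rightarrow> real) \<Rightarrow> diagram \<Rightarrow> diagram" where
  "rescale \<phi> d = \<lparr> curve = (\<lambda>i t. curve d i (\<phi> t)),
     squares = map (\<lambda>(i, \<epsilon>, t). (i, \<epsilon>, inv_into {0..1} \<phi> t)) (squares d) \<rparr>"

lemma rescale_sel [simp]: "curve (rescale \<phi> d) i t = curve d i (\<phi> t)"
  "squares (rescale \<phi> d) = map (\<lambda>(i, \<epsilon>, t). (i, \<epsilon>, inv_into {0..1} \<phi> t)) (squares d)"
  by (simp_all add: rescale_def)

context
  fixes n d \<phi> \<phi>' c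
  assumes d: "is_diagram n d" and \<phi>: "time_change \<phi> \<phi>' c"
begin

lemma phi_in: "t \<in> {0..1} \<Longrightarrow> \<phi> t \<in> {0..1}"
  using time_change_bij[OF \<phi>] by (auto simp: bij_betw_def)

lemma rho: "t \<in> {0..1} \<Longrightarrow> inv_into {0..1} \<phi> t \<in> {0..1} \<and> \<phi> (inv_into {0..1} \<phi> t) = t"
  using time_change_bij[OF \<phi>] inv_into_into[of t \<phi> "{0..1}"] f_inv_into_f[of t \<phi> "{0..1}"]
  unfolding bij_betw_def by simp

lemma rho_phi: "t \<in> {0..1} \<Longrightarrow> inv_into {0..1} \<phi> (\<phi> t) = t"
  using time_change_bij[OF \<phi>] by (auto simp: bij_betw_def inv_into_f_f)

lemma rho_open: "0 < t \<Longrightarrow> t < 1 \<Longrightarrow> 0 < inv_into {0..1} \<phi> t \<and> inv_into {0..1} \<phi> t < 1"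
proof -
  assume t: "0 < t" "t < 1"
  then have r: "inv_into {0..1} \<phi> t \<in> {0..1}" "\<phi> (inv_into {0..1} \<phi> t) = t" using rho[of t] by auto
  then have "inv_into {0..1} \<phi> t \<noteq> 0" "inv_into {0..1} \<phi> t \<noteq> 1" using t time_changeD(2,3)[OF \<phi>] by auto
  then show ?thesis using r(1) by auto
qed

lemma rescale_deriv:
  assumes "i \<in> {1..n}" "t \<in> {0..1}"
  shows "(curve (rescale \<phi> d) i has_real_derivative slope d i (\<phi> t) * \<phi>' t) (at t within {0..1})"
proof -
  have "(curve d i has_real_derivative slope d i (\<phi> t)) (at (\<phi> t) within \<phi> ` {0..1})"
    using slope_deriv[OF is_diagramD(1)[OF d assms(1)] phi_in[OF assms(2)]] time_change_bij[OF \<phi>]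
    by (simp add: bij_betw_def)
  from DERIV_image_chain[OF this time_changeD(5)[OF \<phi> assms(2)]]
  show ?thesis by (simp add: comp_def rescale_def)
qed

lemma rescale_slope:
  "i \<in> {1..n} \<Longrightarrow> t \<in> {0..1} \<Longrightarrow> slope (rescale \<phi> d) i t = slope d i (\<phi> t) * \<phi>' t"
  by (rule slope_eqI[OF rescale_deriv])

lemma rescale_is_diagram: "is_diagram n (rescale \<phi> d)"
  unfolding is_diagram_def
proof (intro conjI ballI impI; (intro conjI)?)
  fix i assume i: "i \<in> {1..n}"
  have "continuous_on {0..1} (\<lambda>t. slope d i (\<phi> t) * \<phi>' t)"
    by (intro continuous_on_mult time_changeD(4)[OF \<phi>]
        continuous_on_compose2[OF is_diagramD(2)[OF d i] time_change_continuous[OF \<phi>]]) (use phi_in in auto)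
  then show "curve (rescale \<phi> d) i differentiable_on {0..1}" "continuous_on {0..1} (slope (rescale \<phi> d) i)"
    using smoothI[OF rescale_deriv[OF i]] by blast+
next
  fix t :: real assume t: "t \<in> {0, 1}"
  then have "\<phi> t \<in> {0, 1}" using time_changeD(2,3)[OF \<phi>] by auto
  then show "inj_on (\<lambda>i. curve (rescale \<phi> d) i t) {1..n}" using is_diagramD(3)[OF d, of "\<phi> t"] by simp
next
  fix t :: real and i j k
  assume *: "t \<in> {0..1}" "i \<in> {1..n}" "j \<in> {1..n}" "k \<in> {1..n}" "i \<noteq> j" "j \<noteq> k" "i \<noteq> k"
  show "\<not> (curve (rescale \<phi> d) i t = curve (rescale \<phi> d) j t \<and> curve (rescale \<phi> d) j t = curve (rescale \<phi> d) k t)"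
    using is_diagramD(4)[OF d phi_in[OF *(1)] *(2-7)] by auto
next
  fix t :: real and i j
  assume *: "t \<in> {0..1}" "i \<in> {1..n}" "j \<in> {1..n}" "i \<noteq> j" "curve (rescale \<phi> d) i t = curve (rescale \<phi> d) j t"
  have "0 < \<phi>' t" using time_changeD(6)[OF \<phi> *(1)] time_changeD(1)[OF \<phi>] by linarith
  then show "slope (rescale \<phi> d) i t \<noteq> slope (rescale \<phi> d) j t"
    using is_diagramD(5)[OF d phi_in[OF *(1)] *(2-4)] *(5) by (simp add: rescale_slope[OF *(2,1)] rescale_slope[OF *(3,1)])
next
  fix x assume "x \<in> set (squares (rescale \<phi> d))"
  then obtain i b t where x: "x = (i, b, inv_into {0..1} \<phi> t)" "(i, b, t) \<in> set (squares d)" by auto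
  note S = is_diagramD(6-8)[OF d x(2)]
  show "case x of (i, b, t) \<Rightarrow> i \<in> {1..n} \<and> t \<in> {0<..<1} \<and>
     (\<forall>j\<in>{1..n}. j \<noteq> i \<longrightarrow> curve (rescale \<phi> d) j t \<noteq> curve (rescale \<phi> d) i t)"
    using S rho_open[of t] rho[of t] by (simp add: x(1))
qed

lemma rescale_place: "place n (rescale \<phi> d) i t = place n d i (\<phi> t)"
  by (simp add: place_def)

lemma rescale_events: "events n (rescale \<phi> d) = image_mset (\<lambda>(t, g). (inv_into {0..1} \<phi> t, g)) (events n d)"
proof -
  let ?\<rho> = "inv_into {0..1} \<phi>"
  have c: "(\<lambda>(t, r). (t, GenT r)) ` crossings n (rescale \<phi> d) = (\<lambda>(t, g). (?\<rho> t, g)) ` (\<lambda>(t, r). (t, GenT r)) ` crossings n d"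
  proof -
    have "crossings n (rescale \<phi> d) = (\<lambda>(t, r). (?\<rho> t, r)) ` crossings n d"
    proof
      show "crossings n (rescale \<phi> d) \<subseteq> (\<lambda>(t, r). (?\<rho> t, r)) ` crossings n d"
      proof
        fix p assume "p \<in> crossings n (rescale \<phi> d)"
        then obtain t i j where *: "p = (t, place n (rescale \<phi> d) i t)" "t \<in> {0..1}" "i \<in> {1..n}" "j \<in> {1..n}" "i \<noteq> j"
          "curve (rescale \<phi> d) i t = curve (rescale \<phi> d) j t" unfolding crossings_def by blast
        have "(\<phi> t, place n d i (\<phi> t)) \<in> crossings n d" using * phi_in by (intro crossingsI[of _ i _ j]) auto
        then show "p \<in> (\<lambda>(t, r). (?\<rho> t, r)) ` crossings n d"
          using *(1,2) rho_phi[of t] by (auto simp: rescale_place intro!: image_eqI[of _ _ "(\<phi> t, place n d i (\<phi> t))"])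
      qed
      show "(\<lambda>(t, r). (?\<rho> t, r)) ` crossings n d \<subseteq> crossings n (rescale \<phi> d)"
      proof clarify
        fix t r assume "(t, r) \<in> crossings n d"
        then obtain i j where *: "t \<in> {0..1}" "i \<in> {1..n}" "j \<in> {1..n}" "i \<noteq> j" "curve d i t = curve d j t" "r = place n d i t"
          by (rule crossingsE)
        then show "(?\<rho> t, r) \<in> crossings n (rescale \<phi> d)"
          using crossingsI[of "?\<rho> t" i n j "rescale \<phi> d"] rho[of t] by (simp add: rescale_place)
      qed
    qed
    then show ?thesis by (simp add: image_image case_prod_beta)
  qed
  have inj: "inj_on (\<lambda>(t, g). (?\<rho> t, g)) ((\<lambda>(t, r). (t, GenT r)) ` crossings n d)"
  proof (rule inj_onI)
    fix p q assume *: "p \<in> (\<lambda>(t, r). (t, GenT r)) ` crossings n d" "q \<in> (\<lambda>(t, r). (t, GenT r)) ` crossings n d"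
      "(\<lambda>(t, g). (?\<rho> t, g)) p = (\<lambda>(t, g). (?\<rho> t, g)) q"
    then have "fst p \<in> {0..1}" "fst q \<in> {0..1}" by (auto simp: crossings_def)
    moreover have "?\<rho> (fst p) = ?\<rho> (fst q)" "snd p = snd q" using *(3) by (auto simp: case_prod_beta)
    moreover have "fst p = fst q" using rho[of "fst p"] rho[of "fst q"] calculation by metis
    ultimately show "p = q" by (simp add: prod_eq_iff)
  qed
  have sq: "image_mset (\<lambda>(i, \<epsilon>, t). (t, square_gen \<epsilon> (place n (rescale \<phi> d) i t))) (mset (squares (rescale \<phi> d)))
     = image_mset (\<lambda>(t, g). (?\<rho> t, g)) (image_mset (\<lambda>(i, \<epsilon>, t). (t, square_gen \<epsilon> (place n d i t))) (mset (squares d)))"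
    unfolding rescale_sel mset_map image_mset.compositionality
  proof (rule image_mset_cong)
    fix p assume p: "p \<in># mset (squares d)"
    obtain i b t where p1: "p = (i, b, t)" by (rule prod_cases3)
    have "t \<in> {0..1}" using is_diagramD(7)[OF d, of i b t] p p1 by auto
    then show "((\<lambda>(i, \<epsilon>, t). (t, square_gen \<epsilon> (place n (rescale \<phi> d) i t))) \<circ> (\<lambda>(i, \<epsilon>, t). (i, \<epsilon>, ?\<rho> t))) p =
        ((\<lambda>(t, g). (?\<rho> t, g)) \<circ> (\<lambda>(i, \<epsilon>, t). (t, square_gen \<epsilon> (place n d i t)))) p"
      using rho[of t] by (simp add: p1 rescale_place)
  qed
  show ?thesis
    unfolding events_def sq c image_mset_union image_mset_mset_set[OF inj] ..
qed

end

text \<open>The time changes form a convex set that contains the identity.\<close>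

lemma rescale_isotopic:
  assumes d: "is_diagram n d" and \<phi>: "time_change \<phi> \<phi>' c"
  shows "isotopic n d (rescale \<phi> d)"
proof -
  define \<Phi> where "\<Phi> s t = (1 - s) * t + s * \<phi> t" for s t
  define \<Phi>' where "\<Phi>' s t = (1 - s) + s * \<phi>' t" for s t
  define k where "k = min 1 c"
  have k: "0 < k" using time_changeD(1)[OF \<phi>] by (simp add: k_def)
  have tc: "time_change (\<Phi> s) (\<Phi>' s) k" if s: "s \<in> {0..1}" for s
    unfolding time_change_def
  proof (intro conjI ballI)
    show "\<Phi> s 0 = 0" "\<Phi> s 1 = 1" using time_changeD(2,3)[OF \<phi>] by (auto simp: \<Phi>_def)
    show "continuous_on {0..1} (\<Phi>' s)" unfolding \<Phi>'_def[abs_def]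
      using time_changeD(4)[OF \<phi>] by (intro continuous_intros)
    fix t :: real assume t: "t \<in> {0..1}"
    show "(\<Phi> s has_real_derivative \<Phi>' s t) (at t within {0..1})"
      unfolding \<Phi>_def[abs_def] \<Phi>'_def using time_changeD(5)[OF \<phi> t] by (auto intro!: derivative_eq_intros)
    have "(1 - s) * k + s * k \<le> (1 - s) * 1 + s * \<phi>' t"
      using s time_changeD(6)[OF \<phi> t] by (intro add_mono mult_left_mono) (auto simp: k_def)
    then show "k \<le> \<Phi>' s t" by (simp add: \<Phi>'_def algebra_simps)
  qed (rule k)
  let ?H = "\<lambda>s. rescale (\<Phi> s) d"
  let ?K = "{0..1::real} \<times> {0..1::real}"
  have c\<Phi>: "continuous_on ?K (\<lambda>p. \<Phi> (fst p) (snd p))" and c\<Phi>': "continuous_on ?K (\<lambda>p. \<Phi>' (fst p) (snd p))"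
    unfolding \<Phi>_def \<Phi>'_def
    by (intro continuous_intros continuous_on_compose2[OF time_change_continuous[OF \<phi>] continuous_on_snd[OF continuous_on_id]]
        continuous_on_compose2[OF time_changeD(4)[OF \<phi>] continuous_on_snd[OF continuous_on_id]]; auto)+
  have \<Phi>in: "\<Phi> s t \<in> {0..1}" if "s \<in> {0..1}" "t \<in> {0..1}" for s t using phi_in[OF d tc[OF that(1)] that(2)] .
  have \<Phi>img: "(\<lambda>p. \<Phi> (fst p) (snd p)) ` ?K \<subseteq> {0..1}" using \<Phi>in by auto
  have "isotopy n ?H"
  proof (rule isotopyI)
    show "is_diagram n (?H s)" if "s \<in> {0..1}" for s by (rule rescale_is_diagram[OF d tc[OF that]])
  next
    fix i assume i: "i \<in> {1..n}"
    show "continuous_on ?K (\<lambda>(s, t). curve (?H s) i t)"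
      using continuous_on_compose2[OF curve_continuous[OF d i] c\<Phi> \<Phi>img] by (simp add: case_prod_beta)
    have "continuous_on ?K (\<lambda>p. slope d i (\<Phi> (fst p) (snd p)) * \<Phi>' (fst p) (snd p))"
      by (intro continuous_on_mult c\<Phi>' continuous_on_compose2[OF is_diagramD(2)[OF d i] c\<Phi> \<Phi>img])
    then show "continuous_on ?K (\<lambda>(s, t). slope (?H s) i t)"
      by (rule continuous_on_eq) (auto simp: rescale_slope[OF d tc i])
  next
    show "map (\<lambda>(i, \<epsilon>, t). (i, \<epsilon>)) (squares (?H s)) = map (\<lambda>(i, \<epsilon>, t). (i, \<epsilon>)) (squares (?H 0))" for s
      by (simp add: case_prod_beta comp_def)
  next
    fix m assume m: "m < length (squares (?H 0))"
    obtain i b h where sq: "squares d ! m = (i, b, h)" by (rule prod_cases3)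
    have mem: "(i, b, h) \<in> set (squares d)" using nth_mem[of m "squares d"] m sq by simp
    have h: "h \<in> {0..1}" using is_diagramD(7)[OF d mem] by simp
    let ?r = "\<lambda>s. inv_into {0..1} (\<Phi> s) h"
    have r: "?r s \<in> {0..1}" "\<Phi> s (?r s) = h" if "s \<in> {0..1}" for s using rho[OF d tc[OF that] h] by auto
    have lip: "k * \<bar>?r s - ?r s'\<bar> \<le> \<bar>s - s'\<bar>" if s: "s \<in> {0..1}" "s' \<in> {0..1}" for s s'
    proof -
      have exp: "k * \<bar>?r s - ?r s'\<bar> \<le> \<bar>\<Phi> s (?r s) - \<Phi> s (?r s')\<bar>"
        using time_change_expands[OF tc[OF s(1)] r(1)[OF s(1)] r(1)[OF s(2)]]
          time_change_expands[OF tc[OF s(1)] r(1)[OF s(2)] r(1)[OF s(1)]] by (cases "?r s \<le> ?r s'") auto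
      have "\<Phi> s (?r s) - \<Phi> s (?r s') = \<Phi> s' (?r s') - \<Phi> s (?r s')" using r s by simp
      also have "\<dots> = (s' - s) * (\<phi> (?r s') - ?r s')" by (simp add: \<Phi>_def algebra_simps)
      finally have "\<bar>\<Phi> s (?r s) - \<Phi> s (?r s')\<bar> = \<bar>s' - s\<bar> * \<bar>\<phi> (?r s') - ?r s'\<bar>" by (simp add: abs_mult)
      also have "\<dots> \<le> \<bar>s' - s\<bar> * 1"
        using phi_in[OF d \<phi> r(1)[OF s(2)]] r(1)[OF s(2)] by (intro mult_left_mono) auto
      finally show ?thesis using exp by simp
    qed
    have "continuous_on {0..1} ?r"
      unfolding continuous_on_iff
    proof (intro ballI allI impI)
      fix s e :: real assume s: "s \<in> {0..1}" and e: "0 < e"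
      have "dist (?r s') (?r s) < e" if "s' \<in> {0..1}" "dist s' s < k * e" for s'
      proof -
        have "k * \<bar>?r s' - ?r s\<bar> < k * e" using lip[OF that(1) s] that(2) by (simp add: dist_real_def)
        then show ?thesis using k by (simp add: dist_real_def)
      qed
      then show "\<exists>b>0. \<forall>s'\<in>{0..1}. dist s' s < b \<longrightarrow> dist (?r s') (?r s) < e" using k e by (intro exI[of _ "k * e"]) auto
    qed
    then show "continuous_on {0..1} (\<lambda>s. snd (snd (squares (?H s) ! m)))" using m sq by simp
  qed
  moreover have "same_picture n d (?H 0)"
  proof (rule agree_same_picture)
    have t0: "inv_into {0..1} (\<Phi> 0) t = t" if "t \<in> {0..1}" for t using rho_phi[OF d tc[of 0] that] by (simp add: \<Phi>_def)
    have "map (\<lambda>(i, \<epsilon>, t). (i, \<epsilon>, inv_into {0..1} (\<Phi> 0) t)) (squares d) = squares d"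
    proof (rule map_idI)
      fix p assume p: "p \<in> set (squares d)"
      obtain i b t where p1: "p = (i, b, t)" by (rule prod_cases3)
      have "t \<in> {0..1}" using is_diagramD(7)[OF d, of i b t] p p1 by auto
      then show "(\<lambda>(i, \<epsilon>, t). (i, \<epsilon>, inv_into {0..1} (\<Phi> 0) t)) p = p" using t0 p1 by simp
    qed
    then show "agree n d (?H 0)" by (simp add: agree_def \<Phi>_def)
  qed
  moreover have "\<Phi> 1 = \<phi>" by (simp add: \<Phi>_def fun_eq_iff)
  then have "?H 1 = rescale \<phi> d" by simp
  ultimately show ?thesis
    unfolding isotopic_def using d rescale_is_diagram[OF d \<phi>] same_picture_refl by (metis (no_types, lifting))
qed

lemma event_heights: 
  assumes d: "is_diagram n d" and e: "(t, g) \<in># events n d" shows "0 < t \<and> t < 1"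
  using e unfolding finite_events_set[OF d]
proof
  assume "(t, g) \<in> (\<lambda>(t, r). (t, GenT r)) ` crossings n d"
  then obtain r where "(t, r) \<in> crossings n d" by auto
  then obtain i j where ij: "t \<in> {0..1}" "i \<in> {1..n}" "j \<in> {1..n}" "i \<noteq> j" "curve d i t = curve d j t" by (rule crossingsE)
  then have "t \<notin> {0, 1}" using inj_onD[OF is_diagramD(3)[OF d, of t], of i j] by auto
  then show ?thesis using ij(1) by auto
next
  assume "(t, g) \<in> (\<lambda>(i, \<epsilon>, t). (t, square_gen \<epsilon> (place n d i t))) ` set (squares d)"
  then show ?thesis using is_diagramD(7)[OF d] by auto
qed

text \<open>A time change that interpolates the correspondence of heights makes the events
  equal.\<close>

theorem same_order_isotopic:
  assumes d: "is_diagram n d" and e: "is_diagram n e"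
    and es: "mset es = events n d" and es': "mset es' = events n e" and so: "same_order es es'"
  shows "isotopic n d e"
proof -
  have len: "length es' = length es" using so unfolding same_order_def by (metis length_map)
  let ?L = "length es"
  have less: "fst (es ! k) < fst (es ! l) \<longleftrightarrow> fst (es' ! k) < fst (es' ! l)" if "k < ?L" "l < ?L" for k l
    using so that by (simp add: same_order_def)
  have eq: "fst (es ! k) = fst (es ! l)" if "k < ?L" "l < ?L" "fst (es' ! k) = fst (es' ! l)" for k l
    using less[of k l] less[of l k] that by linarith
  let ?T = "fst ` set es'"
  \<comment> \<open>well-defined, since events of equal height in \<open>es'\<close> have equal heights in \<open>es\<close>\<close>
  define g where "g t = fst (es ! (SOME k. k < ?L \<and> fst (es' ! k) = t))" for t
  have g: "g (fst (es' ! k)) = fst (es ! k)" if k: "k < ?L" for k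
    unfolding g_def
  proof (rule someI2[of _ k])
    fix l assume "l < ?L \<and> fst (es' ! l) = fst (es' ! k)"
    then show "fst (es ! l) = fst (es ! k)" using eq[of l k] k by blast
  qed (use k in blast)
  have T: "\<exists>k<?L. t = fst (es' ! k)" if t: "t \<in> ?T" for t
  proof -
    obtain p where "p \<in> set es'" "t = fst p" using t by blast
    then show ?thesis using len by (metis in_set_conv_nth)
  qed
  have h: "0 < fst p \<and> fst p < 1" if "p \<in> set es" for p
    using event_heights[OF d, of "fst p" "snd p"] that es by (metis prod.collapse set_mset_mset)
  have h': "0 < fst p \<and> fst p < 1" if "p \<in> set es'" for p
    using event_heights[OF e, of "fst p" "snd p"] that es' by (metis prod.collapse set_mset_mset)
  have "\<exists>\<phi> \<phi>' c. time_change \<phi> \<phi>' c \<and> (\<forall>t\<in>?T. \<phi> t = g t)"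
  proof (rule time_change_exists)
    show "?T \<subseteq> {0<..<1}" using h' by auto
    show "g ` ?T \<subseteq> {0<..<1}"
    proof
      fix y assume "y \<in> g ` ?T"
      then obtain t where t: "y = g t" "t \<in> ?T" by (rule imageE)
      obtain k where k: "k < ?L" "t = fst (es' ! k)" using T[OF t(2)] by blast
      have "y = fst (es ! k)" unfolding t(1) k(2) by (rule g[OF k(1)])
      then show "y \<in> {0<..<1}" using h[of "es ! k"] k(1) by simp
    qed
    show "g x < g y" if xy: "x \<in> ?T" "y \<in> ?T" "x < y" for x y
    proof -
      obtain k l where kl: "k < ?L" "x = fst (es' ! k)" "l < ?L" "y = fst (es' ! l)"
        using T[OF xy(1)] T[OF xy(2)] by blast
      then show ?thesis using less[OF kl(1,3)] xy(3) g[OF kl(1)] g[OF kl(3)] by simp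
    qed
  qed simp
  then obtain \<phi> \<phi>' c where \<phi>: "time_change \<phi> \<phi>' c" "\<And>t. t \<in> ?T \<Longrightarrow> \<phi> t = g t" by blast
  let ?\<rho> = "inv_into {0..1} \<phi>"
  have "map (\<lambda>(t, g). (?\<rho> t, g)) es = es'"
  proof (rule nth_equalityI)
    fix k assume "k < length (map (\<lambda>(t, g). (?\<rho> t, g)) es)"
    then have k: "k < ?L" by simp
    have mem: "es' ! k \<in> set es'" using k len by simp
    have "\<phi> (fst (es' ! k)) = fst (es ! k)" using \<phi>(2)[of "fst (es' ! k)"] g[OF k] mem by simp
    moreover have "fst (es' ! k) \<in> {0..1}" using h'[OF mem] by auto
    ultimately have "?\<rho> (fst (es ! k)) = fst (es' ! k)" using rho_phi[OF d \<phi>(1)] by metis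
    moreover have "snd (es ! k) = snd (es' ! k)" using so k len unfolding same_order_def by (metis nth_map)
    ultimately show "map (\<lambda>(t, g). (?\<rho> t, g)) es ! k = es' ! k" using k by (simp add: case_prod_beta prod_eq_iff)
  qed (simp add: len)
  then have "events n (rescale \<phi> d) = events n e"
    unfolding rescale_events[OF d \<phi>(1)] es[symmetric] es'[symmetric] by (metis mset_map)
  then have "isotopic n (rescale \<phi> d) e" by (rule same_events_isotopic[OF rescale_is_diagram[OF d \<phi>(1)] e])
  then show ?thesis using rescale_isotopic[OF d \<phi>(1)] isotopic_trans by blast
qed

section \<open>Stacking\<close>

lemma DERIV_glue:
  fixes f g h :: "real \<Rightarrow> real"
  assumes A: "closed A" "\<And>x. x \<in> A \<Longrightarrow> f x = g x" "t \<in> A \<Longrightarrow> (g has_real_derivative D) (at t within A)"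
    and B: "closed B" "\<And>x. x \<in> B \<Longrightarrow> f x = h x" "t \<in> B \<Longrightarrow> (h has_real_derivative D) (at t within B)"
  shows "(f has_real_derivative D) (at t within A \<union> B)"
proof -
  have *: "(f has_real_derivative D) (at t within C)"
    if C: "closed C" "\<And>x. x \<in> C \<Longrightarrow> f x = k x" "t \<in> C \<Longrightarrow> (k has_real_derivative D) (at t within C)" for C k
  proof (cases "t \<in> C")
    case True
    show ?thesis
      by (rule has_field_derivative_transform_within[OF C(3)[OF True] zero_less_one True]) (simp add: C(2))
  next
    case False
    then have "at t within C = bot"
      using C(1) by (metis closed_limpt trivial_limit_within)
    then show ?thesis by (simp add: has_field_derivative_iff)
  qed
  show ?thesis
    using *[OF A] *[OF B] by (simp add: has_field_derivative_iff Lim_within_Un)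
qed

lemma stack_place:
  assumes "is_stack n a b d" "i \<in> {1..n}" "t \<in> {0..1}"
  shows "place n d i (t / 2) = place n b i t" "place n d i ((1 + t) / 2) = place n a i t"
  using assms by (auto simp: is_stack_def intro!: place_eqI)

lemma stack_crossings:
  assumes st: "is_stack n a b d"
  shows "crossings n d = (\<lambda>(t, r). (t / 2, r)) ` crossings n b \<union> (\<lambda>(t, r). ((1 + t) / 2, r)) ` crossings n a"
proof -
  have cb: "curve d i (t / 2) = curve b i t" and ca: "curve d i ((1 + t) / 2) = curve a i t"
    if "i \<in> {1..n}" "t \<in> {0..1}" for i t
    using st that by (auto simp: is_stack_def)
  show ?thesis
  proof
    show "crossings n d \<subseteq> (\<lambda>(t, r). (t / 2, r)) ` crossings n b \<union> (\<lambda>(t, r). ((1 + t) / 2, r)) ` crossings n a"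
    proof
      fix p assume "p \<in> crossings n d"
      then obtain t i j where p: "p = (t, place n d i t)" and t: "t \<in> {0..1}" and ij: "i \<in> {1..n}" "j \<in> {1..n}" "i \<noteq> j"
        and eq: "curve d i t = curve d j t" unfolding crossings_def by blast
      show "p \<in> (\<lambda>(t, r). (t / 2, r)) ` crossings n b \<union> (\<lambda>(t, r). ((1 + t) / 2, r)) ` crossings n a"
      proof (cases "t \<le> 1/2")
        case True
        then have u: "2 * t \<in> {0..1}" using t by auto
        have "(2 * t, place n b i (2 * t)) \<in> crossings n b"
          using cb[OF ij(1) u] cb[OF ij(2) u] eq by (intro crossingsI[OF u ij]) simp
        moreover have "p = (2 * t / 2, place n b i (2 * t))" using stack_place(1)[OF st ij(1) u] p by simp
        ultimately show ?thesis by (intro UnI1 image_eqI[of _ _ "(2 * t, place n b i (2 * t))"]) auto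
      next
        case False
        then have u: "2 * t - 1 \<in> {0..1}" using t by auto
        have e: "(1 + (2 * t - 1)) / 2 = t" by simp
        have "(2 * t - 1, place n a i (2 * t - 1)) \<in> crossings n a"
          using ca[OF ij(1) u] ca[OF ij(2) u] eq unfolding e by (intro crossingsI[OF u ij]) simp
        moreover have "p = (t, place n a i (2 * t - 1))" using stack_place(2)[OF st ij(1) u] p unfolding e by simp
        ultimately show ?thesis by (intro UnI2 image_eqI[of _ _ "(2 * t - 1, place n a i (2 * t - 1))"]) auto
      qed
    qed
    show "(\<lambda>(t, r). (t / 2, r)) ` crossings n b \<union> (\<lambda>(t, r). ((1 + t) / 2, r)) ` crossings n a \<subseteq> crossings n d"
    proof (intro Un_least image_subsetI)
      fix p assume "p \<in> crossings n b"
      then obtain t i j where *: "p = (t, place n b i t)" "t \<in> {0..1}" "i \<in> {1..n}" "j \<in> {1..n}" "i \<noteq> j" "curve b i t = curve b j t"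
        unfolding crossings_def by blast
      then show "(case p of (t, r) \<Rightarrow> (t / 2, r)) \<in> crossings n d"
        using crossingsI[of "t / 2" i n j d] cb stack_place(1)[OF st *(3,2)] by simp
    next
      fix p assume "p \<in> crossings n a"
      then obtain t i j where *: "p = (t, place n a i t)" "t \<in> {0..1}" "i \<in> {1..n}" "j \<in> {1..n}" "i \<noteq> j" "curve a i t = curve a j t"
        unfolding crossings_def by blast
      then show "(case p of (t, r) \<Rightarrow> ((1 + t) / 2, r)) \<in> crossings n d"
        using crossingsI[of "(1 + t) / 2" i n j d] ca stack_place(2)[OF st *(3,2)] by simp
    qed
  qed
qed

theorem stack_events:
  assumes st: "is_stack n a b d"
  shows "events n d = image_mset (\<lambda>(t, g). (t / 2, g)) (events n b) + image_mset (\<lambda>(t, g). ((1 + t) / 2, g)) (events n a)"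
proof -
  have a: "is_diagram n a" and b: "is_diagram n b"
    and sq: "mset (squares d) = image_mset (\<lambda>(i, \<epsilon>, t). (i, \<epsilon>, t / 2)) (mset (squares b)) +
       image_mset (\<lambda>(i, \<epsilon>, t). (i, \<epsilon>, (1 + t) / 2)) (mset (squares a))"
    using st by (auto simp: is_stack_def)
  let ?C = "\<lambda>f. (\<lambda>(t, r). (t, GenT r)) ` crossings n f"
  let ?lo = "\<lambda>(t, g). (t / 2, g) :: real \<times> hecke_gen" and ?hi = "\<lambda>(t, g). ((1 + t) / 2, g) :: real \<times> hecke_gen"
  have C: "?C d = ?lo ` ?C b \<union> ?hi ` ?C a"
    unfolding stack_crossings[OF st] by (auto simp: image_Un image_image case_prod_beta)
  have fin: "finite (?C a)" "finite (?C b)" using finite_crossings[OF a] finite_crossings[OF b] by auto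
  have h: "0 < fst p \<and> fst p < 1" if "p \<in> ?C f" "is_diagram n f" for p f
    using event_heights[OF that(2), of "fst p" "snd p"] that(1) unfolding finite_events_set[OF that(2)] by auto
  have disj: "?lo ` ?C b \<inter> ?hi ` ?C a = {}"
  proof (rule equals0I)
    fix x assume "x \<in> ?lo ` ?C b \<inter> ?hi ` ?C a"
    then obtain p q where "p \<in> ?C b" "q \<in> ?C a" "x = ?lo p" "x = ?hi q" by blast
    then show False using h[of p b] h[of q a] a b by (auto simp: case_prod_beta)
  qed
  have inj: "inj_on ?lo X" "inj_on ?hi X" for X by (auto simp: inj_on_def)
  have c: "mset_set (?C d) = image_mset ?lo (mset_set (?C b)) + image_mset ?hi (mset_set (?C a))"
    unfolding C using fin disj by (simp add: mset_set_Union image_mset_mset_set[OF inj(1)] image_mset_mset_set[OF inj(2)])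
  have s: "image_mset (\<lambda>(i, \<epsilon>, t). (t, square_gen \<epsilon> (place n d i t))) (mset (squares d)) =
    image_mset ?lo (image_mset (\<lambda>(i, \<epsilon>, t). (t, square_gen \<epsilon> (place n b i t))) (mset (squares b))) +
    image_mset ?hi (image_mset (\<lambda>(i, \<epsilon>, t). (t, square_gen \<epsilon> (place n a i t))) (mset (squares a)))"
    unfolding sq image_mset_union image_mset.compositionality
  proof (intro arg_cong2[where f = "(+)"] image_mset_cong)
    fix p assume p: "p \<in># mset (squares b)"
    obtain i e t where p1: "p = (i, e, t)" by (rule prod_cases3)
    have "i \<in> {1..n}" "t \<in> {0..1}" using is_diagramD(6,7)[OF b, of i e t] p p1 by auto
    then show "((\<lambda>(i, \<epsilon>, t). (t, square_gen \<epsilon> (place n d i t))) \<circ> (\<lambda>(i, \<epsilon>, t). (i, \<epsilon>, t / 2))) p =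
        (?lo \<circ> (\<lambda>(i, \<epsilon>, t). (t, square_gen \<epsilon> (place n b i t)))) p"
      using stack_place(1)[OF st] by (simp add: p1)
  next
    fix p assume p: "p \<in># mset (squares a)"
    obtain i e t where p1: "p = (i, e, t)" by (rule prod_cases3)
    have "i \<in> {1..n}" "t \<in> {0..1}" using is_diagramD(6,7)[OF a, of i e t] p p1 by auto
    then show "((\<lambda>(i, \<epsilon>, t). (t, square_gen \<epsilon> (place n d i t))) \<circ> (\<lambda>(i, \<epsilon>, t). (i, \<epsilon>, (1 + t) / 2))) p =
        (?hi \<circ> (\<lambda>(i, \<epsilon>, t). (t, square_gen \<epsilon> (place n a i t)))) p"
      using stack_place(2)[OF st] by (simp add: p1)
  qed
  show ?thesis unfolding events_def c s image_mset_union by (simp add: add_ac)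
qed

text \<open>The events of the upper diagram are read first.\<close>

lemma stack_reads:
  assumes st: "is_stack n a b d" and v: "reads n a v" and w: "reads n b w"
  shows "reads n d (v @ w)"
proof -
  have D: "is_diagram n a" "is_diagram n b" "is_diagram n d" using st by (auto simp: is_stack_def)
  obtain es where es: "descending es" "mset es = events n a" "map snd es = v"
    using v by (auto simp: reads_def reads_events_def)
  obtain fs where fs: "descending fs" "mset fs = events n b" "map snd fs = w"
    using w by (auto simp: reads_def reads_events_def)
  let ?es = "map (\<lambda>(t, g). ((1 + t) / 2, g)) es" and ?fs = "map (\<lambda>(t, g). (t / 2, g)) fs"
  have h: "0 < fst p \<and> fst p < 1" if "p \<in># events n f" "is_diagram n f" for p f
    using event_heights[OF that(2), of "fst p" "snd p"] that(1) by simp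
  have "descending (?es @ ?fs)"
    unfolding descending_def sorted_wrt_append sorted_wrt_map
  proof (intro conjI ballI)
    show "sorted_wrt (\<lambda>x y. fst (case y of (t, g) \<Rightarrow> ((1 + t) / 2, g)) \<le> fst (case x of (t, g) \<Rightarrow> ((1 + t) / 2, g))) es"
      using es(1) unfolding descending_def by (rule sorted_wrt_mono_rel[rotated]) (auto simp: case_prod_beta)
    show "sorted_wrt (\<lambda>x y. fst (case y of (t, g) \<Rightarrow> (t / 2, g)) \<le> fst (case x of (t, g) \<Rightarrow> (t / 2, g))) fs"
      using fs(1) unfolding descending_def by (rule sorted_wrt_mono_rel[rotated]) (auto simp: case_prod_beta)
    fix x y assume "x \<in> set ?es" "y \<in> set ?fs"
    then obtain p q where pq: "p \<in> set es" "q \<in> set fs" "x = (\<lambda>(t, g). ((1 + t) / 2, g)) p" "y = (\<lambda>(t, g). (t / 2, g)) q" by auto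
    have "p \<in># events n a" "q \<in># events n b" using pq es(2) fs(2) by (metis set_mset_mset)+
    then show "fst y \<le> fst x" using h[of p a] h[of q b] D pq by (auto simp: case_prod_beta)
  qed
  moreover have "mset (?es @ ?fs) = events n d"
    unfolding stack_events[OF st] es(2)[symmetric] fs(2)[symmetric] by (simp add: add.commute)
  moreover have "map snd (?es @ ?fs) = v @ w"
    using es(3) fs(3) by (simp add: comp_def case_prod_beta)
  ultimately show ?thesis using D(3) unfolding reads_def reads_events_def by blast
qed

subsection \<open>Flat diagrams\<close>

text \<open>Flat diagrams can always be stacked: the ends match, and the curves remain \<open>C\<^sup>1\<close> because all slopes at the ends
  vanish. The curves are numbered by their lower ends.\<close>

definition flat :: "nat \<Rightarrow> diagram \<Rightarrow> bool" where
  "flat n d \<longleftrightarrow> is_diagram n d \<and> (\<forall>i\<in>{1..n}. curve d i 0 = real i \<and> slope d i 0 = 0 \<and> slope d i 1 = 0 \<and>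
     (\<exists>m\<in>{1..n}. curve d i 1 = real m))"

definition top_end :: "nat \<Rightarrow> diagram \<Rightarrow> nat \<Rightarrow> nat" where
  "top_end n d i = (if i \<in> {1..n} then nat \<lfloor>curve d i 1\<rfloor> else i)"

lemma flatD:
  assumes "flat n d"
  shows "is_diagram n d" "\<And>i. i \<in> {1..n} \<Longrightarrow> curve d i 0 = real i" "\<And>i. i \<in> {1..n} \<Longrightarrow> slope d i 0 = 0"
    "\<And>i. i \<in> {1..n} \<Longrightarrow> slope d i 1 = 0" "\<And>i. i \<in> {1..n} \<Longrightarrow> curve d i 1 = real (top_end n d i)"
    "\<And>i. i \<in> {1..n} \<Longrightarrow> top_end n d i \<in> {1..n}"
proof -
  note F = assms[unfolded flat_def]
  show "is_diagram n d" using F by blast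
  fix i assume i: "i \<in> {1..n}"
  note Fi = F[THEN conjunct2, rule_format, OF i]
  show "curve d i 0 = real i" "slope d i 0 = 0" "slope d i 1 = 0" using Fi by blast+
  obtain m where m: "m \<in> {1..n}" "curve d i 1 = real m" using Fi by blast
  then have "top_end n d i = m" using i by (simp add: top_end_def)
  then show "curve d i 1 = real (top_end n d i)" "top_end n d i \<in> {1..n}" using m by simp_all
qed

lemma top_end_permutes: assumes d: "flat n d" shows "top_end n d permutes {1..n}"
proof (rule bij_imp_permutes)
  have "inj_on (top_end n d) {1..n}"
    using inj_onD[OF is_diagramD(3)[OF flatD(1)[OF d], of 1]] flatD(5)[OF d] by (intro inj_onI) simp
  then show "bij_betw (top_end n d) {1..n} {1..n}"
    using flatD(6)[OF d] by (intro bij_betw_imageI endo_inj_surj) auto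
qed (auto simp: top_end_def)

definition pile :: "nat \<Rightarrow> diagram \<Rightarrow> diagram \<Rightarrow> diagram" where
  "pile n a b = \<lparr> curve = (\<lambda>i t. if t \<le> 1/2 then curve b i (2 * t) else curve a (top_end n b i) (2 * t - 1)),
     squares = map (\<lambda>(i, \<epsilon>, t). (i, \<epsilon>, t / 2)) (squares b) @
       map (\<lambda>(i, \<epsilon>, t). (inv_into UNIV (top_end n b) i, \<epsilon>, (1 + t) / 2)) (squares a) \<rparr>"

lemma pile_sel:
  "curve (pile n a b) i t = (if t \<le> 1/2 then curve b i (2 * t) else curve a (top_end n b i) (2 * t - 1))"
  "squares (pile n a b) = map (\<lambda>(i, \<epsilon>, t). (i, \<epsilon>, t / 2)) (squares b) @
       map (\<lambda>(i, \<epsilon>, t). (inv_into UNIV (top_end n b) i, \<epsilon>, (1 + t) / 2)) (squares a)"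
  by (simp_all add: pile_def)

lemma pile_upper:
  assumes a: "flat n a" and b: "flat n b" and i: "i \<in> {1..n}" and t: "1/2 \<le> t"
  shows "curve (pile n a b) i t = curve a (top_end n b i) (2 * t - 1)"
proof (cases "t = 1/2")
  case True
  then have e: "2 * t = 1" "2 * t - 1 = 0" by simp_all
  show ?thesis using flatD(5)[OF b i] flatD(2)[OF a flatD(6)[OF b i]] True unfolding pile_sel e by simp
qed (use t in \<open>simp add: pile_sel\<close>)

lemma pile_deriv:
  assumes a: "flat n a" and b: "flat n b" and i: "i \<in> {1..n}" and t: "t \<in> {0..1}"
  shows "(curve (pile n a b) i has_real_derivative
    (if t \<le> 1/2 then 2 * slope b i (2 * t) else 2 * slope a (top_end n b i) (2 * t - 1))) (at t within {0..1})"
proof -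
  let ?j = "top_end n b i"
  let ?D = "if t \<le> 1/2 then 2 * slope b i (2 * t) else 2 * slope a ?j (2 * t - 1)"
  have j: "?j \<in> {1..n}" by (rule flatD(6)[OF b i])
  have split: "{0..1::real} = {0..1/2} \<union> {1/2..1}" by auto
  have lo: "((\<lambda>t. curve b i (2 * t)) has_real_derivative 2 * slope b i (2 * t)) (at t within {0..1/2})" if "t \<in> {0..1/2}"
  proof -
    have m: "((\<lambda>t. 2 * t) has_real_derivative 2) (at t within {0..1/2})" by (auto intro!: derivative_eq_intros)
    have "(curve b i has_real_derivative slope b i (2 * t)) (at (2 * t) within {0..1})"
      by (rule slope_deriv[OF is_diagramD(1)[OF flatD(1)[OF b] i]]) (use that in auto)
    then have "(curve b i has_real_derivative slope b i (2 * t)) (at (2 * t) within (\<lambda>t. 2 * t) ` {0..1/2})"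
      by (rule DERIV_subset) auto
    from DERIV_image_chain[OF this m] show ?thesis by (simp add: comp_def mult.commute)
  qed
  have hi: "((\<lambda>t. curve a ?j (2 * t - 1)) has_real_derivative 2 * slope a ?j (2 * t - 1)) (at t within {1/2..1})" if "t \<in> {1/2..1}"
  proof -
    have m: "((\<lambda>t. 2 * t - 1) has_real_derivative 2) (at t within {1/2..1})" by (auto intro!: derivative_eq_intros)
    have "(curve a ?j has_real_derivative slope a ?j (2 * t - 1)) (at (2 * t - 1) within {0..1})"
      by (rule slope_deriv[OF is_diagramD(1)[OF flatD(1)[OF a] j]]) (use that in auto)
    then have "(curve a ?j has_real_derivative slope a ?j (2 * t - 1)) (at (2 * t - 1) within (\<lambda>t. 2 * t - 1) ` {1/2..1})"
      by (rule DERIV_subset) auto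
    from DERIV_image_chain[OF this m] show ?thesis by (simp add: comp_def mult.commute)
  qed
  show ?thesis
    unfolding split
  proof (rule DERIV_glue)
    show "curve (pile n a b) i x = curve b i (2 * x)" if "x \<in> {0..1/2}" for x using that by (simp add: pile_sel)
    show "curve (pile n a b) i x = curve a ?j (2 * x - 1)" if "x \<in> {1/2..1}" for x
      using that by (intro pile_upper[OF a b i]) simp
    show "((\<lambda>t. curve b i (2 * t)) has_real_derivative ?D) (at t within {0..1/2})" if "t \<in> {0..1/2}"
      using lo[OF that] that by simp
    show "((\<lambda>t. curve a ?j (2 * t - 1)) has_real_derivative ?D) (at t within {1/2..1})" if t2: "t \<in> {1/2..1}"
    proof (cases "t = 1/2")
      case True
      then have e: "2 * t = 1" "2 * t - 1 = 0" by simp_all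
      have "?D = 2 * slope a ?j (2 * t - 1)" unfolding e using flatD(4)[OF b i] flatD(3)[OF a j] by simp
      then show ?thesis using hi[OF t2] by simp
    next
      case False
      then show ?thesis using hi[OF t2] t2 by simp
    qed
  qed auto
qed

lemma pile_slope:
  assumes "flat n a" "flat n b" "i \<in> {1..n}" "t \<in> {0..1}"
  shows "slope (pile n a b) i t = (if t \<le> 1/2 then 2 * slope b i (2 * t) else 2 * slope a (top_end n b i) (2 * t - 1))"
  by (rule slope_eqI[OF pile_deriv[OF assms] assms(4)])

text \<open>The ends have to stay fixed for the curves of a pile to be continued in the same way all
  along.\<close>

definition flat_isotopy :: "nat \<Rightarrow> (real \<Rightarrow> diagram) \<Rightarrow> bool" where
  "flat_isotopy n H \<longleftrightarrow> isotopy n H \<and> (\<forall>s\<in>{0..1}. flat n (H s) \<and> top_end n (H s) = top_end n (H 0))"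

lemma halves_continuous:
  fixes f g :: "real \<times> real \<Rightarrow> real"
  assumes f: "continuous_on ({0..1} \<times> {0..1}) f" and g: "continuous_on ({0..1} \<times> {0..1}) g"
    and eq: "\<And>s. s \<in> {0..1} \<Longrightarrow> f (s, 1) = g (s, 0)"
  shows "continuous_on ({0..1} \<times> {0..1}) (\<lambda>(s, t). if t \<le> 1/2 then f (s, 2 * t) else g (s, 2 * t - 1))"
proof -
  let ?A = "{0..1::real} \<times> {0..1/2::real}" and ?B = "{0..1::real} \<times> {1/2..1::real}"
  have AB: "{0..1::real} \<times> {0..1::real} = ?A \<union> ?B" by auto
  have 1: "continuous_on ?A (\<lambda>p. f (fst p, 2 * snd p))"
    by (rule continuous_on_compose2[OF f]) (auto intro!: continuous_intros)
  have 2: "continuous_on ?B (\<lambda>p. g (fst p, 2 * snd p - 1))"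
    by (rule continuous_on_compose2[OF g]) (auto intro!: continuous_intros)
  have "continuous_on (?A \<union> ?B) (\<lambda>p. if snd p \<le> 1/2 then f (fst p, 2 * snd p) else g (fst p, 2 * snd p - 1))"
  proof (rule continuous_on_cases[OF _ _ 1 2])
    show "closed ?A" "closed ?B" by (intro closed_Times closed_atLeastAtMost)+
    show "\<forall>p. p \<in> ?A \<and> \<not> snd p \<le> 1/2 \<or> p \<in> ?B \<and> snd p \<le> 1/2 \<longrightarrow> f (fst p, 2 * snd p) = g (fst p, 2 * snd p - 1)"
    proof (intro allI impI)
      fix p :: "real \<times> real" assume "p \<in> ?A \<and> \<not> snd p \<le> 1/2 \<or> p \<in> ?B \<and> snd p \<le> 1/2"
      then have e: "2 * snd p = 1" and s: "fst p \<in> {0..1}" by auto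
      show "f (fst p, 2 * snd p) = g (fst p, 2 * snd p - 1)" unfolding e using eq[OF s] by simp
    qed
  qed
  then show ?thesis unfolding AB[symmetric] by (simp add: case_prod_beta)
qed

lemma pile_is_diagram:
  assumes a: "flat n a" and b: "flat n b"
  shows "is_diagram n (pile n a b)"
proof -
  let ?p = "pile n a b" and ?\<tau> = "top_end n b"
  note A = is_diagramD[OF flatD(1)[OF a]] and B = is_diagramD[OF flatD(1)[OF b]]
  note \<tau> = top_end_permutes[OF b]
  have \<tau>in: "?\<tau> i \<in> {1..n}" if "i \<in> {1..n}" for i by (rule flatD(6)[OF b that])
  have \<tau>inj: "?\<tau> i = ?\<tau> j \<longleftrightarrow> i = j" for i j using permutes_inj[OF \<tau>] by (auto dest: injD)
  have up: "curve ?p i t = curve a (?\<tau> i) (2 * t - 1)" if "i \<in> {1..n}" "1/2 \<le> t" for i t by (rule pile_upper[OF a b that])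
  have lo: "curve ?p i t = curve b i (2 * t)" if "t \<le> 1/2" for i t using that by (simp add: pile_sel)
  show ?thesis
    unfolding is_diagram_def
  proof (intro conjI ballI impI; (intro conjI)?)
    fix i assume i: "i \<in> {1..n}"
    have c: "continuous_on ({0..1::real} \<times> {0..1::real}) (\<lambda>p. k * g (snd p))" if "continuous_on {0..1} g" for g :: "real \<Rightarrow> real" and k
      by (intro continuous_on_mult continuous_on_const continuous_on_compose2[OF that continuous_on_snd[OF continuous_on_id]]) auto
    have cc: "continuous_on ({0..1} \<times> {0..1}) (\<lambda>(s::real, t). if t \<le> 1/2 then 2 * slope b i (snd (s, 2 * t)) else 2 * slope a (?\<tau> i) (snd (s, 2 * t - 1)))"
      by (rule halves_continuous[OF c[OF B(2)[OF i]] c[OF A(2)[OF \<tau>in[OF i]]]])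
         (use flatD(4)[OF b i] flatD(3)[OF a \<tau>in[OF i]] in simp)
    have "continuous_on {0..1} (\<lambda>t. if t \<le> 1/2 then 2 * slope b i (2 * t) else 2 * slope a (?\<tau> i) (2 * t - 1))"
    proof -
      have "continuous_on {0..1} (\<lambda>t::real. (0::real, t))" by (intro continuous_intros)
      moreover have "(\<lambda>t::real. (0::real, t)) ` {0..1} \<subseteq> {0..1} \<times> {0..1}" by auto
      ultimately have "continuous_on {0..1} (\<lambda>t. case (0::real, t) of (s, t) \<Rightarrow>
          if t \<le> 1/2 then 2 * slope b i (snd (s, 2 * t)) else 2 * slope a (?\<tau> i) (snd (s, 2 * t - 1)))"
        by (rule continuous_on_compose2[OF cc])
      then show ?thesis by (simp only: prod.case snd_conv)
    qed
    then show "curve ?p i differentiable_on {0..1}" "continuous_on {0..1} (slope ?p i)"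
      using smoothI[OF pile_deriv[OF a b i]] by blast+
  next
    fix t :: real assume t: "t \<in> {0, 1}"
    show "inj_on (\<lambda>i. curve ?p i t) {1..n}"
    proof (rule inj_onI)
      fix i j assume ij: "i \<in> {1..n}" "j \<in> {1..n}" "curve ?p i t = curve ?p j t"
      show "i = j"
      proof (cases "t = 0")
        case True
        then show ?thesis using ij lo[of 0] inj_onD[OF B(3)[of 0], of i j] by simp
      next
        case False
        then have "t = 1" using t by simp
        then have "?\<tau> i = ?\<tau> j" using ij up[of _ 1] inj_onD[OF A(3)[of 1], of "?\<tau> i" "?\<tau> j"] \<tau>in by simp
        then show ?thesis using \<tau>inj by simp
      qed
    qed
  next
    fix t :: real and i j k
    assume t: "t \<in> {0..1}" and i: "i \<in> {1..n}" "j \<in> {1..n}" "k \<in> {1..n}" and ne: "i \<noteq> j" "j \<noteq> k" "i \<noteq> k"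
    show "\<not> (curve ?p i t = curve ?p j t \<and> curve ?p j t = curve ?p k t)"
    proof (cases "t \<le> 1/2")
      case True
      then have "2 * t \<in> {0..1}" using t by auto
      then show ?thesis using B(4)[OF _ i ne] lo[OF True] by auto
    next
      case False
      then have "2 * t - 1 \<in> {0..1}" using t by auto
      then show ?thesis using A(4)[OF _ \<tau>in[OF i(1)] \<tau>in[OF i(2)] \<tau>in[OF i(3)], of "2 * t - 1"] ne \<tau>inj up[OF i(1)] up[OF i(2)] up[OF i(3)] False by auto
    qed
  next
    fix t :: real and i j
    assume t: "t \<in> {0..1}" and i: "i \<in> {1..n}" "j \<in> {1..n}" "i \<noteq> j" and eq: "curve ?p i t = curve ?p j t"
    show "slope ?p i t \<noteq> slope ?p j t"
    proof (cases "t \<le> 1/2")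
      case True
      then have "2 * t \<in> {0..1}" using t by auto
      then show ?thesis using B(5)[OF _ i] lo[OF True] eq True pile_slope[OF a b i(1) t] pile_slope[OF a b i(2) t] by auto
    next
      case False
      then have "2 * t - 1 \<in> {0..1}" using t by auto
      then show ?thesis
        using A(5)[OF _ \<tau>in[OF i(1)] \<tau>in[OF i(2)], of "2 * t - 1"] i(3) \<tau>inj up[OF i(1)] up[OF i(2)] eq False
          pile_slope[OF a b i(1) t] pile_slope[OF a b i(2) t] by auto
    qed
  next
    fix x assume "x \<in> set (squares ?p)"
    then consider (b) i e t where "x = (i, e, t / 2)" "(i, e, t) \<in> set (squares b)"
      | (a) i e t where "x = (inv_into UNIV ?\<tau> i, e, (1 + t) / 2)" "(i, e, t) \<in> set (squares a)"
      by (auto simp: pile_sel)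
    then show "case x of (i, e, t) \<Rightarrow> i \<in> {1..n} \<and> t \<in> {0<..<1} \<and> (\<forall>j\<in>{1..n}. j \<noteq> i \<longrightarrow> curve ?p j t \<noteq> curve ?p i t)"
    proof cases
      case b
      then show ?thesis using B(6-8)[OF b(2)] lo[of "t / 2"] by auto
    next
      case a
      let ?i = "inv_into UNIV ?\<tau> i"
      note S = A(6-8)[OF a(2)]
      have i: "?i \<in> {1..n}" "?\<tau> ?i = i" using permutes_inv_in[OF \<tau> S(1)] permutes_inverses(1)[OF \<tau>] by auto
      have "curve ?p j ((1 + t) / 2) \<noteq> curve ?p ?i ((1 + t) / 2)" if j: "j \<in> {1..n}" "j \<noteq> ?i" for j
      proof -
        have "?\<tau> j \<noteq> i" using j(2) i(2) \<tau>inj by metis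
        moreover have "1/2 \<le> (1 + t) / 2" "2 * ((1 + t) / 2) - 1 = t" using S(2) by (auto simp: field_simps)
        ultimately show ?thesis using S(3)[OF \<tau>in[OF j(1)]] up[OF j(1), of "(1 + t) / 2"] up[OF i(1), of "(1 + t) / 2"] i(2) by simp
      qed
      then show ?thesis using a(1) i(1) S(2) by simp
    qed
  qed
qed

lemma pile_flat:
  assumes a: "flat n a" and b: "flat n b"
  shows "flat n (pile n a b)" "top_end n (pile n a b) = top_end n a \<circ> top_end n b"
proof -
  have ends: "curve (pile n a b) i 0 = real i" "curve (pile n a b) i 1 = real (top_end n a (top_end n b i))"
    "top_end n a (top_end n b i) \<in> {1..n}" "slope (pile n a b) i 0 = 0" "slope (pile n a b) i 1 = 0" if i: "i \<in> {1..n}" for i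
    using flatD[OF a] flatD[OF b] i pile_slope[OF a b i, of 0] pile_slope[OF a b i, of 1] by (auto simp: pile_sel)
  show "flat n (pile n a b)"
    unfolding flat_def using pile_is_diagram[OF a b] ends by blast
  show "top_end n (pile n a b) = top_end n a \<circ> top_end n b"
    by (rule ext) (use ends in \<open>auto simp: top_end_def\<close>)
qed

text \<open>The relation \<^const>\<open>is_stack\<close> wants equal numbers for matching curves,
  hence the renumbering of the upper diagram.\<close>

lemma pile_is_stack:
  assumes a: "flat n a" and b: "flat n b"
  shows "\<exists>a'. same_picture n a a' \<and> is_stack n a' b (pile n a b)"
proof (intro exI conjI)
  let ?a = "renumber (top_end n b) id a"
  show sp: "same_picture n a ?a" by (rule same_picture_renumber[OF top_end_permutes[OF b] permutes_id])
  show "is_stack n ?a b (pile n a b)"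
    unfolding is_stack_def
  proof (intro conjI ballI)
    show "is_diagram n ?a" by (rule is_diagram_same_picture[OF flatD(1)[OF a] sp])
    show "curve (pile n a b) i (t / 2) = curve b i t" if "t \<in> {0..1}" for i t using that by (simp add: pile_sel)
    fix i and t :: real assume i: "i \<in> {1..n}" and t: "t \<in> {0..1}"
    have "2 * ((1 + t) / 2) - 1 = t" by (simp add: field_simps)
    then show "curve (pile n a b) i ((1 + t) / 2) = curve ?a i t"
      using pile_upper[OF a b i, of "(1 + t) / 2"] t by simp
  next
    show "mset (squares (pile n a b)) = image_mset (\<lambda>(i, \<epsilon>, t). (i, \<epsilon>, t / 2)) (mset (squares b)) +
       image_mset (\<lambda>(i, \<epsilon>, t). (i, \<epsilon>, (1 + t) / 2)) (mset (squares ?a))"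
      unfolding pile_sel mset_append mset_map mset_renumber[OF permutes_id] image_mset.compositionality
      by (intro arg_cong2[where f = "(+)"] image_mset_cong) auto
  qed (use flatD(1)[OF b] pile_is_diagram[OF a b] in auto)
qed

lemma pile_events:
  assumes a: "flat n a" and b: "flat n b"
  shows "events n (pile n a b) = image_mset (\<lambda>(t, g). (t / 2, g)) (events n b) + image_mset (\<lambda>(t, g). ((1 + t) / 2, g)) (events n a)"
proof -
  obtain a' where "same_picture n a a'" "is_stack n a' b (pile n a b)" using pile_is_stack[OF a b] by blast
  then show ?thesis using stack_events events_same_picture[OF flatD(1)[OF a]] by metis
qed

lemma pile_isotopy:
  assumes A: "flat_isotopy n A" and B: "flat_isotopy n B"
  shows "flat_isotopy n (\<lambda>s. pile n (A s) (B s))"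
proof -
  have fA: "flat n (A s)" "top_end n (A s) = top_end n (A 0)" and fB: "flat n (B s)" "top_end n (B s) = top_end n (B 0)"
    if "s \<in> {0..1}" for s
    using A[unfolded flat_isotopy_def, THEN conjunct2, rule_format, OF that]
      B[unfolded flat_isotopy_def, THEN conjunct2, rule_format, OF that] by auto
  have iA: "isotopy n A" and iB: "isotopy n B" using A B by (auto simp: flat_isotopy_def)
  note hA = isotopyD[OF iA] and hB = isotopyD[OF iB]
  let ?\<tau> = "top_end n (B 0)"
  have z: "(0::real) \<in> {0..1}" by simp
  have "isotopy n (\<lambda>s. pile n (A s) (B s))"
  proof (rule isotopyI)
    show "is_diagram n (pile n (A s) (B s))" if "s \<in> {0..1}" for s by (rule pile_is_diagram[OF fA(1)[OF that] fB(1)[OF that]])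
  next
    fix i assume i: "i \<in> {1..n}"
    have j: "?\<tau> i \<in> {1..n}" by (rule flatD(6)[OF fB(1)[OF z] i])
    have match: "curve (B s) i 1 = curve (A s) (?\<tau> i) 0" if "s \<in> {0..1}" for s
      using flatD(5)[OF fB(1)[OF that] i] fB(2)[OF that] flatD(2)[OF fA(1)[OF that] j] by simp
    have "continuous_on ({0..1} \<times> {0..1}) (\<lambda>(s, t). if t \<le> 1/2 then (\<lambda>(s, t). curve (B s) i t) (s, 2 * t)
        else (\<lambda>(s, t). curve (A s) (?\<tau> i) t) (s, 2 * t - 1))"
      by (rule halves_continuous[OF hB(2)[OF i] hA(2)[OF j]]) (use match in simp)
    then show "continuous_on ({0..1} \<times> {0..1}) (\<lambda>(s, t). curve (pile n (A s) (B s)) i t)"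
    proof (rule continuous_on_eq)
      fix p assume "p \<in> {0..1::real} \<times> {0..1::real}"
      then obtain s t where p: "p = (s, t)" "s \<in> {0..1}" "t \<in> {0..1}" by auto
      show "(case p of (s, t) \<Rightarrow> if t \<le> 1/2 then (\<lambda>(s, t). curve (B s) i t) (s, 2 * t)
        else (\<lambda>(s, t). curve (A s) (?\<tau> i) t) (s, 2 * t - 1)) = (case p of (s, t) \<Rightarrow> curve (pile n (A s) (B s)) i t)"
        using fB(2)[OF p(2)] by (simp add: p(1) pile_sel)
    qed
    have smatch: "2 * slope (B s) i 1 = 2 * slope (A s) (?\<tau> i) 0" if "s \<in> {0..1}" for s
      using flatD(4)[OF fB(1)[OF that] i] flatD(3)[OF fA(1)[OF that] j] by simp
    have c2: "continuous_on ({0..1} \<times> {0..1}) (\<lambda>(s, t). 2 * slope (B s) i t)" "continuous_on ({0..1} \<times> {0..1}) (\<lambda>(s, t). 2 * slope (A s) (?\<tau> i) t)"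
      using hB(3)[OF i] hA(3)[OF j] by (auto simp: case_prod_beta intro!: continuous_intros)
    have "continuous_on ({0..1} \<times> {0..1}) (\<lambda>(s, t). if t \<le> 1/2 then (\<lambda>(s, t). 2 * slope (B s) i t) (s, 2 * t)
        else (\<lambda>(s, t). 2 * slope (A s) (?\<tau> i) t) (s, 2 * t - 1))"
      by (rule halves_continuous[OF c2]) (use smatch in simp)
    then show "continuous_on ({0..1} \<times> {0..1}) (\<lambda>(s, t). slope (pile n (A s) (B s)) i t)"
    proof (rule continuous_on_eq)
      fix p assume "p \<in> {0..1::real} \<times> {0..1::real}"
      then obtain s t where p: "p = (s, t)" "s \<in> {0..1}" "t \<in> {0..1}" by auto
      show "(case p of (s, t) \<Rightarrow> if t \<le> 1/2 then (\<lambda>(s, t). 2 * slope (B s) i t) (s, 2 * t)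
        else (\<lambda>(s, t). 2 * slope (A s) (?\<tau> i) t) (s, 2 * t - 1)) = (case p of (s, t) \<Rightarrow> slope (pile n (A s) (B s)) i t)"
        using pile_slope[OF fA(1)[OF p(2)] fB(1)[OF p(2)] i p(3)] fB(2)[OF p(2)] by (simp add: p(1))
    qed
  next
    fix s :: real assume s: "s \<in> {0..1}"
    have m: "map (\<lambda>(i, \<epsilon>, t). (i, \<epsilon>)) (squares (pile n (A u) (B u))) = map (\<lambda>(i, \<epsilon>, t). (i, \<epsilon>)) (squares (B u)) @
       map (\<lambda>(i, \<epsilon>). (inv_into UNIV ?\<tau> i, \<epsilon>)) (map (\<lambda>(i, \<epsilon>, t). (i, \<epsilon>)) (squares (A u)))" if "u \<in> {0..1}" for u
      using fB(2)[OF that] by (simp add: pile_sel comp_def case_prod_beta)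
    show "map (\<lambda>(i, \<epsilon>, t). (i, \<epsilon>)) (squares (pile n (A s) (B s))) = map (\<lambda>(i, \<epsilon>, t). (i, \<epsilon>)) (squares (pile n (A 0) (B 0)))"
      unfolding m[OF s] m[OF z] hA(4)[OF s] hB(4)[OF s] ..
  next
    fix k assume k: "k < length (squares (pile n (A 0) (B 0)))"
    let ?b = "length (squares (B 0))"
    show "continuous_on {0..1} (\<lambda>s. snd (snd (squares (pile n (A s) (B s)) ! k)))"
    proof (cases "k < ?b")
      case True
      have "continuous_on {0..1} (\<lambda>s. snd (snd (squares (B s) ! k)) / 2)"
        by (rule continuous_on_divide[OF hB(5)[OF True] continuous_on_const]) simp
      then show ?thesis
      proof (rule continuous_on_eq)
        fix s :: real assume "s \<in> {0..1}"
        then show "snd (snd (squares (B s) ! k)) / 2 = snd (snd (squares (pile n (A s) (B s)) ! k))"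
          using True isotopy_length[OF iB, of s] by (simp add: pile_sel nth_append case_prod_beta)
      qed
    next
      case False
      then have k': "k - ?b < length (squares (A 0))" using k by (simp add: pile_sel)
      have "continuous_on {0..1} (\<lambda>s. (1 + snd (snd (squares (A s) ! (k - ?b)))) / 2)"
        by (rule continuous_on_divide[OF continuous_on_add[OF continuous_on_const hA(5)[OF k']] continuous_on_const]) simp
      then show ?thesis
      proof (rule continuous_on_eq)
        fix s :: real assume "s \<in> {0..1}"
        then show "(1 + snd (snd (squares (A s) ! (k - ?b)))) / 2 = snd (snd (squares (pile n (A s) (B s)) ! k))"
          using False k' isotopy_length[OF iB, of s] isotopy_length[OF iA, of s] by (simp add: pile_sel nth_append case_prod_beta)
      qed
    qed
  qed
  then show ?thesis
    unfolding flat_isotopy_def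
  proof (intro conjI ballI)
    fix s :: real assume s: "s \<in> {0..1}"
    show "flat n (pile n (A s) (B s))" by (rule pile_flat(1)[OF fA(1)[OF s] fB(1)[OF s]])
    show "top_end n (pile n (A s) (B s)) = top_end n (pile n (A 0) (B 0))"
      unfolding pile_flat(2)[OF fA(1)[OF s] fB(1)[OF s]] pile_flat(2)[OF fA(1)[OF z] fB(1)[OF z]]
      by (simp only: fA(2)[OF s] fB(2)[OF s])
  qed
qed

section \<open>Standard diagrams\<close>

subsection \<open>Blocks\<close>

lemma hecke_gens_iff:
  "GenX r \<in> hecke_gens n \<longleftrightarrow> r \<in> {1..n}" "GenXinv r \<in> hecke_gens n \<longleftrightarrow> r \<in> {1..n}"
  "GenT r \<in> hecke_gens n \<longleftrightarrow> r \<in> {1..<n}"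
  by (auto simp: hecke_gens_def)

lemma smooth_step_ge: "- 1 \<le> smooth_step u"
  using smooth_step_bounds(1)[of u] by linarith

definition block_crossings :: "hecke_gen list \<Rightarrow> nat set" where
  "block_crossings w = {r. GenT r \<in> set w}"

definition crossing_index :: "hecke_gen list \<Rightarrow> nat \<Rightarrow> nat" where
  "crossing_index w r = (SOME k. k < length w \<and> w ! k = GenT r)"

fun strand :: "hecke_gen \<Rightarrow> nat" where
  "strand (GenX r) = r" | "strand (GenXinv r) = r" | "strand (GenT r) = r"

definition is_crossing :: "hecke_gen \<Rightarrow> bool" where
  "is_crossing g \<longleftrightarrow> (\<exists>r. g = GenT r)"

text \<open>The letter number \<open>k\<close> is placed at height \<open>h k\<close>. A crossing
  exchanges its two strands within the heights \<open>h k - 1/4\<close> to \<open>h k + 1/4\<close>,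
  which is why the heights are kept between \<open>1/4\<close> and \<open>3/4\<close>. As the
  letters are pairwise far apart, they do not interfere and their heights can be changed
  independently.\<close>

definition block :: "hecke_gen list \<Rightarrow> (nat \<Rightarrow> real) \<Rightarrow> diagram" where
  "block w h = \<lparr> curve = (\<lambda>i t.
       if i \<in> block_crossings w then real i + smooth_step (2 * (t - h (crossing_index w i)) + 1/2)
       else if i - 1 \<in> block_crossings w then real i - smooth_step (2 * (t - h (crossing_index w (i - 1))) + 1/2)
       else real i),
     squares = map (\<lambda>k. (strand (w ! k), w ! k = GenX (strand (w ! k)), h k))
       (filter (\<lambda>k. \<not> is_crossing (w ! k)) [0..<length w]) \<rparr>"

locale block_letters =
  fixes n :: nat and w :: "hecke_gen list"
  assumes letters: "w \<in> lists (hecke_gens n)"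
    and far: "\<And>k l. k < length w \<Longrightarrow> l < length w \<Longrightarrow> k \<noteq> l \<Longrightarrow> far_apart (w ! k) (w ! l)"
begin

abbreviation "C \<equiv> block_crossings w"

definition height_ok :: "(nat \<Rightarrow> real) \<Rightarrow> bool" where
  "height_ok h \<longleftrightarrow> (\<forall>k<length w. 1/4 < h k \<and> h k < 3/4)"

lemma C_range: "r \<in> C \<Longrightarrow> 1 \<le> r \<and> r < n"
  using letters by (auto simp: block_crossings_def hecke_gens_iff)

lemma index: assumes "r \<in> C" shows "crossing_index w r < length w" "w ! crossing_index w r = GenT r"
proof -
  have "\<exists>k. k < length w \<and> w ! k = GenT r" using assms by (auto simp: block_crossings_def in_set_conv_nth)
  from someI_ex[OF this] show "crossing_index w r < length w" "w ! crossing_index w r = GenT r"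
    by (auto simp: crossing_index_def)
qed

lemma index_unique: "k < length w \<Longrightarrow> w ! k = GenT r \<Longrightarrow> crossing_index w r = k"
proof (rule ccontr)
  assume k: "k < length w" "w ! k = GenT r" and ne: "crossing_index w r \<noteq> k"
  then have "r \<in> C" by (auto simp: block_crossings_def in_set_conv_nth)
  then show False using far[of "crossing_index w r" k] index[of r] k ne by simp
qed

lemma C_apart: assumes "r \<in> C" "s \<in> C" "r \<noteq> s" shows "r + 1 < s \<or> s + 1 < r"
proof -
  have "crossing_index w r \<noteq> crossing_index w s" using index(2)[OF assms(1)] index(2)[OF assms(2)] assms(3) by auto
  then show ?thesis
    using far[OF index(1)[OF assms(1)] index(1)[OF assms(2)]] index(2)[OF assms(1)] index(2)[OF assms(2)] by simp
qed

lemma C_next: "r \<in> C \<Longrightarrow> Suc r \<notin> C" "r \<in> C \<Longrightarrow> r - 1 \<notin> C"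
  using C_apart[of r "Suc r"] C_apart[of r "r - 1"] C_range[of r] by force+

lemma square_off:
  assumes "k < length w" "\<not> is_crossing (w ! k)"
  shows "strand (w ! k) \<in> {1..n}" "strand (w ! k) \<notin> C" "strand (w ! k) - 1 \<notin> C"
proof -
  have "w ! k \<in> hecke_gens n" using letters assms(1) by auto
  then show s: "strand (w ! k) \<in> {1..n}" using assms(2) by (cases "w ! k") (auto simp: is_crossing_def hecke_gens_iff)
  have f: "far_apart (GenT r) (w ! k)" if "r \<in> C" for r
  proof -
    have "crossing_index w r \<noteq> k" using index(2)[OF that] assms(2) by (auto simp: is_crossing_def)
    then show ?thesis using far[OF index(1)[OF that] assms(1)] index(2)[OF that] by simp
  qed
  show "strand (w ! k) \<notin> C" "strand (w ! k) - 1 \<notin> C"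
    using f[of "strand (w ! k)"] f[of "strand (w ! k) - 1"] assms(2) s
    by (cases "w ! k"; force simp: is_crossing_def)+
qed

definition block_slope :: "(nat \<Rightarrow> real) \<Rightarrow> nat \<Rightarrow> real \<Rightarrow> real" where
  "block_slope h i t = (if i \<in> C then 2 * smooth_step' (2 * (t - h (crossing_index w i)) + 1/2)
     else if i - 1 \<in> C then - 2 * smooth_step' (2 * (t - h (crossing_index w (i - 1))) + 1/2) else 0)"

context
  fixes h assumes h: "height_ok h"
begin

abbreviation "b \<equiv> block w h"
abbreviation "u r t \<equiv> 2 * (t - h (crossing_index w r)) + 1/2"

lemma curve_left: "r \<in> C \<Longrightarrow> curve b r t = real r + smooth_step (u r t)"
  by (simp add: block_def)

lemma curve_right: "r \<in> C \<Longrightarrow> curve b (Suc r) t = real (Suc r) - smooth_step (u r t)"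
  using C_next(1) by (simp add: block_def)

lemma curve_off: "i \<notin> C \<Longrightarrow> i - 1 \<notin> C \<Longrightarrow> curve b i t = real i"
  by (simp add: block_def)

lemma h_index: "r \<in> C \<Longrightarrow> 1/4 < h (crossing_index w r) \<and> h (crossing_index w r) < 3/4"
  using h index(1) by (auto simp: height_ok_def)

lemma strand_cases:
  obtains (left) "i \<in> C" | (right) r where "r \<in> C" "i = Suc r" | (off) "i \<notin> C" "i - 1 \<notin> C"
  by (metis C_range Suc_pred' diff_is_0_eq' less_or_eq_imp_le not_less_eq_eq One_nat_def diff_0_eq_0 le_0_eq not_gr_zero)

lemma curve_upper: "i \<notin> C \<Longrightarrow> curve b i t \<le> real i"
  by (rule strand_cases[of i]) (use smooth_step_bounds in \<open>auto simp: curve_right curve_off\<close>)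

lemma curve_upper': "curve b i t \<le> real i + 1"
  by (rule strand_cases[of i]) (use smooth_step_bounds smooth_step_ge in \<open>auto simp: curve_left curve_right curve_off\<close>)

lemma curve_lower: "i - 1 \<notin> C \<Longrightarrow> real i \<le> curve b i t"
  by (rule strand_cases[of i]) (use smooth_step_bounds in \<open>auto simp: curve_left curve_off\<close>)

lemma curve_lower': "real i - 1 \<le> curve b i t"
  by (rule strand_cases[of i]) (use smooth_step_bounds smooth_step_ge in \<open>auto simp: curve_left curve_right curve_off\<close>)

text \<open>Distinct crossings use disjoint pairs of strands, and no curve moves outside its
  pair.\<close>

lemma block_less:
  assumes ij: "i < j" and ne: "\<not> (i \<in> C \<and> j = Suc i)"
  shows "curve b i t < curve b j t"
proof (cases "j - 1 \<in> C")
  case False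
  then have L: "real j \<le> curve b j t" by (rule curve_lower)
  show ?thesis
  proof (cases "i \<in> C")
    case True
    then have "real i + 1 < real j" using ij ne by auto
    then show ?thesis using L curve_upper'[of i t] by linarith
  qed (use L curve_upper[of i t] ij in force)
next
  case True
  have L: "real j - 1 \<le> curve b j t" by (rule curve_lower')
  show ?thesis
  proof (cases "i \<in> C")
    case i: True
    then have "i \<noteq> j - 1" using ij ne by auto
    then have "i + 1 < j - 1" using C_apart[OF i True] ij by linarith
    then have "real i + 1 < real j - 1" by linarith
    then show ?thesis using L curve_upper'[of i t] by linarith
  next
    case False
    then have "i \<noteq> j - 1" using True by auto
    then have "real i < real j - 1" using ij by linarith
    then show ?thesis using L curve_upper[OF False, of t] by linarith
  qed
qed

lemma block_pair: "r \<in> C \<Longrightarrow> curve b r t = curve b (Suc r) t \<longleftrightarrow> t = h (crossing_index w r)"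
proof -
  assume r: "r \<in> C"
  have "curve b r t = curve b (Suc r) t \<longleftrightarrow> smooth_step (u r t) = 1/2"
    using curve_left[OF r, of t] curve_right[OF r, of t] by auto
  then show ?thesis unfolding smooth_step_eq_half by auto
qed

lemma block_eq:
  assumes "i \<noteq> j" "curve b i t = curve b j t"
  shows "\<exists>r\<in>C. {i, j} = {r, Suc r} \<and> t = h (crossing_index w r)"
proof (cases "i < j")
  case True
  then have "i \<in> C \<and> j = Suc i" using block_less[of i j t] assms(2) by force
  then show ?thesis using assms(2) block_pair[of i t] by auto
next
  case False
  then have "j \<in> C \<and> i = Suc j" using block_less[of j i t] assms by force
  then show ?thesis using assms(2) block_pair[of j t] by auto
qed

lemma block_deriv: "(curve b i has_real_derivative block_slope h i t) (at t within A)"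
proof -
  have s: "((\<lambda>t. smooth_step (u r t)) has_real_derivative smooth_step' (u r t) * 2) (at t within A)" for r
  proof -
    have "((\<lambda>t. u r t) has_real_derivative 2) (at t)" by (auto intro!: derivative_eq_intros)
    from DERIV_chain2[OF smooth_step_deriv this] show ?thesis by (rule has_field_derivative_at_within)
  qed
  show ?thesis
    unfolding block_def diagram.simps block_slope_def using s[of i] s[of "i - 1"]
    by (cases "i \<in> C"; cases "i - 1 \<in> C") (auto intro!: derivative_eq_intros)
qed

lemma block_slope_eq: "t \<in> {0..1} \<Longrightarrow> slope b i t = block_slope h i t"
  by (rule slope_eqI[OF block_deriv])

lemma block_squares:
  assumes "(i, e, t) \<in> set (squares b)"
  shows "\<exists>k<length w. \<not> is_crossing (w ! k) \<and> i = strand (w ! k) \<and> t = h k"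
  using assms by (auto simp: block_def)

lemma block_is_diagram: "is_diagram n b"
  unfolding is_diagram_def
proof (intro conjI ballI impI; (intro conjI)?)
  fix i :: nat
  have "continuous_on {0..1} (block_slope h i)"
    unfolding block_slope_def[abs_def]
    by (cases "i \<in> C"; cases "i - 1 \<in> C") (auto intro!: continuous_intros smooth_step'_cont)
  then show "curve b i differentiable_on {0..1}" "continuous_on {0..1} (slope b i)"
    using smoothI[OF block_deriv] by blast+
next
  fix t :: real assume t: "t \<in> {0, 1}"
  show "inj_on (\<lambda>i. curve b i t) {1..n}"
  proof (rule inj_onI, rule ccontr)
    fix i j :: nat assume ij: "curve b i t = curve b j t" "i \<noteq> j"
    obtain r where r: "r \<in> C" "t = h (crossing_index w r)" using block_eq[OF ij(2,1)] by blast
    then show False using h_index[OF r(1)] t by auto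
  qed
next
  fix t :: real and i j k :: nat assume ne: "i \<noteq> j" "j \<noteq> k" "i \<noteq> k"
  show "\<not> (curve b i t = curve b j t \<and> curve b j t = curve b k t)"
  proof
    assume "curve b i t = curve b j t \<and> curve b j t = curve b k t"
    then have eq: "curve b i t = curve b j t" "curve b j t = curve b k t" by simp_all
    obtain r where r: "r \<in> C" "{i, j} = {r, Suc r}" using block_eq[OF ne(1) eq(1)] by blast
    obtain s where s: "s \<in> C" "{j, k} = {s, Suc s}" using block_eq[OF ne(2) eq(2)] by blast
    have "r = s" using C_apart[OF r(1) s(1)] r(2) s(2) by (auto simp: doubleton_eq_iff)
    then show False using r(2) s(2) ne by (auto simp: doubleton_eq_iff)
  qed
next
  fix t :: real and i j :: nat assume t: "t \<in> {0..1}" and ne: "i \<noteq> j" and eq: "curve b i t = curve b j t"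
  obtain r where r: "r \<in> C" "{i, j} = {r, Suc r}" "t = h (crossing_index w r)" using block_eq[OF ne eq] by blast
  have "block_slope h r t = 4" "block_slope h (Suc r) t = - 4"
    using r(1,3) C_next(1)[OF r(1)] smooth_step_half(2) by (auto simp: block_slope_def)
  then show "slope b i t \<noteq> slope b j t" using r(2) block_slope_eq[OF t] by (auto simp: doubleton_eq_iff)
next
  fix x assume "x \<in> set (squares b)"
  then obtain i e t where x: "x = (i, e, t)" "(i, e, t) \<in> set (squares b)" by (metis prod_cases3)
  then obtain k where k: "k < length w" "\<not> is_crossing (w ! k)" "i = strand (w ! k)" "t = h k" using block_squares by blast
  have "curve b j t \<noteq> curve b i t" if ji: "j \<noteq> i" for j
  proof
    assume "curve b j t = curve b i t"
    then obtain r where "r \<in> C" "{j, i} = {r, Suc r}" using block_eq[OF ji] by blast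
    then show False using square_off(2,3)[OF k(1,2)] k(3) by (auto simp: doubleton_eq_iff)
  qed
  moreover have "0 < t \<and> t < 1" using h k(1,4) by (force simp: height_ok_def)
  ultimately show "case x of (i, e, t) \<Rightarrow> i \<in> {1..n} \<and> t \<in> {0<..<1} \<and> (\<forall>j\<in>{1..n}. j \<noteq> i \<longrightarrow> curve b j t \<noteq> curve b i t)"
    using x square_off(1)[OF k(1,2)] k(3) by auto
qed

lemma block_ends:
  "r \<in> C \<Longrightarrow> smooth_step (u r 0) = 0 \<and> smooth_step' (u r 0) = 0 \<and> smooth_step (u r 1) = 1 \<and> smooth_step' (u r 1) = 0"
  using h_index[of r] smooth_step_outside(1,3)[of "u r 0"] smooth_step_outside(2,4)[of "u r 1"] by simp

lemma block_flat: "flat n b"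
  unfolding flat_def
proof (intro conjI ballI block_is_diagram)
  fix i :: nat assume i: "i \<in> {1..n}"
  show "curve b i 0 = real i"
    by (rule strand_cases[of i]) (use block_ends in \<open>auto simp: curve_left curve_right curve_off\<close>)
  have "block_slope h i 0 = 0" "block_slope h i 1 = 0"
    using block_ends[of i] block_ends[of "i - 1"] by (auto simp: block_slope_def)
  then show "slope b i 0 = 0" "slope b i 1 = 0" by (simp_all add: block_slope_eq)
  show "\<exists>m\<in>{1..n}. curve b i 1 = real m"
  proof (rule strand_cases[of i])
    assume "i \<in> C" then show ?thesis using block_ends[of i] C_range[of i] by (intro bexI[of _ "Suc i"]) (auto simp: curve_left)
  next
    fix r assume "r \<in> C" "i = Suc r"
    then show ?thesis using block_ends[of r] C_range[of r] by (intro bexI[of _ r]) (auto simp: curve_right)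
  next
    assume "i \<notin> C" "i - 1 \<notin> C" then show ?thesis using i by (intro bexI[of _ i]) (auto simp: curve_off)
  qed
qed

lemma block_top_end: "top_end n b i = (if i \<in> {1..n} then (if i \<in> C then Suc i else if i - 1 \<in> C then i - 1 else i) else i)"
proof (cases "i \<in> {1..n}")
  case True
  have "curve b i 1 = real (if i \<in> C then Suc i else if i - 1 \<in> C then i - 1 else i)"
    by (rule strand_cases[of i])
       (use block_ends C_next in \<open>auto simp: curve_left curve_right curve_off\<close>)
  then show ?thesis unfolding top_end_def using True by (simp only: if_True floor_of_nat nat_int)
next
  case False
  then show ?thesis unfolding top_end_def by (simp only: if_False)
qed

lemma block_place:
  assumes i: "i \<in> {1..n}" and off: "i - 1 \<notin> C" and t: "i \<in> C \<longrightarrow> t = h (crossing_index w i)"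
  shows "place n b i t = i"
proof -
  have "{k \<in> {1..n}. curve b k t < curve b i t} = {1..<i}"
  proof (intro Set.set_eqI iffI)
    fix k assume "k \<in> {k \<in> {1..n}. curve b k t < curve b i t}"
    then have k: "1 \<le> k" "k \<noteq> i" "curve b k t < curve b i t" by auto
    show "k \<in> {1..<i}"
    proof (rule ccontr)
      assume "k \<notin> {1..<i}"
      then have ik: "i < k" using k by simp
      show False
      proof (cases "i \<in> C \<and> k = Suc i")
        case True
        then have "curve b i t = curve b k t" using block_pair[of i t] t by simp
        then show False using k(3) by simp
      next
        case False
        from block_less[OF ik False, of t] show False using k(3) by simp
      qed
    qed
  next
    fix k assume k: "k \<in> {1..<i}"
    then have "\<not> (k \<in> C \<and> i = Suc k)" using off by auto
    then have "curve b k t < curve b i t" using k by (intro block_less) auto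
    then show "k \<in> {k \<in> {1..n}. curve b k t < curve b i t}" using k i by auto
  qed
  then show ?thesis using i by (simp add: place_def)
qed

lemma block_crossings_eq: "crossings n b = (\<lambda>r. (h (crossing_index w r), r)) ` C"
proof (intro Set.set_eqI iffI)
  fix p assume "p \<in> crossings n b"
  then obtain t i j where p: "p = (t, place n b i t)" "t \<in> {0..1}" "i \<in> {1..n}" "j \<in> {1..n}" "i \<noteq> j" "curve b i t = curve b j t"
    unfolding crossings_def by blast
  obtain r where r: "r \<in> C" "{i, j} = {r, Suc r}" "t = h (crossing_index w r)" using block_eq[OF p(5,6)] by blast
  have "place n b r t = r" using block_place[of r t] C_next(2)[OF r(1)] C_range[OF r(1)] r(3) by simp
  moreover have "place n b i t = place n b r t" using p(6) r(2) unfolding place_def by (auto simp: doubleton_eq_iff)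
  ultimately show "p \<in> (\<lambda>r. (h (crossing_index w r), r)) ` C" using p(1) r by auto
next
  fix p assume "p \<in> (\<lambda>r. (h (crossing_index w r), r)) ` C"
  then obtain r where r: "r \<in> C" "p = (h (crossing_index w r), r)" by auto
  let ?t = "h (crossing_index w r)"
  have "curve b r ?t = curve b (Suc r) ?t" using block_pair[OF r(1), of ?t] by simp
  then have "(?t, place n b r ?t) \<in> crossings n b"
    using C_range[OF r(1)] h_index[OF r(1)] by (intro crossingsI[of _ r _ "Suc r"]) auto
  moreover have "place n b r ?t = r" using block_place[of r ?t] C_next(2)[OF r(1)] C_range[OF r(1)] by simp
  ultimately show "p \<in> crossings n b" using r by simp
qed

lemma block_events: "events n b = mset (map (\<lambda>k. (h k, w ! k)) [0..<length w])"
proof -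
  let ?ks = "[0..<length w]"
  let ?K = "{k. k < length w \<and> is_crossing (w ! k)}"
  have inj: "inj_on (crossing_index w) C" using index(2) by (intro inj_onI) (metis hecke_gen.inject(3))
  have K: "?K = crossing_index w ` C"
  proof (intro Set.set_eqI iffI)
    fix k assume "k \<in> ?K"
    then obtain r where "k < length w" "w ! k = GenT r" by (auto simp: is_crossing_def)
    then show "k \<in> crossing_index w ` C"
      using index_unique[of k r] by (intro image_eqI[of _ _ r]) (auto simp: block_crossings_def in_set_conv_nth)
  next
    fix k assume "k \<in> crossing_index w ` C" then show "k \<in> ?K" using index by (auto simp: is_crossing_def)
  qed
  have finC: "finite C" by (rule finite_subset[of _ "{1..<n}"]) (use C_range in auto)
  have g: "inj_on (\<lambda>(t, r). (t, GenT r)) X" for X :: "(real \<times> nat) set" by (auto simp: inj_on_def)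
  have g2: "inj_on (\<lambda>r. (h (crossing_index w r), r)) X" for X by (auto simp: inj_on_def)
  have "mset_set ((\<lambda>(t, r). (t, GenT r)) ` crossings n b) = image_mset (\<lambda>r. (h (crossing_index w r), GenT r)) (mset_set C)"
    unfolding block_crossings_eq image_mset_mset_set[OF g, symmetric] image_mset_mset_set[OF g2, symmetric] image_mset.compositionality
    by (rule image_mset_cong) auto
  also have "\<dots> = image_mset (\<lambda>k. (h k, w ! k)) (image_mset (crossing_index w) (mset_set C))"
    unfolding image_mset.compositionality using finC index(2) by (intro image_mset_cong) auto
  also have "image_mset (crossing_index w) (mset_set C) = mset_set ?K" unfolding image_mset_mset_set[OF inj] K ..
  also have "mset_set ?K = mset (filter (\<lambda>k. is_crossing (w ! k)) ?ks)"
    by (subst mset_set_set[symmetric]) (auto intro!: arg_cong[where f = mset_set])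
  finally have c: "mset_set ((\<lambda>(t, r). (t, GenT r)) ` crossings n b) =
    mset (map (\<lambda>k. (h k, w ! k)) (filter (\<lambda>k. is_crossing (w ! k)) ?ks))" by simp
  have "image_mset (\<lambda>(i, \<epsilon>, t). (t, square_gen \<epsilon> (place n b i t))) (mset (squares b)) =
     image_mset (\<lambda>k. (h k, w ! k)) (mset (filter (\<lambda>k. \<not> is_crossing (w ! k)) ?ks))"
    unfolding block_def diagram.simps mset_map image_mset.compositionality
  proof (rule image_mset_cong)
    fix k assume "k \<in># mset (filter (\<lambda>k. \<not> is_crossing (w ! k)) ?ks)"
    then have k: "k < length w" "\<not> is_crossing (w ! k)" by auto
    note off = square_off[OF k]
    have r: "place n b (strand (w ! k)) (h k) = strand (w ! k)" by (rule block_place) (use off in auto)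
    have "square_gen (w ! k = GenX (strand (w ! k))) (strand (w ! k)) = w ! k"
      using k(2) by (cases "w ! k") (auto simp: square_gen_def is_crossing_def)
    then show "((\<lambda>(i, \<epsilon>, t). (t, square_gen \<epsilon> (place n \<lparr>curve = \<lambda>i t. if i \<in> block_crossings w then real i + smooth_step (2 * (t - h (crossing_index w i)) + 1/2)
       else if i - 1 \<in> block_crossings w then real i - smooth_step (2 * (t - h (crossing_index w (i - 1))) + 1/2)
       else real i, squares = map (\<lambda>k. (strand (w ! k), w ! k = GenX (strand (w ! k)), h k))
       (filter (\<lambda>k. \<not> is_crossing (w ! k)) [0..<length w])\<rparr> i t))) \<circ>
       (\<lambda>k. (strand (w ! k), w ! k = GenX (strand (w ! k)), h k))) k = (h k, w ! k)"
      using r[unfolded block_def] by simp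
  qed
  then have "events n b = image_mset (\<lambda>k. (h k, w ! k))
      (filter_mset (\<lambda>k. is_crossing (w ! k)) (mset ?ks) + filter_mset (\<lambda>k. \<not> is_crossing (w ! k)) (mset ?ks))"
    unfolding events_def c by (simp only: mset_map mset_filter image_mset_union)
  also have "\<dots> = image_mset (\<lambda>k. (h k, w ! k)) (mset ?ks)" by (simp only: multiset_partition[symmetric])
  finally show ?thesis by (simp only: mset_map)
qed

end

text \<open>Heights in a block may pass one another; this is what exchanges letters that are far
  apart.\<close>

lemma block_isotopy:
  assumes h: "height_ok h" "height_ok h'"
  shows "flat_isotopy n (\<lambda>s. block w (\<lambda>k. (1 - s) * h k + s * h' k))"
proof -
  let ?h = "\<lambda>s k. (1 - s) * h k + s * h' k"
  have ok: "height_ok (?h s)" if s: "s \<in> {0..1}" for s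
    unfolding height_ok_def
  proof (intro allI impI)
    fix k assume "k < length w"
    then have "1/4 < h k" "1/4 < h' k" "h k < 3/4" "h' k < 3/4" using h by (auto simp: height_ok_def)
    then show "1/4 < ?h s k \<and> ?h s k < 3/4"
      using convex_less[of "1/4" "h k" "1/4" "h' k" s] convex_less[of "h k" "3/4" "h' k" "3/4" s] s
      unfolding distrib_right[symmetric] by simp
  qed
  have "isotopy n (\<lambda>s. block w (?h s))"
  proof (rule isotopyI)
    show "is_diagram n (block w (?h s))" if "s \<in> {0..1}" for s by (rule block_is_diagram[OF ok[OF that]])
  next
    fix i
    show "continuous_on ({0..1} \<times> {0..1}) (\<lambda>(s, t). curve (block w (?h s)) i t)"
      by (cases "i \<in> C"; cases "i - 1 \<in> C")
         (auto simp: block_def case_prod_beta intro!: continuous_intros smooth_step_cont)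
    have "continuous_on ({0..1} \<times> {0..1}) (\<lambda>p. block_slope (?h (fst p)) i (snd p))"
      by (cases "i \<in> C"; cases "i - 1 \<in> C")
         (auto simp: block_slope_def intro!: continuous_intros smooth_step'_cont)
    then show "continuous_on ({0..1} \<times> {0..1}) (\<lambda>(s, t). slope (block w (?h s)) i t)"
      by (rule continuous_on_eq) (auto simp: block_slope_eq[OF ok])
  next
    show "map (\<lambda>(i, \<epsilon>, t). (i, \<epsilon>)) (squares (block w (?h s))) = map (\<lambda>(i, \<epsilon>, t). (i, \<epsilon>)) (squares (block w (?h 0)))" for s
      by (simp add: block_def)
  next
    fix k assume "k < length (squares (block w (?h 0)))"
    then show "continuous_on {0..1} (\<lambda>s. snd (snd (squares (block w (?h s)) ! k)))"
      by (auto simp: block_def intro!: continuous_intros)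
  qed
  moreover have top: "top_end n (block w (?h s)) = top_end n (block w (?h 0))" if "s \<in> {0..1}" for s
  proof
    fix i
    have z: "(0::real) \<in> {0..1}" by simp
    show "top_end n (block w (?h s)) i = top_end n (block w (?h 0)) i"
      unfolding block_top_end[OF ok[OF that]] block_top_end[OF ok[OF z]] ..
  qed
  ultimately show ?thesis
    unfolding flat_isotopy_def using block_flat[OF ok] top by blast
qed

end

subsection \<open>Piles of blocks\<close>

definition const_half :: "nat \<Rightarrow> real" where "const_half k = 1/2"

lemma vertical_block: "vertical_diagram = block [] h"
  by (simp add: vertical_diagram_def block_def block_crossings_def)

lemma square_block: "square_diagram r \<epsilon> = block [square_gen \<epsilon> r] const_half"
  by (auto simp: square_diagram_def block_def block_crossings_def square_gen_def is_crossing_def const_half_def)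

text \<open>The first block is on top, in accordance with reading words from the top down.\<close>

primrec standard :: "nat \<Rightarrow> (hecke_gen list \<times> (nat \<Rightarrow> real)) list \<Rightarrow> diagram" where
  "standard n [] = vertical_diagram"
| "standard n (B # bs) = pile n (block (fst B) (snd B)) (standard n bs)"

definition block_event_list :: "hecke_gen list \<times> (nat \<Rightarrow> real) \<Rightarrow> (real \<times> hecke_gen) list" where
  "block_event_list B = map (\<lambda>k. (snd B k, fst B ! k)) [0..<length (fst B)]"

primrec event_list :: "(hecke_gen list \<times> (nat \<Rightarrow> real)) list \<Rightarrow> (real \<times> hecke_gen) list" where
  "event_list [] = []"
| "event_list (B # bs) = map (\<lambda>(t, g). ((1 + t) / 2, g)) (block_event_list B) @ map (\<lambda>(t, g). (t / 2, g)) (event_list bs)"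

definition valid_block :: "nat \<Rightarrow> hecke_gen list \<times> (nat \<Rightarrow> real) \<Rightarrow> bool" where
  "valid_block n B \<longleftrightarrow> block_letters n (fst B) \<and> (\<forall>k<length (fst B). 1/4 < snd B k \<and> snd B k < 3/4)"

lemma valid_block_props:
  assumes "valid_block n B"
  shows "flat n (block (fst B) (snd B))" "events n (block (fst B) (snd B)) = mset (block_event_list B)"
proof -
  interpret block_letters n "fst B" using assms by (simp add: valid_block_def)
  have h: "height_ok (snd B)" using assms by (simp add: valid_block_def height_ok_def)
  show "flat n (block (fst B) (snd B))" by (rule block_flat[OF h])
  show "events n (block (fst B) (snd B)) = mset (block_event_list B)"
    unfolding block_event_list_def by (rule block_events[OF h])
qed

lemma block_letters_Nil: "block_letters n []"
  by unfold_locales auto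

lemma block_letters_single: "g \<in> hecke_gens n \<Longrightarrow> block_letters n [g]"
  by unfold_locales auto

lemma vertical_props: "flat n vertical_diagram" "events n vertical_diagram = {#}"
  using valid_block_props[of n "([], const_half)"] block_letters_Nil
  by (simp_all add: valid_block_def vertical_block[of const_half] block_event_list_def)

lemma standard_props:
  assumes "list_all (valid_block n) bs"
  shows "flat n (standard n bs)" "events n (standard n bs) = mset (event_list bs)"
proof -
  have "flat n (standard n bs) \<and> events n (standard n bs) = mset (event_list bs)"
    using assms
  proof (induction bs)
    case Nil
    show ?case using vertical_props by simp
  next
    case (Cons B bs)
    then have IH: "flat n (standard n bs)" "events n (standard n bs) = mset (event_list bs)" and B: "valid_block n B" by auto
    note b = valid_block_props[OF B]
    show ?case using pile_flat(1)[OF b(1) IH(1)] pile_events[OF b(1) IH(1)] b(2) IH(2) by (simp add: add.commute)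
  qed
  then show "flat n (standard n bs)" "events n (standard n bs) = mset (event_list bs)" by auto
qed

lemma event_list_letters: "map snd (event_list bs) = concat (map fst bs)"
proof (induction bs)
  case (Cons B bs)
  have "map snd (block_event_list B) = fst B" by (simp add: block_event_list_def comp_def map_nth)
  then have "map snd (map (\<lambda>(t, g). ((1 + t) / 2, g)) (block_event_list B)) = fst B" by (simp add: comp_def case_prod_beta)
  moreover have "map snd (map (\<lambda>(t, g). (t / 2, g)) (event_list bs)) = map snd (event_list bs)" by (simp add: comp_def case_prod_beta)
  ultimately show ?case using Cons by simp
qed simp

lemma event_list_heights:
  assumes "list_all (valid_block n) bs" "p \<in> set (event_list bs)" shows "0 < fst p \<and> fst p < 1"
proof -
  have "p \<in># events n (standard n bs)" using standard_props(2)[OF assms(1)] assms(2) by simp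
  then show ?thesis
    using event_heights[OF flatD(1)[OF standard_props(1)[OF assms(1)]], of "fst p" "snd p"] by simp
qed

definition strictly_descending :: "(real \<times> hecke_gen) list \<Rightarrow> bool" where
  "strictly_descending es \<longleftrightarrow> sorted_wrt (\<lambda>e f. fst f < fst e) es"

lemma strictly_descending_imp: "strictly_descending es \<Longrightarrow> descending es"
  unfolding strictly_descending_def descending_def
  using sorted_wrt_mono_rel[of es "\<lambda>e f. fst f < fst e" "\<lambda>e f. fst f \<le> fst e"] by auto

lemma event_list_strict:
  assumes "list_all (valid_block n) bs" "list_all (\<lambda>B. strictly_descending (block_event_list B)) bs"
  shows "strictly_descending (event_list bs)"
  using assms
proof (induction bs)
  case Nil
  show ?case by (simp add: strictly_descending_def)
next
  case (Cons B bs)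
  have low: "0 < fst p \<and> fst p < 1" if "p \<in> set (event_list bs)" for p by (rule event_list_heights[of n, OF _ that]) (use Cons.prems(1) in simp)
  have high: "1/4 < fst p" if "p \<in> set (block_event_list B)" for p
    using that Cons.prems(1) by (auto simp: block_event_list_def valid_block_def)
  have 1: "sorted_wrt (\<lambda>e f. fst (case f of (t, g) \<Rightarrow> ((1 + t) / 2, g)) < fst (case e of (t, g) \<Rightarrow> ((1 + t) / 2, g))) (block_event_list B)"
    using Cons.prems(2) unfolding list.pred_inject strictly_descending_def
    by (elim conjE sorted_wrt_mono_rel[rotated]) (auto simp: case_prod_beta)
  have 2: "sorted_wrt (\<lambda>e f. fst (case f of (t, g) \<Rightarrow> (t / 2, g)) < fst (case e of (t, g) \<Rightarrow> (t / 2, g))) (event_list bs)"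
    using Cons unfolding list.pred_inject strictly_descending_def
    by (elim conjE, intro sorted_wrt_mono_rel[OF _ Cons.IH[unfolded strictly_descending_def]]) (auto simp: case_prod_beta strictly_descending_def)
  have 3: "fst (case f of (t, g) \<Rightarrow> (t / 2, g)) < fst (case e of (t, g) \<Rightarrow> ((1 + t) / 2, g))"
    if "e \<in> set (block_event_list B)" "f \<in> set (event_list bs)" for e f
    using high[OF that(1)] low[OF that(2)] by (simp add: case_prod_beta)
  show ?case
    unfolding strictly_descending_def event_list.simps sorted_wrt_append sorted_wrt_map
    using 1 2 3 by auto
qed

text \<open>If no two events have equal heights, the order of the events is the order of the letters
  in the word.\<close>

lemma strict_same_letters_isotopic:
  assumes "list_all (valid_block n) bs" "list_all (\<lambda>B. strictly_descending (block_event_list B)) bs"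
    and "list_all (valid_block n) cs" "list_all (\<lambda>B. strictly_descending (block_event_list B)) cs"
    and "concat (map fst bs) = concat (map fst cs)"
  shows "isotopic n (standard n bs) (standard n cs)"
proof (rule same_order_isotopic)
  show "same_order (event_list bs) (event_list cs)"
    using event_list_strict[OF assms(1,2)] event_list_strict[OF assms(3,4)] assms(5)
    unfolding strictly_descending_def by (intro same_order_strict) (simp_all add: event_list_letters)
qed (use standard_props[OF assms(1)] standard_props[OF assms(3)] flatD(1) in auto)

text \<open>The heights in all the blocks are moved at the same time.\<close>

lemma standard_isotopic:
  assumes "list_all (\<lambda>(w, h, h'). valid_block n (w, h) \<and> valid_block n (w, h')) ts"
  shows "isotopic n (standard n (map (\<lambda>(w, h, h'). (w, h)) ts)) (standard n (map (\<lambda>(w, h, h'). (w, h')) ts))"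
proof -
  let ?B = "\<lambda>s (w, h, h'). (w, \<lambda>k. (1 - s) * h k + s * h' k) :: hecke_gen list \<times> (nat \<Rightarrow> real)"
  have "flat_isotopy n (\<lambda>s. standard n (map (?B s) ts))"
    using assms
  proof (induction ts)
    case Nil
    have "isotopy n (\<lambda>s. vertical_diagram)" by (rule isotopy_const[OF flatD(1)[OF vertical_props(1)]])
    then show ?case using vertical_props(1) by (simp add: flat_isotopy_def)
  next
    case (Cons x ts)
    obtain w h h' where x: "x = (w, h, h')" by (rule prod_cases3)
    interpret block_letters n w using Cons.prems by (simp add: x valid_block_def)
    have "height_ok h" "height_ok h'" using Cons.prems by (simp_all add: x valid_block_def height_ok_def)
    from pile_isotopy[OF block_isotopy[OF this] Cons.IH]
    show ?case using Cons.prems by (simp add: x)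
  qed
  then have iso: "isotopy n (\<lambda>s. standard n (map (?B s) ts))" by (simp add: flat_isotopy_def)
  have e: "map (?B 0) ts = map (\<lambda>(w, h, h'). (w, h)) ts" "map (?B 1) ts = map (\<lambda>(w, h, h'). (w, h')) ts"
    by (auto simp: case_prod_beta)
  have z: "(0::real) \<in> {0..1}" "(1::real) \<in> {0..1}" by simp_all
  show ?thesis
    unfolding isotopic_def e[symmetric]
    by (intro conjI exI[of _ "\<lambda>s. standard n (map (?B s) ts)"] iso isotopyD(1)[OF iso z(1)] isotopyD(1)[OF iso z(2)] same_picture_refl)
qed

definition standard_word :: "nat \<Rightarrow> hecke_gen list \<Rightarrow> diagram" where
  "standard_word n w = standard n (map (\<lambda>g. ([g], const_half)) w)"

lemma single_valid: "g \<in> hecke_gens n \<Longrightarrow> valid_block n ([g], const_half)"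
  by (simp add: valid_block_def block_letters_single const_half_def)

lemma single_strict: "strictly_descending (block_event_list ([g], h))"
  by (simp add: strictly_descending_def block_event_list_def)

lemma singles:
  assumes "w \<in> lists (hecke_gens n)"
  shows "list_all (valid_block n) (map (\<lambda>g. ([g], const_half)) w)"
    "list_all (\<lambda>B. strictly_descending (block_event_list B)) (map (\<lambda>g. ([g], const_half)) w)"
    "concat (map fst (map (\<lambda>g. ([g], const_half)) w)) = w"
  using assms by (induction w) (auto simp: single_valid single_strict)

lemma standard_word_props:
  assumes w: "w \<in> lists (hecke_gens n)"
  shows "flat n (standard_word n w)" "reads n (standard_word n w) w"
proof -
  let ?bs = "map (\<lambda>g. ([g], const_half)) w"
  note s = singles[OF w]
  show f: "flat n (standard_word n w)" unfolding standard_word_def by (rule standard_props(1)[OF s(1)])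
  show "reads n (standard_word n w) w"
    unfolding reads_def reads_events_def
    using flatD(1)[OF f] strictly_descending_imp[OF event_list_strict[OF s(1,2)]] standard_props(2)[OF s(1)]
      event_list_letters[of ?bs] s(3) unfolding standard_word_def by (intro conjI exI[of _ "event_list ?bs"]) auto
qed

lemma mset_event_list_replace:
  "mset (block_event_list B) = mset (block_event_list B') \<Longrightarrow> mset (event_list (us @ B # vs)) = mset (event_list (us @ B' # vs))"
  by (induction us) simp_all

text \<open>Put \<open>a\<close> and \<open>b\<close> into one block, move them past each other
  there, and separate them again.\<close>

lemma standard_word_swap:
  assumes w: "v @ [a, b] @ w \<in> lists (hecke_gens n)" and far: "far_apart a b"
  shows "isotopic n (standard_word n (v @ [a, b] @ w)) (standard_word n (v @ [b, a] @ w))"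
proof -
  let ?s = "\<lambda>w. map (\<lambda>g. ([g], const_half)) w"
  \<comment> \<open>with \<open>h\<close> the first letter of the block is on top, with \<open>h'\<close> the second one\<close>
  define h where "h k = (if k = 0 then 5/8 else 3/8 :: real)" for k :: nat
  define h' where "h' k = (if k = 0 then 3/8 else 5/8 :: real)" for k :: nat
  let ?bs = "\<lambda>B. ?s v @ B # ?s w"
  have ab: "a \<in> hecke_gens n" "b \<in> hecke_gens n" "v \<in> lists (hecke_gens n)" "w \<in> lists (hecke_gens n)" using w by auto
  have bl: "block_letters n [a, b]" "block_letters n [b, a]"
    by (unfold_locales; use ab far far_apart_sym[OF far] in \<open>auto simp: less_Suc_eq nth_Cons'\<close>)+
  have vb: "valid_block n ([a, b], h)" "valid_block n ([a, b], h')" "valid_block n ([b, a], h)"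
    using bl by (auto simp: valid_block_def h_def h'_def less_Suc_eq)
  have st: "strictly_descending (block_event_list ([x, y], h))" for x y
    by (simp add: strictly_descending_def block_event_list_def h_def upt_rec)
  have all: "list_all (valid_block n) (?bs B)" if "valid_block n B" for B using that singles(1)[OF ab(3)] singles(1)[OF ab(4)] by simp
  have alls: "list_all (\<lambda>B. strictly_descending (block_event_list B)) (?bs ([x, y], h))" for x y
    using st singles(2)[OF ab(3)] singles(2)[OF ab(4)] by simp
  have word: "isotopic n (standard_word n (v @ [x, y] @ w)) (standard n (?bs ([x, y], h)))"
    if "valid_block n ([x, y], h)" "x \<in> hecke_gens n" "y \<in> hecke_gens n" for x y
  proof -
    have l: "v @ [x, y] @ w \<in> lists (hecke_gens n)" using ab that by auto
    show ?thesis
      unfolding standard_word_def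
      by (rule strict_same_letters_isotopic[OF singles(1,2)[OF l] all[OF that(1)] alls])
         (simp add: singles(3)[OF ab(3), simplified] singles(3)[OF ab(4), simplified])
  qed
  let ?t = "\<lambda>w. map (\<lambda>g. ([g], const_half, const_half)) w"
  let ?ts = "?t v @ ([a, b], h, h') # ?t w"
  have "list_all (\<lambda>(w, h, h'). valid_block n (w, h) \<and> valid_block n (w, h')) ?ts"
    using ab vb single_valid[of _ n] by (auto simp: list_all_iff)
  from standard_isotopic[OF this] have mid: "isotopic n (standard n (?bs ([a, b], h))) (standard n (?bs ([a, b], h')))"
    by (simp add: comp_def)
  have "mset (block_event_list ([a, b], h')) = mset (block_event_list ([b, a], h))"
    by (simp add: block_event_list_def h_def h'_def upt_rec)
  from mset_event_list_replace[OF this]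
  have "events n (standard n (?bs ([a, b], h'))) = events n (standard n (?bs ([b, a], h)))"
    using standard_props(2)[OF all[OF vb(2)]] standard_props(2)[OF all[OF vb(3)]] by simp
  then have last: "isotopic n (standard n (?bs ([a, b], h'))) (standard n (?bs ([b, a], h)))"
    using same_events_isotopic[OF flatD(1)[OF standard_props(1)[OF all[OF vb(2)]]] flatD(1)[OF standard_props(1)[OF all[OF vb(3)]]]] by blast
  show ?thesis
    using isotopic_trans[OF isotopic_trans[OF isotopic_trans[OF word[OF vb(1) ab(1,2)] mid] last] isotopic_sym[OF word[OF vb(3) ab(2,1)]]] .
qed

lemma standard_word_far_commutes:
  assumes "far_commutes v w" "v \<in> lists (hecke_gens n)"
  shows "isotopic n (standard_word n v) (standard_word n w)"
  using assms
proof (induction rule: far_commutes.induct)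
  case (unchanged w)
  then show ?case using isotopic_refl flatD(1)[OF standard_word_props(1)] by blast
next
  case (adjacent_swap u v a b w)
  have "v @ [a, b] @ w \<in> lists (hecke_gens n)" using far_commutes_set[OF adjacent_swap(1)] adjacent_swap.prems by (metis in_lists_conv_set)
  from standard_word_swap[OF this adjacent_swap(2)] show ?case using adjacent_swap.IH[OF adjacent_swap.prems] isotopic_trans by blast
qed

subsection \<open>Every diagram is isotopic to the standard diagram of its word\<close>

text \<open>The margins of the constant isotopy apply.\<close>

lemma ties_far_apart:
  assumes d: "is_diagram n d" and sub: "{#(t, g), (t, g')#} \<subseteq># events n d"
  shows "far_apart g g'"
proof -
  obtain \<mu> \<delta> \<epsilon> where m: "isotopy_margin n (\<lambda>_. d) \<mu> \<delta> \<epsilon>" using isotopy_margin_exists[OF isotopy_const[OF d]] by blast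
  interpret isotopy_margin n "\<lambda>_. d" \<mu> \<delta> \<epsilon> by (rule m)
  have in1: "(t, g) \<in># events n d" "(t, g') \<in># events n d" using mset_subset_eqD[OF sub] by auto
  have c: "(t, r) \<in> crossings n d" if "(t, GenT r) \<in># events n d" for r
    using that unfolding events_parts(1)[OF d] by simp
  have sq: "\<exists>i b. (i, b, t) \<in> set (squares d) \<and> x = square_gen b (place n d i t)"
    if x: "(t, x) \<in># events n d" "\<not> is_crossing x" for x
  proof -
    have "(t, x) \<in># filter_mset (\<lambda>(t, g). \<nexists>r. g = GenT r) (events n d)" using x by (simp add: is_crossing_def)
    then show ?thesis unfolding events_parts(2)[OF d, symmetric] by auto
  qed
  have z: "(0::real) \<in> {0..1}" by simp
  have mixed: "far_apart (GenT r) x" if "(t, GenT r) \<in># events n d" "(t, x) \<in># events n d" "\<not> is_crossing x" for r x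
  proof -
    have "\<exists>i b. (i, b, t) \<in> set (squares d) \<and> x = square_gen b (place n d i t)" by (rule sq[OF that(2,3)])
    then show ?thesis using near_crossing_square_far_apart[OF z c[OF that(1)], of _ _ t] pos by auto
  qed
  consider (tt) r s where "g = GenT r" "g' = GenT s" | (ts) r where "g = GenT r" "\<not> is_crossing g'"
    | (st) r where "\<not> is_crossing g" "g' = GenT r" | (ss) "\<not> is_crossing g" "\<not> is_crossing g'"
    unfolding is_crossing_def by blast
  then show ?thesis
  proof cases
    case tt
    have "r \<noteq> s"
    proof
      assume "r = s"
      then have "2 \<le> count (events n d) (t, GenT r)"
        using mset_subset_eq_count[OF sub, of "(t, GenT r)"] tt by simp
      moreover have "count (image_mset (\<lambda>(i, \<epsilon>, t). (t, square_gen \<epsilon> (place n d i t))) (mset (squares d))) (t, GenT r) = 0"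
        unfolding events_parts(2)[OF d] by simp
      moreover have "count (mset_set ((\<lambda>(t, r). (t, GenT r)) ` crossings n d)) (t, GenT r) \<le> 1"
        by (simp add: count_mset_set')
      ultimately show False by (simp add: events_def)
    qed
    then show ?thesis using near_crossings_far_apart[OF z, of t r t s] c in1 tt pos by simp
  next
    case ts
    then show ?thesis using mixed in1 by simp
  next
    case st
    then show ?thesis using mixed in1 far_apart_sym by simp
  next
    case ss
    then show ?thesis by (cases g; cases g') (auto simp: is_crossing_def)
  qed
qed

lemma same_order_Cons_less:
  assumes so: "same_order es fs" and "snd e = snd f"
    and "\<And>x. x \<in> set es \<Longrightarrow> fst x < fst e" "\<And>x. x \<in> set fs \<Longrightarrow> fst x < fst f"
  shows "same_order (e # es) (f # fs)"
  unfolding same_order_def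
proof (intro conjI allI impI)
  have len: "length fs = length es" using so unfolding same_order_def by (metis length_map)
  fix k l assume kl: "k < length (e # es)" "l < length (e # es)"
  have m: "fst (es ! i) < fst e" "fst (fs ! i) < fst f" if "i < length es" for i using assms(3,4) that len by simp_all
  show "fst ((e # es) ! k) < fst ((e # es) ! l) \<longleftrightarrow> fst ((f # fs) ! k) < fst ((f # fs) ! l)"
  proof (cases k)
    case 0
    show ?thesis
    proof (cases l)
      case (Suc l')
      then show ?thesis using 0 kl m[of l'] by simp
    qed (simp add: 0)
  next
    case (Suc k')
    show ?thesis
    proof (cases l)
      case 0
      then show ?thesis using Suc kl m[of k'] by simp
    next
      case (Suc l')
      then show ?thesis using \<open>k = Suc k'\<close> kl so by (simp add: same_order_def)
    qed
  qed
qed (use so assms(2) in \<open>simp add: same_order_def\<close>)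

lemma same_order_Cons_eq:
  assumes so: "same_order es fs" and "snd e = snd f" and ne: "es \<noteq> []" and "fst e = fst (es ! 0)" "fst f = fst (fs ! 0)"
  shows "same_order (e # es) (f # fs)"
  unfolding same_order_def
proof (intro conjI allI impI)
  have P: "fst (es ! k) < fst (es ! l) \<longleftrightarrow> fst (fs ! k) < fst (fs ! l)" if "k < length es" "l < length es" for k l
    using so that by (simp add: same_order_def)
  have z: "0 < length es" using ne by simp
  fix k l assume kl: "k < length (e # es)" "l < length (e # es)"
  show "fst ((e # es) ! k) < fst ((e # es) ! l) \<longleftrightarrow> fst ((f # fs) ! k) < fst ((f # fs) ! l)"
    using P[OF z, of "l - 1"] P[OF _ z, of "k - 1"] P[of "k - 1" "l - 1"] kl assms(4,5) by (cases k; cases l) auto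
qed (use so assms(2) in \<open>simp add: same_order_def\<close>)

lemma same_order_half: "same_order es fs \<Longrightarrow> same_order es (map (\<lambda>(t, g). (t / 2, g)) fs)"
proof -
  assume so: "same_order es fs"
  then have len: "length fs = length es" unfolding same_order_def by (metis length_map)
  show ?thesis using so len by (auto simp: same_order_def case_prod_beta comp_def)
qed

text \<open>Events of equal height are collected in one block with all letters in the middle. In the
  induction a new top event joins the first block if it has the height of the next event, and
  otherwise becomes a block of its own.\<close>

lemma grouping:
  assumes "descending es" "snd ` set es \<subseteq> hecke_gens n"
    and "\<And>i j. i < length es \<Longrightarrow> j < length es \<Longrightarrow> i \<noteq> j \<Longrightarrow> fst (es ! i) = fst (es ! j) \<Longrightarrow> far_apart (snd (es ! i)) (snd (es ! j))"
  shows "\<exists>ws. list_all (\<lambda>w. w \<noteq> [] \<and> block_letters n w) ws \<and> same_order es (event_list (map (\<lambda>w. (w, const_half)) ws))"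
  using assms
proof (induction es)
  case Nil
  then show ?case by (intro exI[of _ "[]"]) (simp add: same_order_def)
next
  case (Cons e es)
  let ?b = "map (\<lambda>w. (w, const_half))"
  have ge: "snd e \<in> hecke_gens n" using Cons.prems(2) by auto
  have "\<exists>ws. list_all (\<lambda>w. w \<noteq> [] \<and> block_letters n w) ws \<and> same_order es (event_list (?b ws))"
  proof (rule Cons.IH)
    show "descending es" using Cons.prems(1) by (simp add: descending_def)
    show "snd ` set es \<subseteq> hecke_gens n" using Cons.prems(2) by auto
    show "far_apart (snd (es ! i)) (snd (es ! j))" if "i < length es" "j < length es" "i \<noteq> j" "fst (es ! i) = fst (es ! j)" for i j
      using Cons.prems(3)[of "Suc i" "Suc j"] that by simp
  qed
  then obtain ws where ws: "list_all (\<lambda>w. w \<noteq> [] \<and> block_letters n w) ws" "same_order es (event_list (?b ws))" by blast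
  have vb: "list_all (valid_block n) (?b ws)" using ws(1) by (auto simp: list_all_iff valid_block_def const_half_def)
  have le: "fst x \<le> fst e" if "x \<in> set es" for x using Cons.prems(1) that by (simp add: descending_def)
  have len: "length (event_list (?b ws)) = length es" using ws(2) unfolding same_order_def by (metis length_map)
  show ?case
  proof (cases "\<exists>x\<in>set es. fst x = fst e")
    case False
    then have lt: "fst x < fst e" if "x \<in> set es" for x using le[OF that] that by force
    let ?f = "((1 + 1/2) / 2, snd e) :: real \<times> hecke_gen"
    have "event_list (?b ([snd e] # ws)) = ?f # map (\<lambda>(t, g). (t / 2, g)) (event_list (?b ws))"
      by (simp add: block_event_list_def const_half_def)
    moreover have "same_order (e # es) (?f # map (\<lambda>(t, g). (t / 2, g)) (event_list (?b ws)))"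
    proof (intro same_order_Cons_less same_order_half ws(2))
      fix x assume "x \<in> set (map (\<lambda>(t, g). (t / 2, g)) (event_list (?b ws)))"
      then obtain y where "y \<in> set (event_list (?b ws))" "x = (fst y / 2, snd y)" by (auto simp: case_prod_beta)
      then show "fst x < fst ?f" using event_list_heights[OF vb, of y] by simp
    qed (use lt in simp_all)
    ultimately show ?thesis using ws(1) block_letters_single[OF ge] by (intro exI[of _ "[snd e] # ws"]) simp
  next
    case True
    then have ne: "es \<noteq> []" by auto
    then obtain w0 ws0 where w: "ws = w0 # ws0" "w0 \<noteq> []" using ws len by (cases ws) auto
    have e0: "fst (es ! 0) = fst e"
    proof -
      obtain x where x: "x \<in> set es" "fst x = fst e" using True by blast
      have "fst x \<le> fst (es ! 0)" using x(1) Cons.prems(1) by (cases es) (auto simp: descending_def)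
      then show ?thesis using le[of "es ! 0"] ne x(2) by force
    qed
    let ?h = "(1 + 1/2) / 2 :: real"
    have first: "event_list (?b ws) ! k = (?h, w0 ! k)" if "k < length w0" for k
      using that by (simp add: w nth_append block_event_list_def const_half_def)
    have l0: "length w0 \<le> length es" using len by (simp add: w block_event_list_def)
    have letter: "snd (es ! k) = w0 ! k" if k: "k < length w0" for k
    proof -
      have "map snd es ! k = map snd (event_list (?b ws)) ! k" using ws(2) by (simp only: same_order_def)
      then show ?thesis using k l0 len first[OF k] by simp
    qed
    have height: "fst (es ! k) = fst e" if k: "k < length w0" for k
    proof -
      have P: "fst (es ! i) < fst (es ! j) \<longleftrightarrow> fst (event_list (?b ws) ! i) < fst (event_list (?b ws) ! j)"
        if "i < length es" "j < length es" for i j using ws(2) that by (simp add: same_order_def)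
      have "0 < length w0" using w(2) by simp
      then show ?thesis using P[of 0 k] P[of k 0] first[OF k] first[of 0] l0 k e0 by force
    qed
    have far: "far_apart (snd e) (w0 ! k)" if k: "k < length w0" for k
      using Cons.prems(3)[of 0 "Suc k"] k l0 height[OF k] letter[OF k] by simp
    interpret W: block_letters n w0 using ws(1) w(1) by simp
    have bl: "block_letters n (snd e # w0)"
    proof
      show "snd e # w0 \<in> lists (hecke_gens n)" using ge W.letters by simp
      fix k l assume kl: "k < length (snd e # w0)" "l < length (snd e # w0)" "k \<noteq> l"
      show "far_apart ((snd e # w0) ! k) ((snd e # w0) ! l)"
        using kl far[of "l - 1"] far_apart_sym[OF far[of "k - 1"]] W.far[of "k - 1" "l - 1"] by (cases k; cases l) auto
    qed
    have "block_event_list (snd e # w0, const_half) = (1/2, snd e) # block_event_list (w0, const_half)"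
      unfolding block_event_list_def by (simp add: const_half_def upt_conv_Cons map_Suc_upt[symmetric] comp_def del: upt_Suc map_Suc_upt)
    then have "event_list (?b ((snd e # w0) # ws0)) = (?h, snd e) # event_list (?b ws)" by (simp add: w)
    moreover have "same_order (e # es) ((?h, snd e) # event_list (?b ws))"
      using first[of 0] w(2) e0 by (intro same_order_Cons_eq ws(2) ne) auto
    ultimately show ?thesis using ws(1) bl w(1) by (intro exI[of _ "(snd e # w0) # ws0"]) simp
  qed
qed

text \<open>Distinct heights for the letters of a block with \<open>m\<close> letters, decreasing
  and between \<open>1/4\<close> and \<open>3/4\<close>.\<close>

definition spread :: "nat \<Rightarrow> nat \<Rightarrow> real" where
  "spread m k = 3/4 - (real k + 1) / (2 * (real m + 1))"

lemma spread_props: "k < m \<Longrightarrow> 1/4 < spread m k \<and> spread m k < 3/4" "k < l \<Longrightarrow> spread m l < spread m k"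
proof -
  assume "k < m"
  then have "0 < (real k + 1) / (2 * (real m + 1))" "(real k + 1) / (2 * (real m + 1)) < 1/2" by (auto simp: field_simps)
  then show "1/4 < spread m k \<and> spread m k < 3/4" unfolding spread_def by linarith
next
  assume "k < l"
  then have "(real k + 1) / (2 * (real m + 1)) < (real l + 1) / (2 * (real m + 1))" by (intro divide_strict_right_mono) auto
  then show "spread m l < spread m k" by (simp add: spread_def)
qed

text \<open>The diagram is isotopic to a pile of blocks with the same pattern of equal heights.
  Spreading the letters within each block makes all heights distinct, and then only the word
  matters.\<close>

theorem reads_isotopic_standard:
  assumes r: "reads n d w"
  shows "isotopic n d (standard_word n w)"
proof -
  have d: "is_diagram n d" using r by (simp add: reads_def)
  obtain es where es: "descending es" "mset es = events n d" "map snd es = w" using r by (auto simp: reads_def reads_events_def)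
  have w: "w \<in> lists (hecke_gens n)" by (rule reads_letters[OF r])
  have "\<exists>ws. list_all (\<lambda>w. w \<noteq> [] \<and> block_letters n w) ws \<and> same_order es (event_list (map (\<lambda>w. (w, const_half)) ws))"
  proof (rule grouping[OF es(1)])
    have "set w = snd ` set es" unfolding es(3)[symmetric] by simp
    then show "snd ` set es \<subseteq> hecke_gens n" using w by (auto simp: in_lists_conv_set)
    fix i j assume ij: "i < length es" "j < length es" "i \<noteq> j" "fst (es ! i) = fst (es ! j)"
    have "{#es ! i, es ! j#} \<subseteq># events n d" using pair_in_mset_nth[OF ij(1-3)] es(2) by simp
    then show "far_apart (snd (es ! i)) (snd (es ! j))"
      using ties_far_apart[OF d, of "fst (es ! i)" "snd (es ! i)" "snd (es ! j)"] ij(4) by (metis prod.collapse)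
  qed
  then obtain ws where ws: "list_all (\<lambda>w. w \<noteq> [] \<and> block_letters n w) ws" "same_order es (event_list (map (\<lambda>w. (w, const_half)) ws))" by blast
  let ?b = "map (\<lambda>w. (w, const_half)) ws" and ?c = "map (\<lambda>w. (w, spread (length w))) ws"
  have vb: "list_all (valid_block n) ?b" and vc: "list_all (valid_block n) ?c"
    using ws(1) spread_props(1) by (auto simp: list_all_iff valid_block_def const_half_def)
  have sc: "list_all (\<lambda>B. strictly_descending (block_event_list B)) ?c"
    unfolding list_all_iff strictly_descending_def block_event_list_def
    using spread_props(2) by (auto simp: sorted_wrt_map intro!: sorted_wrt_mono_rel[OF _ sorted_wrt_upt])
  have 1: "isotopic n d (standard n ?b)"
    by (rule same_order_isotopic[OF d flatD(1)[OF standard_props(1)[OF vb]] es(2) standard_props(2)[OF vb, symmetric] ws(2)])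
  let ?t = "map (\<lambda>w. (w, const_half, spread (length w))) ws"
  have "list_all (\<lambda>(w, h, h'). valid_block n (w, h) \<and> valid_block n (w, h')) ?t"
    using vb vc by (auto simp: list_all_iff)
  from standard_isotopic[OF this] have 2: "isotopic n (standard n ?b) (standard n ?c)" by (simp add: comp_def)
  have "concat (map fst ?c) = concat (map fst ?b)" by (simp add: comp_def)
  also have "\<dots> = w" using event_list_letters[of ?b] ws(2) es(3) by (simp add: same_order_def)
  finally have cw: "concat (map fst ?c) = w" .
  have 3: "isotopic n (standard n ?c) (standard_word n w)"
    unfolding standard_word_def
    by (rule strict_same_letters_isotopic[OF vc sc singles(1,2)[OF w]]) (use cw singles(3)[OF w] in simp)
  show ?thesis using isotopic_trans[OF isotopic_trans[OF 1 2] 3] .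
qed

lemma isotopic_iff_words:
  assumes "reads n d v" "reads n e w"
  shows "isotopic n d e \<longleftrightarrow> far_commutes v w"
proof
  assume "isotopic n d e" then show "far_commutes v w" using isotopic_far_commutes assms by blast
next
  assume f: "far_commutes v w"
  have "isotopic n (standard_word n v) (standard_word n w)"
    by (rule standard_word_far_commutes[OF f reads_letters[OF assms(1)]])
  then show "isotopic n d e"
    using reads_isotopic_standard[OF assms(1)] isotopic_sym[OF reads_isotopic_standard[OF assms(2)]] isotopic_trans by blast
qed

section \<open>Algebras, their monoid algebras and quotients\<close>

locale assoc_algebra = ring A for A :: "('r::comm_ring_1, 'a) module" (structure) +
  assumes smult_closed [simp, intro]: "x \<in> carrier A \<Longrightarrow> a \<odot> x \<in> carrier A"
    and smult_l_distr: "x \<in> carrier A \<Longrightarrow> (a + b) \<odot> x = a \<odot> x \<oplus> b \<odot> x"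
    and smult_r_distr: "x \<in> carrier A \<Longrightarrow> y \<in> carrier A \<Longrightarrow> a \<odot> (x \<oplus> y) = a \<odot> x \<oplus> a \<odot> y"
    and smult_smult: "x \<in> carrier A \<Longrightarrow> (a * b) \<odot> x = a \<odot> (b \<odot> x)"
    and smult_one: "x \<in> carrier A \<Longrightarrow> 1 \<odot> x = x"
    and smult_mult_left: "x \<in> carrier A \<Longrightarrow> y \<in> carrier A \<Longrightarrow> (a \<odot> x) \<otimes> y = a \<odot> (x \<otimes> y)"
    and smult_mult_right: "x \<in> carrier A \<Longrightarrow> y \<in> carrier A \<Longrightarrow> x \<otimes> (a \<odot> y) = a \<odot> (x \<otimes> y)"
begin

lemma smult_zero_left: assumes x: "x \<in> carrier A" shows "0 \<odot> x = \<zero>"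
proof -
  have "0 \<odot> x \<oplus> 0 \<odot> x = 0 \<odot> x"
    using smult_l_distr[OF x, of 0 0] by simp
  then show ?thesis using x by (metis add.l_cancel_one' smult_closed)
qed

lemma smult_zero_right: "a \<odot> \<zero> = \<zero>"
proof -
  have "a \<odot> \<zero> \<oplus> a \<odot> \<zero> = a \<odot> \<zero>"
    using smult_r_distr[of \<zero> \<zero> a] by simp
  then show ?thesis by (metis add.l_cancel_one' smult_closed zero_closed)
qed

lemma smult_minus_one: assumes x: "x \<in> carrier A" shows "(- 1) \<odot> x = \<ominus> x"
proof -
  have "(- 1) \<odot> x \<oplus> x = \<zero>"
    using smult_l_distr[OF x, of "-1" 1] x by (simp add: smult_one smult_zero_left)
  then show ?thesis using x by (simp add: minus_equality)
qed

lemma smult_minus: assumes x: "x \<in> carrier A" shows "(- a) \<odot> x = \<ominus> (a \<odot> x)"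
  using smult_smult[OF x, of "-1" a] x by (simp add: smult_minus_one)

lemma smult_minus_right: assumes x: "x \<in> carrier A" shows "a \<odot> (\<ominus> x) = \<ominus> (a \<odot> x)"
  using smult_smult[OF x, of a "-1"] x by (simp add: smult_minus_one smult_minus smult_one)

lemma smult_diff: assumes x: "x \<in> carrier A" shows "(a - b) \<odot> x = a \<odot> x \<ominus> b \<odot> x"
  using smult_l_distr[OF x, of a "- b"] x by (simp add: smult_minus minus_eq)

end

definition algebra_hom :: "('r::comm_ring_1, 'a) module \<Rightarrow> ('r, 'b) module \<Rightarrow> ('a \<Rightarrow> 'b) set" where
  "algebra_hom A B = {f \<in> ring_hom A B. \<forall>a. \<forall>x \<in> carrier A. f (a \<odot>\<^bsub>A\<^esub> x) = a \<odot>\<^bsub>B\<^esub> f x}"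

lemma algebra_homD:
  assumes "f \<in> algebra_hom A B"
  shows "f \<in> ring_hom A B"
    and "\<And>x. x \<in> carrier A \<Longrightarrow> f x \<in> carrier B"
    and "\<And>x y. x \<in> carrier A \<Longrightarrow> y \<in> carrier A \<Longrightarrow> f (x \<otimes>\<^bsub>A\<^esub> y) = f x \<otimes>\<^bsub>B\<^esub> f y"
    and "\<And>x y. x \<in> carrier A \<Longrightarrow> y \<in> carrier A \<Longrightarrow> f (x \<oplus>\<^bsub>A\<^esub> y) = f x \<oplus>\<^bsub>B\<^esub> f y"
    and "f \<one>\<^bsub>A\<^esub> = \<one>\<^bsub>B\<^esub>"
    and "\<And>a x. x \<in> carrier A \<Longrightarrow> f (a \<odot>\<^bsub>A\<^esub> x) = a \<odot>\<^bsub>B\<^esub> f x"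
  using assms unfolding algebra_hom_def ring_hom_def by auto

lemma algebra_hom_minus:
  assumes f: "f \<in> algebra_hom A B" and A: "assoc_algebra A" and B: "assoc_algebra B"
    and x: "x \<in> carrier A" and y: "y \<in> carrier A"
  shows "f (x \<ominus>\<^bsub>A\<^esub> y) = f x \<ominus>\<^bsub>B\<^esub> f y"
proof -
  interpret A: assoc_algebra A by fact
  interpret B: assoc_algebra B by fact
  note h = algebra_homD[OF f]
  have "f (\<ominus>\<^bsub>A\<^esub> y) = \<ominus>\<^bsub>B\<^esub> f y"
    using h(6)[OF y, of "-1"] h(2)[OF y] y by (simp add: A.smult_minus_one B.smult_minus_one)
  then show ?thesis using h(4)[OF x, of "\<ominus>\<^bsub>A\<^esub> y"] y by (simp add: A.minus_eq B.minus_eq)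
qed

lemma algebra_hom_zero:
  assumes f: "f \<in> algebra_hom A B" and A: "assoc_algebra A" and B: "assoc_algebra B"
  shows "f \<zero>\<^bsub>A\<^esub> = \<zero>\<^bsub>B\<^esub>"
  using ring_hom_zero[OF algebra_homD(1)[OF f]] A B by (simp add: assoc_algebra_def)

lemma algebra_hom_comp:
  "f \<in> algebra_hom A B \<Longrightarrow> g \<in> algebra_hom B C \<Longrightarrow> g \<circ> f \<in> algebra_hom A C"
  by (simp add: algebra_hom_def ring_hom_def Pi_def)

lemma algebra_iso_if_inverse:
  assumes f: "f \<in> algebra_hom A B" and g: "g \<in> algebra_hom B A"
    and gf: "\<And>x. x \<in> carrier A \<Longrightarrow> g (f x) = x" and fg: "\<And>y. y \<in> carrier B \<Longrightarrow> f (g y) = y"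
  shows "f \<in> algebra_iso A B"
proof -
  have "bij_betw f (carrier A) (carrier B)"
    by (rule bij_betw_byWitness[where f' = g])
       (use gf fg algebra_homD(2)[OF f] algebra_homD(2)[OF g] in auto)
  then show ?thesis using f by (simp add: algebra_iso_def ring_iso_def algebra_hom_def)
qed

subsection \<open>Monoid algebras\<close>

definition supp :: "('m \<Rightarrow> 'r::zero) \<Rightarrow> 'm set" where "supp f = {x. f x \<noteq> 0}"

text \<open>The product of the monoid algebra, written as a double sum over fixed finite sets so
  that sums can be exchanged.\<close>

definition conv :: "'m monoid \<Rightarrow> ('m \<Rightarrow> 'r::comm_ring_1) \<Rightarrow> ('m \<Rightarrow> 'r) \<Rightarrow> 'm \<Rightarrow> 'r" where
  "conv M f g z = (\<Sum>x\<in>supp f. \<Sum>y\<in>supp g. if x \<otimes>\<^bsub>M\<^esub> y = z then f x * g y else 0)"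

lemma conv_superset:
  assumes "finite F" "supp f \<subseteq> F" "finite G" "supp g \<subseteq> G"
  shows "conv M f g z = (\<Sum>x\<in>F. \<Sum>y\<in>G. if x \<otimes>\<^bsub>M\<^esub> y = z then f x * g y else 0)"
proof -
  have "(\<Sum>y\<in>supp g. if x \<otimes>\<^bsub>M\<^esub> y = z then f x * g y else 0) =
    (\<Sum>y\<in>G. if x \<otimes>\<^bsub>M\<^esub> y = z then f x * g y else 0)" for x
    using assms by (intro sum.mono_neutral_left) (auto simp: supp_def)
  moreover have "(\<Sum>x\<in>supp f. \<Sum>y\<in>G. if x \<otimes>\<^bsub>M\<^esub> y = z then f x * g y else 0) =
    (\<Sum>x\<in>F. \<Sum>y\<in>G. if x \<otimes>\<^bsub>M\<^esub> y = z then f x * g y else 0)"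
    using assms by (intro sum.mono_neutral_left) (auto simp: supp_def intro!: sum.neutral split: if_splits)
  ultimately show ?thesis by (simp add: conv_def)
qed

lemma mult_eq_conv:
  assumes "finite (supp f)" "finite (supp g)"
  shows "f \<otimes>\<^bsub>monoid_algebra M\<^esub> g = conv M f g"
proof
  fix z
  have eq: "{(x, y). f x \<noteq> 0 \<and> g y \<noteq> 0 \<and> x \<otimes>\<^bsub>M\<^esub> y = z} =
        (supp f \<times> supp g) \<inter> {p. fst p \<otimes>\<^bsub>M\<^esub> snd p = z}"
    by (auto simp: supp_def)
  have "conv M f g z = (\<Sum>p\<in>supp f \<times> supp g. if fst p \<otimes>\<^bsub>M\<^esub> snd p = z then f (fst p) * g (snd p) else 0)"
    by (simp add: conv_def sum.cartesian_product case_prod_beta)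
  also have "\<dots> = (\<Sum>p\<in>(supp f \<times> supp g) \<inter> {p. fst p \<otimes>\<^bsub>M\<^esub> snd p = z}. f (fst p) * g (snd p))"
    using assms by (subst sum.inter_restrict) auto
  finally show "(f \<otimes>\<^bsub>monoid_algebra M\<^esub> g) z = conv M f g z"
    by (simp add: monoid_algebra_def eq case_prod_beta)
qed

lemma carrier_monoid_algebra:
  "f \<in> carrier (monoid_algebra M) \<longleftrightarrow> finite (supp f) \<and> supp f \<subseteq> carrier M"
  by (simp add: monoid_algebra_def supp_def)

lemma monoid_algebra_ops:
  "f \<oplus>\<^bsub>monoid_algebra M\<^esub> g = (\<lambda>x. f x + g x)" "\<zero>\<^bsub>monoid_algebra M\<^esub> = (\<lambda>x. 0)"
  "a \<odot>\<^bsub>monoid_algebra M\<^esub> f = (\<lambda>x. a * f x)" "\<one>\<^bsub>monoid_algebra M\<^esub> = basis_elt \<one>\<^bsub>M\<^esub>"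
  by (simp_all add: monoid_algebra_def)

lemma supp_basis_elt: "supp (basis_elt m :: _ \<Rightarrow> 'r::comm_ring_1) = {m}"
  by (auto simp: supp_def basis_elt_def)

lemma supp_add: "supp (\<lambda>x. f x + g x :: 'r::comm_ring_1) \<subseteq> supp f \<union> supp g"
  by (auto simp: supp_def)

lemma supp_smult: "supp (\<lambda>x. a * f x :: 'r::comm_ring_1) \<subseteq> supp f"
  by (auto simp: supp_def)

lemma basis_elt_closed [simp]: "m \<in> carrier M \<Longrightarrow> basis_elt m \<in> carrier (monoid_algebra M)"
  by (simp add: carrier_monoid_algebra supp_basis_elt)

lemma monoid_algebra_add_closed:
  assumes "f \<in> carrier (monoid_algebra M)" "g \<in> carrier (monoid_algebra M)"
  shows "(\<lambda>x. f x + g x) \<in> carrier (monoid_algebra M)"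
  using assms supp_add[of f g] by (auto simp: carrier_monoid_algebra intro: finite_subset)

lemma monoid_algebra_smult_closed:
  assumes "f \<in> carrier (monoid_algebra M)"
  shows "(\<lambda>x. a * f x) \<in> carrier (monoid_algebra M)"
  using assms supp_smult[of a f] by (auto simp: carrier_monoid_algebra intro: finite_subset)

lemma monoid_algebra_induct [consumes 1, case_names zero step]:
  assumes f: "f \<in> carrier (monoid_algebra M)"
    and z: "P (\<lambda>x. 0)"
    and s: "\<And>a m f. m \<in> carrier M \<Longrightarrow> f \<in> carrier (monoid_algebra M) \<Longrightarrow> P f \<Longrightarrow>
              P (\<lambda>x. a * basis_elt m x + f x)"
  shows "P (f :: _ \<Rightarrow> 'r::comm_ring_1)"
proof -
  have "finite S \<Longrightarrow> supp f \<subseteq> S \<Longrightarrow> S \<subseteq> carrier M \<Longrightarrow> P f" for S and f :: "'a \<Rightarrow> 'r"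
  proof (induction S arbitrary: f rule: finite_induct)
    case empty
    then have "f = (\<lambda>x. 0)" by (auto simp: supp_def)
    then show ?case using z by simp
  next
    case (insert m S)
    let ?g = "f(m := 0)"
    have g: "supp ?g \<subseteq> S" using insert by (auto simp: supp_def)
    then have "?g \<in> carrier (monoid_algebra M)"
      using insert by (auto simp: carrier_monoid_algebra intro: finite_subset)
    then have "P (\<lambda>x. f m * basis_elt m x + ?g x)"
      using insert g by (intro s) (simp_all del: fun_upd_apply)
    also have "(\<lambda>x. f m * basis_elt m x + ?g x) = f" by (auto simp: basis_elt_def)
    finally show ?case .
  qed
  then show ?thesis using f by (auto simp: carrier_monoid_algebra)
qed

lemma conv_add_left:
  assumes "finite (supp f)" "finite (supp g)" "finite (supp h)"
  shows "conv M (\<lambda>x. f x + g x) h = (\<lambda>z. conv M f h z + conv M g h z)"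
proof
  fix z
  let ?F = "supp f \<union> supp g"
  have "conv M (\<lambda>x. f x + g x) h z =
     (\<Sum>x\<in>?F. \<Sum>y\<in>supp h. if x \<otimes>\<^bsub>M\<^esub> y = z then (f x + g x) * h y else 0)"
    using assms supp_add[of f g] by (intro conv_superset) auto
  also have "\<dots> = (\<Sum>x\<in>?F. \<Sum>y\<in>supp h. (if x \<otimes>\<^bsub>M\<^esub> y = z then f x * h y else 0) + (if x \<otimes>\<^bsub>M\<^esub> y = z then g x * h y else 0))"
    by (intro sum.cong) (auto simp: algebra_simps)
  also have "\<dots> = conv M f h z + conv M g h z"
    using assms by (simp add: sum.distrib conv_superset[of ?F f "supp h" h] conv_superset[of ?F g "supp h" h])
  finally show "conv M (\<lambda>x. f x + g x) h z = conv M f h z + conv M g h z" .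
qed

lemma conv_add_right:
  assumes "finite (supp f)" "finite (supp g)" "finite (supp h)"
  shows "conv M h (\<lambda>x. f x + g x) = (\<lambda>z. conv M h f z + conv M h g z)"
proof
  fix z
  let ?F = "supp f \<union> supp g"
  have "conv M h (\<lambda>x. f x + g x) z =
     (\<Sum>y\<in>supp h. \<Sum>x\<in>?F. if y \<otimes>\<^bsub>M\<^esub> x = z then h y * (f x + g x) else 0)"
    using assms supp_add[of f g] by (intro conv_superset) auto
  also have "\<dots> = (\<Sum>y\<in>supp h. \<Sum>x\<in>?F. (if y \<otimes>\<^bsub>M\<^esub> x = z then h y * f x else 0) + (if y \<otimes>\<^bsub>M\<^esub> x = z then h y * g x else 0))"
    by (intro sum.cong) (auto simp: algebra_simps)
  also have "\<dots> = conv M h f z + conv M h g z"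
    using assms by (simp add: sum.distrib conv_superset[of "supp h" h ?F f] conv_superset[of "supp h" h ?F g])
  finally show "conv M h (\<lambda>x. f x + g x) z = conv M h f z + conv M h g z" .
qed

lemma conv_smult_left:
  assumes "finite (supp f)" "finite (supp h)"
  shows "conv M (\<lambda>x. a * f x) h = (\<lambda>z. a * conv M f h z)"
proof
  fix z
  show "conv M (\<lambda>x. a * f x) h z = a * conv M f h z"
    using assms supp_smult[of a f]
    by (subst conv_superset[of "supp f" _ "supp h"])
       (auto simp: conv_def sum_distrib_left mult.assoc intro!: sum.cong)
qed

lemma conv_smult_right:
  assumes "finite (supp f)" "finite (supp h)"
  shows "conv M h (\<lambda>x. a * f x) = (\<lambda>z. a * conv M h f z)"
proof
  fix z
  show "conv M h (\<lambda>x. a * f x) z = a * conv M h f z"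
    using assms supp_smult[of a f]
    by (subst conv_superset[of "supp h" _ "supp f"])
       (auto simp: conv_def sum_distrib_left algebra_simps intro!: sum.cong)
qed

lemma conv_basis_elt: "conv M (basis_elt x) (basis_elt y) = basis_elt (x \<otimes>\<^bsub>M\<^esub> y)"
  unfolding conv_def supp_basis_elt by (auto simp: basis_elt_def)

lemma conv_zero: "conv M (\<lambda>x. 0) f = (\<lambda>x. 0)" "conv M f (\<lambda>x. 0) = (\<lambda>x. 0)"
  by (auto simp: conv_def supp_def)

lemma conv_closed:
  assumes "Group.monoid M" "f \<in> carrier (monoid_algebra M)" "g \<in> carrier (monoid_algebra M)"
  shows "conv M f g \<in> carrier (monoid_algebra M)"
proof -
  have "supp (conv M f g) \<subseteq> (\<lambda>(x, y). x \<otimes>\<^bsub>M\<^esub> y) ` (supp f \<times> supp g)"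
  proof
    fix z assume "z \<in> supp (conv M f g)"
    then have "conv M f g z \<noteq> 0" by (simp add: supp_def)
    then obtain x where x: "x \<in> supp f"
      "(\<Sum>y\<in>supp g. if x \<otimes>\<^bsub>M\<^esub> y = z then f x * g y else 0) \<noteq> 0"
      unfolding conv_def by (rule sum.not_neutral_contains_not_neutral)
    from x(2) obtain y where "y \<in> supp g" "(if x \<otimes>\<^bsub>M\<^esub> y = z then f x * g y else 0) \<noteq> 0"
      by (rule sum.not_neutral_contains_not_neutral)
    then show "z \<in> (\<lambda>(x, y). x \<otimes>\<^bsub>M\<^esub> y) ` (supp f \<times> supp g)"
      using x by (auto split: if_splits)
  qed
  moreover have "finite ((\<lambda>(x, y). x \<otimes>\<^bsub>M\<^esub> y) ` (supp f \<times> supp g))"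
    "(\<lambda>(x, y). x \<otimes>\<^bsub>M\<^esub> y) ` (supp f \<times> supp g) \<subseteq> carrier M"
    using assms(2,3) monoid.m_closed[OF assms(1)] by (auto simp: carrier_monoid_algebra)
  ultimately show ?thesis
    unfolding carrier_monoid_algebra by (meson finite_subset subset_trans)
qed

lemma conv_step_left:
  assumes "finite (supp f)" "finite (supp g)"
  shows "conv M (\<lambda>x. a * basis_elt m x + f x) g = (\<lambda>z. a * conv M (basis_elt m) g z + conv M f g z)"
  using assms finite_subset[OF supp_smult[of a "basis_elt m"]]
  by (simp only: conv_add_left conv_smult_left supp_basis_elt finite.intros)

lemma conv_step_right:
  assumes "finite (supp f)" "finite (supp g)"
  shows "conv M g (\<lambda>x. a * basis_elt m x + f x) = (\<lambda>z. a * conv M g (basis_elt m) z + conv M g f z)"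
  using assms finite_subset[OF supp_smult[of a "basis_elt m"]]
  by (simp only: conv_add_right conv_smult_right supp_basis_elt finite.intros)

lemma conv_assoc:
  assumes M: "Group.monoid M" and f: "f \<in> carrier (monoid_algebra M)"
    and g: "g \<in> carrier (monoid_algebra M)" and h: "h \<in> carrier (monoid_algebra M)"
  shows "conv M (conv M f g) h = conv M f (conv M g h)"
proof -
  interpret M: Group.monoid M by fact
  have fin: "f \<in> carrier (monoid_algebra M) \<Longrightarrow> finite (supp f)" for f :: "_ \<Rightarrow> 'b"
    by (simp add: carrier_monoid_algebra)
  have fb: "finite (supp (basis_elt m :: _ \<Rightarrow> 'b))" for m by (simp add: supp_basis_elt)
  have comb: "conv M (\<lambda>z. a * p z + q z) h = (\<lambda>z. a * conv M p h z + conv M q h z)"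
    "conv M h (\<lambda>z. a * p z + q z) = (\<lambda>z. a * conv M h p z + conv M h q z)"
    if "finite (supp p)" "finite (supp q)" "finite (supp h)" for a and p q h :: "_ \<Rightarrow> 'b"
    using that finite_subset[OF supp_smult[of a p]]
    by (simp_all only: conv_add_left conv_add_right conv_smult_left conv_smult_right)
  have cl: "f \<in> carrier (monoid_algebra M) \<Longrightarrow> g \<in> carrier (monoid_algebra M) \<Longrightarrow>
      finite (supp (conv M f g))" for f g :: "_ \<Rightarrow> 'b"
    using conv_closed[OF M] by (blast intro: fin)
  have bb: "conv M (conv M (basis_elt m) (basis_elt n)) h = conv M (basis_elt m) (conv M (basis_elt n) h)"
    if m: "m \<in> carrier M" and n: "n \<in> carrier M" for m n
    using h
  proof (induction h rule: monoid_algebra_induct)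
    case zero
    show ?case by (simp only: conv_zero)
  next
    case (step a k h)
    have f1: "finite (supp (conv M (basis_elt n :: _ \<Rightarrow> 'b) h))" using step n by (intro cl) auto
    have f2: "finite (supp (basis_elt (n \<otimes>\<^bsub>M\<^esub> k) :: _ \<Rightarrow> 'b))" by (rule fb)
    show ?case
      unfolding conv_step_right[OF fin[OF step(2)] fb] conv_basis_elt comb(2)[OF f2 f1 fb]
        M.m_assoc[OF m n step(1)] step(3)[unfolded conv_basis_elt] by (rule refl)
  qed
  have bg: "conv M (conv M (basis_elt m) g) h = conv M (basis_elt m) (conv M g h)"
    if m: "m \<in> carrier M" for m
    using g
  proof (induction g rule: monoid_algebra_induct)
    case zero
    show ?case by (simp only: conv_zero)
  next
    case (step a k g)
    have f: "finite (supp (conv M (basis_elt k :: _ \<Rightarrow> 'b) h))" "finite (supp (conv M g h))"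
      "finite (supp (conv M (basis_elt m) g))"
      using step m h by (auto intro!: cl)
    have f': "finite (supp (conv M (basis_elt m) (basis_elt k) :: _ \<Rightarrow> 'b))"
      unfolding conv_basis_elt by (rule fb)
    show ?case
      unfolding conv_step_right[OF fin[OF step(2)] fb] conv_step_left[OF fin[OF step(2)] fin[OF h]]
        comb(1)[OF f' f(3) fin[OF h]] comb(2)[OF f(1,2) fb] bb[OF m step(1)] step(3)
      by (rule refl)
  qed
  show ?thesis
    using f
  proof (induction f rule: monoid_algebra_induct)
    case zero
    show ?case by (simp only: conv_zero)
  next
    case (step a k f)
    have f: "finite (supp (conv M (basis_elt k :: _ \<Rightarrow> 'b) g))" "finite (supp (conv M f g))"
      "finite (supp (conv M g h))"
      using step g h by (auto intro!: cl)
    show ?case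
      unfolding conv_step_left[OF fin[OF step(2)] fin[OF g]] conv_step_left[OF fin[OF step(2)] f(3)]
        comb(1)[OF f(1,2) fin[OF h]] bg[OF step(1)] step(3)
      by (rule refl)
  qed
qed

lemma conv_one:
  assumes M: "Group.monoid M" and f: "f \<in> carrier (monoid_algebra M)"
  shows "conv M (basis_elt \<one>\<^bsub>M\<^esub>) f = f" "conv M f (basis_elt \<one>\<^bsub>M\<^esub>) = f"
proof -
  interpret M: Group.monoid M by fact
  have "conv M (basis_elt \<one>\<^bsub>M\<^esub>) f = f \<and> conv M f (basis_elt \<one>\<^bsub>M\<^esub>) = f"
    using f
  proof (induction f rule: monoid_algebra_induct)
    case zero
    show ?case by (simp add: conv_zero)
  next
    case (step a k f)
    have fin: "finite (supp f)" "finite (supp (basis_elt \<one>\<^bsub>M\<^esub> :: _ \<Rightarrow> 'b))"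
      using step by (simp_all add: carrier_monoid_algebra supp_basis_elt)
    show ?case
      unfolding conv_step_left[OF fin] conv_step_right[OF fin] conv_basis_elt
        M.l_one[OF step(1)] M.r_one[OF step(1)] step(3)[THEN conjunct1] step(3)[THEN conjunct2]
      by (intro conjI refl)
  qed
  then show "conv M (basis_elt \<one>\<^bsub>M\<^esub>) f = f" "conv M f (basis_elt \<one>\<^bsub>M\<^esub>) = f" by auto
qed

lemma monoid_algebra_is_algebra:
  assumes M: "Group.monoid M"
  shows "assoc_algebra (monoid_algebra M :: ('r::comm_ring_1, 'm \<Rightarrow> 'r) module)"
proof -
  interpret M: Group.monoid M by fact
  let ?A = "monoid_algebra M :: ('r, 'm \<Rightarrow> 'r) module"
  have fin: "f \<in> carrier ?A \<Longrightarrow> finite (supp f)" for f by (simp add: carrier_monoid_algebra)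
  have mult: "f \<in> carrier ?A \<Longrightarrow> g \<in> carrier ?A \<Longrightarrow> f \<otimes>\<^bsub>?A\<^esub> g = conv M f g" for f g
    by (simp add: mult_eq_conv fin)
  have zero: "(\<lambda>x. 0) \<in> carrier ?A" by (simp add: carrier_monoid_algebra supp_def)
  note cl = conv_closed[OF M] and one = conv_one[OF M] and assoc = conv_assoc[OF M]
  have "ring ?A"
  proof (rule ringI)
    show "abelian_group ?A"
    proof (rule abelian_groupI)
      fix f assume "f \<in> carrier ?A"
      then show "\<exists>g\<in>carrier ?A. g \<oplus>\<^bsub>?A\<^esub> f = \<zero>\<^bsub>?A\<^esub>"
        by (intro bexI[where x = "\<lambda>x. (-1) * f x"] monoid_algebra_smult_closed)
           (simp_all add: monoid_algebra_ops)
    qed (simp_all add: monoid_algebra_ops zero monoid_algebra_add_closed ac_simps)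
    show "Group.monoid ?A"
      by (rule monoidI) (simp_all add: mult cl one assoc monoid_algebra_ops(4))
    fix f g h assume "f \<in> carrier ?A" "g \<in> carrier ?A" "h \<in> carrier ?A"
    then show "(f \<oplus>\<^bsub>?A\<^esub> g) \<otimes>\<^bsub>?A\<^esub> h = f \<otimes>\<^bsub>?A\<^esub> h \<oplus>\<^bsub>?A\<^esub> g \<otimes>\<^bsub>?A\<^esub> h"
      "h \<otimes>\<^bsub>?A\<^esub> (f \<oplus>\<^bsub>?A\<^esub> g) = h \<otimes>\<^bsub>?A\<^esub> f \<oplus>\<^bsub>?A\<^esub> h \<otimes>\<^bsub>?A\<^esub> g"
      using mult monoid_algebra_add_closed[of f M g]
      by (simp_all add: monoid_algebra_ops(1) conv_add_left conv_add_right fin)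
  qed
  then show ?thesis
  proof (intro assoc_algebra.intro assoc_algebra_axioms.intro)
    fix f g a b assume f: "f \<in> carrier ?A"
    then show "a \<odot>\<^bsub>?A\<^esub> f \<in> carrier ?A" "(a + b) \<odot>\<^bsub>?A\<^esub> f = a \<odot>\<^bsub>?A\<^esub> f \<oplus>\<^bsub>?A\<^esub> b \<odot>\<^bsub>?A\<^esub> f"
      "(a * b) \<odot>\<^bsub>?A\<^esub> f = a \<odot>\<^bsub>?A\<^esub> (b \<odot>\<^bsub>?A\<^esub> f)" "1 \<odot>\<^bsub>?A\<^esub> f = f"
      by (simp_all add: monoid_algebra_ops(1,3) monoid_algebra_smult_closed distrib_right mult.assoc)
    assume g: "g \<in> carrier ?A"
    show "a \<odot>\<^bsub>?A\<^esub> (f \<oplus>\<^bsub>?A\<^esub> g) = a \<odot>\<^bsub>?A\<^esub> f \<oplus>\<^bsub>?A\<^esub> a \<odot>\<^bsub>?A\<^esub> g"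
      by (simp add: monoid_algebra_ops(1,3) distrib_left)
    show "(a \<odot>\<^bsub>?A\<^esub> f) \<otimes>\<^bsub>?A\<^esub> g = a \<odot>\<^bsub>?A\<^esub> (f \<otimes>\<^bsub>?A\<^esub> g)"
      "f \<otimes>\<^bsub>?A\<^esub> (a \<odot>\<^bsub>?A\<^esub> g) = a \<odot>\<^bsub>?A\<^esub> (f \<otimes>\<^bsub>?A\<^esub> g)"
      using mult f g monoid_algebra_smult_closed[OF f, of a] monoid_algebra_smult_closed[OF g, of a]
      by (simp_all add: monoid_algebra_ops(3) conv_smult_left conv_smult_right fin)
  qed
qed

lemma monoid_algebra_mult_basis:
  "basis_elt x \<otimes>\<^bsub>monoid_algebra M\<^esub> basis_elt y = (basis_elt (x \<otimes>\<^bsub>M\<^esub> y) :: _ \<Rightarrow> 'r::comm_ring_1)"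
  by (simp add: mult_eq_conv conv_basis_elt supp_basis_elt)

lemma algebra_hom_monoid_algebra_eqI:
  assumes M: "Group.monoid M" and B: "assoc_algebra B"
    and F: "F \<in> algebra_hom (monoid_algebra M) B" and G: "G \<in> algebra_hom (monoid_algebra M) B"
    and eq: "\<And>m. m \<in> carrier M \<Longrightarrow> F (basis_elt m) = G (basis_elt m)"
    and f: "f \<in> carrier (monoid_algebra M)"
  shows "F f = G f"
  using f
proof (induction f rule: monoid_algebra_induct)
  case zero
  show ?case
    using algebra_hom_zero[OF F monoid_algebra_is_algebra[OF M] B]
      algebra_hom_zero[OF G monoid_algebra_is_algebra[OF M] B]
    by (simp add: monoid_algebra_ops)
next
  case (step a m f)
  have "(\<lambda>x. a * basis_elt m x) \<in> carrier (monoid_algebra M)"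
    using step by (intro monoid_algebra_smult_closed) simp
  then show ?case
    using step eq algebra_homD(4)[OF F, of "\<lambda>x. a * basis_elt m x" f]
      algebra_homD(4)[OF G, of "\<lambda>x. a * basis_elt m x" f]
      algebra_homD(6)[OF F, of "basis_elt m" a] algebra_homD(6)[OF G, of "basis_elt m" a]
    by (simp add: monoid_algebra_ops)
qed

text \<open>The universal property of a monoid algebra: it turns monoid homomorphisms into algebra
  homomorphisms.\<close>

definition linear_extension ::
    "('r::comm_ring_1, 'b) module \<Rightarrow> ('m \<Rightarrow> 'b) \<Rightarrow> ('m \<Rightarrow> 'r) \<Rightarrow> 'b" where
  "linear_extension B \<phi> f = (\<Oplus>\<^bsub>B\<^esub>x\<in>supp f. f x \<odot>\<^bsub>B\<^esub> \<phi> x)"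

lemma linear_extension_hom:
  fixes B :: "('r::comm_ring_1, 'b) module"
  assumes M: "Group.monoid M" and B: "assoc_algebra B"
    and cl: "\<And>m. m \<in> carrier M \<Longrightarrow> \<phi> m \<in> carrier B"
    and mult: "\<And>m n. m \<in> carrier M \<Longrightarrow> n \<in> carrier M \<Longrightarrow> \<phi> (m \<otimes>\<^bsub>M\<^esub> n) = \<phi> m \<otimes>\<^bsub>B\<^esub> \<phi> n"
    and one: "\<phi> \<one>\<^bsub>M\<^esub> = \<one>\<^bsub>B\<^esub>"
  shows "linear_extension B \<phi> \<in> algebra_hom (monoid_algebra M) B"
    and "\<And>m. m \<in> carrier M \<Longrightarrow> linear_extension B \<phi> (basis_elt m) = \<phi> m"
proof -
  interpret M: Group.monoid M by fact
  interpret B: assoc_algebra B by fact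
  let ?A = "monoid_algebra M :: ('r, _) module"
  let ?L = "linear_extension B \<phi> :: (_ \<Rightarrow> 'r) \<Rightarrow> 'b"
  interpret A: assoc_algebra ?A by (rule monoid_algebra_is_algebra[OF M])
  have sup: "?L f = (\<Oplus>\<^bsub>B\<^esub>x\<in>F. f x \<odot>\<^bsub>B\<^esub> \<phi> x)" if "finite F" "supp f \<subseteq> F" "F \<subseteq> carrier M" for f F
    unfolding linear_extension_def
  proof (rule B.add.finprod_mono_neutral_cong_left)
    show "f i \<odot>\<^bsub>B\<^esub> \<phi> i = \<zero>\<^bsub>B\<^esub>" if "i \<in> F - supp f" for i
      using \<open>F \<subseteq> carrier M\<close> that by (auto simp: supp_def B.smult_zero_left cl)
  qed (use that cl in auto)
  have Lcl: "?L f \<in> carrier B" if "f \<in> carrier ?A" for f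
    using that cl unfolding linear_extension_def
    by (intro B.finsum_closed) (auto simp: carrier_monoid_algebra)
  show basis: "?L (basis_elt m) = \<phi> m" if "m \<in> carrier M" for m
    using that sup[of "{m}" "basis_elt m"] cl[OF that]
    by (simp add: supp_basis_elt) (simp add: basis_elt_def B.smult_one)
  have add: "?L (\<lambda>x. f x + g x) = ?L f \<oplus>\<^bsub>B\<^esub> ?L g" if "f \<in> carrier ?A" "g \<in> carrier ?A" for f g
  proof -
    let ?F = "supp f \<union> supp g"
    have F: "finite ?F" "?F \<subseteq> carrier M" using that by (auto simp: carrier_monoid_algebra)
    have "?L (\<lambda>x. f x + g x) = (\<Oplus>\<^bsub>B\<^esub>x\<in>?F. (f x + g x) \<odot>\<^bsub>B\<^esub> \<phi> x)"
      using sup[OF F(1) _ F(2)] supp_add[of f g] by simp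
    also have "\<dots> = (\<Oplus>\<^bsub>B\<^esub>x\<in>?F. f x \<odot>\<^bsub>B\<^esub> \<phi> x \<oplus>\<^bsub>B\<^esub> g x \<odot>\<^bsub>B\<^esub> \<phi> x)"
      using F cl by (intro B.finsum_cong') (auto simp: B.smult_l_distr subset_iff)
    also have "\<dots> = (\<Oplus>\<^bsub>B\<^esub>x\<in>?F. f x \<odot>\<^bsub>B\<^esub> \<phi> x) \<oplus>\<^bsub>B\<^esub> (\<Oplus>\<^bsub>B\<^esub>x\<in>?F. g x \<odot>\<^bsub>B\<^esub> \<phi> x)"
      using F cl by (intro B.finsum_addf) (auto simp: subset_iff)
    also have "\<dots> = ?L f \<oplus>\<^bsub>B\<^esub> ?L g"
      using sup[OF F(1) _ F(2)] by simp
    finally show ?thesis .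
  qed
  have zero: "?L (\<lambda>x. 0) = \<zero>\<^bsub>B\<^esub>" by (simp add: linear_extension_def supp_def)
  have smult_basis: "?L (\<lambda>x. a * basis_elt m x) = a \<odot>\<^bsub>B\<^esub> \<phi> m" if "m \<in> carrier M" for a m
    using that sup[of "{m}" "\<lambda>x. a * basis_elt m x"] cl[OF that] supp_smult[of a "basis_elt m"]
    by (simp add: supp_basis_elt) (simp add: basis_elt_def)
  have smult: "?L (\<lambda>x. a * f x) = a \<odot>\<^bsub>B\<^esub> ?L f" if "f \<in> carrier ?A" for a f
    using that
  proof (induction f rule: monoid_algebra_induct)
    case zero
    then show ?case using \<open>?L (\<lambda>x. 0) = \<zero>\<^bsub>B\<^esub>\<close> by (simp add: B.smult_zero_right)
  next
    case (step b m f)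
    have "?L (\<lambda>x. a * (b * basis_elt m x + f x)) = ?L (\<lambda>x. (a * b) * basis_elt m x + a * f x)"
      by (simp add: algebra_simps)
    then show ?case
      using step Lcl cl
      by (simp add: add smult_basis monoid_algebra_smult_closed B.smult_r_distr B.smult_smult)
  qed
  have mult1: "?L (conv M (basis_elt m) g) = \<phi> m \<otimes>\<^bsub>B\<^esub> ?L g" if "g \<in> carrier ?A" "m \<in> carrier M" for m g
    using that(1)
  proof (induction g rule: monoid_algebra_induct)
    case zero
    then show ?case using \<open>?L (\<lambda>x. 0) = \<zero>\<^bsub>B\<^esub>\<close> that cl by (simp add: conv_zero)
  next
    case (step b n f)
    have fin: "finite (supp (\<lambda>x. b * basis_elt n x))" "finite (supp f)" "finite (supp (basis_elt m :: _ \<Rightarrow> 'r))"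
      "finite (supp (basis_elt n :: _ \<Rightarrow> 'r))"
      using step finite_subset[OF supp_smult[of b "basis_elt n"]]
      by (simp_all add: carrier_monoid_algebra supp_basis_elt)
    show ?case
      using step that cl Lcl
      by (simp add: conv_add_right conv_smult_right fin conv_basis_elt add smult_basis monoid_algebra_smult_closed
          conv_closed[OF M] mult B.r_distr B.smult_mult_right)
  qed
  have mult2: "?L (conv M f g) = ?L f \<otimes>\<^bsub>B\<^esub> ?L g" if "f \<in> carrier ?A" "g \<in> carrier ?A" for f g
    using that(1)
  proof (induction f rule: monoid_algebra_induct)
    case zero
    then show ?case using \<open>?L (\<lambda>x. 0) = \<zero>\<^bsub>B\<^esub>\<close> that Lcl by (simp add: conv_zero)
  next
    case (step b n f)
    have fin: "finite (supp (\<lambda>x. b * basis_elt n x))" "finite (supp f)" "finite (supp g)"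
      "finite (supp (basis_elt n :: _ \<Rightarrow> 'r))"
      using step that(2) finite_subset[OF supp_smult[of b "basis_elt n"]]
      by (simp_all add: carrier_monoid_algebra supp_basis_elt)
    show ?case
      using step that(2) cl Lcl
      by (simp add: conv_add_left conv_smult_left fin add smult smult_basis basis monoid_algebra_smult_closed
          conv_closed[OF M] mult1 B.l_distr B.smult_mult_left)
  qed
  show "?L \<in> algebra_hom ?A B"
    unfolding algebra_hom_def
  proof (intro CollectI conjI ring_hom_memI allI ballI)
    fix f g assume "f \<in> carrier ?A" "g \<in> carrier ?A"
    then show "?L (f \<otimes>\<^bsub>?A\<^esub> g) = ?L f \<otimes>\<^bsub>B\<^esub> ?L g" "?L (f \<oplus>\<^bsub>?A\<^esub> g) = ?L f \<oplus>\<^bsub>B\<^esub> ?L g"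
      using mult2 add mult_eq_conv[of f g M] by (simp_all add: carrier_monoid_algebra monoid_algebra_ops)
  qed (simp_all add: Lcl monoid_algebra_ops smult basis one)
qed

subsection \<open>Quotients\<close>

lemma quotient_algebra_props:
  fixes A :: "('r::comm_ring_1, 'a) module"
  assumes A: "assoc_algebra A" and R: "R \<subseteq> carrier A \<times> carrier A"
  shows "assoc_algebra (quotient_algebra A R)"
    and "relation_class A R \<in> algebra_hom A (quotient_algebra A R)"
    and "\<And>C. C \<in> carrier (quotient_algebra A R) \<Longrightarrow> \<exists>x\<in>carrier A. C = relation_class A R x"
    and "\<And>l r. (l, r) \<in> R \<Longrightarrow> relation_class A R l = relation_class A R r"
proof -
  interpret A: assoc_algebra A by fact
  let ?G = "{l \<ominus>\<^bsub>A\<^esub> r | l r. (l, r) \<in> R}"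
  let ?I = "relation_ideal A R" and ?Q = "quotient_algebra A R" and ?c = "relation_class A R"
  have G: "?G \<subseteq> carrier A" using R by auto
  have I: "?I = Idl\<^bsub>A\<^esub> ?G" by (simp add: relation_ideal_def)
  interpret I: ideal ?I A unfolding I by (rule A.genideal_ideal[OF G])
  have Isub: "?I \<subseteq> carrier A" by (rule I.a_subset)
  have Q: "carrier ?Q = carrier (A Quot ?I)" "mult ?Q = mult (A Quot ?I)" "one ?Q = one (A Quot ?I)"
     "add ?Q = add (A Quot ?I)" "zero ?Q = zero (A Quot ?I)"
    by (simp_all add: quotient_algebra_def ring.defs)
  have Qs: "a \<odot>\<^bsub>?Q\<^esub> C = (\<Union>x\<in>C. ?c (a \<odot>\<^bsub>A\<^esub> x))" for a C
    by (simp add: quotient_algebra_def ring.defs module.defs)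
  have smultI: "a \<odot>\<^bsub>A\<^esub> x \<in> ?I" if "x \<in> ?I" for a x
  proof -
    have "(a \<odot>\<^bsub>A\<^esub> \<one>\<^bsub>A\<^esub>) \<otimes>\<^bsub>A\<^esub> x \<in> ?I" using that by (intro I.I_l_closed) auto
    then show ?thesis using that Isub by (auto simp: A.smult_mult_left)
  qed
  have ceq: "?c x = ?c y \<longleftrightarrow> x \<ominus>\<^bsub>A\<^esub> y \<in> ?I" if "x \<in> carrier A" "y \<in> carrier A" for x y
    unfolding relation_class_def
    using that A.quotient_eq_iff_same_a_r_cos[OF I.is_ideal] by auto
  have smultc: "a \<odot>\<^bsub>?Q\<^esub> ?c x = ?c (a \<odot>\<^bsub>A\<^esub> x)" if x: "x \<in> carrier A" for a x
  proof -
    have "?c (a \<odot>\<^bsub>A\<^esub> y) = ?c (a \<odot>\<^bsub>A\<^esub> x)" if y: "y \<in> ?c x" for y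
    proof -
      have yc: "y \<in> carrier A" using y x A.a_r_coset_subset_G[OF Isub x] by (auto simp: relation_class_def)
      have "?c y = ?c x" using I.a_repr_independence'[OF _ x] y by (simp add: relation_class_def)
      then have "y \<ominus>\<^bsub>A\<^esub> x \<in> ?I" using ceq[OF yc x] by simp
      then have "a \<odot>\<^bsub>A\<^esub> (y \<ominus>\<^bsub>A\<^esub> x) \<in> ?I" by (rule smultI)
      then show ?thesis using ceq x yc
        by (simp add: A.minus_eq A.smult_r_distr A.smult_minus_right)
    qed
    moreover have "x \<in> ?c x" using x I.a_rcos_self by (simp add: relation_class_def)
    ultimately show ?thesis unfolding Qs by blast
  qed
  have hom: "?c \<in> ring_hom A (A Quot ?I)"
    using I.rcos_ring_hom by (simp add: relation_class_def[abs_def])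
  have chom: "?c \<in> ring_hom A ?Q" using hom unfolding ring_hom_def Q by simp
  show alg_hom: "?c \<in> algebra_hom A ?Q"
    using chom smultc by (simp add: algebra_hom_def)
  show surj: "\<exists>x\<in>carrier A. C = ?c x" if "C \<in> carrier ?Q" for C
    using that unfolding Q by (auto simp: FactRing_simps relation_class_def)
  note h = algebra_homD[OF alg_hom]
  have ringQ: "ring ?Q"
  proof -
    interpret R0: ring "A Quot ?I" by (rule I.quotient_is_ring)
    show ?thesis
    proof (rule ringI)
      show "abelian_group ?Q"
      proof (rule abelian_groupI)
        fix x y z assume "x \<in> carrier ?Q" "y \<in> carrier ?Q" "z \<in> carrier ?Q"
        then show "(x \<oplus>\<^bsub>?Q\<^esub> y) \<oplus>\<^bsub>?Q\<^esub> z = x \<oplus>\<^bsub>?Q\<^esub> (y \<oplus>\<^bsub>?Q\<^esub> z)" by (simp add: Q R0.a_assoc)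
      next
        fix x y assume "x \<in> carrier ?Q" "y \<in> carrier ?Q"
        then show "x \<oplus>\<^bsub>?Q\<^esub> y = y \<oplus>\<^bsub>?Q\<^esub> x" by (simp only: Q R0.a_comm)
      next
        fix x assume "x \<in> carrier ?Q"
        then show "\<exists>y\<in>carrier ?Q. y \<oplus>\<^bsub>?Q\<^esub> x = \<zero>\<^bsub>?Q\<^esub>"
          unfolding Q by (intro bexI[where x = "\<ominus>\<^bsub>A Quot ?I\<^esub> x"] R0.l_neg R0.a_inv_closed)
      qed (simp_all add: Q)
      show "Group.monoid ?Q"
        by (rule monoidI) (auto simp: Q R0.m_assoc)
    qed (auto simp: Q R0.l_distr R0.r_distr)
  qed
  then show "assoc_algebra ?Q"
  proof (intro assoc_algebra.intro assoc_algebra_axioms.intro)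
    fix x y a b assume "x \<in> carrier ?Q"
    then obtain x' where x: "x' \<in> carrier A" "x = ?c x'" using surj by auto
    show "a \<odot>\<^bsub>?Q\<^esub> x \<in> carrier ?Q" "(a + b) \<odot>\<^bsub>?Q\<^esub> x = a \<odot>\<^bsub>?Q\<^esub> x \<oplus>\<^bsub>?Q\<^esub> b \<odot>\<^bsub>?Q\<^esub> x"
      "(a * b) \<odot>\<^bsub>?Q\<^esub> x = a \<odot>\<^bsub>?Q\<^esub> (b \<odot>\<^bsub>?Q\<^esub> x)" "1 \<odot>\<^bsub>?Q\<^esub> x = x"
      using x by (simp_all add: smultc A.smult_l_distr A.smult_smult A.smult_one h(2) flip: h(4))
    assume "y \<in> carrier ?Q"
    then obtain y' where y: "y' \<in> carrier A" "y = ?c y'" using surj by auto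
    show "a \<odot>\<^bsub>?Q\<^esub> (x \<oplus>\<^bsub>?Q\<^esub> y) = a \<odot>\<^bsub>?Q\<^esub> x \<oplus>\<^bsub>?Q\<^esub> a \<odot>\<^bsub>?Q\<^esub> y"
      "a \<odot>\<^bsub>?Q\<^esub> x \<otimes>\<^bsub>?Q\<^esub> y = a \<odot>\<^bsub>?Q\<^esub> (x \<otimes>\<^bsub>?Q\<^esub> y)"
      "x \<otimes>\<^bsub>?Q\<^esub> (a \<odot>\<^bsub>?Q\<^esub> y) = a \<odot>\<^bsub>?Q\<^esub> (x \<otimes>\<^bsub>?Q\<^esub> y)"
      using x y by (simp_all add: smultc A.smult_r_distr A.smult_mult_left A.smult_mult_right flip: h(3,4))
  qed
  show "?c l = ?c r" if "(l, r) \<in> R" for l r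
  proof -
    have "l \<ominus>\<^bsub>A\<^esub> r \<in> ?I" unfolding I using A.genideal_self[OF G] that by blast
    then show ?thesis using ceq that R by auto
  qed
qed

lemma quotient_algebra_descend:
  fixes A :: "('r::comm_ring_1, 'a) module"
  assumes A: "assoc_algebra A" and B: "assoc_algebra B" and R: "R \<subseteq> carrier A \<times> carrier A"
    and F: "F \<in> algebra_hom A B" and kill: "\<And>l r. (l, r) \<in> R \<Longrightarrow> F l = F r"
  shows "\<exists>G\<in>algebra_hom (quotient_algebra A R) B. \<forall>x\<in>carrier A. G (relation_class A R x) = F x"
proof -
  interpret A: assoc_algebra A by fact
  interpret B: assoc_algebra B by fact
  interpret F: ring_hom_ring A B F
    using algebra_homD(1)[OF F] by (intro ring_hom_ringI2) (unfold_locales)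
  let ?Q = "quotient_algebra A R" and ?c = "relation_class A R"
  let ?G = "{l \<ominus>\<^bsub>A\<^esub> r | l r. (l, r) \<in> R}"
  have G: "?G \<subseteq> carrier A" using R by auto
  have "?G \<subseteq> a_kernel A B F"
  proof
    fix z assume "z \<in> ?G"
    then obtain l r where z: "z = l \<ominus>\<^bsub>A\<^esub> r" "(l, r) \<in> R" by auto
    then have lr: "l \<in> carrier A" "r \<in> carrier A" using R by auto
    have "F z = F l \<ominus>\<^bsub>B\<^esub> F r" using z lr algebra_hom_minus[OF F A B] by simp
    also have "\<dots> = \<zero>\<^bsub>B\<^esub>" using kill[OF z(2)] lr by (simp add: B.minus_eq B.r_neg)
    finally have "F z = \<zero>\<^bsub>B\<^esub>" .
    moreover have "z \<in> carrier A" using z(1) lr by simp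
    ultimately show "z \<in> a_kernel A B F" unfolding a_kernel_def' by blast
  qed
  then have sub: "relation_ideal A R \<subseteq> a_kernel A B F"
    unfolding relation_ideal_def by (intro A.genideal_minimal F.kernel_is_ideal)
  note Q = quotient_algebra_props[OF A R]
  note hc = algebra_homD[OF Q(2)] and hF = algebra_homD[OF F]
  have wd: "F x = F y" if "x \<in> carrier A" "y \<in> carrier A" "?c x = ?c y" for x y
  proof -
    have "ideal (relation_ideal A R) A" unfolding relation_ideal_def by (rule A.genideal_ideal[OF G])
    then have "x \<ominus>\<^bsub>A\<^esub> y \<in> relation_ideal A R"
      using that A.quotient_eq_iff_same_a_r_cos[of "relation_ideal A R" x y] by (auto simp: relation_class_def)
    then have "F (x \<ominus>\<^bsub>A\<^esub> y) = \<zero>\<^bsub>B\<^esub>" using sub unfolding a_kernel_def' by blast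
    then have "F x \<ominus>\<^bsub>B\<^esub> F y = \<zero>\<^bsub>B\<^esub>" using algebra_hom_minus[OF F A B] that by simp
    moreover have "F x \<in> carrier B" "F y \<in> carrier B" using hF(2) that by auto
    moreover have "F x = (F x \<ominus>\<^bsub>B\<^esub> F y) \<oplus>\<^bsub>B\<^esub> F y"
      using calculation(2,3) by (simp add: B.minus_eq B.a_assoc B.l_neg)
    ultimately show ?thesis by simp
  qed
  define H where "H C = F (SOME x. x \<in> carrier A \<and> C = ?c x)" for C
  have H: "H (?c x) = F x" if x: "x \<in> carrier A" for x
    unfolding H_def
  proof (rule someI2[where a = x])
    show "x \<in> carrier A \<and> ?c x = ?c x" using x by blast
    show "F y = F x" if "y \<in> carrier A \<and> ?c x = ?c y" for y
      using wd[of y x] x that by metis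
  qed
  have "H \<in> algebra_hom ?Q B"
    unfolding algebra_hom_def
  proof (intro CollectI conjI ring_hom_memI allI ballI)
    fix x y assume "x \<in> carrier ?Q" "y \<in> carrier ?Q"
    then obtain x' y' where xy: "x' \<in> carrier A" "x = ?c x'" "y' \<in> carrier A" "y = ?c y'"
      using Q(3) by meson
    show "H (x \<otimes>\<^bsub>?Q\<^esub> y) = H x \<otimes>\<^bsub>B\<^esub> H y" "H (x \<oplus>\<^bsub>?Q\<^esub> y) = H x \<oplus>\<^bsub>B\<^esub> H y"
      using xy by (simp_all add: H hF(3,4) flip: hc(3,4))
  next
    fix x assume "x \<in> carrier ?Q"
    then obtain x' where x: "x' \<in> carrier A" "x = ?c x'" using Q(3) by meson
    show "H x \<in> carrier B" "\<And>a. H (a \<odot>\<^bsub>?Q\<^esub> x) = a \<odot>\<^bsub>B\<^esub> H x"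
      using x by (simp_all add: H hF(2,6) flip: hc(6))
  next
    show "H \<one>\<^bsub>?Q\<^esub> = \<one>\<^bsub>B\<^esub>" by (simp add: H hF(5) flip: hc(5))
  qed
  then show ?thesis using H by auto
qed

lemma algebra_hom_quotient_eqI:
  assumes A: "assoc_algebra A" and R: "R \<subseteq> carrier A \<times> carrier A"
    and eq: "\<And>x. x \<in> carrier A \<Longrightarrow> F (relation_class A R x) = G (relation_class A R x)"
    and C: "C \<in> carrier (quotient_algebra A R)"
  shows "F C = G C"
  using quotient_algebra_props(3)[OF A R C] eq by auto

section \<open>Relations for an element and for its sum with one\<close>

context assoc_algebra
begin

lemma diff_eq_diff_iff:
  assumes "a \<in> carrier A" "b \<in> carrier A" "c \<in> carrier A" "d \<in> carrier A"
  shows "a \<ominus> b = c \<ominus> d \<longleftrightarrow> a \<oplus> d = c \<oplus> b"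
proof
  assume e: "a \<ominus> b = c \<ominus> d"
  have "a \<oplus> d = (a \<ominus> b) \<oplus> (b \<oplus> d)"
    using assms by (simp add: minus_eq a_assoc r_neg1)
  also have "\<dots> = (c \<ominus> d) \<oplus> (d \<oplus> b)" using assms by (simp add: e a_comm)
  also have "\<dots> = c \<oplus> b" using assms by (simp add: minus_eq a_assoc r_neg1)
  finally show "a \<oplus> d = c \<oplus> b" .
next
  assume e: "a \<oplus> d = c \<oplus> b"
  have "a \<ominus> b = (a \<oplus> d) \<oplus> (\<ominus> d \<oplus> \<ominus> b)"
    using assms by (simp add: minus_eq a_assoc r_neg2 r_neg1)
  also have "\<dots> = (c \<oplus> b) \<oplus> (\<ominus> b \<oplus> \<ominus> d)" using assms by (simp add: e a_comm)
  also have "\<dots> = c \<ominus> d" using assms by (simp add: minus_eq a_assoc r_neg2 r_neg1)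
  finally show "a \<ominus> b = c \<ominus> d" .
qed

lemma diff_add_cancel: "a \<in> carrier A \<Longrightarrow> b \<in> carrier A \<Longrightarrow> (a \<ominus> b) \<oplus> b = a"
  by (simp add: minus_eq a_assoc l_neg)

lemma add_diff_cancel: "a \<in> carrier A \<Longrightarrow> b \<in> carrier A \<Longrightarrow> (a \<oplus> b) \<ominus> b = a"
  by (simp add: minus_eq a_assoc r_neg)

lemma add_cancel: "a \<in> carrier A \<Longrightarrow> b \<in> carrier A \<Longrightarrow> c \<in> carrier A \<Longrightarrow> c \<oplus> a = c \<oplus> b \<longleftrightarrow> a = b"
  by (metis r_neg1)

lemma quadratic_iff:
  assumes T: "T \<in> carrier A"
  shows "T \<otimes> T = (q - 1) \<odot> T \<oplus> q \<odot> \<one> \<longleftrightarrow> T \<otimes> T \<oplus> T = q \<odot> T \<oplus> q \<odot> \<one>"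
proof -
  have "T \<otimes> T = (q - 1) \<odot> T \<oplus> q \<odot> \<one> \<longleftrightarrow> T \<oplus> T \<otimes> T = T \<oplus> ((q - 1) \<odot> T \<oplus> q \<odot> \<one>)"
    using T by (subst add_cancel) auto
  also have "T \<oplus> ((q - 1) \<odot> T \<oplus> q \<odot> \<one>) = ((q - 1) \<odot> T \<oplus> T) \<oplus> q \<odot> \<one>"
    using T by (simp add: a_ac)
  also have "(q - 1) \<odot> T \<oplus> T = q \<odot> T"
    using T by (simp add: smult_diff smult_one diff_add_cancel)
  finally show ?thesis using T by (simp add: a_comm)
qed

lemma crossing_quadratic_iff:
  assumes T: "T \<in> carrier A"
  shows "(T \<oplus> \<one>) \<otimes> (T \<oplus> \<one>) = (1 + q) \<odot> (T \<oplus> \<one>) \<longleftrightarrow> T \<otimes> T \<oplus> T = q \<odot> T \<oplus> q \<odot> \<one>"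
proof -
  have "(T \<oplus> \<one>) \<otimes> (T \<oplus> \<one>) = (T \<oplus> \<one>) \<oplus> (T \<otimes> T \<oplus> T)"
    using T by (simp add: l_distr r_distr a_ac)
  moreover have "(1 + q) \<odot> (T \<oplus> \<one>) = (T \<oplus> \<one>) \<oplus> (q \<odot> T \<oplus> q \<odot> \<one>)"
    using T by (simp add: smult_l_distr smult_r_distr smult_one a_ac)
  ultimately show ?thesis using T by (simp del: a_assoc add: add_cancel)
qed

text \<open>Expanding \<open>(T + 1)\<close> cancels the terms \<open>X\<close>.\<close>

lemma crossing_slide_iff:
  assumes "T \<in> carrier A" "X \<in> carrier A" "Y \<in> carrier A"
  shows "X \<otimes> (T \<oplus> \<one>) \<ominus> (T \<oplus> \<one>) \<otimes> Y = X \<ominus> q \<odot> Y \<longleftrightarrow> X \<otimes> T \<oplus> q \<odot> Y = T \<otimes> Y \<oplus> Y"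
    and "(T \<oplus> \<one>) \<otimes> X \<ominus> Y \<otimes> (T \<oplus> \<one>) = X \<ominus> q \<odot> Y \<longleftrightarrow> T \<otimes> X \<oplus> q \<odot> Y = Y \<otimes> T \<oplus> Y"
proof -
  have 1: "X \<otimes> (T \<oplus> \<one>) \<oplus> q \<odot> Y = X \<oplus> (X \<otimes> T \<oplus> q \<odot> Y)"
    "(T \<oplus> \<one>) \<otimes> X \<oplus> q \<odot> Y = X \<oplus> (T \<otimes> X \<oplus> q \<odot> Y)"
    using assms by (simp_all add: l_distr r_distr a_ac)
  have 2: "X \<oplus> (T \<oplus> \<one>) \<otimes> Y = X \<oplus> (T \<otimes> Y \<oplus> Y)" "X \<oplus> Y \<otimes> (T \<oplus> \<one>) = X \<oplus> (Y \<otimes> T \<oplus> Y)"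
    using assms by (simp_all add: l_distr r_distr a_ac)
  show "X \<otimes> (T \<oplus> \<one>) \<ominus> (T \<oplus> \<one>) \<otimes> Y = X \<ominus> q \<odot> Y \<longleftrightarrow> X \<otimes> T \<oplus> q \<odot> Y = T \<otimes> Y \<oplus> Y"
    using assms by (simp add: diff_eq_diff_iff 1 2 add_cancel del: a_assoc)
  show "(T \<oplus> \<one>) \<otimes> X \<ominus> Y \<otimes> (T \<oplus> \<one>) = X \<ominus> q \<odot> Y \<longleftrightarrow> T \<otimes> X \<oplus> q \<odot> Y = Y \<otimes> T \<oplus> Y"
    using assms by (simp add: diff_eq_diff_iff 1 2 add_cancel del: a_assoc)
qed

lemma smult_cancel:
  assumes "q' * q = 1" "x \<in> carrier A" "y \<in> carrier A" "q \<odot> x = q \<odot> y"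
  shows "x = y"
  using assms by (metis smult_one smult_smult)

text \<open>Multiply the slide relation by \<open>T\<close> from the left; after the quadratic
  relation the terms \<open>q T Y\<close> cancel.\<close>

lemma bernstein_from_slide:
  assumes c: "T \<in> carrier A" "X \<in> carrier A" "Y \<in> carrier A"
    and quad: "T \<otimes> T \<oplus> T = q \<odot> T \<oplus> q \<odot> \<one>"
    and slide: "X \<otimes> T \<oplus> q \<odot> Y = T \<otimes> Y \<oplus> Y"
  shows "T \<otimes> X \<otimes> T = q \<odot> Y"
proof -
  have "q \<odot> (T \<otimes> Y) \<oplus> T \<otimes> X \<otimes> T = T \<otimes> (X \<otimes> T \<oplus> q \<odot> Y)"
    using c by (simp add: r_distr smult_mult_right m_assoc a_comm)
  also have "\<dots> = (T \<otimes> T \<oplus> T) \<otimes> Y"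
    using c by (simp add: slide l_distr r_distr m_assoc)
  also have "\<dots> = q \<odot> (T \<otimes> Y) \<oplus> q \<odot> Y"
    using c by (simp add: quad l_distr smult_mult_left)
  finally show ?thesis using c by (simp add: add_cancel del: a_assoc)
qed

text \<open>The same computation backwards gives \<open>q\<close> times the slide relation.
  Multiplication by \<open>T\<close> from the left and from the right gives the two forms.\<close>

lemma slide_from_bernstein:
  assumes c: "T \<in> carrier A" "X \<in> carrier A" "Y \<in> carrier A" and q: "q' * q = 1"
    and quad: "T \<otimes> T \<oplus> T = q \<odot> T \<oplus> q \<odot> \<one>"
    and bern: "T \<otimes> X \<otimes> T = q \<odot> Y"
  shows "X \<otimes> T \<oplus> q \<odot> Y = T \<otimes> Y \<oplus> Y" "T \<otimes> X \<oplus> q \<odot> Y = Y \<otimes> T \<oplus> Y"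
proof -
  have "q \<odot> (X \<otimes> T \<oplus> q \<odot> Y) = q \<odot> (T \<otimes> X \<otimes> T) \<oplus> q \<odot> (X \<otimes> T)"
    using c by (simp add: bern smult_r_distr a_comm)
  also have "\<dots> = (q \<odot> T \<oplus> q \<odot> \<one>) \<otimes> (X \<otimes> T)"
    using c by (simp add: l_distr smult_mult_left m_assoc)
  also have "\<dots> = T \<otimes> (T \<otimes> X \<otimes> T) \<oplus> T \<otimes> X \<otimes> T"
    using c by (simp add: l_distr m_assoc flip: quad)
  also have "\<dots> = q \<odot> (T \<otimes> Y \<oplus> Y)"
    using c by (simp only: bern) (simp add: smult_mult_right smult_r_distr)
  finally show "X \<otimes> T \<oplus> q \<odot> Y = T \<otimes> Y \<oplus> Y" using c by - (rule smult_cancel[OF q], auto)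
  have "q \<odot> (T \<otimes> X \<oplus> q \<odot> Y) = q \<odot> (T \<otimes> X \<otimes> T) \<oplus> q \<odot> (T \<otimes> X)"
    using c by (simp add: bern smult_r_distr a_comm)
  also have "\<dots> = (T \<otimes> X) \<otimes> (q \<odot> T \<oplus> q \<odot> \<one>)"
    using c by (simp add: r_distr smult_mult_right)
  also have "\<dots> = (T \<otimes> X \<otimes> T) \<otimes> T \<oplus> T \<otimes> X \<otimes> T"
    using c by (simp add: r_distr m_assoc flip: quad)
  also have "\<dots> = q \<odot> (Y \<otimes> T \<oplus> Y)"
    using c by (simp only: bern) (simp add: smult_mult_left smult_r_distr)
  finally show "T \<otimes> X \<oplus> q \<odot> Y = Y \<otimes> T \<oplus> Y" using c by - (rule smult_cancel[OF q], auto)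
qed

text \<open>Expanding both sides, the terms of degree two coincide except for squares of
  \<open>S\<close> and \<open>T\<close>, which the quadratic relations convert into the terms with
  the factor \<open>q\<close>.\<close>

lemma crossing_braid_iff:
  assumes c: "S \<in> carrier A" "T \<in> carrier A"
    and quad: "S \<otimes> S \<oplus> S = q \<odot> S \<oplus> q \<odot> \<one>" "T \<otimes> T \<oplus> T = q \<odot> T \<oplus> q \<odot> \<one>"
  shows "(S \<oplus> \<one>) \<otimes> (T \<oplus> \<one>) \<otimes> (S \<oplus> \<one>) \<ominus> (T \<oplus> \<one>) \<otimes> (S \<oplus> \<one>) \<otimes> (T \<oplus> \<one>)
      = q \<odot> (S \<oplus> \<one>) \<ominus> q \<odot> (T \<oplus> \<one>) \<longleftrightarrow> S \<otimes> T \<otimes> S = T \<otimes> S \<otimes> T"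
proof -
  let ?m = "S \<otimes> T \<oplus> T \<otimes> S"
  let ?Z = "(q \<odot> S \<oplus> q \<odot> \<one>) \<oplus> (q \<odot> T \<oplus> q \<odot> \<one>) \<oplus> ?m \<oplus> (S \<oplus> T \<oplus> \<one>)"
  have reorder: "(p \<oplus> (r \<oplus> (s \<oplus> u))) \<oplus> (t \<oplus> (u \<oplus> (v \<oplus> w)))
      = (r \<oplus> u) \<oplus> (t \<oplus> s) \<oplus> (u \<oplus> v \<oplus> w) \<oplus> p"
    if "p \<in> carrier A" "r \<in> carrier A" "s \<in> carrier A" "t \<in> carrier A"
      "u \<in> carrier A" "v \<in> carrier A" "w \<in> carrier A" for p r s t u v w
    using that by (simp add: a_ac)
  have exp: "(U \<oplus> \<one>) \<otimes> (V \<oplus> \<one>) \<otimes> (U \<oplus> \<one>)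
      = (U \<otimes> U \<oplus> U) \<oplus> (U \<otimes> V \<oplus> V \<otimes> U) \<oplus> (U \<oplus> V \<oplus> \<one>) \<oplus> U \<otimes> V \<otimes> U"
    if c: "U \<in> carrier A" "V \<in> carrier A" for U V
  proof -
    have "(U \<oplus> \<one>) \<otimes> (V \<oplus> \<one>) = U \<otimes> V \<oplus> (U \<oplus> (V \<oplus> \<one>))"
      using c by (simp add: l_distr r_distr a_ac)
    then have "(U \<oplus> \<one>) \<otimes> (V \<oplus> \<one>) \<otimes> (U \<oplus> \<one>)
        = (U \<otimes> V \<otimes> U \<oplus> (U \<otimes> U \<oplus> (V \<otimes> U \<oplus> U))) \<oplus> (U \<otimes> V \<oplus> (U \<oplus> (V \<oplus> \<one>)))"
      using c by (simp add: r_distr l_distr)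
    also have "\<dots> = (U \<otimes> U \<oplus> U) \<oplus> (U \<otimes> V \<oplus> V \<otimes> U) \<oplus> (U \<oplus> V \<oplus> \<one>) \<oplus> U \<otimes> V \<otimes> U"
      by (rule reorder) (use c in auto)
    finally show ?thesis .
  qed
  have rearrange: "a \<oplus> m \<oplus> s \<oplus> x \<oplus> b = a \<oplus> b \<oplus> m \<oplus> s \<oplus> x"
    if "a \<in> carrier A" "b \<in> carrier A" "m \<in> carrier A" "s \<in> carrier A" "x \<in> carrier A" for a b m s x
    using that by (simp add: a_ac)
  have 1: "(S \<oplus> \<one>) \<otimes> (T \<oplus> \<one>) \<otimes> (S \<oplus> \<one>) \<oplus> q \<odot> (T \<oplus> \<one>) = ?Z \<oplus> S \<otimes> T \<otimes> S"
    using c by (simp only: exp quad smult_r_distr one_closed) (rule rearrange; simp)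
  have "(T \<oplus> \<one>) \<otimes> (S \<oplus> \<one>) \<otimes> (T \<oplus> \<one>) \<oplus> q \<odot> (S \<oplus> \<one>)
      = (q \<odot> T \<oplus> q \<odot> \<one>) \<oplus> (q \<odot> S \<oplus> q \<odot> \<one>) \<oplus> (T \<otimes> S \<oplus> S \<otimes> T) \<oplus> (T \<oplus> S \<oplus> \<one>) \<oplus> T \<otimes> S \<otimes> T"
    using c by (simp only: exp quad smult_r_distr one_closed) (rule rearrange; simp)
  then have 2: "q \<odot> (S \<oplus> \<one>) \<oplus> (T \<oplus> \<one>) \<otimes> (S \<oplus> \<one>) \<otimes> (T \<oplus> \<one>) = ?Z \<oplus> T \<otimes> S \<otimes> T"
    using c a_comm[of "q \<odot> T \<oplus> q \<odot> \<one>" "q \<odot> S \<oplus> q \<odot> \<one>"] a_comm[of "T \<otimes> S" "S \<otimes> T"] a_comm[of T S]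
      a_comm[of "q \<odot> (S \<oplus> \<one>)" "(T \<oplus> \<one>) \<otimes> (S \<oplus> \<one>) \<otimes> (T \<oplus> \<one>)"] by simp
  have "(S \<oplus> \<one>) \<otimes> (T \<oplus> \<one>) \<otimes> (S \<oplus> \<one>) \<ominus> (T \<oplus> \<one>) \<otimes> (S \<oplus> \<one>) \<otimes> (T \<oplus> \<one>)
      = q \<odot> (S \<oplus> \<one>) \<ominus> q \<odot> (T \<oplus> \<one>) \<longleftrightarrow> ?Z \<oplus> S \<otimes> T \<otimes> S = ?Z \<oplus> T \<otimes> S \<otimes> T"
    unfolding 1[symmetric] 2[symmetric] using c by (intro diff_eq_diff_iff) auto
  then show ?thesis using c by (subst (asm) add_cancel) auto
qed

lemma add_one_commute_iff:
  assumes "S \<in> carrier A" "T \<in> carrier A"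
  shows "(S \<oplus> \<one>) \<otimes> T = T \<otimes> (S \<oplus> \<one>) \<longleftrightarrow> S \<otimes> T = T \<otimes> S"
proof -
  have "(S \<oplus> \<one>) \<otimes> T = T \<oplus> S \<otimes> T" "T \<otimes> (S \<oplus> \<one>) = T \<oplus> T \<otimes> S"
    using assms by (simp_all add: l_distr r_distr a_comm)
  then show ?thesis using assms by (simp add: add_cancel)
qed

lemma commute_inverse:
  assumes c: "T \<in> carrier A" "X \<in> carrier A" "Y \<in> carrier A"
    and inv: "X \<otimes> Y = \<one>" "Y \<otimes> X = \<one>" and comm: "T \<otimes> X = X \<otimes> T"
  shows "T \<otimes> Y = Y \<otimes> T"
proof -
  have "T \<otimes> Y = Y \<otimes> X \<otimes> (T \<otimes> Y)" using c inv by simp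
  also have "\<dots> = Y \<otimes> (X \<otimes> T) \<otimes> Y" using c by (simp add: m_assoc)
  also have "\<dots> = Y \<otimes> T \<otimes> (X \<otimes> Y)" unfolding comm[symmetric] using c by (simp add: m_assoc)
  finally show ?thesis using c inv by simp
qed

definition word_product :: "('g \<Rightarrow> 'a) \<Rightarrow> 'g list \<Rightarrow> 'a" where
  "word_product e w = foldr (\<lambda>g x. e g \<otimes> x) w \<one>"

lemma word_product_simps [simp]:
  "word_product e [] = \<one>" "word_product e (g # w) = e g \<otimes> word_product e w"
  by (simp_all add: word_product_def)

lemma word_product_closed:
  "(\<And>g. g \<in> set w \<Longrightarrow> e g \<in> carrier A) \<Longrightarrow> word_product e w \<in> carrier A"
  by (induction w) auto

lemma word_product_append:
  "(\<And>g. g \<in> set v \<union> set w \<Longrightarrow> e g \<in> carrier A) \<Longrightarrow>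
    word_product e (v @ w) = word_product e v \<otimes> word_product e w"
  by (induction v) (auto simp: m_assoc word_product_closed)

lemma word_product_far_commutes:
  assumes "far_commutes v w" "set v \<subseteq> G"
    and cl: "\<And>g. g \<in> G \<Longrightarrow> e g \<in> carrier A"
    and comm: "\<And>a b. a \<in> G \<Longrightarrow> b \<in> G \<Longrightarrow> far_apart a b \<Longrightarrow> e a \<otimes> e b = e b \<otimes> e a"
  shows "word_product e v = word_product e w"
  using assms(1,2)
proof (induction rule: far_commutes.induct)
  case (adjacent_swap x v a b w)
  have *: "set v \<subseteq> G" "set w \<subseteq> G" "a \<in> G" "b \<in> G"
    using far_commutes_set[OF adjacent_swap(1)] adjacent_swap.prems by auto
  then have e: "word_product e w \<in> carrier A" "e a \<in> carrier A" "e b \<in> carrier A"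
    using cl by (auto intro!: word_product_closed)
  have "e a \<otimes> (e b \<otimes> word_product e w) = e b \<otimes> (e a \<otimes> word_product e w)"
    using comm[OF *(3,4) adjacent_swap(2)] e by (simp flip: m_assoc)
  moreover have "word_product e x = word_product e (v @ [a, b] @ w)" using adjacent_swap by simp
  moreover have "word_product e (v @ c # d # w) = word_product e v \<otimes> word_product e (c # d # w)"
    if "c \<in> G" "d \<in> G" for c d
    by (rule word_product_append) (use * cl that in auto)
  ultimately show ?case using * by simp
qed simp

end

section \<open>The universal property of the affine Hecke algebra\<close>

declare hecke_gens_iff [simp]

lemma free_monoid_is_monoid: "Group.monoid (free_monoid G)"
  by (rule monoidI) (auto simp: free_monoid_def)

lemma free_monoid_simps:
  "carrier (free_monoid G) = lists G" "mult (free_monoid G) = (@)" "one (free_monoid G) = []"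
  by (simp_all add: free_monoid_def)

lemma free_hecke_algebra: "assoc_algebra (free_hecke n)"
  unfolding free_hecke_def by (rule monoid_algebra_is_algebra[OF free_monoid_is_monoid])

lemma free_hecke_basis_closed [simp]:
  "w \<in> lists (hecke_gens n) \<Longrightarrow> basis_elt w \<in> carrier (free_hecke n)"
  by (simp add: free_hecke_def free_monoid_simps)

lemma free_hecke_basis_mult:
  "basis_elt v \<otimes>\<^bsub>free_hecke n\<^esub> basis_elt w = basis_elt (v @ w)"
  by (simp add: free_hecke_def monoid_algebra_mult_basis free_monoid_simps)

lemma free_hecke_one: "\<one>\<^bsub>free_hecke n\<^esub> = basis_elt []"
  by (simp add: free_hecke_def monoid_algebra_ops free_monoid_simps)

lemma hecke_relations_closed: "hecke_relations n \<q> \<subseteq> carrier (free_hecke n) \<times> carrier (free_hecke n)"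
proof -
  interpret assoc_algebra "free_hecke n" by (rule free_hecke_algebra)
  show ?thesis unfolding hecke_relations_def Let_def by auto
qed

text \<open>The element \<open>e g\<close> is the image of the generator \<open>g\<close>.\<close>

definition hecke_relations_hold ::
    "nat \<Rightarrow> 'r::comm_ring_1 \<Rightarrow> ('r, 'a) module \<Rightarrow> (hecke_gen \<Rightarrow> 'a) \<Rightarrow> bool" where
  "hecke_relations_hold n \<q> A e \<longleftrightarrow>
     e ` hecke_gens n \<subseteq> carrier A \<and>
     (\<forall>r\<in>{1..n}. e (GenX r) \<otimes>\<^bsub>A\<^esub> e (GenXinv r) = \<one>\<^bsub>A\<^esub> \<and> e (GenXinv r) \<otimes>\<^bsub>A\<^esub> e (GenX r) = \<one>\<^bsub>A\<^esub>) \<and>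
     (\<forall>r\<in>{1..n}. \<forall>s\<in>{1..n}. \<forall>Y\<in>{GenX, GenXinv}. \<forall>Z\<in>{GenX, GenXinv}.
        e (Y r) \<otimes>\<^bsub>A\<^esub> e (Z s) = e (Z s) \<otimes>\<^bsub>A\<^esub> e (Y r)) \<and>
     (\<forall>r\<in>{1..<n}. e (GenT r) \<otimes>\<^bsub>A\<^esub> e (GenT r) = (\<q> - 1) \<odot>\<^bsub>A\<^esub> e (GenT r) \<oplus>\<^bsub>A\<^esub> \<q> \<odot>\<^bsub>A\<^esub> \<one>\<^bsub>A\<^esub>) \<and>
     (\<forall>r\<in>{1..<n}. e (GenT r) \<otimes>\<^bsub>A\<^esub> e (GenX r) \<otimes>\<^bsub>A\<^esub> e (GenT r) = \<q> \<odot>\<^bsub>A\<^esub> e (GenX (r + 1))) \<and>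
     (\<forall>r\<in>{1..<n}. r + 1 \<in> {1..<n} \<longrightarrow>
        e (GenT r) \<otimes>\<^bsub>A\<^esub> e (GenT (r + 1)) \<otimes>\<^bsub>A\<^esub> e (GenT r) =
        e (GenT (r + 1)) \<otimes>\<^bsub>A\<^esub> e (GenT r) \<otimes>\<^bsub>A\<^esub> e (GenT (r + 1))) \<and>
     (\<forall>r\<in>{1..<n}. \<forall>s\<in>{1..n}. s \<noteq> r \<longrightarrow> s \<noteq> r + 1 \<longrightarrow>
        e (GenT r) \<otimes>\<^bsub>A\<^esub> e (GenX s) = e (GenX s) \<otimes>\<^bsub>A\<^esub> e (GenT r)) \<and>
     (\<forall>r\<in>{1..<n}. \<forall>s\<in>{1..<n}. s \<noteq> r + 1 \<longrightarrow> r \<noteq> s + 1 \<longrightarrow>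
        e (GenT r) \<otimes>\<^bsub>A\<^esub> e (GenT s) = e (GenT s) \<otimes>\<^bsub>A\<^esub> e (GenT r))"

definition hecke_letter :: "nat \<Rightarrow> 'r::comm_ring_1 \<Rightarrow> hecke_gen \<Rightarrow> (hecke_gen list \<Rightarrow> 'r) set" where
  "hecke_letter n \<q> g = relation_class (free_hecke n) (hecke_relations n \<q>) (basis_elt [g])"

lemma hecke_algebra_props:
  shows "assoc_algebra (hecke_algebra n \<q>)"
    and "relation_class (free_hecke n) (hecke_relations n \<q>) \<in> algebra_hom (free_hecke n) (hecke_algebra n \<q>)"
    and "\<And>l r. (l, r) \<in> hecke_relations n \<q> \<Longrightarrow>
      relation_class (free_hecke n) (hecke_relations n \<q>) l = relation_class (free_hecke n) (hecke_relations n \<q>) r"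
  unfolding hecke_algebra_def
  by (rule quotient_algebra_props[OF free_hecke_algebra hecke_relations_closed]; assumption?)+

lemma hecke_letters_relations: "hecke_relations_hold n \<q> (hecke_algebra n \<q>) (hecke_letter n \<q>)"
proof -
  interpret F: assoc_algebra "free_hecke n :: ('a, _) module" by (rule free_hecke_algebra)
  note P = hecke_algebra_props[where n = n and \<q> = \<q>]
  note h = algebra_homD[OF P(2)]
  have cl: "basis_elt [g] \<in> carrier (free_hecke n :: ('a, _) module)" if "g \<in> hecke_gens n" for g
    using that by simp
  have r: "relation_class (free_hecke n) (hecke_relations n \<q>) l = relation_class (free_hecke n) (hecke_relations n \<q>) r"
    if "(l, r) \<in> hecke_relations n \<q>" for l r using P(3)[OF that] .
  show ?thesis
    unfolding hecke_relations_hold_def hecke_letter_def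
  proof (intro conjI ballI impI, goal_cases)
    case 1
    then show ?case using h(2) cl by auto
  next
    case (2 r)
    have "(basis_elt [GenX r] \<otimes>\<^bsub>free_hecke n\<^esub> basis_elt [GenXinv r], \<one>\<^bsub>free_hecke n\<^esub>) \<in> hecke_relations n \<q>"
      unfolding hecke_relations_def Let_def using 2 by (intro UnI1 CollectI exI[of _ r] conjI) auto
    from r[OF this] show ?case using 2 cl by (simp add: h(3,5))
  next
    case (3 r)
    have "(basis_elt [GenXinv r] \<otimes>\<^bsub>free_hecke n\<^esub> basis_elt [GenX r], \<one>\<^bsub>free_hecke n\<^esub>) \<in> hecke_relations n \<q>"
      unfolding hecke_relations_def Let_def using 3 by (intro UnI1[OF UnI1[OF UnI1[OF UnI1[OF UnI1[OF UnI1[OF UnI2]]]]]] CollectI exI[of _ r] conjI) auto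
    from r[OF this] show ?case using 3 cl by (simp add: h(3,5))
  next
    case (4 r s Y Z)
    have "(basis_elt [Y r] \<otimes>\<^bsub>free_hecke n\<^esub> basis_elt [Z s], basis_elt [Z s] \<otimes>\<^bsub>free_hecke n\<^esub> basis_elt [Y r]) \<in> hecke_relations n \<q>"
      unfolding hecke_relations_def Let_def Un_iff mem_Collect_eq
      by (rule disjI1, rule disjI1, rule disjI1, rule disjI1, rule disjI1, rule disjI2,
          rule exI[of _ "\<lambda>r. basis_elt [Y r]"], rule exI[of _ "\<lambda>r. basis_elt [Z r]"],
          rule exI[of _ r], rule exI[of _ s]) (use 4 in auto)
    moreover have "Y r \<in> hecke_gens n" "Z s \<in> hecke_gens n" using 4 by auto
    ultimately show ?case using r h(3)[OF cl cl] by metis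
  next
    case (5 r)
    have "(basis_elt [GenT r] \<otimes>\<^bsub>free_hecke n\<^esub> basis_elt [GenT r],
       (\<q> - 1) \<odot>\<^bsub>free_hecke n\<^esub> basis_elt [GenT r] \<oplus>\<^bsub>free_hecke n\<^esub> \<q> \<odot>\<^bsub>free_hecke n\<^esub> \<one>\<^bsub>free_hecke n\<^esub>) \<in> hecke_relations n \<q>"
      using 5 unfolding hecke_relations_def Let_def by blast
    from r[OF this] show ?case using 5 cl by (simp add: h(3,4,5,6))
  next
    case (6 r)
    have "(basis_elt [GenT r] \<otimes>\<^bsub>free_hecke n\<^esub> basis_elt [GenX r] \<otimes>\<^bsub>free_hecke n\<^esub> basis_elt [GenT r],
       \<q> \<odot>\<^bsub>free_hecke n\<^esub> basis_elt [GenX (r + 1)]) \<in> hecke_relations n \<q>"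
      using 6 unfolding hecke_relations_def Let_def by blast
    from r[OF this] show ?case using 6 cl by (simp add: h(3,6))
  next
    case (7 r)
    have "(basis_elt [GenT r] \<otimes>\<^bsub>free_hecke n\<^esub> basis_elt [GenT (r + 1)] \<otimes>\<^bsub>free_hecke n\<^esub> basis_elt [GenT r],
       basis_elt [GenT (r + 1)] \<otimes>\<^bsub>free_hecke n\<^esub> basis_elt [GenT r] \<otimes>\<^bsub>free_hecke n\<^esub> basis_elt [GenT (r + 1)]) \<in> hecke_relations n \<q>"
      using 7 unfolding hecke_relations_def Let_def by blast
    from r[OF this] show ?case using 7 cl by (simp add: h(3))
  next
    case (8 r s)
    have "(basis_elt [GenT r] \<otimes>\<^bsub>free_hecke n\<^esub> basis_elt [GenX s], basis_elt [GenX s] \<otimes>\<^bsub>free_hecke n\<^esub> basis_elt [GenT r]) \<in> hecke_relations n \<q>"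
      using 8 unfolding hecke_relations_def Let_def by blast
    from r[OF this] show ?case using 8 cl by (simp add: h(3))
  next
    case (9 r s)
    have "(basis_elt [GenT r] \<otimes>\<^bsub>free_hecke n\<^esub> basis_elt [GenT s], basis_elt [GenT s] \<otimes>\<^bsub>free_hecke n\<^esub> basis_elt [GenT r]) \<in> hecke_relations n \<q>"
      using 9 unfolding hecke_relations_def Let_def by blast
    from r[OF this] show ?case using 9 cl by (simp add: h(3))
  qed
qed

text \<open>Extend to words, then linearly, and pass to the quotient.\<close>

lemma hecke_algebra_hom_exists:
  fixes \<q> :: "'r::comm_ring_1"
  assumes B: "assoc_algebra B" and rel: "hecke_relations_hold n \<q> B e"
  shows "\<exists>f\<in>algebra_hom (hecke_algebra n \<q>) B. \<forall>g\<in>hecke_gens n. f (hecke_letter n \<q> g) = e g"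
proof -
  interpret B: assoc_algebra B by fact
  let ?F = "free_hecke n :: ('r, _) module"
  interpret F: assoc_algebra ?F by (rule free_hecke_algebra)
  have ecl: "e g \<in> carrier B" if "g \<in> hecke_gens n" for g
    using rel that by (auto simp: hecke_relations_hold_def)
  let ?\<phi> = "B.word_product e"
  let ?L = "linear_extension B ?\<phi> :: (hecke_gen list \<Rightarrow> 'r) \<Rightarrow> _"
  have L: "?L \<in> algebra_hom ?F B" "\<And>w. w \<in> lists (hecke_gens n) \<Longrightarrow> ?L (basis_elt w) = ?\<phi> w"
  proof -
    have *: "\<And>w. w \<in> carrier (free_monoid (hecke_gens n)) \<Longrightarrow> ?\<phi> w \<in> carrier B"
      "\<And>v w. v \<in> carrier (free_monoid (hecke_gens n)) \<Longrightarrow> w \<in> carrier (free_monoid (hecke_gens n)) \<Longrightarrow>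
        ?\<phi> (v \<otimes>\<^bsub>free_monoid (hecke_gens n)\<^esub> w) = ?\<phi> v \<otimes>\<^bsub>B\<^esub> ?\<phi> w"
      "?\<phi> \<one>\<^bsub>free_monoid (hecke_gens n)\<^esub> = \<one>\<^bsub>B\<^esub>"
      unfolding free_monoid_simps
      by (auto intro!: B.word_product_closed B.word_product_append ecl)
    note L = linear_extension_hom[OF free_monoid_is_monoid B *]
    show "?L \<in> algebra_hom ?F B" unfolding free_hecke_def by (rule L(1))
    show "?L (basis_elt w) = ?\<phi> w" if "w \<in> lists (hecke_gens n)" for w
      using L(2)[of w] that by (simp only: free_monoid_simps)
  qed
  note h = algebra_homD[OF L(1)]
  have Lg: "?L (basis_elt [g]) = e g" if "g \<in> hecke_gens n" for g
    using L(2)[of "[g]"] that ecl by simp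
  have cl: "basis_elt [g] \<in> carrier ?F" if "g \<in> hecke_gens n" for g
    using that by simp
  have "?L l = ?L r" if "(l, r) \<in> hecke_relations n \<q>" for l r
  proof -
    note R = rel[unfolded hecke_relations_hold_def]
    note R1 = R[THEN conjunct2, THEN conjunct1] and R2 = R[THEN conjunct2, THEN conjunct2]
    note R3 = R2[THEN conjunct2] note R4 = R3[THEN conjunct2] note R5 = R4[THEN conjunct2]
    note R6 = R5[THEN conjunct2] note R7 = R6[THEN conjunct2]
    show ?thesis
      using that unfolding hecke_relations_def Let_def Un_iff mem_Collect_eq
    proof (elim disjE exE conjE, goal_cases)
      case (1 k)
      then show ?case using R1[rule_format, of k] by (simp add: h(3,5) cl Lg)
    next
      case (2 k)
      then show ?case using R1[rule_format, of k] by (simp add: h(3,5) cl Lg)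
    next
      case (3 Y Z k m)
      have *: "?L (basis_elt [Y' k] \<otimes>\<^bsub>?F\<^esub> basis_elt [Z' m]) = ?L (basis_elt [Z' m] \<otimes>\<^bsub>?F\<^esub> basis_elt [Y' k])"
        if "Y' \<in> {GenX, GenXinv}" "Z' \<in> {GenX, GenXinv}" for Y' Z'
      proof -
        have g: "Y' k \<in> hecke_gens n" "Z' m \<in> hecke_gens n" using that 3 by auto
        have "e (Y' k) \<otimes>\<^bsub>B\<^esub> e (Z' m) = e (Z' m) \<otimes>\<^bsub>B\<^esub> e (Y' k)"
          using R2[THEN conjunct1] that 3(4,5) by blast
        then show ?thesis unfolding h(3)[OF cl[OF g(1)] cl[OF g(2)]] h(3)[OF cl[OF g(2)] cl[OF g(1)]]
            Lg[OF g(1)] Lg[OF g(2)] .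
      qed
      have "Y = (\<lambda>r. basis_elt [GenX r]) \<or> Y = (\<lambda>r. basis_elt [GenXinv r])"
        "Z = (\<lambda>r. basis_elt [GenX r]) \<or> Z = (\<lambda>r. basis_elt [GenXinv r])"
        using 3(2,3) by simp_all
      then show ?case
        using 3(1) *[OF insertI1 insertI1] *[OF insertI1 insertI2[OF singletonI]]
          *[OF insertI2[OF singletonI] insertI1] *[OF insertI2[OF singletonI] insertI2[OF singletonI]]
        by (elim disjE) (simp_all only: prod.inject)
    next
      case (4 k)
      then show ?case using R3[THEN conjunct1, rule_format, of k] by (simp add: h(3,4,5,6) cl Lg)
    next
      case (5 k)
      then show ?case using R4[THEN conjunct1, rule_format, of k] by (simp add: h(3,6) cl Lg)
    next
      case (6 k)
      then show ?case using R5[THEN conjunct1, rule_format, of k] by (simp add: h(3) cl Lg)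
    next
      case (7 k m)
      then show ?case using R6[THEN conjunct1, rule_format, of k m] by (simp add: h(3) cl Lg)
    next
      case (8 k m)
      then show ?case using R7[rule_format, of k m] by (simp add: h(3) cl Lg)
    qed
  qed
  then obtain f where f: "f \<in> algebra_hom (hecke_algebra n \<q>) B"
    "\<And>x. x \<in> carrier ?F \<Longrightarrow> f (relation_class ?F (hecke_relations n \<q>) x) = ?L x"
    using quotient_algebra_descend[OF free_hecke_algebra B hecke_relations_closed L(1)]
    unfolding hecke_algebra_def by metis
  then show ?thesis using cl Lg unfolding hecke_letter_def by (intro bexI[of _ f]) auto
qed

lemma hecke_algebra_hom_eqI:
  fixes \<q> :: "'r::comm_ring_1"
  assumes B: "assoc_algebra B"
    and F: "F \<in> algebra_hom (hecke_algebra n \<q>) B" and G: "G \<in> algebra_hom (hecke_algebra n \<q>) B"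
    and eq: "\<And>g. g \<in> hecke_gens n \<Longrightarrow> F (hecke_letter n \<q> g) = G (hecke_letter n \<q> g)"
    and x: "x \<in> carrier (hecke_algebra n \<q>)"
  shows "F x = G x"
proof (rule algebra_hom_quotient_eqI[OF free_hecke_algebra hecke_relations_closed _ x[unfolded hecke_algebra_def]])
  fix y :: "hecke_gen list \<Rightarrow> 'r" assume y: "y \<in> carrier (free_hecke n)"
  let ?c = "relation_class (free_hecke n) (hecke_relations n \<q>)"
  have FG: "F \<circ> ?c \<in> algebra_hom (free_hecke n) B" "G \<circ> ?c \<in> algebra_hom (free_hecke n) B"
    using algebra_hom_comp[OF hecke_algebra_props(2)] F G by blast+
  note hF = algebra_homD[OF FG(1)] and hG = algebra_homD[OF FG(2)]
  have "(F \<circ> ?c) (basis_elt w) = (G \<circ> ?c) (basis_elt w)" if "w \<in> lists (hecke_gens n)" for w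
    using that
  proof (induction w)
    case Nil
    show ?case using hF(5) hG(5) unfolding free_hecke_one by simp
  next
    case (Cons g w)
    have b: "basis_elt (g # w) = basis_elt [g] \<otimes>\<^bsub>free_hecke n\<^esub> (basis_elt w :: _ \<Rightarrow> 'r)"
      by (simp add: free_hecke_basis_mult)
    have g: "g \<in> hecke_gens n" "w \<in> lists (hecke_gens n)" using Cons by auto
    have cl: "basis_elt [g] \<in> carrier (free_hecke n)" "basis_elt w \<in> carrier (free_hecke n)"
      using g by simp_all
    have "(F \<circ> ?c) (basis_elt [g]) = (G \<circ> ?c) (basis_elt [g])"
      using eq[OF g(1)] by (simp add: hecke_letter_def)
    then show ?case unfolding b hF(3)[OF cl] hG(3)[OF cl] Cons.IH by simp
  qed
  then have w: "(F \<circ> ?c) (basis_elt w) = (G \<circ> ?c) (basis_elt w)" if "w \<in> carrier (free_monoid (hecke_gens n))" for w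
    using that unfolding free_monoid_simps .
  have "(F \<circ> ?c) y = (G \<circ> ?c) y"
    by (rule algebra_hom_monoid_algebra_eqI[OF free_monoid_is_monoid[of "hecke_gens n"] B,
          folded free_hecke_def, OF FG w y])
  then show "F (?c y) = G (?c y)" by simp
qed

section \<open>The type O algebra as a quotient of the algebra of words\<close>

text \<open>The algebraic part of the argument uses only that the monoid of diagrams is presented by
  the letters, subject to the commutation of letters that are far apart.\<close>

locale diagram_presentation =
  fixes n :: nat and cls :: "hecke_gen list \<Rightarrow> diagram set"
  assumes carrier_eq: "carrier (diagram_monoid n) = cls ` lists (hecke_gens n)"
    and cls_append: "v \<in> lists (hecke_gens n) \<Longrightarrow> w \<in> lists (hecke_gens n) \<Longrightarrow>
          cls (v @ w) = cls v \<otimes>\<^bsub>diagram_monoid n\<^esub> cls w"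
    and cls_Nil: "cls [] = \<one>\<^bsub>diagram_monoid n\<^esub>"
    and cls_eq_iff: "v \<in> lists (hecke_gens n) \<Longrightarrow> w \<in> lists (hecke_gens n) \<Longrightarrow>
          cls v = cls w \<longleftrightarrow> far_commutes v w"
    and cls_X: "r \<in> {1..n} \<Longrightarrow> cls [GenX r] = isotopy_class n (square_diagram r True)"
    and cls_Xinv: "r \<in> {1..n} \<Longrightarrow> cls [GenXinv r] = isotopy_class n (square_diagram r False)"
    and cls_T: "r \<in> {1..<n} \<Longrightarrow> cls [GenT r] = isotopy_class n (crossing_diagram r)"
begin

abbreviation "words \<equiv> lists (hecke_gens n)"

lemma cls_closed: "w \<in> words \<Longrightarrow> cls w \<in> carrier (diagram_monoid n)"
  by (simp add: carrier_eq)

lemma diagram_monoid_is_monoid: "Group.monoid (diagram_monoid n)"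
proof (rule monoidI)
  fix x y z
  assume "x \<in> carrier (diagram_monoid n)" "y \<in> carrier (diagram_monoid n)" "z \<in> carrier (diagram_monoid n)"
  then obtain u v w where *: "x = cls u" "u \<in> words" "y = cls v" "v \<in> words" "z = cls w" "w \<in> words"
    by (auto simp: carrier_eq)
  then have "u @ v \<in> words" "v @ w \<in> words" by auto
  then show "x \<otimes>\<^bsub>diagram_monoid n\<^esub> y \<in> carrier (diagram_monoid n)"
    "x \<otimes>\<^bsub>diagram_monoid n\<^esub> y \<otimes>\<^bsub>diagram_monoid n\<^esub> z =
       x \<otimes>\<^bsub>diagram_monoid n\<^esub> (y \<otimes>\<^bsub>diagram_monoid n\<^esub> z)"
    using * cls_closed by (simp_all flip: cls_append)
next
  fix x assume "x \<in> carrier (diagram_monoid n)"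
  then obtain u where "x = cls u" "u \<in> words" by (auto simp: carrier_eq)
  then show "\<one>\<^bsub>diagram_monoid n\<^esub> \<otimes>\<^bsub>diagram_monoid n\<^esub> x = x"
    "x \<otimes>\<^bsub>diagram_monoid n\<^esub> \<one>\<^bsub>diagram_monoid n\<^esub> = x"
    using cls_append[of "[]" u] cls_append[of u "[]"] by (simp_all add: cls_Nil)
qed (use cls_closed[of "[]"] in \<open>simp add: cls_Nil\<close>)

lemma diagram_span_algebra: "assoc_algebra (diagram_span n)"
  unfolding diagram_span_def by (rule monoid_algebra_is_algebra[OF diagram_monoid_is_monoid])

definition gen :: "hecke_gen \<Rightarrow> diagram set \<Rightarrow> 'r::comm_ring_1" where
  "gen g = basis_elt (cls [g])"

lemma gen_closed [simp]: "g \<in> hecke_gens n \<Longrightarrow> gen g \<in> carrier (diagram_span n)"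
  by (simp add: gen_def diagram_span_def cls_closed)

lemma gen_eqs:
  "r \<in> {1..n} \<Longrightarrow> basis_elt (isotopy_class n (square_diagram r True)) = gen (GenX r)"
  "r \<in> {1..n} \<Longrightarrow> basis_elt (isotopy_class n (square_diagram r False)) = gen (GenXinv r)"
  "r \<in> {1..<n} \<Longrightarrow> basis_elt (isotopy_class n (crossing_diagram r)) = gen (GenT r)"
  by (simp_all add: gen_def cls_X cls_Xinv cls_T)

lemma diagram_span_basis_mult:
  "v \<in> words \<Longrightarrow> w \<in> words \<Longrightarrow>
    basis_elt (cls v) \<otimes>\<^bsub>diagram_span n\<^esub> basis_elt (cls w) = (basis_elt (cls (v @ w)) :: _ \<Rightarrow> 'r::comm_ring_1)"
  by (simp add: diagram_span_def monoid_algebra_mult_basis cls_append)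

lemma diagram_span_one: "\<one>\<^bsub>diagram_span n\<^esub> = basis_elt (cls [])"
  by (simp add: diagram_span_def monoid_algebra_ops cls_Nil)

definition typeO_relations_hold ::
    "'r::comm_ring_1 \<Rightarrow> ('r, 'a) module \<Rightarrow> (hecke_gen \<Rightarrow> 'a) \<Rightarrow> bool" where
  "typeO_relations_hold \<q> A e \<longleftrightarrow>
     (\<forall>r\<in>{1..n}. e (GenX r) \<otimes>\<^bsub>A\<^esub> e (GenXinv r) = \<one>\<^bsub>A\<^esub>) \<and>
     (\<forall>r\<in>{1..n}. e (GenXinv r) \<otimes>\<^bsub>A\<^esub> e (GenX r) = \<one>\<^bsub>A\<^esub>) \<and>
     (\<forall>r\<in>{1..<n}. e (GenX r) \<otimes>\<^bsub>A\<^esub> e (GenT r) \<ominus>\<^bsub>A\<^esub> e (GenT r) \<otimes>\<^bsub>A\<^esub> e (GenX (r + 1)) =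
        e (GenX r) \<ominus>\<^bsub>A\<^esub> \<q> \<odot>\<^bsub>A\<^esub> e (GenX (r + 1))) \<and>
     (\<forall>r\<in>{1..<n}. e (GenT r) \<otimes>\<^bsub>A\<^esub> e (GenX r) \<ominus>\<^bsub>A\<^esub> e (GenX (r + 1)) \<otimes>\<^bsub>A\<^esub> e (GenT r) =
        e (GenX r) \<ominus>\<^bsub>A\<^esub> \<q> \<odot>\<^bsub>A\<^esub> e (GenX (r + 1))) \<and>
     (\<forall>r\<in>{1..<n}. e (GenT r) \<otimes>\<^bsub>A\<^esub> e (GenT r) = (1 + \<q>) \<odot>\<^bsub>A\<^esub> e (GenT r)) \<and>
     (\<forall>r\<in>{1..<n}. r + 1 \<in> {1..<n} \<longrightarrow>
        e (GenT r) \<otimes>\<^bsub>A\<^esub> e (GenT (r + 1)) \<otimes>\<^bsub>A\<^esub> e (GenT r) \<ominus>\<^bsub>A\<^esub>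
        e (GenT (r + 1)) \<otimes>\<^bsub>A\<^esub> e (GenT r) \<otimes>\<^bsub>A\<^esub> e (GenT (r + 1)) =
        \<q> \<odot>\<^bsub>A\<^esub> e (GenT r) \<ominus>\<^bsub>A\<^esub> \<q> \<odot>\<^bsub>A\<^esub> e (GenT (r + 1)))"

text \<open>The relations that the letters satisfy already in the monoid of diagrams.\<close>

definition commutes_far_apart :: "('r::comm_ring_1, 'a) module \<Rightarrow> (hecke_gen \<Rightarrow> 'a) \<Rightarrow> bool" where
  "commutes_far_apart A e \<longleftrightarrow> e ` hecke_gens n \<subseteq> carrier A \<and>
    (\<forall>a\<in>hecke_gens n. \<forall>b\<in>hecke_gens n. far_apart a b \<longrightarrow> e a \<otimes>\<^bsub>A\<^esub> e b = e b \<otimes>\<^bsub>A\<^esub> e a)"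

definition typeO_pairs where
  "typeO_pairs \<q> = (let A = diagram_span n in
     {(gen (GenX r) \<otimes>\<^bsub>A\<^esub> gen (GenXinv r), \<one>\<^bsub>A\<^esub>) | r. r \<in> {1..n}}
      \<union> {(gen (GenXinv r) \<otimes>\<^bsub>A\<^esub> gen (GenX r), \<one>\<^bsub>A\<^esub>) | r. r \<in> {1..n}}
      \<union> {(gen (GenX r) \<otimes>\<^bsub>A\<^esub> gen (GenT r) \<ominus>\<^bsub>A\<^esub> gen (GenT r) \<otimes>\<^bsub>A\<^esub> gen (GenX (r + 1)),
           gen (GenX r) \<ominus>\<^bsub>A\<^esub> \<q> \<odot>\<^bsub>A\<^esub> gen (GenX (r + 1))) | r. r \<in> {1..<n}}
      \<union> {(gen (GenT r) \<otimes>\<^bsub>A\<^esub> gen (GenX r) \<ominus>\<^bsub>A\<^esub> gen (GenX (r + 1)) \<otimes>\<^bsub>A\<^esub> gen (GenT r),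
           gen (GenX r) \<ominus>\<^bsub>A\<^esub> \<q> \<odot>\<^bsub>A\<^esub> gen (GenX (r + 1))) | r. r \<in> {1..<n}}
      \<union> {(gen (GenT r) \<otimes>\<^bsub>A\<^esub> gen (GenT r), (1 + \<q>) \<odot>\<^bsub>A\<^esub> gen (GenT r)) | r. r \<in> {1..<n}}
      \<union> {(gen (GenT r) \<otimes>\<^bsub>A\<^esub> gen (GenT (r + 1)) \<otimes>\<^bsub>A\<^esub> gen (GenT r) \<ominus>\<^bsub>A\<^esub>
           gen (GenT (r + 1)) \<otimes>\<^bsub>A\<^esub> gen (GenT r) \<otimes>\<^bsub>A\<^esub> gen (GenT (r + 1)),
           \<q> \<odot>\<^bsub>A\<^esub> gen (GenT r) \<ominus>\<^bsub>A\<^esub> \<q> \<odot>\<^bsub>A\<^esub> gen (GenT (r + 1))) | r.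
           r \<in> {1..<n} \<and> r + 1 \<in> {1..<n}})"

lemma typeO_relations_eq: "typeO_relations n \<q> = (typeO_pairs \<q> :: (_ \<times> (_ \<Rightarrow> 'r::comm_ring_1)) set)"
proof -
  have S: "(\<And>r. P r \<Longrightarrow> f r = f' r \<and> g r = g' r) \<Longrightarrow> {(f r, g r) | r. P r} = {(f' r, g' r) | r. P r}"
    for P :: "nat \<Rightarrow> bool" and f g f' g' :: "nat \<Rightarrow> 'x"
    by (auto; metis)
  show ?thesis
    unfolding typeO_relations_def typeO_pairs_def Let_def
    by (intro arg_cong2[where f = "(\<union>)"] S) (auto simp: gen_eqs)
qed

lemma typeO_relations_closed: "typeO_relations n \<q> \<subseteq> carrier (diagram_span n) \<times> carrier (diagram_span n)"
proof -
  interpret assoc_algebra "diagram_span n" by (rule diagram_span_algebra)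
  show ?thesis unfolding typeO_relations_eq typeO_pairs_def Let_def by auto
qed

lemma typeO_algebra_props:
  shows "assoc_algebra (typeO_algebra n \<q>)"
    and "relation_class (diagram_span n) (typeO_relations n \<q>) \<in> algebra_hom (diagram_span n) (typeO_algebra n \<q>)"
    and "\<And>l r. (l, r) \<in> typeO_relations n \<q> \<Longrightarrow>
      relation_class (diagram_span n) (typeO_relations n \<q>) l = relation_class (diagram_span n) (typeO_relations n \<q>) r"
  unfolding typeO_algebra_def
  by (rule quotient_algebra_props[OF diagram_span_algebra typeO_relations_closed]; assumption?)+

definition typeO_letter :: "'r::comm_ring_1 \<Rightarrow> hecke_gen \<Rightarrow> (diagram set \<Rightarrow> 'r) set" where
  "typeO_letter \<q> g = relation_class (diagram_span n) (typeO_relations n \<q>) (gen g)"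

lemma typeO_letters_closed:
  fixes \<q> :: "'r::comm_ring_1"
  shows "g \<in> hecke_gens n \<Longrightarrow> typeO_letter \<q> g \<in> carrier (typeO_algebra n \<q>)"
  unfolding typeO_letter_def by (rule algebra_homD(2)[OF typeO_algebra_props(2) gen_closed])

lemma typeO_letters_relations:
  fixes \<q> :: "'r::comm_ring_1"
  shows "typeO_relations_hold \<q> (typeO_algebra n \<q>) (typeO_letter \<q>)"
proof -
  let ?A = "diagram_span n :: ('r, _) module"
  interpret A: assoc_algebra ?A by (rule diagram_span_algebra)
  note P = typeO_algebra_props[where \<q> = \<q>]
  note h = algebra_homD[OF P(2)] and hm = algebra_hom_minus[OF P(2) diagram_span_algebra P(1)]
  show ?thesis
    unfolding typeO_relations_hold_def typeO_letter_def
  proof (intro conjI ballI impI, goal_cases)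
    case (1 r)
    have "(gen (GenX r) \<otimes>\<^bsub>?A\<^esub> gen (GenXinv r), \<one>\<^bsub>?A\<^esub>) \<in> typeO_relations n \<q>"
      using 1 unfolding typeO_relations_eq typeO_pairs_def Let_def by blast
    from P(3)[OF this] show ?case using 1 by (simp add: h(3,5))
  next
    case (2 r)
    have "(gen (GenXinv r) \<otimes>\<^bsub>?A\<^esub> gen (GenX r), \<one>\<^bsub>?A\<^esub>) \<in> typeO_relations n \<q>"
      using 2 unfolding typeO_relations_eq typeO_pairs_def Let_def by blast
    from P(3)[OF this] show ?case using 2 by (simp add: h(3,5))
  next
    case (3 r)
    have "(gen (GenX r) \<otimes>\<^bsub>?A\<^esub> gen (GenT r) \<ominus>\<^bsub>?A\<^esub> gen (GenT r) \<otimes>\<^bsub>?A\<^esub> gen (GenX (r + 1)),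
           gen (GenX r) \<ominus>\<^bsub>?A\<^esub> \<q> \<odot>\<^bsub>?A\<^esub> gen (GenX (r + 1))) \<in> typeO_relations n \<q>"
      using 3 unfolding typeO_relations_eq typeO_pairs_def Let_def by blast
    from P(3)[OF this] show ?case using 3 by (simp add: h(3,6) hm)
  next
    case (4 r)
    have "(gen (GenT r) \<otimes>\<^bsub>?A\<^esub> gen (GenX r) \<ominus>\<^bsub>?A\<^esub> gen (GenX (r + 1)) \<otimes>\<^bsub>?A\<^esub> gen (GenT r),
           gen (GenX r) \<ominus>\<^bsub>?A\<^esub> \<q> \<odot>\<^bsub>?A\<^esub> gen (GenX (r + 1))) \<in> typeO_relations n \<q>"
      using 4 unfolding typeO_relations_eq typeO_pairs_def Let_def by blast
    from P(3)[OF this] show ?case using 4 by (simp add: h(3,6) hm)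
  next
    case (5 r)
    have "(gen (GenT r) \<otimes>\<^bsub>?A\<^esub> gen (GenT r), (1 + \<q>) \<odot>\<^bsub>?A\<^esub> gen (GenT r)) \<in> typeO_relations n \<q>"
      using 5 unfolding typeO_relations_eq typeO_pairs_def Let_def by blast
    from P(3)[OF this] show ?case using 5 by (simp add: h(3,6))
  next
    case (6 r)
    have "(gen (GenT r) \<otimes>\<^bsub>?A\<^esub> gen (GenT (r + 1)) \<otimes>\<^bsub>?A\<^esub> gen (GenT r) \<ominus>\<^bsub>?A\<^esub>
           gen (GenT (r + 1)) \<otimes>\<^bsub>?A\<^esub> gen (GenT r) \<otimes>\<^bsub>?A\<^esub> gen (GenT (r + 1)),
           \<q> \<odot>\<^bsub>?A\<^esub> gen (GenT r) \<ominus>\<^bsub>?A\<^esub> \<q> \<odot>\<^bsub>?A\<^esub> gen (GenT (r + 1))) \<in> typeO_relations n \<q>"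
      using 6 unfolding typeO_relations_eq typeO_pairs_def Let_def by blast
    from P(3)[OF this] show ?case using 6 by (simp add: h(3,6) hm)
  qed
qed

lemma typeO_letters_commute:
  fixes \<q> :: "'r::comm_ring_1"
  shows "commutes_far_apart (typeO_algebra n \<q>) (typeO_letter \<q>)"
  unfolding commutes_far_apart_def
proof (intro conjI ballI impI)
  show "typeO_letter \<q> ` hecke_gens n \<subseteq> carrier (typeO_algebra n \<q>)"
    using typeO_letters_closed by auto
  fix a b assume ab: "a \<in> hecke_gens n" "b \<in> hecke_gens n" "far_apart a b"
  note h = algebra_homD[OF typeO_algebra_props(2)]
  have "cls [a, b] = cls [b, a]"
    using ab far_commutes_swap[OF ab(3), of "[]" "[]"] cls_eq_iff[of "[a, b]" "[b, a]"] by simp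
  then have e: "gen a \<otimes>\<^bsub>diagram_span n\<^esub> gen b = gen b \<otimes>\<^bsub>diagram_span n\<^esub> (gen a :: _ \<Rightarrow> 'r)"
    unfolding gen_def using ab by (simp add: diagram_span_basis_mult)
  show "typeO_letter \<q> a \<otimes>\<^bsub>typeO_algebra n \<q>\<^esub> typeO_letter \<q> b = typeO_letter \<q> b \<otimes>\<^bsub>typeO_algebra n \<q>\<^esub> typeO_letter \<q> a"
    unfolding typeO_letter_def h(3)[OF gen_closed[OF ab(1)] gen_closed[OF ab(2)], symmetric]
      h(3)[OF gen_closed[OF ab(2)] gen_closed[OF ab(1)], symmetric] e ..
qed

text \<open>The product of the images of the letters of a word depends only on the diagram of the
  word, because equal diagrams have words that differ by far commutation.\<close>

lemma typeO_algebra_hom_exists: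
  fixes \<q> :: "'r::comm_ring_1"
  assumes B: "assoc_algebra B" and comm: "commutes_far_apart B e" and rel: "typeO_relations_hold \<q> B e"
  shows "\<exists>f\<in>algebra_hom (typeO_algebra n \<q>) B. \<forall>g\<in>hecke_gens n. f (typeO_letter \<q> g) = e g"
proof -
  interpret B: assoc_algebra B by fact
  let ?A = "diagram_span n :: ('r, _) module" and ?M = "diagram_monoid n"
  interpret A: assoc_algebra ?A by (rule diagram_span_algebra)
  have ecl: "e g \<in> carrier B" if "g \<in> hecke_gens n" for g
    using comm that by (auto simp: commutes_far_apart_def)
  define \<phi> where "\<phi> m = B.word_product e (SOME w. w \<in> words \<and> cls w = m)" for m
  have \<phi>: "\<phi> (cls w) = B.word_product e w" if w: "w \<in> words" for w
    unfolding \<phi>_def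
  proof (rule someI2[where a = w])
    fix v assume v: "v \<in> words \<and> cls v = cls w"
    then have "far_commutes v w" using cls_eq_iff w by blast
    then show "B.word_product e v = B.word_product e w"
      by (rule B.word_product_far_commutes[where G = "hecke_gens n"])
         (use v ecl comm in \<open>auto simp: commutes_far_apart_def\<close>)
  qed (use w in simp)
  have Bw: "B.word_product e w \<in> carrier B" if "w \<in> words" for w
    using that ecl by (intro B.word_product_closed) auto
  have Ba: "B.word_product e (v @ w) = B.word_product e v \<otimes>\<^bsub>B\<^esub> B.word_product e w"
    if "v \<in> words" "w \<in> words" for v w
    using that ecl by (intro B.word_product_append) auto
  have *: "\<And>m. m \<in> carrier ?M \<Longrightarrow> \<phi> m \<in> carrier B"
    "\<And>l m. l \<in> carrier ?M \<Longrightarrow> m \<in> carrier ?M \<Longrightarrow> \<phi> (l \<otimes>\<^bsub>?M\<^esub> m) = \<phi> l \<otimes>\<^bsub>B\<^esub> \<phi> m"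
    "\<phi> \<one>\<^bsub>?M\<^esub> = \<one>\<^bsub>B\<^esub>"
  proof -
    show "\<phi> m \<in> carrier B" if m: "m \<in> carrier ?M" for m
    proof -
      obtain w where "m = cls w" "w \<in> words" using m unfolding carrier_eq by (elim imageE)
      then show ?thesis using Bw \<phi> by metis
    qed
    show "\<phi> (l \<otimes>\<^bsub>?M\<^esub> m) = \<phi> l \<otimes>\<^bsub>B\<^esub> \<phi> m" if lm: "l \<in> carrier ?M" "m \<in> carrier ?M" for l m
    proof -
      obtain v w where vw: "l = cls v" "v \<in> words" "m = cls w" "w \<in> words"
        using lm unfolding carrier_eq by auto
      then have "v @ w \<in> words" by simp
      then show ?thesis unfolding vw cls_append[OF vw(2,4), symmetric]
        by (simp add: \<phi> vw(2,4) Ba del: append_in_lists_conv)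
    qed
    show "\<phi> \<one>\<^bsub>?M\<^esub> = \<one>\<^bsub>B\<^esub>" using \<phi>[of "[]"] by (simp add: cls_Nil)
  qed
  let ?L = "linear_extension B \<phi> :: (diagram set \<Rightarrow> 'r) \<Rightarrow> _"
  note L' = linear_extension_hom[OF diagram_monoid_is_monoid B *]
  have L: "?L \<in> algebra_hom ?A B" unfolding diagram_span_def by (rule L'(1))
  have Lg: "?L (gen g) = e g" if "g \<in> hecke_gens n" for g
    unfolding gen_def using that cls_closed[of "[g]"] \<phi>[of "[g]"] ecl[OF that]
    by (subst L'(2)) auto
  note h = algebra_homD[OF L] and hm = algebra_hom_minus[OF L diagram_span_algebra B]
  have "?L l = ?L r" if "(l, r) \<in> typeO_relations n \<q>" for l r
  proof -
    note R = rel[unfolded typeO_relations_hold_def]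
    note R2 = R[THEN conjunct2] note R3 = R2[THEN conjunct2] note R4 = R3[THEN conjunct2]
    note R5 = R4[THEN conjunct2] note R6 = R5[THEN conjunct2]
    show ?thesis
      using that unfolding typeO_relations_eq typeO_pairs_def Let_def Un_iff mem_Collect_eq
    proof (elim disjE exE conjE, goal_cases)
      case (1 k)
      then show ?case using R[THEN conjunct1, rule_format, of k] by (simp add: h(3,5) Lg)
    next
      case (2 k)
      then show ?case using R2[THEN conjunct1, rule_format, of k] by (simp add: h(3,5) Lg)
    next
      case (3 k)
      then show ?case using R3[THEN conjunct1, rule_format, of k] by (simp add: h(3,6) hm Lg)
    next
      case (4 k)
      then show ?case using R4[THEN conjunct1, rule_format, of k] by (simp add: h(3,6) hm Lg)
    next
      case (5 k)
      then show ?case using R5[THEN conjunct1, rule_format, of k] by (simp add: h(3,6) hm Lg)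
    next
      case (6 k)
      then show ?case using R6[rule_format, of k] by (simp add: h(3,6) hm Lg)
    qed
  qed
  then obtain f where f: "f \<in> algebra_hom (typeO_algebra n \<q>) B"
    "\<And>x. x \<in> carrier ?A \<Longrightarrow> f (relation_class ?A (typeO_relations n \<q>) x) = ?L x"
    using quotient_algebra_descend[OF diagram_span_algebra B typeO_relations_closed L]
    unfolding typeO_algebra_def by metis
  then show ?thesis using Lg unfolding typeO_letter_def by (intro bexI[of _ f]) auto
qed

lemma typeO_algebra_hom_eqI:
  fixes \<q> :: "'r::comm_ring_1"
  assumes B: "assoc_algebra B"
    and F: "F \<in> algebra_hom (typeO_algebra n \<q>) B" and G: "G \<in> algebra_hom (typeO_algebra n \<q>) B"
    and eq: "\<And>g. g \<in> hecke_gens n \<Longrightarrow> F (typeO_letter \<q> g) = G (typeO_letter \<q> g)"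
    and x: "x \<in> carrier (typeO_algebra n \<q>)"
  shows "F x = G x"
proof (rule algebra_hom_quotient_eqI[OF diagram_span_algebra typeO_relations_closed _ x[unfolded typeO_algebra_def]])
  fix y :: "diagram set \<Rightarrow> 'r" assume y: "y \<in> carrier (diagram_span n)"
  let ?c = "relation_class (diagram_span n) (typeO_relations n \<q>)"
  have FG: "F \<circ> ?c \<in> algebra_hom (diagram_span n) B" "G \<circ> ?c \<in> algebra_hom (diagram_span n) B"
    using algebra_hom_comp[OF typeO_algebra_props(2)] F G by blast+
  note hF = algebra_homD[OF FG(1)] and hG = algebra_homD[OF FG(2)]
  have "(F \<circ> ?c) (basis_elt (cls w)) = (G \<circ> ?c) (basis_elt (cls w))" if "w \<in> words" for w
    using that
  proof (induction w)
    case Nil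
    show ?case using hF(5) hG(5) unfolding diagram_span_one by simp
  next
    case (Cons g w)
    have g: "g \<in> hecke_gens n" "w \<in> words" using Cons by auto
    have b: "basis_elt (cls (g # w)) = gen g \<otimes>\<^bsub>diagram_span n\<^esub> (basis_elt (cls w) :: _ \<Rightarrow> 'r)"
      unfolding gen_def using g by (subst diagram_span_basis_mult) simp_all
    have cl: "gen g \<in> carrier (diagram_span n)" "basis_elt (cls w) \<in> carrier (diagram_span n)"
      using g by (simp_all add: diagram_span_def cls_closed gen_def)
    have "(F \<circ> ?c) (gen g) = (G \<circ> ?c) (gen g)"
      using eq[OF g(1)] by (simp add: typeO_letter_def)
    then show ?case unfolding b hF(3)[OF cl] hG(3)[OF cl] Cons.IH by simp
  qed
  then have w: "(F \<circ> ?c) (basis_elt m) = (G \<circ> ?c) (basis_elt m)" if "m \<in> carrier (diagram_monoid n)" for m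
    using that unfolding carrier_eq by auto
  have "(F \<circ> ?c) y = (G \<circ> ?c) y"
    by (rule algebra_hom_monoid_algebra_eqI[OF diagram_monoid_is_monoid B,
          folded diagram_span_def, OF FG w y])
  then show "F (?c y) = G (?c y)" by simp
qed

text \<open>The commutation of \<open>T\<^sub>r\<close> with the inverses of squares on other
  strands is not among the Hecke relations, but follows from that with the squares.\<close>

lemma hecke_relations_iff_typeO_relations:
  assumes A: "assoc_algebra A" and cl: "\<And>g. g \<in> hecke_gens n \<Longrightarrow> e g \<in> carrier A"
    and e': "\<And>r. e' (GenX r) = e (GenX r)" "\<And>r. e' (GenXinv r) = e (GenXinv r)"
      "\<And>r. r \<in> {1..<n} \<Longrightarrow> e' (GenT r) = e (GenT r) \<oplus>\<^bsub>A\<^esub> \<one>\<^bsub>A\<^esub>"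
    and q: "q' * \<q> = 1"
  shows "hecke_relations_hold n \<q> A e \<longleftrightarrow> commutes_far_apart A e' \<and> typeO_relations_hold \<q> A e'"
proof -
  interpret A: assoc_algebra A by fact
  have X: "e (GenX r) \<in> carrier A" "e (GenXinv r) \<in> carrier A" if "r \<in> {1..n}" for r using cl that by auto
  have T: "e (GenT r) \<in> carrier A" if "r \<in> {1..<n}" for r using cl that by auto
  have T1: "e (GenT r) \<in> carrier A" "e (GenX r) \<in> carrier A" "e (GenX (r + 1)) \<in> carrier A" if "r \<in> {1..<n}" for r
    using cl that by auto
  show ?thesis
  proof
    assume H: "hecke_relations_hold n \<q> A e"
    note R = H[unfolded hecke_relations_hold_def]
    note R1 = R[THEN conjunct2, THEN conjunct1, rule_format] and R2 = R[THEN conjunct2, THEN conjunct2]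
    note R3 = R2[THEN conjunct2] note R4 = R3[THEN conjunct2] note R5 = R4[THEN conjunct2]
    note R6 = R5[THEN conjunct2] note R7 = R6[THEN conjunct2, rule_format]
    note xx = R2[THEN conjunct1, rule_format] and quad = R3[THEN conjunct1, rule_format]
      and bern = R4[THEN conjunct1, rule_format] and braid = R5[THEN conjunct1, rule_format]
      and tx = R6[THEN conjunct1, rule_format]
    have quad': "e (GenT r) \<otimes>\<^bsub>A\<^esub> e (GenT r) \<oplus>\<^bsub>A\<^esub> e (GenT r) = \<q> \<odot>\<^bsub>A\<^esub> e (GenT r) \<oplus>\<^bsub>A\<^esub> \<q> \<odot>\<^bsub>A\<^esub> \<one>\<^bsub>A\<^esub>"
      if "r \<in> {1..<n}" for r
      using quad[OF that] A.quadratic_iff[OF T[OF that]] by blast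
    have txi: "e (GenT r) \<otimes>\<^bsub>A\<^esub> e (GenXinv s) = e (GenXinv s) \<otimes>\<^bsub>A\<^esub> e (GenT r)"
      if "r \<in> {1..<n}" "s \<in> {1..n}" "s \<noteq> r" "s \<noteq> r + 1" for r s
      using A.commute_inverse[OF T[OF that(1)] X[OF that(2)]] R1[OF that(2)] tx[OF that] by blast
    have cx: "e' (GenT r) \<otimes>\<^bsub>A\<^esub> e' (Z s) = e' (Z s) \<otimes>\<^bsub>A\<^esub> e' (GenT r)"
      if "r \<in> {1..<n}" "s \<in> {1..n}" "s \<noteq> r" "s \<noteq> r + 1" "Z = GenX \<or> Z = GenXinv" for r s Z
      using that(5) A.add_one_commute_iff[OF T[OF that(1)] X(1)[OF that(2)]]
        A.add_one_commute_iff[OF T[OF that(1)] X(2)[OF that(2)]] tx[OF that(1-4)] txi[OF that(1-4)]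
      by (auto simp only: e' e'(3)[OF that(1)])
    have cc: "e' (GenT r) \<otimes>\<^bsub>A\<^esub> e' (GenT s) = e' (GenT s) \<otimes>\<^bsub>A\<^esub> e' (GenT r)"
      if "r \<in> {1..<n}" "s \<in> {1..<n}" "s \<noteq> r + 1" "r \<noteq> s + 1" for r s
    proof -
      have "(e (GenT r) \<oplus>\<^bsub>A\<^esub> \<one>\<^bsub>A\<^esub>) \<otimes>\<^bsub>A\<^esub> e (GenT s) = e (GenT s) \<otimes>\<^bsub>A\<^esub> (e (GenT r) \<oplus>\<^bsub>A\<^esub> \<one>\<^bsub>A\<^esub>)"
        using R7[OF that] A.add_one_commute_iff[OF T[OF that(1)] T[OF that(2)]] by blast
      then have "(e (GenT s) \<oplus>\<^bsub>A\<^esub> \<one>\<^bsub>A\<^esub>) \<otimes>\<^bsub>A\<^esub> (e (GenT r) \<oplus>\<^bsub>A\<^esub> \<one>\<^bsub>A\<^esub>) = (e (GenT r) \<oplus>\<^bsub>A\<^esub> \<one>\<^bsub>A\<^esub>) \<otimes>\<^bsub>A\<^esub> (e (GenT s) \<oplus>\<^bsub>A\<^esub> \<one>\<^bsub>A\<^esub>)"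
        using A.add_one_commute_iff[OF T[OF that(2)], of "e (GenT r) \<oplus>\<^bsub>A\<^esub> \<one>\<^bsub>A\<^esub>"] T[OF that(1)] by simp
      then show ?thesis unfolding e'(3)[OF that(1)] e'(3)[OF that(2)] by (rule sym)
    qed
    have ecl': "e' g \<in> carrier A" if "g \<in> hecke_gens n" for g
      using that T X by (cases g) (auto simp: e')
    have "commutes_far_apart A e'"
      unfolding commutes_far_apart_def
    proof (intro conjI ballI impI)
      show "e' ` hecke_gens n \<subseteq> carrier A" using ecl' by auto
      fix a b assume ab: "a \<in> hecke_gens n" "b \<in> hecke_gens n" "far_apart a b"
      show "e' a \<otimes>\<^bsub>A\<^esub> e' b = e' b \<otimes>\<^bsub>A\<^esub> e' a"
      proof (cases "\<exists>r. a = GenT r")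
        case True
        then obtain r where a: "a = GenT r" ..
        show ?thesis
        proof (cases b)
          case (GenT s) then show ?thesis using ab a by (auto intro!: cc)
        next
          case (GenX s) then show ?thesis using ab a cx[of r s GenX] by simp
        next
          case (GenXinv s) then show ?thesis using ab a cx[of r s GenXinv] by simp
        qed
      next
        case a: False
        show ?thesis
        proof (cases "\<exists>r. b = GenT r")
          case True
          then obtain r where b: "b = GenT r" ..
          from a obtain s Z where "a = Z s" "Z = GenX \<or> Z = GenXinv" by (cases a) auto
          then show ?thesis using ab b cx[of r s Z] by auto
        next
          case b: False
          from a obtain s Z where "a = Z s" "Z = GenX \<or> Z = GenXinv" "e' a = e a" by (cases a) (auto simp: e')
          moreover from b obtain r Y where "b = Y r" "Y = GenX \<or> Y = GenXinv" "e' b = e b" by (cases b) (auto simp: e')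
          ultimately show ?thesis using xx[of s r Z Y] ab by auto
        qed
      qed
    qed
    moreover have "typeO_relations_hold \<q> A e'"
      unfolding typeO_relations_hold_def
    proof (intro conjI ballI impI, goal_cases)
      case (1 r) then show ?case using R1[of r] by (simp add: e')
    next
      case (2 r) then show ?case using R1[of r] by (simp add: e')
    next
      case (3 r) show ?case
        unfolding e' e'(3)[OF 3] A.crossing_slide_iff(1)[OF T1[OF 3]]
        by (rule A.slide_from_bernstein(1)[OF T1[OF 3] q quad'[OF 3] bern[OF 3]])
    next
      case (4 r) show ?case
        unfolding e' e'(3)[OF 4] A.crossing_slide_iff(2)[OF T1[OF 4]]
        by (rule A.slide_from_bernstein(2)[OF T1[OF 4] q quad'[OF 4] bern[OF 4]])
    next
      case (5 r) show ?case
        unfolding e'(3)[OF 5] A.crossing_quadratic_iff[OF T[OF 5]] by (rule quad'[OF 5])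
    next
      case (6 r) show ?case
        unfolding e'(3)[OF 6(1)] e'(3)[OF 6(2)]
          A.crossing_braid_iff[OF T[OF 6(1)] T[OF 6(2)] quad'[OF 6(1)] quad'[OF 6(2)]]
        by (rule braid[OF 6])
    qed
    ultimately show "commutes_far_apart A e' \<and> typeO_relations_hold \<q> A e'" ..
  next
    assume H: "commutes_far_apart A e' \<and> typeO_relations_hold \<q> A e'"
    note C = H[THEN conjunct1, unfolded commutes_far_apart_def, THEN conjunct2, rule_format]
    note R = H[THEN conjunct2, unfolded typeO_relations_hold_def]
    note R2 = R[THEN conjunct2] note R3 = R2[THEN conjunct2] note R4 = R3[THEN conjunct2]
    note R5 = R4[THEN conjunct2] note R6 = R5[THEN conjunct2]
    note inv1 = R[THEN conjunct1, rule_format] and inv2 = R2[THEN conjunct1, rule_format]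
      and slide = R3[THEN conjunct1, rule_format] and quad = R5[THEN conjunct1, rule_format]
      and braid = R6[rule_format]
    have quad': "e (GenT r) \<otimes>\<^bsub>A\<^esub> e (GenT r) \<oplus>\<^bsub>A\<^esub> e (GenT r) = \<q> \<odot>\<^bsub>A\<^esub> e (GenT r) \<oplus>\<^bsub>A\<^esub> \<q> \<odot>\<^bsub>A\<^esub> \<one>\<^bsub>A\<^esub>"
      if "r \<in> {1..<n}" for r
      using quad[OF that] unfolding e'(3)[OF that] A.crossing_quadratic_iff[OF T[OF that]] .
    show "hecke_relations_hold n \<q> A e"
      unfolding hecke_relations_hold_def
    proof (intro conjI ballI impI, goal_cases)
      case 1 show ?case using cl by auto
    next
      case (2 r) then show ?case using inv1[of r] by (simp add: e')
    next
      case (3 r) then show ?case using inv2[of r] by (simp add: e')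
    next
      case (4 r s Y Z)
      then have "Y r \<in> hecke_gens n" "Z s \<in> hecke_gens n" "far_apart (Y r) (Z s)" "e' (Y r) = e (Y r)" "e' (Z s) = e (Z s)"
        by (auto simp: e')
      then show ?case using C[of "Y r" "Z s"] by simp
    next
      case (5 r) show ?case using quad'[OF 5] A.quadratic_iff[OF T[OF 5]] by blast
    next
      case (6 r)
      have "e (GenX r) \<otimes>\<^bsub>A\<^esub> e (GenT r) \<oplus>\<^bsub>A\<^esub> \<q> \<odot>\<^bsub>A\<^esub> e (GenX (r + 1)) = e (GenT r) \<otimes>\<^bsub>A\<^esub> e (GenX (r + 1)) \<oplus>\<^bsub>A\<^esub> e (GenX (r + 1))"
        using slide[OF 6] unfolding e' e'(3)[OF 6] A.crossing_slide_iff(1)[OF T1[OF 6]] .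
      then show ?case by (rule A.bernstein_from_slide[OF T1[OF 6] quad'[OF 6]])
    next
      case (7 r) show ?case
        using braid[OF 7] unfolding e'(3)[OF 7(1)] e'(3)[OF 7(2)]
          A.crossing_braid_iff[OF T[OF 7(1)] T[OF 7(2)] quad'[OF 7(1)] quad'[OF 7(2)]] .
    next
      case (8 r s)
      then have "e' (GenT r) \<otimes>\<^bsub>A\<^esub> e' (GenX s) = e' (GenX s) \<otimes>\<^bsub>A\<^esub> e' (GenT r)" by (intro C) auto
      then show ?case unfolding e' e'(3)[OF 8(1)] A.add_one_commute_iff[OF T[OF 8(1)] X(1)[OF 8(2)]] .
    next
      case (9 r s)
      show ?case
      proof (cases "r = s")
        case False
        then have c: "e' (GenT r) \<otimes>\<^bsub>A\<^esub> e' (GenT s) = e' (GenT s) \<otimes>\<^bsub>A\<^esub> e' (GenT r)" using 9 by (intro C) auto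
        have "e (GenT r) \<otimes>\<^bsub>A\<^esub> e' (GenT s) = e' (GenT s) \<otimes>\<^bsub>A\<^esub> e (GenT r)"
          using c T[OF 9(2)] unfolding e'(3)[OF 9(1)] by (subst (asm) A.add_one_commute_iff[OF T[OF 9(1)]]) (auto simp: e'(3)[OF 9(2)])
        then have "(e (GenT s) \<oplus>\<^bsub>A\<^esub> \<one>\<^bsub>A\<^esub>) \<otimes>\<^bsub>A\<^esub> e (GenT r) = e (GenT r) \<otimes>\<^bsub>A\<^esub> (e (GenT s) \<oplus>\<^bsub>A\<^esub> \<one>\<^bsub>A\<^esub>)"
          unfolding e'(3)[OF 9(2)] by (rule sym)
        then show ?thesis unfolding A.add_one_commute_iff[OF T[OF 9(2)] T[OF 9(1)]] by (rule sym)
      qed simp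
    qed
  qed
qed

text \<open>Both universal properties apply to the letters, with \<open>T\<close> replaced by
  \<open>T + 1\<close> in one direction and \<open>c\<close> by \<open>c - 1\<close> in the other.
  The composites fix the generators.\<close>

theorem hecke_typeO_iso:
  fixes \<q> :: "'r::comm_ring_1"
  assumes q: "q' * \<q> = 1"
  shows "\<exists>f \<in> algebra_iso (hecke_algebra n \<q>) (typeO_algebra n \<q>).
           (\<forall>r\<in>{1..<n}. f (hecke_T n \<q> r \<oplus>\<^bsub>hecke_algebra n \<q>\<^esub> \<one>\<^bsub>hecke_algebra n \<q>\<^esub>)
                          = typeO_class n \<q> (crossing_diagram r)) \<and>
           (\<forall>r\<in>{1..n}. f (hecke_X n \<q> r) = typeO_class n \<q> (square_diagram r True))"
proof -
  let ?H = "hecke_algebra n \<q>" and ?O = "typeO_algebra n \<q>"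
  interpret H: assoc_algebra ?H by (rule hecke_algebra_props(1))
  interpret O: assoc_algebra ?O by (rule typeO_algebra_props(1))
  note Ha = hecke_algebra_props(1)[where n = n and \<q> = \<q>] and Oa = typeO_algebra_props(1)[where \<q> = \<q>]
  have Hcl: "hecke_letter n \<q> g \<in> carrier ?H" if "g \<in> hecke_gens n" for g
    using hecke_letters_relations[where n = n and \<q> = \<q>, unfolded hecke_relations_hold_def, THEN conjunct1] that
    by blast
  note Ocl = typeO_letters_closed[where \<q> = \<q>]
  define eH where "eH g = (case g of GenT r \<Rightarrow> hecke_letter n \<q> g \<oplus>\<^bsub>?H\<^esub> \<one>\<^bsub>?H\<^esub> | _ \<Rightarrow> hecke_letter n \<q> g)" for g
  define eO where "eO g = (case g of GenT r \<Rightarrow> typeO_letter \<q> g \<ominus>\<^bsub>?O\<^esub> \<one>\<^bsub>?O\<^esub> | _ \<Rightarrow> typeO_letter \<q> g)" for g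
  have H: "commutes_far_apart ?H eH \<and> typeO_relations_hold \<q> ?H eH"
  proof -
    have *: "\<And>r. eH (GenX r) = hecke_letter n \<q> (GenX r)" "\<And>r. eH (GenXinv r) = hecke_letter n \<q> (GenXinv r)"
      "\<And>r. r \<in> {1..<n} \<Longrightarrow> eH (GenT r) = hecke_letter n \<q> (GenT r) \<oplus>\<^bsub>?H\<^esub> \<one>\<^bsub>?H\<^esub>"
      by (simp_all add: eH_def)
    show ?thesis
      using hecke_relations_iff_typeO_relations[OF Ha Hcl * q] hecke_letters_relations[where n = n and \<q> = \<q>] by blast
  qed
  then obtain G where G: "G \<in> algebra_hom ?O ?H" "\<And>g. g \<in> hecke_gens n \<Longrightarrow> G (typeO_letter \<q> g) = eH g"
    using typeO_algebra_hom_exists[OF Ha H[THEN conjunct1] H[THEN conjunct2]] by blast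
  have eOcl: "eO g \<in> carrier ?O" if "g \<in> hecke_gens n" for g
    using that Ocl by (cases g) (auto simp: eO_def)
  have TO: "typeO_letter \<q> (GenT r) = eO (GenT r) \<oplus>\<^bsub>?O\<^esub> \<one>\<^bsub>?O\<^esub>" if "r \<in> {1..<n}" for r
    using that Ocl[of "GenT r"] by (simp add: eO_def O.diff_add_cancel)
  have O: "hecke_relations_hold n \<q> ?O eO"
  proof -
    have *: "\<And>r. typeO_letter \<q> (GenX r) = eO (GenX r)" "\<And>r. typeO_letter \<q> (GenXinv r) = eO (GenXinv r)"
      by (simp_all add: eO_def)
    show ?thesis
      using hecke_relations_iff_typeO_relations[OF Oa eOcl * TO q] typeO_letters_relations typeO_letters_commute by blast
  qed
  then obtain F where F: "F \<in> algebra_hom ?H ?O" "\<And>g. g \<in> hecke_gens n \<Longrightarrow> F (hecke_letter n \<q> g) = eO g"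
    using hecke_algebra_hom_exists[OF Oa O] by blast
  note hF = algebra_homD[OF F(1)] and hG = algebra_homD[OF G(1)]
  have idH: "id \<in> algebra_hom ?H ?H" and idO: "id \<in> algebra_hom ?O ?O"
    by (auto simp: algebra_hom_def ring_hom_def)
  have FT: "F (eH g) = typeO_letter \<q> g" if "g \<in> hecke_gens n" for g
  proof (cases g)
    case (GenT r)
    then have r: "r \<in> {1..<n}" using that by simp
    have "F (eH g) = F (hecke_letter n \<q> g) \<oplus>\<^bsub>?O\<^esub> \<one>\<^bsub>?O\<^esub>"
      using Hcl[OF that] by (simp add: eH_def GenT hF(4,5))
    then show ?thesis unfolding GenT TO[OF r] F(2)[OF that, unfolded GenT] .
  qed (use F(2)[OF that] in \<open>simp_all add: eH_def eO_def\<close>)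
  have GT: "G (eO g) = hecke_letter n \<q> g" if "g \<in> hecke_gens n" for g
  proof (cases g)
    case (GenT r)
    have "G (eO g) = G (typeO_letter \<q> g) \<ominus>\<^bsub>?H\<^esub> \<one>\<^bsub>?H\<^esub>"
      using Ocl[OF that] by (simp add: eO_def GenT algebra_hom_minus[OF G(1) Oa Ha] hG(5))
    also have "\<dots> = hecke_letter n \<q> g"
      using Hcl[OF that] unfolding G(2)[OF that] by (simp add: eH_def GenT H.add_diff_cancel)
    finally show ?thesis .
  qed (use G(2)[OF that] in \<open>simp_all add: eH_def eO_def\<close>)
  have GF: "G (F x) = x" if "x \<in> carrier ?H" for x
    using hecke_algebra_hom_eqI[OF Ha algebra_hom_comp[OF F(1) G(1)] idH _ that] F(2) GT by simp
  have FG: "F (G y) = y" if "y \<in> carrier ?O" for y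
    using typeO_algebra_hom_eqI[OF Oa algebra_hom_comp[OF G(1) F(1)] idO _ that] G(2) FT by simp
  have iso: "F \<in> algebra_iso ?H ?O"
    by (rule algebra_iso_if_inverse[OF F(1) G(1) GF FG])
  moreover have "F (hecke_T n \<q> r \<oplus>\<^bsub>?H\<^esub> \<one>\<^bsub>?H\<^esub>) = typeO_class n \<q> (crossing_diagram r)" if "r \<in> {1..<n}" for r
    using FT[of "GenT r"] that by (simp add: eH_def hecke_T_def hecke_letter_def typeO_letter_def typeO_class_def gen_eqs)
  moreover have "F (hecke_X n \<q> r) = typeO_class n \<q> (square_diagram r True)" if "r \<in> {1..n}" for r
    using FT[of "GenX r"] that by (simp add: eH_def hecke_X_def hecke_letter_def typeO_letter_def typeO_class_def gen_eqs)
  ultimately show ?thesis by blast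
qed

end

section \<open>The monoid of diagrams\<close>

lemma isotopy_class_eq_iff:
  assumes "is_diagram n d" shows "isotopy_class n d = isotopy_class n e \<longleftrightarrow> isotopic n d e"
proof
  assume "isotopy_class n d = isotopy_class n e"
  moreover have "d \<in> isotopy_class n d" using isotopic_refl[OF assms] by (simp add: isotopy_class_def)
  ultimately have "isotopic n e d" by (simp add: isotopy_class_def)
  then show "isotopic n d e" by (rule isotopic_sym)
next
  assume "isotopic n d e"
  then show "isotopy_class n d = isotopy_class n e"
    unfolding isotopy_class_def using isotopic_trans isotopic_sym by blast
qed

lemma single_block_reads:
  assumes g: "g \<in> hecke_gens n" shows "reads n (block [g] const_half) [g]"
proof -
  note B = valid_block_props[OF single_valid[OF g], simplified]
  have "events n (block [g] const_half) = mset [(1/2, g)]"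
    using B(2) by (simp add: block_event_list_def const_half_def)
  then show ?thesis
    using flatD(1)[OF B(1)] unfolding reads_def reads_events_def
    by (intro conjI exI[of _ "[(1/2, g)]"]) (simp_all add: descending_def)
qed

text \<open>The positions of the strands when the strands \<open>r\<close> and \<open>r + 1\<close>
  have covered the part \<open>s\<close> of their way to each other's place.\<close>

definition exchange :: "nat \<Rightarrow> real \<Rightarrow> nat \<Rightarrow> real" where
  "exchange r s i = (if i = r then real r + s else if i = Suc r then real (Suc r) - s else real i)"

lemma exchange_less:
  assumes s: "0 \<le> s" "s \<le> 1" and ij: "i < j" "\<not> (i = r \<and> j = Suc r)"
  shows "exchange r s i < exchange r s j"
proof -
  have lt: "m < k \<Longrightarrow> real m + 1 \<le> real k" for m k by linarith
  show ?thesis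
  proof (cases "i = r")
    case True
    then have "Suc r < j" using ij by linarith
    then show ?thesis using lt[of "Suc r" j] True s by (simp add: exchange_def)
  next
    case False
    then have up: "exchange r s i \<le> real i" using s by (simp add: exchange_def)
    show ?thesis
    proof (cases "j = Suc r")
      case True
      then have "i < r" using ij False by linarith
      then show ?thesis using lt[of i r] True up s by (simp add: exchange_def)
    next
      case F: False
      then have "real j \<le> exchange r s j" using s by (simp add: exchange_def)
      then show ?thesis using up lt[OF ij(1)] by linarith
    qed
  qed
qed

lemma exchange_less_iff:
  assumes s: "0 \<le> s" "s \<le> 1"
  shows "exchange r s i < exchange r s j \<longleftrightarrow>
    (if i = r \<and> j = Suc r then s < 1/2 else if i = Suc r \<and> j = r then 1/2 < s else i < j)"
proof -
  have "exchange r s r < exchange r s (Suc r) \<longleftrightarrow> s < 1/2" "exchange r s (Suc r) < exchange r s r \<longleftrightarrow> 1/2 < s"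
    by (auto simp: exchange_def)
  then show ?thesis using exchange_less[OF s, of i j r] exchange_less[OF s, of j i r]
    by (cases i j rule: linorder_cases) auto
qed

lemma crossing_diagram_curve: "curve (crossing_diagram r) i t = exchange r t i"
  by (simp add: crossing_diagram_def exchange_def)

lemma exchange_eqD:
  assumes "0 \<le> s" "s \<le> 1" "i \<noteq> j" "exchange r s i = exchange r s j"
  shows "{i, j} = {r, Suc r} \<and> s = 1/2"
  using exchange_less_iff[OF assms(1,2), of r i j] exchange_less_iff[OF assms(1,2), of r j i] assms(3,4)
  by (auto split: if_splits)

lemma crossing_diagram_is_diagram: "is_diagram n (crossing_diagram r)"
proof -
  let ?d = "crossing_diagram r"
  let ?v = "\<lambda>i. if i = r then 1 else if i = Suc r then - 1 else 0 :: real"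
  have D: "(curve ?d i has_real_derivative ?v i) (at t within A)" for i t A
    unfolding crossing_diagram_def diagram.simps
    by (cases "i = r"; cases "i = Suc r") (auto intro!: derivative_eq_intros)
  have S: "slope ?d i t = ?v i" if "t \<in> {0..1}" for i t by (rule slope_eqI[OF D that])
  have E: "{i, j} = {r, Suc r} \<and> t = 1/2" if "t \<in> {0..1}" "i \<noteq> j" "curve ?d i t = curve ?d j t" for i j t
    using that by (intro exchange_eqD) (simp_all add: crossing_diagram_curve)
  show ?thesis
    unfolding is_diagram_def
  proof (intro conjI ballI impI)
    fix i :: nat
    have "continuous_on {0..1} (\<lambda>t. ?v i)" by (rule continuous_on_const)
    then show "curve ?d i differentiable_on {0..1}" "continuous_on {0..1} (slope ?d i)"
      using smoothI[OF D] by blast+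
  next
    fix t :: real assume t: "t \<in> {0, 1}"
    show "inj_on (\<lambda>i. curve ?d i t) {1..n}"
    proof (rule inj_onI, rule ccontr)
      fix i j assume ij: "curve ?d i t = curve ?d j t" "i \<noteq> j"
      have "t \<in> {0..1}" using t by auto
      from E[OF this ij(2,1)] show False using t by auto
    qed
  next
    fix t :: real and i j k :: nat assume t: "t \<in> {0..1}" and ne: "i \<noteq> j" "j \<noteq> k" "i \<noteq> k"
    show "\<not> (curve ?d i t = curve ?d j t \<and> curve ?d j t = curve ?d k t)"
    proof
      assume eq: "curve ?d i t = curve ?d j t \<and> curve ?d j t = curve ?d k t"
      show False using E[OF t ne(1) conjunct1[OF eq]] E[OF t ne(2) conjunct2[OF eq]] ne
        by (auto simp: doubleton_eq_iff)
    qed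
  next
    fix t :: real and i j :: nat assume t: "t \<in> {0..1}" and ne: "i \<noteq> j" and eq: "curve ?d i t = curve ?d j t"
    show "slope ?d i t \<noteq> slope ?d j t" using E[OF t ne eq] S[OF t] by (auto simp: doubleton_eq_iff)
  qed (simp add: crossing_diagram_def)
qed

text \<open>The crossing diagram has straight strands and is not flat. It has the same events as the
  block of one crossing, because at each height the curves of both are in the same order.\<close>

lemma crossing_diagram_reads:
  assumes r: "r \<in> {1..<n}" shows "reads n (crossing_diagram r) [GenT r]"
proof -
  let ?d = "crossing_diagram r" and ?b = "block [GenT r] const_half"
  have g: "GenT r \<in> hecke_gens n" using r by (simp add: hecke_gens_iff)
  interpret block_letters n "[GenT r]" by (rule block_letters_single[OF g])
  have h: "height_ok const_half" by (simp add: height_ok_def const_half_def)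
  have C: "C = {r}" by (auto simp: block_crossings_def)
  have idx: "crossing_index [GenT r] r = 0" by (rule index_unique) simp_all
  have b: "curve ?b i t = exchange r (smooth_step (2 * (t - 1/2) + 1/2)) i" for i t
  proof -
    have "i - Suc 0 = r \<longleftrightarrow> i = Suc r" using r by auto
    then show ?thesis by (simp add: block_def exchange_def C idx const_half_def)
  qed
  have less: "curve ?d i t < curve ?d j t \<longleftrightarrow> curve ?b i t < curve ?b j t" if t: "t \<in> {0..1}" for i j t
  proof -
    let ?u = "2 * (t - 1/2) + 1/2 :: real"
    have "0 \<le> smooth_step ?u" "smooth_step ?u \<le> 1" using smooth_step_bounds[of ?u] by auto
    moreover have "smooth_step ?u < 1/2 \<longleftrightarrow> t < 1/2" "1/2 < smooth_step ?u \<longleftrightarrow> 1/2 < t"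
      using smooth_step_less_half(2)[of ?u] smooth_step_greater_half(1)[of ?u] smooth_step_eq_half[of ?u]
      by (cases t "1/2 :: real" rule: linorder_cases; simp)+
    ultimately show ?thesis using t by (simp add: b crossing_diagram_curve exchange_less_iff)
  qed
  have eq: "curve ?d i t = curve ?d j t \<longleftrightarrow> curve ?b i t = curve ?b j t" if "t \<in> {0..1}" for i j t
    using less[OF that, of i j] less[OF that, of j i] by linarith
  have place: "place n ?d i t = place n ?b i t" if "t \<in> {0..1}" for i t
    by (rule place_eqI) (rule less[OF that])
  have "crossings n ?d = crossings n ?b"
  proof -
    have "t \<in> {0..1} \<and> (\<exists>i\<in>{1..n}. \<exists>j\<in>{1..n}. i \<noteq> j \<and> curve ?d i t = curve ?d j t \<and> s = place n ?d i t) \<longleftrightarrow>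
      t \<in> {0..1} \<and> (\<exists>i\<in>{1..n}. \<exists>j\<in>{1..n}. i \<noteq> j \<and> curve ?b i t = curve ?b j t \<and> s = place n ?b i t)" for t s
      by (cases "t \<in> {0..1}") (simp_all only: eq place simp_thms)
    then show ?thesis unfolding crossings_def by (simp only:)
  qed
  moreover have "squares ?d = []" "squares ?b = []"
    by (simp_all add: crossing_diagram_def block_def is_crossing_def)
  ultimately have "events n ?d = events n ?b" by (simp add: events_def)
  then show ?thesis
    using single_block_reads[OF g] crossing_diagram_is_diagram by (simp add: reads_def)
qed

lemma stack_of_words:
  assumes v: "v \<in> lists (hecke_gens n)" and w: "w \<in> lists (hecke_gens n)"
    and a: "isotopic n (standard_word n v) a" and b: "isotopic n (standard_word n w) b" and d: "is_stack n a b d"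
  shows "isotopic n (standard_word n (v @ w)) d"
proof -
  have "is_diagram n a" "is_diagram n b" using d by (simp_all add: is_stack_def)
  then obtain v' w' where r: "reads n a v'" "reads n b w'" using reads_exists by blast
  have "far_commutes v v'" "far_commutes w w'"
    using isotopic_iff_words[OF standard_word_props(2)[OF v] r(1)] isotopic_iff_words[OF standard_word_props(2)[OF w] r(2)] a b by blast+
  then have "far_commutes (v @ w) (v' @ w')" by (rule far_commutes_append)
  moreover have "v @ w \<in> lists (hecke_gens n)" using v w by simp
  ultimately show ?thesis
    using isotopic_iff_words[OF standard_word_props(2) stack_reads[OF d r]] by blast
qed

text \<open>The standard diagram of the empty word is the vertical diagram itself, and the standard
  diagrams of single letters are isotopic to the square and crossing diagrams because they have the
  same words.\<close>

lemma standard_words_present_diagrams: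
  "diagram_presentation n (\<lambda>w. isotopy_class n (standard_word n w))"
proof
  have D: "is_diagram n (standard_word n w)" if "w \<in> lists (hecke_gens n)" for w
    using flatD(1)[OF standard_word_props(1)[OF that]] .
  have word: "isotopy_class n (standard_word n w) = isotopy_class n d" if "reads n d w" for d w
  proof -
    have d: "is_diagram n d" using that by (simp add: reads_def)
    show ?thesis by (rule HOL.sym, rule isotopy_class_eq_iff[OF d, THEN iffD2, OF reads_isotopic_standard[OF that]])
  qed
  show "carrier (diagram_monoid n) = (\<lambda>w. isotopy_class n (standard_word n w)) ` lists (hecke_gens n)"
  proof (intro Set.set_eqI iffI)
    fix x assume "x \<in> carrier (diagram_monoid n)"
    then obtain d where d: "x = isotopy_class n d" "is_diagram n d" by (auto simp: diagram_monoid_def)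
    obtain w where w: "reads n d w" using reads_exists[OF d(2)] by blast
    show "x \<in> (\<lambda>w. isotopy_class n (standard_word n w)) ` lists (hecke_gens n)"
      using word[OF w] reads_letters[OF w] d(1) by blast
  qed (use D in \<open>auto simp: diagram_monoid_def\<close>)
  show "isotopy_class n (standard_word n []) = \<one>\<^bsub>diagram_monoid n\<^esub>"
    by (simp add: standard_word_def diagram_monoid_def)
  show "isotopy_class n (standard_word n [GenX r]) = isotopy_class n (square_diagram r True)"
    "isotopy_class n (standard_word n [GenXinv r]) = isotopy_class n (square_diagram r False)" if "r \<in> {1..n}" for r
    using single_block_reads[of "GenX r" n] single_block_reads[of "GenXinv r" n] that
    by (auto intro!: word simp: square_block square_gen_def hecke_gens_iff)
  show "isotopy_class n (standard_word n [GenT r]) = isotopy_class n (crossing_diagram r)" if "r \<in> {1..<n}" for r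
    by (rule word[OF crossing_diagram_reads[OF that]])
  fix v w assume vw: "v \<in> lists (hecke_gens n)" "w \<in> lists (hecke_gens n)"
  show "isotopy_class n (standard_word n v) = isotopy_class n (standard_word n w) \<longleftrightarrow> far_commutes v w"
    using isotopy_class_eq_iff[OF D[OF vw(1)]] isotopic_iff_words[OF standard_word_props(2)[OF vw(1)] standard_word_props(2)[OF vw(2)]] by simp
  let ?v = "standard_word n v" and ?w = "standard_word n w"
  obtain a where a: "same_picture n ?v a" "is_stack n a ?w (pile n ?v ?w)"
    using pile_is_stack[OF standard_word_props(1)[OF vw(1)] standard_word_props(1)[OF vw(2)]] by blast
  have av: "isotopic n ?v a" by (rule same_picture_isotopic[OF D[OF vw(1)] a(1)])
  have ww: "isotopic n ?w ?w" by (rule isotopic_refl[OF D[OF vw(2)]])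
  have "isotopic n (standard_word n (v @ w)) e \<longleftrightarrow>
      (\<exists>a\<in>isotopy_class n ?v. \<exists>b\<in>isotopy_class n ?w. \<exists>d. is_stack n a b d \<and> isotopic n d e)" (is "?L \<longleftrightarrow> ?R") for e
  proof
    assume L: ?L
    have "isotopic n (pile n ?v ?w) e"
      using isotopic_trans[OF isotopic_sym[OF stack_of_words[OF vw av ww a(2)]] L] .
    then show ?R using a(2) av ww unfolding isotopy_class_def by blast
  next
    assume ?R
    then obtain a b d where "isotopic n ?v a" "isotopic n ?w b" "is_stack n a b d" and de: "isotopic n d e"
      unfolding isotopy_class_def by blast
    from stack_of_words[OF vw this(1-3)] show ?L using de isotopic_trans by blast
  qed
  then have "isotopy_class n (standard_word n (v @ w)) =
      {e. \<exists>a\<in>isotopy_class n ?v. \<exists>b\<in>isotopy_class n ?w. \<exists>d. is_stack n a b d \<and> isotopic n d e}"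
    unfolding isotopy_class_def[of n "standard_word n (v @ w)"] by (rule Collect_cong)
  then show "isotopy_class n (standard_word n (v @ w)) =
      isotopy_class n ?v \<otimes>\<^bsub>diagram_monoid n\<^esub> isotopy_class n ?w"
    by (simp add: diagram_monoid_def)
qed

theorem theorem3p4:
  fixes q d\<^sub>1 :: "'k::field" and \<q> :: "'k fps" and n :: nat
  assumes "q \<noteq> 0" and "q \<noteq> 1"
    and "CHAR('k) > 0 \<Longrightarrow> d\<^sub>1 = 0"
    and "\<q> = fps_const q * fps_exp d\<^sub>1"
    and "n \<ge> 1"
  shows "\<exists>f \<in> algebra_iso (hecke_algebra n \<q>) (typeO_algebra n \<q>).
           (\<forall>r\<in>{1..<n}. f (hecke_T n \<q> r \<oplus>\<^bsub>hecke_algebra n \<q>\<^esub> \<one>\<^bsub>hecke_algebra n \<q>\<^esub>)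
                          = typeO_class n \<q> (crossing_diagram r)) \<and>
           (\<forall>r\<in>{1..n}. f (hecke_X n \<q> r) = typeO_class n \<q> (square_diagram r True))"
proof -
  \<comment> \<open>the constant coefficient of \<open>fps_exp d\<^sub>1\<close> is \<open>1\<close>\<close>
  have "fps_nth \<q> 0 \<noteq> 0" using assms(1,4) by simp
  then have "inverse \<q> * \<q> = 1" by (rule inverse_mult_eq_1)
  then show ?thesis by (rule diagram_presentation.hecke_typeO_iso[OF standard_words_present_diagrams])
qed

end
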